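(* Assume $\sum_{j\ge1}\|\psi_j\|_{L^\infty(\Omega)}^p<\infty$ for $p\in(0,1)$. Then the choice $$\lambda=\begin{cases}\frac1{2-2\delta}\ \text{ for all } \delta\in(0,\tfrac12) & \text{if } p\in(0,\tfrac23],\\ \frac p{2-p} & \text{if } p\in(\tfrac23,1),\end{cases}$$ together with the choice of the weights $$\gamma_{\mathfrak u}=\Bigg((|\mathfrak u|+1)!\prod_{j\in\mathfrak u}\frac{b_j}{\big(2\zeta(2\lambda)/(2\pi^2)^\lambda\big)^{1/2}}\Bigg)^{2/(1+\lambda)}$$ ensures that the bound $$e_{s,h,n}\le \sqrt{c_2}\,C_{\boldsymbol\gamma,s}(\lambda)\left(\tfrac2n\right)^{\frac1{2\lambda}}C_q\big(\|z\|_{L^2(\Omega)}+\|u_0\|_{L^2(\Omega)}\big)$$ on the root-mean-square error $e_{s,h,n}$ is finite independently of $s$, where $$C_{\boldsymbol\gamma,s}(\lambda):=\left(\sum_{\mathfrak u\subseteq\{1,\dots,s\}}\gamma_{\mathfrak u}^\lambda\left(\frac{2\zeta(2\lambda)}{(2\pi^2)^\lambda}\right)^{|\mathfrak u|}\right)^{\frac1{2\lambda}}\left(\sum_{\mathfrak u\subseteq\{1,\dots,s\}}\frac{((|\mathfrak u|+1)!)^2}{\gamma_{\mathfrak u}}\prod_{j\in\mathfrak u}b_j^2\right)^{\frac12}.$$ (However, $C_{\boldsymbol\gamma,s}\big(\frac1{2-2\delta}\big)\to\infty$ as $\delta\to0$ and $C_{\boldsymbol\gamma,s}\big(\frac p{2-p}\big)\to\infty$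 as $p\to(2/3)^+$.) In consequence, under the same summability assumption, for $z\in\mathcal Z$, $s,m\in\mathbb N$, $n=2^m$, and the randomly shifted lattice rule with $n$ points in $s$ dimensions constructed by the CBC algorithm with these weights, the root-mean-square error $$e_{s,h,n}:=\sqrt{\mathbb E_{\boldsymbol\Delta}\left[\left\|\int_{[-\frac12,\frac12]^s}q_{s,h}(\cdot,\boldsymbol y,z)\,\mathrm d\boldsymbol y-\frac1n\sum_{i=1}^nq_{s,h}(\cdot,\boldsymbol y^{(i)},z)\right\|_{L^2(\Omega)}^2\right]}$$ is of order $$\kappa(n):=\begin{cases}n^{-(1-\delta)}\ \text{ for all } \delta\in(0,\tfrac12) & \text{if } p\in(0,\tfrac23],\\ n^{-(1/p-1/2)} & \text{if } p\in(\tfrac23,1).\end{cases}$$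
   Context: $d\in\{1,2,3\}$, $\Omega\subset\mathbb R^d$ is a bounded domain with Lipschitz boundary, $u_0\in L^2(\Omega)$, $\langle\cdot,\cdot\rangle$ is the $L^2(\Omega)$ inner product, $\|v\|_{H_0^1(\Omega)}:=\|\nabla v\|_{L^2(\Omega)}$, and $H^{-1}(\Omega)$ is the dual of $H_0^1(\Omega)$ with pivot space $L^2(\Omega)$. $c_1,c_2>0$ are embedding constants: $\|v\|_{H^{-1}(\Omega)}\le c_1\|v\|_{L^2(\Omega)}$ and $\|v\|_{L^2(\Omega)}\le c_2\|v\|_{H_0^1(\Omega)}$. $\mathcal Z:=\{z\in L^2(\Omega):z_{\min}\le z\le z_{\max}\text{ a.e. in }\Omega\}$ with given $z_{\min},z_{\max}\in L^2(\Omega)$, $z_{\min}\le z_{\max}$ a.e. $\Xi=[-\frac12,\frac12]^{\mathbb N}$, $\Xi_s=[-\frac12,\frac12]^s$. The coefficient is $a(\boldsymbol x,\boldsymbol y)=\bar a(\boldsymbol x)+\sum_{j\ge1}y_j\psi_j(\boldsymbol x)$ with $\bar a\in L^\infty(\Omega)$, $\sum_j\|\psi_j\|_{L^\infty(\Omega)}<\infty$ and $0<a_{\min}\le a(\boldsymbol x,\boldsymbol y)\le a_{\max}<\infty$ on $\Omega\times\Xi$. Put $b_j:=\|\psi_j\|_{L^\infty(\Omega)}/a_{\min}$, $C_q:=\max\left(\frac{c_1}{a_{\min}},\frac{c_1^2c_2}{a_{\min}^2}\right)$ and $b(\boldsymbol y;w,v):=\int_\Omega a(\boldsymbol x,\boldsymbol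 y)\nabla w\cdot\nabla v\,\mathrm d\boldsymbol x$. $V_h\subset H_0^1(\Omega)$ is a finite-dimensional (continuous piecewise linear finite element) subspace. For $\boldsymbol y\in\Xi_s$, identified with $(y_1,\dots,y_s,0,0,\dots)\in\Xi$, $u_{s,h}(\cdot,\boldsymbol y,z),q_{s,h}(\cdot,\boldsymbol y,z)\in V_h$ are the unique solutions of $b(\boldsymbol y;u_{s,h},v_h)=\langle z,v_h\rangle$ and $b(\boldsymbol y;q_{s,h},w_h)=\langle u_{s,h}(\cdot,\boldsymbol y,z)-u_0,w_h\rangle$ for all $v_h,w_h\in V_h$. Conventions on weights: $\gamma_\emptyset=1$ and $0/0=0$; it is required that if $\gamma_{\mathfrak u}=0$ then the integral over $\boldsymbol y_{\mathfrak u}$ of the squared integral over the inactive variables of the mixed first derivative $\partial^{|\mathfrak u|}/\partial\boldsymbol y_{\mathfrak u}$ of the integrand is also zero. A shifted rank-1 lattice rule is the equal-weight quadrature rule with points $\boldsymbol y^{(i)}=\mathrm{frac}(i\boldsymbol g/n+\boldsymbol\Delta)-(\frac12,\dots,\frac12)$, $i=1,\dots,n$, with generating vector $\boldsymbol g\in\mathbb N^s$, shift $\boldsymbol\Delta\in[0,1]^s$ and $\mathrm{frac}$ the componentwise fractional part. $\mathbb E_{\boldsymbol\Delta}$ is the expectation over $\boldsymbol\Delta$ uniform on $[0,1]^s$; $\zeta(x)=\sum_{k\ge1}k^{-x}$, $x>1$, is the Riemann zeta function. The CBC (component-by-component) algorithm chooses $g_1=1$ and then successively $g_t\in\{1\le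 g<n:\gcd(g,n)=1\}$ minimizing, with $g_1,\dots,g_{t-1}$ fixed, the squared shift-averaged worst-case error $\sum_{\emptyset\ne\mathfrak u\subseteq\{1,\dots,t\}}\gamma_{\mathfrak u}\frac1n\sum_{i=1}^n\prod_{j\in\mathfrak u}B_2(\mathrm{frac}(ig_j/n))$, up to constant factors absorbed in the weights, where $B_2(x)=x^2-x+\frac16$.
   Formalization: The displayed error bound with √c₂ is false for large c₂; it is proved with c₂ in place of √c₂ (and with √c₂ when c₂ ≤ 1). The blow-up of C_{γ,s} is stated for those s with some b_j ≠ 0, j ≤ s, since otherwise C_{γ,s} = 1. *)

theory Defs
  imports "HOL-Analysis.Analysis" "HOL-Probability.Probability"
begin

section \<open>Lebesgue spaces on a domain\<close>

text \<open>Elements of Lebesgue and Sobolev spaces on \<open>\<Omega>\<close> are represented by functions on the whole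
  ambient space; only their restriction to \<open>\<Omega>\<close>, up to null sets, matters.\<close>

definition L2 :: "'a::euclidean_space set \<Rightarrow> ('a \<Rightarrow> 'b::euclidean_space) set" where
  "L2 \<Omega> = {f. f \<in> borel_measurable (lebesgue_on \<Omega>) \<and> integrable (lebesgue_on \<Omega>) (\<lambda>x. (norm (f x))\<^sup>2)}"

definition L2_inner :: "'a::euclidean_space set \<Rightarrow> ('a \<Rightarrow> 'b::euclidean_space) \<Rightarrow> ('a \<Rightarrow> 'b) \<Rightarrow> real" where
  "L2_inner \<Omega> f g = (LINT x|lebesgue_on \<Omega>. f x \<bullet> g x)"

definition L2_norm :: "'a::euclidean_space set \<Rightarrow> ('a \<Rightarrow> 'b::euclidean_space) \<Rightarrow> real" where
  "L2_norm \<Omega> f = sqrt (LINT x|lebesgue_on \<Omega>. (norm (f x))\<^sup>2)"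

definition Linf :: "'a::euclidean_space set \<Rightarrow> ('a \<Rightarrow> real) set" where
  "Linf \<Omega> = {f. f \<in> borel_measurable (lebesgue_on \<Omega>) \<and> esssup (lebesgue_on \<Omega>) (\<lambda>x. ereal \<bar>f x\<bar>) < \<infinity>}"

definition Linf_norm :: "'a::euclidean_space set \<Rightarrow> ('a \<Rightarrow> real) \<Rightarrow> real" where
  "Linf_norm \<Omega> f = real_of_ereal (esssup (lebesgue_on \<Omega>) (\<lambda>x. ereal \<bar>f x\<bar>))"

section \<open>Bounded Lipschitz domains\<close>

text \<open>Near each boundary point \<open>\<Omega>\<close> is the region above the graph of a Lipschitz function, with
  respect to some unit vector \<open>e\<close> as the vertical direction; the horizontal component of \<open>x\<close> is
  \<open>x - (x \<bullet> e) e\<close>.\<close>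

definition lipschitz_boundary :: "'a::euclidean_space set \<Rightarrow> bool" where
  "lipschitz_boundary \<Omega> \<longleftrightarrow>
     (\<forall>x0\<in>frontier \<Omega>. \<exists>r>0. \<exists>e L. \<exists>g :: 'a \<Rightarrow> real.
        norm e = 1 \<and> L-lipschitz_on {w. w \<bullet> e = 0} g \<and>
        (\<forall>x\<in>ball x0 r. x \<in> \<Omega> \<longleftrightarrow> g (x - (x \<bullet> e) *\<^sub>R e) < x \<bullet> e))"

definition bounded_lipschitz_domain :: "'a::euclidean_space set \<Rightarrow> bool" where
  "bounded_lipschitz_domain \<Omega> \<longleftrightarrow>
     open \<Omega> \<and> connected \<Omega> \<and> \<Omega> \<noteq> {} \<and> bounded \<Omega> \<and> lipschitz_boundary \<Omega>"

section \<open>Sobolev spaces\<close>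

primrec C_k :: "nat \<Rightarrow> ('a::euclidean_space \<Rightarrow> real) \<Rightarrow> bool" where
  "C_k 0 f \<longleftrightarrow> continuous_on UNIV f"
| "C_k (Suc k) f \<longleftrightarrow> (\<forall>x. f differentiable (at x)) \<and>
     (\<forall>i\<in>Basis. C_k k (\<lambda>x. frechet_derivative f (at x) i))"

definition gradient :: "('a::euclidean_space \<Rightarrow> real) \<Rightarrow> 'a \<Rightarrow> 'a" where
  "gradient f x = (\<Sum>i\<in>Basis. frechet_derivative f (at x) i *\<^sub>R i)"

definition test_function :: "'a::euclidean_space set \<Rightarrow> ('a \<Rightarrow> real) \<Rightarrow> bool" where
  "test_function \<Omega> \<phi> \<longleftrightarrow> (\<forall>k. C_k k \<phi>) \<and>
     compact (closure {x. \<phi> x \<noteq> 0}) \<and> closure {x. \<phi> x \<noteq> 0} \<subseteq> \<Omega>"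

definition has_weak_gradient :: "'a::euclidean_space set \<Rightarrow> ('a \<Rightarrow> real) \<Rightarrow> ('a \<Rightarrow> 'a) \<Rightarrow> bool" where
  "has_weak_gradient \<Omega> u G \<longleftrightarrow> (\<forall>\<phi>. test_function \<Omega> \<phi> \<longrightarrow> (\<forall>i\<in>Basis.
     (LINT x|lebesgue_on \<Omega>. u x * (gradient \<phi> x \<bullet> i)) = - (LINT x|lebesgue_on \<Omega>. (G x \<bullet> i) * \<phi> x)))"

definition H1 :: "'a::euclidean_space set \<Rightarrow> ('a \<Rightarrow> real) set" where
  "H1 \<Omega> = {u \<in> L2 \<Omega>. \<exists>G\<in>L2 \<Omega>. has_weak_gradient \<Omega> u G}"

definition weak_gradient :: "'a::euclidean_space set \<Rightarrow> ('a \<Rightarrow> real) \<Rightarrow> 'a \<Rightarrow> 'a" where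
  "weak_gradient \<Omega> u = (SOME G. G \<in> L2 \<Omega> \<and> has_weak_gradient \<Omega> u G)"

text \<open>\<open>H01 \<Omega>\<close> is the closure of the test functions in \<open>H1 \<Omega>\<close>.\<close>

definition H01 :: "'a::euclidean_space set \<Rightarrow> ('a \<Rightarrow> real) set" where
  "H01 \<Omega> = {u \<in> H1 \<Omega>. \<exists>\<phi> :: nat \<Rightarrow> 'a \<Rightarrow> real. (\<forall>k. test_function \<Omega> (\<phi> k)) \<and>
     (\<lambda>k. L2_norm \<Omega> (\<lambda>x. \<phi> k x - u x)) \<longlonglongrightarrow> 0 \<and>
     (\<lambda>k. L2_norm \<Omega> (\<lambda>x. gradient (\<phi> k) x - weak_gradient \<Omega> u x)) \<longlonglongrightarrow> 0}"

definition H01_norm :: "'a::euclidean_space set \<Rightarrow> ('a \<Rightarrow> real) \<Rightarrow> real" where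
  "H01_norm \<Omega> v = L2_norm \<Omega> (weak_gradient \<Omega> v)"

text \<open>The dual norm of \<open>v \<in> L\<^sup>2(\<Omega>)\<close>, acting on \<open>H01 \<Omega>\<close> through the pivot space \<open>L\<^sup>2(\<Omega>)\<close>.\<close>

definition Hm1_norm :: "'a::euclidean_space set \<Rightarrow> ('a \<Rightarrow> real) \<Rightarrow> real" where
  "Hm1_norm \<Omega> v = (SUP w\<in>{w \<in> H01 \<Omega>. H01_norm \<Omega> w \<le> 1}. \<bar>L2_inner \<Omega> v w\<bar>)"

section \<open>The parametric problem and its Galerkin discretisation\<close>

text \<open>Sequences and coordinates are indexed from \<open>0\<close>: \<open>y j\<close>, \<open>\<psi> j\<close>, \<open>b j\<close>, \<open>g j\<close> stand for
  \<open>y\<^sub>j\<^sub>+\<^sub>1\<close>, \<open>\<psi>\<^sub>j\<^sub>+\<^sub>1\<close>, \<open>b\<^sub>j\<^sub>+\<^sub>1\<close>, \<open>g\<^sub>j\<^sub>+\<^sub>1\<close>, and \<open>{..<s}\<close> replaces \<open>{1,\<dots>,s}\<close>.\<close>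

definition Xi :: "(nat \<Rightarrow> real) set" where
  "Xi = {y. \<forall>j. y j \<in> {-1/2..1/2}}"

definition Xi_s :: "nat \<Rightarrow> (nat \<Rightarrow> real) set" where
  "Xi_s s = PiE {..<s} (\<lambda>_. {-1/2..1/2})"

definition zero_ext :: "nat \<Rightarrow> (nat \<Rightarrow> real) \<Rightarrow> nat \<Rightarrow> real" where
  "zero_ext s y j = (if j < s then y j else 0)"

definition diffusion :: "('a \<Rightarrow> real) \<Rightarrow> (nat \<Rightarrow> 'a \<Rightarrow> real) \<Rightarrow> (nat \<Rightarrow> real) \<Rightarrow> 'a \<Rightarrow> real" where
  "diffusion abar \<psi> y x = abar x + (\<Sum>j. y j * \<psi> j x)"

definition bform :: "'a::euclidean_space set \<Rightarrow> ('a \<Rightarrow> real) \<Rightarrow> ('a \<Rightarrow> real) \<Rightarrow> ('a \<Rightarrow> real) \<Rightarrow> real" where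
  "bform \<Omega> a w v = (LINT x|lebesgue_on \<Omega>. a x * (weak_gradient \<Omega> w x \<bullet> weak_gradient \<Omega> v x))"

text \<open>A finite-dimensional subspace of \<open>H01 \<Omega>\<close>. Every such space of equivalence classes has a
  linear system of representatives; the last conjunct says that \<open>V\<close> is one, i.e. that distinct
  elements of \<open>V\<close> represent distinct classes. Continuous piecewise linear finite element functions,
  extended by zero outside \<open>\<Omega>\<close>, have this property.\<close>

definition fin_dim_subspace_H01 :: "'a::euclidean_space set \<Rightarrow> ('a \<Rightarrow> real) set \<Rightarrow> bool" where
  "fin_dim_subspace_H01 \<Omega> V \<longleftrightarrow> V \<subseteq> H01 \<Omega> \<and>
     (\<exists>B. finite B \<and> V = range (\<lambda>(c :: ('a \<Rightarrow> real) \<Rightarrow> real) x. \<Sum>\<phi>\<in>B. c \<phi> * \<phi> x)) \<and>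
     (\<forall>v\<in>V. (AE x in lebesgue_on \<Omega>. v x = 0) \<longrightarrow> v = (\<lambda>x. 0))"

definition galerkin ::
  "'a::euclidean_space set \<Rightarrow> ('a \<Rightarrow> real) \<Rightarrow> ('a \<Rightarrow> real) set \<Rightarrow> (('a \<Rightarrow> real) \<Rightarrow> real) \<Rightarrow> 'a \<Rightarrow> real" where
  "galerkin \<Omega> a V F = (THE u. u \<in> V \<and> (\<forall>v\<in>V. bform \<Omega> a u v = F v))"

definition u_sh where
  "u_sh \<Omega> abar \<psi> V z s y = galerkin \<Omega> (diffusion abar \<psi> (zero_ext s y)) V (\<lambda>v. L2_inner \<Omega> z v)"

definition q_sh where
  "q_sh \<Omega> abar \<psi> V u0 z s y = galerkin \<Omega> (diffusion abar \<psi> (zero_ext s y)) V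
     (\<lambda>w. L2_inner \<Omega> (\<lambda>x. u_sh \<Omega> abar \<psi> V z s y x - u0 x) w)"

definition control_set :: "'a::euclidean_space set \<Rightarrow> ('a \<Rightarrow> real) \<Rightarrow> ('a \<Rightarrow> real) \<Rightarrow> ('a \<Rightarrow> real) set" where
  "control_set \<Omega> zmin zmax = {z \<in> L2 \<Omega>. AE x in lebesgue_on \<Omega>. zmin x \<le> z x \<and> z x \<le> zmax x}"

section \<open>Randomly shifted lattice rules and the CBC construction\<close>

definition lattice_point :: "nat \<Rightarrow> nat \<Rightarrow> (nat \<Rightarrow> nat) \<Rightarrow> (nat \<Rightarrow> real) \<Rightarrow> nat \<Rightarrow> nat \<Rightarrow> real" where
  "lattice_point s n g \<Delta> i = (\<lambda>j\<in>{..<s}. frac (real i * real (g j) / real n + \<Delta> j) - 1/2)"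

definition shift_measure :: "nat \<Rightarrow> (nat \<Rightarrow> real) measure" where
  "shift_measure s = PiM {..<s} (\<lambda>_. uniform_measure lborel {0..1})"

text \<open>The \<open>L\<^sup>2(\<Omega>)\<close>-valued integral of \<open>q_sh\<close> is taken pointwise in \<open>x\<close>. This is the Bochner
  integral, since \<open>q_sh\<close> takes values in a finite-dimensional space of genuine functions.\<close>

definition rmse where
  "rmse \<Omega> abar \<psi> V u0 z s n g = sqrt (LINT \<Delta>|shift_measure s.
     (L2_norm \<Omega> (\<lambda>x.
        (LINT y:Xi_s s|PiM {..<s} (\<lambda>_. lborel). q_sh \<Omega> abar \<psi> V u0 z s y x)
        - 1 / real n * (\<Sum>i = 1..n. q_sh \<Omega> abar \<psi> V u0 z s (lattice_point s n g \<Delta> i) x)))\<^sup>2)"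

definition B2 :: "real \<Rightarrow> real" where
  "B2 x = x\<^sup>2 - x + 1/6"

text \<open>The shift-averaged kernel of the unanchored weighted Sobolev space is
  \<open>\<Sum>\<^sub>u \<gamma>\<^sub>u \<Prod>\<^sub>j B\<^sub>2(frac(x\<^sub>j - x'\<^sub>j))\<close>, so no constants have to be absorbed in the weights here.\<close>

definition sq_wce :: "(nat set \<Rightarrow> real) \<Rightarrow> nat \<Rightarrow> nat \<Rightarrow> (nat \<Rightarrow> nat) \<Rightarrow> real" where
  "sq_wce \<gamma> n t g = (\<Sum>U\<in>Pow {..<t} - {{}}. \<gamma> U * (1 / real n) *
     (\<Sum>i = 1..n. \<Prod>j\<in>U. B2 (frac (real i * real (g j) / real n))))"

text \<open>Ties in the component-wise minimisation may be broken arbitrarily, so the CBC algorithm is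
  a predicate on its possible outputs.\<close>

definition cbc_vector :: "(nat set \<Rightarrow> real) \<Rightarrow> nat \<Rightarrow> nat \<Rightarrow> (nat \<Rightarrow> nat) \<Rightarrow> bool" where
  "cbc_vector \<gamma> n s g \<longleftrightarrow> g 0 = 1 \<and>
     (\<forall>t\<in>{1..<s}. is_arg_min (\<lambda>k. sq_wce \<gamma> n (Suc t) (g(t := k)))
        (\<lambda>k. 1 \<le> k \<and> k < n \<and> gcd k n = 1) (g t))"

section \<open>Weights and constants\<close>

definition zeta :: "real \<Rightarrow> real" where
  "zeta x = (\<Sum>k. real (Suc k) powr (- x))"

definition rho :: "real \<Rightarrow> real" where
  "rho lam = 2 * zeta (2 * lam) / (2 * pi\<^sup>2) powr lam"

definition weight :: "(nat \<Rightarrow> real) \<Rightarrow> real \<Rightarrow> nat set \<Rightarrow> real" where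
  "weight b lam U = (fact (card U + 1) * (\<Prod>j\<in>U. b j / rho lam powr (1/2))) powr (2 / (1 + lam))"

text \<open>The conventions \<open>0/0 = 0\<close> and \<open>0\<close> to a positive power is \<open>0\<close> hold for \<open>(/)\<close> and \<open>(powr)\<close>.\<close>

definition C_gamma :: "(nat set \<Rightarrow> real) \<Rightarrow> (nat \<Rightarrow> real) \<Rightarrow> nat \<Rightarrow> real \<Rightarrow> real" where
  "C_gamma \<gamma> b s lam =
     (\<Sum>U\<in>Pow {..<s}. \<gamma> U powr lam * rho lam ^ card U) powr (1 / (2 * lam)) *
     (\<Sum>U\<in>Pow {..<s}. (fact (card U + 1))\<^sup>2 / \<gamma> U * (\<Prod>j\<in>U. (b j)\<^sup>2)) powr (1/2)"

text \<open>\<open>C_q\<close> controls the parametric derivatives of the adjoint state in the \<open>H01\<close> norm; passing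
  to the \<open>L\<^sup>2(\<Omega>)\<close> norm, in which the error is measured, costs a factor \<open>c2\<close> (which is at most
  \<open>sqrt c2\<close> if \<open>c2 \<le> 1\<close>).\<close>

definition C_q :: "real \<Rightarrow> real \<Rightarrow> real \<Rightarrow> real" where
  "C_q c1 c2 amin = max (c1 / amin) (c1\<^sup>2 * c2 / amin\<^sup>2)"

text \<open>The admissible pairs of the parameter \<open>\<lambda>\<close> and the convergence rate \<open>r\<close> in
  \<open>\<kappa>(n) = n powr (-r)\<close>.\<close>

definition lambda_rate :: "real \<Rightarrow> (real \<times> real) set" where
  "lambda_rate p = (if p \<le> 2/3 then {(1 / (2 - 2 * \<delta>), 1 - \<delta>) | \<delta>. 0 < \<delta> \<and> \<delta> < 1/2}
     else {(p / (2 - p), 1 / p - 1/2)})"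

end

theory Submission
  imports Defs "HOL-Library.Function_Algebras"
begin

text \<open>By the Cauchy-Schwarz inequality, the mean-square error over the random shift is at most the
  shift-averaged squared worst-case error of the lattice times a weighted norm of the mixed first
  derivatives of the adjoint state.
  The first factor is expanded by the finite Fourier transform of \<open>B2\<close> on the grid; since
  \<open>t \<mapsto> t powr lam\<close> is subadditive, the minimum over the component chosen by the CBC algorithm is at
  most the average of \<open>lam\<close>-th powers over all admissible components, which is computable.
  For the second factor the Galerkin equations are differentiated in the parameters, which bounds the
  derivative with respect to \<open>y\<^sub>j\<close>, \<open>j \<in> U\<close>, by \<open>(|U| + 1)!\<close> times the product of the \<open>b j\<close>.
  With the chosen weights both factors are powers of one and the same sum
  \<open>\<Sum>U. (|U| + 1)! powr theta * (\<Prod>j\<in>U. a j)\<close> with \<open>theta < 1\<close> and \<open>a\<close> summable, which is bounded because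
  the elementary symmetric functions of \<open>a\<close> decay factorially. It blows up with \<open>zeta (2 * lam)\<close> as
  \<open>lam\<close> tends to \<open>1/2\<close>.\<close>

section \<open>Lattices and the component-by-component construction\<close>

text \<open>The weights are the stationary point of the product of the two sums in
  \<open>C_gamma\<close>: there the terms of both sums are proportional, and the normalisation makes
  them equal. What remains are three demands on \<open>lam\<close>: \<open>1/2 < lam\<close> for
  \<open>zeta (2 * lam)\<close>, \<open>lam < 1\<close> for \<open>theta lam < 1\<close>, and
  \<open>p \<le> theta lam\<close> for summability. Since the rate is \<open>1 / (2 * lam)\<close>,
  \<open>lambda_rate\<close> takes \<open>lam\<close> as small as these allow. Two obstacles shape
  the rest. The error is measured in a function space, whereas the quadrature estimate is scalar: it
  is applied at every point of \<open>\<Omega>\<close> and integrated afterwards, where finite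
  dimension makes point evaluation bounded and the interchange of integrals elementary. And the
  parameters range over a closed cube, with one-sided derivatives at its faces: differentiability is
  therefore carried as a second-order remainder bound in single coordinates, uniform over the cube.
  The solution operator preserves such bounds, so they pass from the data to the state and from the
  state to the adjoint state.\<close>

lemma powr_sum_le_sum_powr:
  fixes f :: "'i \<Rightarrow> real"
  assumes "finite I" "\<And>i. i \<in> I \<Longrightarrow> 0 \<le> f i" "0 < p" "p \<le> 1"
  shows "(\<Sum>i\<in>I. f i) powr p \<le> (\<Sum>i\<in>I. f i powr p)"
proof (cases "(\<Sum>i\<in>I. f i) = 0")
  case True
  then show ?thesis using assms by (simp add: sum_nonneg)
next
  case False
  define S where "S = (\<Sum>i\<in>I. f i)"
  have S: "S > 0" using False assms unfolding S_def by (metis less_eq_real_def sum_nonneg)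
  \<comment> \<open>Ratios to the total lie in [0,1], where a power with exponent at most 1 can only
    increase; the ratios add up to 1.\<close>
  have le: "f i / S \<le> (f i / S) powr p" if "i \<in> I" for i
  proof (cases "f i = 0")
    case False
    have "f i \<le> S" unfolding S_def using assms that by (intro member_le_sum) auto
    then have "f i / S \<le> 1" "f i / S > 0" using S False assms(2)[OF that] by auto
    then have "(f i / S) powr 1 \<le> (f i / S) powr p" using assms by (intro powr_mono') auto
    then show ?thesis using \<open>f i / S > 0\<close> by (subst (asm) powr_one) auto
  qed simp
  have "1 = (\<Sum>i\<in>I. f i / S)" using S by (simp add: S_def sum_divide_distrib[symmetric])
  also have "\<dots> \<le> (\<Sum>i\<in>I. (f i / S) powr p)" by (intro sum_mono le)
  also have "\<dots> = (\<Sum>i\<in>I. f i powr p) / S powr p"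
    using S assms(2) by (simp add: powr_divide sum_divide_distrib)
  finally show ?thesis using S by (simp add: S_def[symmetric] field_simps)
qed

section \<open>Roots of unity and the finite Fourier transform of \<open>B2\<close>\<close>

lemma sum_roots_of_unity:
  fixes n k :: nat
  assumes "1 \<le> n"
  shows "(\<Sum>i<n. cis (2 * pi * real k * real i / real n)) = (if n dvd k then of_nat n else 0)"
proof -
  define w where "w = cis (2 * pi * real k / real n)"
  have w: "cis (2 * pi * real k * real i / real n) = w ^ i" for i
    unfolding w_def Complex.DeMoivre by (rule arg_cong[of _ _ cis]) simp
  have e: "w = exp (2 * of_real pi * \<i> * of_nat k / of_nat n)"
    unfolding w_def cis_conv_exp by (simp add: mult_ac)
  have 1: "w = 1 \<longleftrightarrow> n dvd k" unfolding e by (rule complex_root_unity_eq_1[OF assms])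
  have "w ^ n = cis (2 * pi * real k)" using assms by (simp flip: w)
  also have "\<dots> = 1" by (rule cis_multiple_2pi) simp
  finally have "w ^ n = 1" .
  then show ?thesis unfolding w using 1 by (auto simp: geometric_sum)
qed

text \<open>Lattice points are numbered \<open>1..n\<close>, Fourier identities run over
  \<open>{..<n}\<close>; when \<open>f n = f 0\<close> the two sums coincide.\<close>

lemma sum_shift_one: "(\<Sum>i=1..n. f i) + f 0 = (\<Sum>i<n. f i) + (f n :: 'a::ab_group_add)" for n :: nat
  by (induction n) (simp_all add: algebra_simps)

lemma sum_lessThan_add: "(\<Sum>k<a+b. f k) = (\<Sum>k<a. f k) + (\<Sum>k<b. f (a + k) :: 'a::comm_monoid_add)" for a b :: nat
  by (induction b) (simp_all add: add.assoc)

lemma sum_roots_of_unity':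
  fixes n k :: nat
  assumes "1 \<le> n"
  shows "(\<Sum>i=1..n. cis (2 * pi * real k * real i / real n)) = (if n dvd k then of_nat n else 0)"
proof -
  have "cis (2 * pi * real k * real n / real n) = cis (2 * pi * real k * real 0 / real n)"
    using assms by (simp add: cis_multiple_2pi)
  then show ?thesis
    using sum_shift_one[of "\<lambda>i. cis (2 * pi * real k * real i / real n)" n] sum_roots_of_unity[OF assms, of k]
    by (metis add_right_cancel)
qed

text \<open>The discrete Fourier coefficients of \<open>B2\<close> on the grid with mesh size \<open>1/n\<close>.\<close>

definition B2_coeff :: "nat \<Rightarrow> nat \<Rightarrow> real" where
  "B2_coeff n r = (if r = 0 then 1 / (6 * (real n)\<^sup>2) else 1 / (2 * (real n)\<^sup>2 * (sin (pi * real r / real n))\<^sup>2))"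

lemma B2_coeff_nonneg: "0 \<le> B2_coeff n r"
  by (simp add: B2_coeff_def)

lemma sum_B2_grid:
  assumes "1 \<le> n"
  shows "(\<Sum>m<n. B2 (real m / real n)) = 1 / (6 * real n)"
proof -
  \<comment> \<open>The number of terms is decoupled from the mesh parameter \<open>x\<close>, so
    that induction on \<open>N\<close> applies.\<close>
  have *: "(\<Sum>m<N. B2 (real m / x)) = (2 * real N ^ 3 - 3 * real N ^ 2 + real N) / (6 * x\<^sup>2)
     - (real N ^ 2 - real N) / (2 * x) + real N / 6" if "x \<noteq> 0" for N x
  proof (induction N)
    case (Suc N)
    show ?case unfolding sum.lessThan_Suc Suc.IH unfolding B2_def using that
      by (simp add: field_simps power2_eq_square power3_eq_cube)
  qed simp
  show ?thesis using assms by (subst *) (auto simp: field_simps power2_eq_square power3_eq_cube)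
qed

text \<open>A recurrence of second order needs two consecutive values, hence the
  conjunction.\<close>

lemma second_difference_zero:
  fixes D :: "nat \<Rightarrow> 'a::comm_ring_1"
  assumes "\<And>m. m + 2 \<le> n \<Longrightarrow> D (m + 2) - 2 * D (m + 1) + D m = 0"
  shows "Suc m \<le> n \<Longrightarrow> D m = D 0 + of_nat m * (D 1 - D 0) \<and> D (Suc m) = D 0 + of_nat (Suc m) * (D 1 - D 0)"
proof (induction m)
  case (Suc m)
  then have IH: "D m = D 0 + of_nat m * (D 1 - D 0)" "D (Suc m) = D 0 + of_nat (Suc m) * (D 1 - D 0)"
    by auto
  have "D (m + 2) - 2 * D (m + 1) + D m = 0" by (rule assms) (use Suc in simp)
  then have "D (Suc (Suc m)) = 2 * D (Suc m) - D m"
    by (simp add: algebra_simps numeral_2_eq_2 add_eq_0_iff2)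
  then show ?case using IH by (simp add: algebra_simps)
qed simp

text \<open>Both sides have the same second differences on the grid, so they differ by an affine function;
  periodicity and equality of the means make it vanish.\<close>

lemma B2_dft_grid:
  assumes n: "1 \<le> n" and m: "m \<le> n"
  shows "complex_of_real (B2 (real m / real n))
    = (\<Sum>r<n. of_real (B2_coeff n r) * cis (2 * pi * real r * real m / real n))"
proof -
  define f where "f m = (\<Sum>r<n. of_real (B2_coeff n r) * cis (2 * pi * real r * real m / real n))" for m
  define D where "D m = f m - complex_of_real (B2 (real m / real n))" for m
  have sd: "f (m + 2) - 2 * f (m + 1) + f m = of_real (2 / (real n)\<^sup>2)" if "m + 2 \<le> n" for m
  proof -
    have t: "of_real (B2_coeff n r) * cis (2 * pi * real r * real (m + 2) / real n)
        - 2 * (of_real (B2_coeff n r) * cis (2 * pi * real r * real (m + 1) / real n))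
        + of_real (B2_coeff n r) * cis (2 * pi * real r * real m / real n)
        = of_real (if r = 0 then 0 else - 2 / (real n)\<^sup>2) * cis (2 * pi * real (m + 1) * real r / real n)"
      if r: "r < n" for r
    proof -
      define a where "a = pi * real r / real n"
      have 1: "cis (2 * pi * real r * real k / real n) = cis (2 * a) ^ k" for k
        unfolding Complex.DeMoivre a_def by (rule arg_cong[of _ _ cis]) simp
      have 2: "cis (2 * pi * real (m + 1) * real r / real n) = cis (2 * a) ^ (m + 1)"
        using 1[of "m + 1"] by (simp add: mult_ac)
      \<comment> \<open>The second difference acts on frequency \<open>r\<close> as multiplication
        by \<open>- 4 * (sin a)\<^sup>2\<close>. The values of \<open>B2_coeff\<close> are such that
        the product is \<open>- 2 / (real n)\<^sup>2\<close> for every nonzero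
        \<open>r\<close>.\<close>
      have 3: "cis (2 * a) ^ 2 - 2 * cis (2 * a) + 1 = of_real (- 4 * (sin a)\<^sup>2) * cis (2 * a)"
      proof -
        define C S q where "C = cos (2 * a)" and "S = sin (2 * a)" and "q = (sin a)\<^sup>2"
        have C: "C = 1 - 2 * q" by (simp add: C_def q_def cos_double_sin)
        have S: "S * S = 1 - C * C" using sin_squared_eq[of "2 * a"] by (simp add: C_def S_def power2_eq_square)
        have w: "cis (2 * a) = Complex C S" by (simp add: C_def S_def complex_eq_iff)
        have "C * C - S * S - 2 * C + 1 = - 4 * q * C" "2 * C * S - 2 * S = - 4 * q * S"
          unfolding S by (simp_all add: C algebra_simps)
        then show ?thesis unfolding w q_def[symmetric]
          by (intro complex_eqI) (simp_all add: power2_eq_square)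
      qed
      have 4: "B2_coeff n r * (- 4 * (sin a)\<^sup>2) = (if r = 0 then 0 else - 2 / (real n)\<^sup>2)"
      proof (cases "r = 0")
        case False
        have "0 < a" "a < pi" using False r n by (auto simp: a_def field_simps)
        then have "sin a \<noteq> 0" using sin_gt_zero by fastforce
        then show ?thesis using False n by (simp add: B2_coeff_def a_def[symmetric] field_simps)
      qed (simp add: a_def)
      have "of_real (B2_coeff n r) * cis (2 * a) ^ (m + 2) - 2 * (of_real (B2_coeff n r) * cis (2 * a) ^ (m + 1))
          + of_real (B2_coeff n r) * cis (2 * a) ^ m
          = of_real (B2_coeff n r) * cis (2 * a) ^ m * (cis (2 * a) ^ 2 - 2 * cis (2 * a) + 1)"
        by (simp add: algebra_simps power2_eq_square power_add)
      also have "\<dots> = of_real (B2_coeff n r * (- 4 * (sin a)\<^sup>2)) * cis (2 * a) ^ (m + 1)"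
        unfolding 3 by simp
      finally show ?thesis unfolding 1 2 4 .
    qed
    have "f (m + 2) - 2 * f (m + 1) + f m
        = (\<Sum>r<n. of_real (if r = 0 then 0 else - 2 / (real n)\<^sup>2) * cis (2 * pi * real (m + 1) * real r / real n))"
      unfolding f_def sum_distrib_left sum_subtractf[symmetric] sum.distrib[symmetric]
      by (intro sum.cong refl t) auto
    \<comment> \<open>Supplying the missing term at \<open>r = 0\<close> completes a full sum of
      roots of unity, which vanishes because \<open>0 < m + 1 < n\<close>; the compensating term is
      all that remains.\<close>
    also have "\<dots> = (\<Sum>r<n. of_real (- 2 / (real n)\<^sup>2) * cis (2 * pi * real (m + 1) * real r / real n)
          + (if r = 0 then of_real (2 / (real n)\<^sup>2) else 0))"
      by (intro sum.cong) auto
    also have "\<dots> = of_real (- 2 / (real n)\<^sup>2) * (\<Sum>r<n. cis (2 * pi * real (m + 1) * real r / real n))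
          + of_real (2 / (real n)\<^sup>2)"
    proof -
      have "(\<Sum>r<n. if r = 0 then complex_of_real (2 / (real n)\<^sup>2) else 0) = of_real (2 / (real n)\<^sup>2)"
        using n by simp
      then show ?thesis by (simp only: sum.distrib sum_distrib_left)
    qed
    also have "(\<Sum>r<n. cis (2 * pi * real (m + 1) * real r / real n)) = 0"
      using sum_roots_of_unity[OF n, of "m + 1"] that by (auto dest: dvd_imp_le)
    finally show ?thesis by simp
  qed
  have sdB: "B2 (real (m + 2) / real n) - 2 * B2 (real (m + 1) / real n) + B2 (real m / real n) = 2 / (real n)\<^sup>2" for m
    using n by (simp add: B2_def field_simps power2_eq_square)
  have D2: "D (m + 2) - 2 * D (m + 1) + D m = 0" if "m + 2 \<le> n" for m
  proof -
    have "D (m + 2) - 2 * D (m + 1) + D m = (f (m + 2) - 2 * f (m + 1) + f m)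
       - of_real (B2 (real (m + 2) / real n) - 2 * B2 (real (m + 1) / real n) + B2 (real m / real n))"
      by (simp add: D_def algebra_simps)
    then show ?thesis unfolding sd[OF that] sdB by simp
  qed
  have fn: "f n = f 0"
    unfolding f_def
  proof (intro sum.cong refl)
    fix r
    have "cis (2 * pi * real r * real n / real n) = cis (2 * pi * real r)" using n by simp
    then show "of_real (B2_coeff n r) * cis (2 * pi * real r * real n / real n) = of_real (B2_coeff n r) * cis (2 * pi * real r * real 0 / real n)"
      by (simp add: cis_multiple_2pi)
  qed
  have Dn: "D n = D 0" unfolding D_def fn using n by (simp add: B2_def)
  have lin: "D m = D 0 + of_nat m * (D 1 - D 0)" if "m \<le> n" for m
  proof (cases m)
    case (Suc k)
    then show ?thesis using second_difference_zero[of n D k, OF D2] that by auto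
  qed simp
  have "of_nat n * (D 1 - D 0) = 0" using lin[of n] Dn by simp
  then have D1: "D 1 - D 0 = 0" using n by auto
  have const: "D m = D 0" if "m \<le> n" for m using lin[OF that] D1 by simp
  have "(\<Sum>m<n. f m) = (\<Sum>r<n. of_real (B2_coeff n r) * (\<Sum>m<n. cis (2 * pi * real r * real m / real n)))"
    unfolding f_def sum_distrib_left by (rule sum.swap)
  also have "\<dots> = (\<Sum>r<n. if r = 0 then of_real (B2_coeff n 0) * of_nat n else 0)"
    by (intro sum.cong refl) (auto simp: sum_roots_of_unity[OF n] dest: dvd_imp_le)
  also have "\<dots> = of_real (1 / (6 * real n))"
    using n by (simp add: B2_coeff_def power2_eq_square)
  finally have "(\<Sum>m<n. f m) = of_real (1 / (6 * real n))" .
  moreover have "(\<Sum>m<n. D m) = (\<Sum>m<n. f m) - of_real (\<Sum>m<n. B2 (real m / real n))"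
    by (simp add: D_def sum_subtractf)
  ultimately have "(\<Sum>m<n. D m) = 0" by (simp add: sum_B2_grid[OF n])
  moreover have "(\<Sum>m<n. D m) = (\<Sum>m<n. D 0)" by (intro sum.cong refl const) simp
  then have "(\<Sum>m<n. D m) = of_nat n * D 0" by simp
  ultimately have "D 0 = 0" using n by auto
  then show ?thesis using const[OF m] by (simp add: D_def f_def)
qed

text \<open>Both sides depend only on \<open>k mod n\<close>, so the identity on the grid
  suffices.\<close>

lemma B2_dft:
  assumes n: "1 \<le> n"
  shows "complex_of_real (B2 (frac (real k / real n)))
    = (\<Sum>r<n. of_real (B2_coeff n r) * cis (2 * pi * real (r * k) / real n))"
proof -
  have k: "real k = real (k mod n) + real n * real (k div n)"
    by (metis add.commute div_mult_mod_eq mult.commute of_nat_add of_nat_mult)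
  have "real k / real n = real (k div n) + real (k mod n) / real n"
    using n by (subst k) (simp add: field_simps)
  then have fr: "frac (real k / real n) = real (k mod n) / real n"
    using n by (intro frac_unique_iff[THEN iffD2]) auto
  have "cis (2 * pi * real (r * k) / real n) = cis (2 * pi * real r * real (k mod n) / real n)" for r
  proof -
    have "2 * pi * real (r * k) / real n = 2 * pi * real r * real (k mod n) / real n + 2 * pi * real (r * (k div n))"
      unfolding of_nat_mult using n by (subst k) (simp add: field_simps)
    then have "cis (2 * pi * real (r * k) / real n) = cis (2 * pi * real r * real (k mod n) / real n) * cis (2 * pi * real (r * (k div n)))"
      by (simp only: cis_mult)
    also have "cis (2 * pi * real (r * (k div n))) = 1" by (rule cis_multiple_2pi) simp
    finally show ?thesis by simp
  qed
  then show ?thesis unfolding fr using B2_dft_grid[OF n, of "k mod n"] n by simp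
qed

lemma prod_cis: "finite I \<Longrightarrow> (\<Prod>i\<in>I. cis (f i)) = cis (\<Sum>i\<in>I. f i)"
  by (induction I rule: finite_induct) (auto simp: cis_mult)

text \<open>Expanding the product over \<open>U\<close> gives a sum over frequency vectors
  \<open>x\<close>. Averaging a character over the lattice points leaves exactly the vectors of the
  dual lattice, \<open>n dvd (\<Sum>j\<in>U. x j * g j)\<close>.\<close>

lemma lattice_B2_sum:
  fixes g :: "nat \<Rightarrow> nat"
  assumes n: "1 \<le> n" and U: "finite U"
  shows "1 / real n * (\<Sum>i=1..n. \<Prod>j\<in>U. B2 (frac (real i * real (g j) / real n)))
    = (\<Sum>x\<in>PiE U (\<lambda>_. {..<n}). if n dvd (\<Sum>j\<in>U. x j * g j) then \<Prod>j\<in>U. B2_coeff n (x j) else 0)"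
proof -
  let ?X = "PiE U (\<lambda>_. {..<n})"
  have "complex_of_real (\<Sum>i=1..n. \<Prod>j\<in>U. B2 (frac (real i * real (g j) / real n)))
      = (\<Sum>i=1..n. \<Prod>j\<in>U. \<Sum>r<n. of_real (B2_coeff n r) * cis (2 * pi * real (r * (i * g j)) / real n))"
  proof -
    have "complex_of_real (B2 (frac (real i * real (g j) / real n)))
      = (\<Sum>r<n. of_real (B2_coeff n r) * cis (2 * pi * real (r * (i * g j)) / real n))" for i j
      using B2_dft[OF n, of "i * g j"] by simp
    then show ?thesis by simp
  qed
  also have "\<dots> = (\<Sum>i=1..n. \<Sum>x\<in>?X. \<Prod>j\<in>U. of_real (B2_coeff n (x j)) * cis (2 * pi * real (x j * (i * g j)) / real n))"
    using U by (simp add: prod_sum_PiE)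
  also have "\<dots> = (\<Sum>i=1..n. \<Sum>x\<in>?X. of_real (\<Prod>j\<in>U. B2_coeff n (x j)) * cis (2 * pi * real (\<Sum>j\<in>U. x j * g j) * real i / real n))"
  proof (intro sum.cong refl)
    fix i x
    have "(\<Sum>j\<in>U. 2 * pi * real (x j * (i * g j)) / real n) = 2 * pi * real (\<Sum>j\<in>U. x j * g j) * real i / real n"
      by (simp add: sum_distrib_left sum_distrib_right sum_divide_distrib mult_ac)
    then show "(\<Prod>j\<in>U. of_real (B2_coeff n (x j)) * cis (2 * pi * real (x j * (i * g j)) / real n))
      = of_real (\<Prod>j\<in>U. B2_coeff n (x j)) * cis (2 * pi * real (\<Sum>j\<in>U. x j * g j) * real i / real n)"
      using U by (simp add: prod.distrib prod_cis)
  qed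
  also have "\<dots> = (\<Sum>x\<in>?X. of_real (\<Prod>j\<in>U. B2_coeff n (x j)) * (\<Sum>i=1..n. cis (2 * pi * real (\<Sum>j\<in>U. x j * g j) * real i / real n)))"
    by (subst sum.swap) (simp add: sum_distrib_left)
  also have "\<dots> = of_real (\<Sum>x\<in>?X. if n dvd (\<Sum>j\<in>U. x j * g j) then real n * (\<Prod>j\<in>U. B2_coeff n (x j)) else 0)"
    unfolding sum_roots_of_unity'[OF n] of_real_sum by (intro sum.cong refl) auto
  finally have "(\<Sum>i=1..n. \<Prod>j\<in>U. B2 (frac (real i * real (g j) / real n)))
    = (\<Sum>x\<in>?X. if n dvd (\<Sum>j\<in>U. x j * g j) then real n * (\<Prod>j\<in>U. B2_coeff n (x j)) else 0)"
    unfolding of_real_eq_iff .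
  then show ?thesis using n by (simp add: sum_distrib_left if_distrib cong: if_cong)
qed

section \<open>Comparison of the inverse squared sine with inverse squares\<close>

lemma mult_cos_le_sin: "0 < t \<Longrightarrow> t \<le> pi / 2 \<Longrightarrow> t * cos t \<le> sin (t::real)"
proof -
  assume t: "0 < t" "t \<le> pi / 2"
  \<comment> \<open>This is \<open>t \<le> tan t\<close> freed of its denominator, so that
    \<open>t = pi / 2\<close> is covered.\<close>
  have "(\<lambda>t. sin t - t * cos t) 0 \<le> (\<lambda>t. sin t - t * cos t) t"
  proof (rule DERIV_nonneg_imp_nondecreasing[where f = "\<lambda>t. sin t - t * cos t" and a = 0 and b = t])
    fix x :: real assume "0 \<le> x" "x \<le> t"
    then have "x * sin x \<ge> 0" using t by (intro mult_nonneg_nonneg sin_ge_zero) auto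
    moreover have "((\<lambda>t. sin t - t * cos t) has_real_derivative x * sin x) (at x)"
      by (auto intro!: derivative_eq_intros)
    ultimately show "\<exists>y. ((\<lambda>t. sin t - t * cos t) has_real_derivative y) (at x) \<and> 0 \<le> y" by blast
  qed (use t in auto)
  then show ?thesis by simp
qed

text \<open>The inverse squared sine is one plus the squared cotangent, and the cotangent is at most
  \<open>1 / t\<close>.\<close>

lemma inverse_sin_square_le_aux:
  assumes "0 < t" "t \<le> pi / 2"
  shows "1 / (sin t)\<^sup>2 \<le> 1 + 1 / t\<^sup>2"
proof -
  have s: "sin t > 0" using assms by (intro sin_gt_zero) auto
  have "(t * cos t)\<^sup>2 \<le> (sin t)\<^sup>2"
    using mult_cos_le_sin[OF assms] assms by (intro power_mono mult_nonneg_nonneg cos_ge_zero) auto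
  then have "t\<^sup>2 * (1 - (sin t)\<^sup>2) \<le> (sin t)\<^sup>2" by (simp add: power_mult_distrib cos_squared_eq)
  then show ?thesis using s assms by (simp add: field_simps)
qed

text \<open>Reflection at \<open>pi / 2\<close> exchanges the two halves of the interval. Each half
  uses only the pole at its own end; the other summand is nonnegative.\<close>

lemma inverse_sin_square_le:
  assumes "0 < t" "t < pi"
  shows "1 / (sin t)\<^sup>2 \<le> 1 + 1 / t\<^sup>2 + 1 / (t - pi)\<^sup>2"
proof (cases "t \<le> pi / 2")
  case True
  then show ?thesis using inverse_sin_square_le_aux[of t] assms by (simp add: add_increasing2)
next
  case False
  have "1 / (sin (pi - t))\<^sup>2 \<le> 1 + 1 / (pi - t)\<^sup>2" using False assms by (intro inverse_sin_square_le_aux) auto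
  moreover have "(pi - t)\<^sup>2 = (t - pi)\<^sup>2" by (simp add: power2_commute)
  moreover have "sin (pi - t) = sin t" by (simp add: sin_diff)
  moreover have "1 / t\<^sup>2 \<ge> 0" by simp
  ultimately show ?thesis by (metis add.commute add.left_commute add_increasing)
qed

text \<open>Together with \<open>inverse_sin_square_le\<close> this gives, as \<open>m\<close> grows, the bound
  \<open>pi\<^sup>2 / (sin (pi * x))\<^sup>2 \<le> (\<Sum>k\<in>\<int>. 1 / (x + k)\<^sup>2)\<close> without the theory of partial fractions.\<close>

lemma inverse_sin_square_doubling:
  assumes x: "0 < x" "x < 1"
  shows "1 / (sin (pi * x))\<^sup>2 = (\<Sum>k<2^m. 1 / (sin (pi * (x + real k) / 2^m))\<^sup>2) / 4^m"
proof (induction m)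
  case (Suc m)
  have "(\<Sum>k<2^Suc m. 1 / (sin (pi * (x + real k) / 2^Suc m))\<^sup>2)
     = (\<Sum>k<2^m. 1 / (sin (pi * (x + real k) / 2^Suc m))\<^sup>2) + (\<Sum>k<2^m. 1 / (sin (pi * (x + real (2^m + k)) / 2^Suc m))\<^sup>2)"
    using sum_lessThan_add[of _ "2^m" "2^m"] by (simp only: power_Suc mult_2)
  also have "\<dots> = 4 * (\<Sum>k<2^m. 1 / (sin (pi * (x + real k) / 2^m))\<^sup>2)"
    unfolding sum.distrib[symmetric] sum_distrib_left
  proof (intro sum.cong refl)
    fix k :: nat assume k: "k \<in> {..<2^m}"
    define t where "t = pi * (x + real k) / 2^Suc m"
    have "real k + 1 \<le> 2^m" using k by (metis Suc_leI add.commute lessThan_iff numeral_power_eq_of_nat_cancel_iff of_nat_Suc of_nat_le_iff of_nat_numeral of_nat_power)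
    then have "(x + real k) / 2^Suc m < 1/2" using x by (simp add: field_simps)
    then have "t < pi / 2" unfolding t_def using mult_strict_left_mono[of "(x + real k) / 2^Suc m" "1/2" pi] by simp
    moreover have "t > 0" using x by (simp add: t_def)
    ultimately have s: "sin t > 0" "cos t > 0" by (auto intro!: sin_gt_zero cos_gt_zero)
    \<comment> \<open>Adding \<open>2^m\<close> to the index turns the sine into a cosine. The pair
      then collapses, because the inverse squares of sine and cosine add up to four times the
      inverse square of the sine of the doubled angle.\<close>
    have "pi * (x + real (2^m + k)) / 2^Suc m = t + pi / 2" by (simp add: t_def field_simps)
    then have 1: "sin (pi * (x + real (2^m + k)) / 2^Suc m) = cos t" by (simp add: sin_add)
    have 2: "sin (pi * (x + real k) / 2^m) = 2 * sin t * cos t"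
      unfolding sin_double[symmetric] by (simp add: t_def)
    have "1 / (sin t)\<^sup>2 + 1 / (cos t)\<^sup>2 = ((cos t)\<^sup>2 + (sin t)\<^sup>2) / ((sin t)\<^sup>2 * (cos t)\<^sup>2)"
      using s by (simp add: field_simps)
    also have "\<dots> = 4 * (1 / (2 * sin t * cos t)\<^sup>2)" using s by (simp add: field_simps power_mult_distrib)
    finally show "1 / (sin (pi * (x + real k) / 2^Suc m))\<^sup>2 + 1 / (sin (pi * (x + real (2^m + k)) / 2^Suc m))\<^sup>2
        = 4 * (1 / (sin (pi * (x + real k) / 2^m))\<^sup>2)" unfolding 1 2 t_def .
  qed
  finally show ?case unfolding Suc.IH by simp
qed simp

section \<open>Zeta sums and the aliasing bound for the Fourier coefficients\<close>

definition punctured :: "nat \<Rightarrow> int set" where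
  "punctured M = {- int M..int M} - {0}"

lemma finite_punctured [simp]: "finite (punctured M)"
  by (simp add: punctured_def)

lemma punctured_mono: "M \<le> M' \<Longrightarrow> punctured M \<subseteq> punctured M'"
  by (auto simp: punctured_def)

lemma sum_punctured_even:
  fixes f :: "int \<Rightarrow> real"
  assumes "\<And>h. f (- h) = f h"
  shows "(\<Sum>h\<in>punctured M. f h) = 2 * (\<Sum>k<M. f (int (Suc k)))"
proof -
  have p: "punctured M = (\<lambda>k. int (Suc k)) ` {..<M} \<union> (\<lambda>k. - int (Suc k)) ` {..<M}"
  proof (rule set_eqI)
    fix h
    show "h \<in> punctured M \<longleftrightarrow> h \<in> (\<lambda>k. int (Suc k)) ` {..<M} \<union> (\<lambda>k. - int (Suc k)) ` {..<M}"
    proof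
      assume h: "h \<in> punctured M"
      show "h \<in> (\<lambda>k. int (Suc k)) ` {..<M} \<union> (\<lambda>k. - int (Suc k)) ` {..<M}"
      proof (cases "h > 0")
        case True
        then have "h = int (Suc (nat (h - 1)))" "nat (h - 1) < M" using h by (auto simp: punctured_def)
        then show ?thesis by blast
      next
        case False
        then have "h = - int (Suc (nat (- h - 1)))" "nat (- h - 1) < M" using h by (auto simp: punctured_def)
        then show ?thesis by blast
      qed
    qed (auto simp: punctured_def)
  qed
  let ?P = "(\<lambda>k. int (Suc k)) ` {..<M}" and ?N = "(\<lambda>k. - int (Suc k)) ` {..<M}"
  have "?P \<inter> ?N = {}" by auto
  then have "(\<Sum>h\<in>punctured M. f h) = (\<Sum>h\<in>?P. f h) + (\<Sum>h\<in>?N. f h)"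
    unfolding p by (intro sum.union_disjoint) auto
  also have "(\<Sum>h\<in>?P. f h) = (\<Sum>k<M. f (int (Suc k)))"
    by (subst sum.reindex) (auto simp: inj_on_def)
  also have "(\<Sum>h\<in>?N. f h) = (\<Sum>k<M. f (- int (Suc k)))"
    by (subst sum.reindex) (auto simp: inj_on_def)
  finally show ?thesis unfolding assms by simp
qed

lemma summable_zeta: "1 < x \<Longrightarrow> summable (\<lambda>k. real (Suc k) powr (- x))"
  using summable_real_powr_iff[of "- x"] summable_Suc_iff[of "\<lambda>k. real k powr (- x)"] by simp

lemma zeta_partial_sum_le: "1 < x \<Longrightarrow> (\<Sum>k<M. real (Suc k) powr (- x)) \<le> zeta x"
  unfolding zeta_def by (intro sum_le_suminf summable_zeta) auto

lemma zeta_ge_1: "1 < x \<Longrightarrow> 1 \<le> zeta x"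
  using zeta_partial_sum_le[of x 1] by simp

lemma rho_pos: "1 / 2 < lam \<Longrightarrow> 0 < rho lam"
  using zeta_ge_1[of "2 * lam"] by (simp add: rho_def)

lemma sum_punctured_powr_le:
  assumes "1 / 2 < lam"
  shows "(\<Sum>h\<in>punctured M. \<bar>real_of_int h\<bar> powr (- 2 * lam)) \<le> 2 * zeta (2 * lam)"
  using zeta_partial_sum_le[of "2 * lam" M] assms by (subst sum_punctured_even) auto

text \<open>The Fourier series of \<open>B2\<close> has coefficients
  \<open>1 / (2 * pi\<^sup>2 * h\<^sup>2)\<close> at nonzero \<open>h\<close>. Restricted to the
  grid, all frequencies congruent to \<open>r\<close> modulo \<open>n\<close> are aliased to
  \<open>r\<close>. Only an upper bound is required, and a finite truncation with error
  \<open>e\<close> keeps all sums finite.\<close>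

lemma B2_coeff_le_aux:
  assumes n: "1 \<le> n" and r: "r < n" and e: "0 < e"
  shows "\<exists>M. B2_coeff n r \<le> 1 / (2 * pi\<^sup>2) * (\<Sum>h | h \<in> punctured M \<and> h mod int n = int r. 1 / (real_of_int h)\<^sup>2) + e"
proof (cases "r = 0")
  case False
  define x where "x = real r / real n"
  have x: "0 < x" "x < 1" using r False n by (auto simp: x_def)
  \<comment> \<open>The constant \<open>1\<close> in \<open>inverse_sin_square_le\<close>, summed
    over \<open>2^m\<close> terms and divided by \<open>4^m\<close>, costs \<open>(1/2)^m\<close>;
    this determines \<open>m\<close>.\<close>
  have "(\<lambda>m. (1/2) ^ m * (1 / (2 * (real n)\<^sup>2))) \<longlonglongrightarrow> 0 * (1 / (2 * (real n)\<^sup>2))"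
    by (intro tendsto_intros) auto
  then have "eventually (\<lambda>m. (1/2) ^ m * (1 / (2 * (real n)\<^sup>2)) < e) sequentially"
    using e by (intro order_tendstoD(2)) auto
  then obtain m where m: "(1/2) ^ m * (1 / (2 * (real n)\<^sup>2)) < e"
    by (meson eventually_sequentially order_refl)
  define M where "M = n * 2 ^ m"
  have t: "1 / (sin (pi * (x + real k) / 2^m))\<^sup>2
     \<le> 1 + 4^m / (pi\<^sup>2 * (x + real k)\<^sup>2) + 4^m / (pi\<^sup>2 * (x + real k - 2^m)\<^sup>2)" if "k < 2^m" for k
  proof -
    define t where "t = pi * (x + real k) / 2^m"
    have "real k + 1 \<le> 2^m" using that by (metis Suc_leI add.commute numeral_power_eq_of_nat_cancel_iff of_nat_Suc of_nat_le_iff)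
    then have "(x + real k) / 2^m < 1" using x by (simp add: field_simps)
    then have "t < pi" unfolding t_def using mult_strict_left_mono[of "(x + real k) / 2^m" 1 pi] by simp
    moreover have "t > 0" using x by (simp add: t_def)
    ultimately have "1 / (sin t)\<^sup>2 \<le> 1 + 1 / t\<^sup>2 + 1 / (t - pi)\<^sup>2" by (intro inverse_sin_square_le)
    moreover have four: "(4::real)^m = (2^m)\<^sup>2" by (simp add: power2_eq_square flip: power_mult_distrib)
    have "1 / t\<^sup>2 = 4^m / (pi\<^sup>2 * (x + real k)\<^sup>2)"
      unfolding four by (simp add: t_def power_divide power_mult_distrib)
    moreover have "t - pi = pi * (x + real k - 2^m) / 2^m" by (simp add: t_def field_simps)
    then have "1 / (t - pi)\<^sup>2 = 4^m / (pi\<^sup>2 * (x + real k - 2^m)\<^sup>2)"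
      unfolding four by (simp add: power_divide power_mult_distrib)
    ultimately show ?thesis by (simp add: t_def)
  qed
  have "(\<Sum>k<2^m. 1 / (sin (pi * (x + real k) / 2^m))\<^sup>2) \<le> (\<Sum>k<2^m. 1 + 4^m / (pi\<^sup>2 * (x + real k)\<^sup>2) + 4^m / (pi\<^sup>2 * (x + real k - 2^m)\<^sup>2))"
    by (intro sum_mono t) auto
  also have "\<dots> = 2^m + 4^m / pi\<^sup>2 * ((\<Sum>k<2^m. 1 / (x + real k)\<^sup>2) + (\<Sum>k<2^m. 1 / (x + real k - 2^m)\<^sup>2))"
    by (simp add: sum.distrib sum_distrib_left algebra_simps)
  finally have "(\<Sum>k<2^m. 1 / (sin (pi * (x + real k) / 2^m))\<^sup>2) / 4^m
     \<le> (2^m + 4^m / pi\<^sup>2 * ((\<Sum>k<2^m. 1 / (x + real k)\<^sup>2) + (\<Sum>k<2^m. 1 / (x + real k - 2^m)\<^sup>2))) / 4^m"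
    by (intro divide_right_mono) auto
  also have "\<dots> = (1/2)^m + 1 / pi\<^sup>2 * ((\<Sum>k<2^m. 1 / (x + real k)\<^sup>2) + (\<Sum>k<2^m. 1 / (x + real k - 2^m)\<^sup>2))"
  proof -
    have "(2::real)^m / 4^m = (1/2)^m" by (simp flip: power_divide)
    then show ?thesis by (simp add: add_divide_distrib)
  qed
  finally have sx: "1 / (sin (pi * x))\<^sup>2 \<le> (1/2)^m + 1 / pi\<^sup>2 * ((\<Sum>k<2^m. 1 / (x + real k)\<^sup>2) + (\<Sum>k<2^m. 1 / (x + real k - 2^m)\<^sup>2))"
    using inverse_sin_square_doubling[OF x] by simp
  let ?H = "{h. h \<in> punctured M \<and> h mod int n = int r}"
  \<comment> \<open>The poles at \<open>0\<close> and at \<open>pi\<close> yield the positive and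
    the negative members of the residue class of \<open>r\<close>, all of modulus at most
    \<open>M\<close>.\<close>
  let ?a = "\<lambda>k::nat. int r + int n * int k" let ?b = "\<lambda>k::nat. int r + int n * (int k - 2^m)"
  have ia: "inj_on ?a {..<2^m}" "inj_on ?b {..<2^m}" using n by (auto simp: inj_on_def)
  have bneg: "?b k < 0" if "k < 2^m" for k
  proof -
    have "int k < 2^m" using that by (metis of_nat_less_iff of_nat_numeral of_nat_power)
    then have "int k - 2^m \<le> -1" by linarith
    then have "int n * (int k - 2^m) \<le> int n * (-1)" by (intro mult_left_mono) auto
    then show ?thesis using r by simp
  qed
  have disj: "?a ` {..<2^m} \<inter> ?b ` {..<2^m} = {}"
  proof -
    have "?a k \<noteq> ?b k'" if "k' < 2^m" for k k' using bneg[OF that] by (smt (verit) of_nat_0_le_iff mult_nonneg_nonneg)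
    then show ?thesis by blast
  qed
  have sub: "?a ` {..<2^m} \<union> ?b ` {..<2^m} \<subseteq> ?H"
  proof -
    have "?a k \<in> ?H" if "k < 2^m" for k
    proof -
      have "r + n * k \<le> M" 
      proof -
        have "n * (k + 1) \<le> n * 2^m" using that by (intro mult_left_mono) auto
        then show ?thesis using r by (simp add: M_def)
      qed
      then have "?a k \<le> int M" by (metis of_nat_add of_nat_le_iff of_nat_mult)
      moreover have "?a k > 0" using False by (simp add: add_pos_nonneg)
      moreover have "?a k mod int n = int r" using r by simp
      ultimately show ?thesis by (auto simp: punctured_def)
    qed
    moreover have "?b k \<in> ?H" if "k < 2^m" for k
    proof -
      have "int n * (- (2^m)) \<le> int n * (int k - 2^m)" by (intro mult_left_mono) auto
      then have "- int M \<le> ?b k" by (simp add: M_def)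
      moreover have "?b k mod int n = int r" using r by simp
      ultimately show ?thesis using bneg[OF that] by (auto simp: punctured_def)
    qed
    ultimately show ?thesis by blast
  qed
  have conv: "1 / (real_of_int (int r + int n * j))\<^sup>2 = 1 / (real n)\<^sup>2 * (1 / (x + real_of_int j)\<^sup>2)" for j
  proof -
    have "real_of_int (int r + int n * j) = real n * (x + real_of_int j)" using n by (simp add: x_def field_simps)
    then show ?thesis by (simp add: power_mult_distrib)
  qed
  have "1 / (real n)\<^sup>2 * ((\<Sum>k<2^m. 1 / (x + real k)\<^sup>2) + (\<Sum>k<2^m. 1 / (x + real k - 2^m)\<^sup>2))
     = (\<Sum>k<2^m. 1 / (real_of_int (?a k))\<^sup>2) + (\<Sum>k<2^m. 1 / (real_of_int (?b k))\<^sup>2)"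
    unfolding conv by (simp add: sum_distrib_left distrib_left add_diff_eq)
  also have "\<dots> = (\<Sum>h\<in>?a ` {..<2^m} \<union> ?b ` {..<2^m}. 1 / (real_of_int h)\<^sup>2)"
    using ia disj by (subst sum.union_disjoint) (auto simp: sum.reindex)
  also have "\<dots> \<le> (\<Sum>h\<in>?H. 1 / (real_of_int h)\<^sup>2)"
    using sub by (intro sum_mono2) auto
  finally have le: "1 / (real n)\<^sup>2 * ((\<Sum>k<2^m. 1 / (x + real k)\<^sup>2) + (\<Sum>k<2^m. 1 / (x + real k - 2^m)\<^sup>2)) \<le> (\<Sum>h\<in>?H. 1 / (real_of_int h)\<^sup>2)" .
  have "B2_coeff n r = 1 / (2 * (real n)\<^sup>2) * (1 / (sin (pi * x))\<^sup>2)" using False by (simp add: B2_coeff_def x_def)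
  also have "\<dots> \<le> 1 / (2 * (real n)\<^sup>2) * ((1/2)^m + 1 / pi\<^sup>2 * ((\<Sum>k<2^m. 1 / (x + real k)\<^sup>2) + (\<Sum>k<2^m. 1 / (x + real k - 2^m)\<^sup>2)))"
    using sx by (intro mult_left_mono) auto
  also have "\<dots> = (1/2) ^ m * (1 / (2 * (real n)\<^sup>2)) + 1 / (2 * pi\<^sup>2) * (1 / (real n)\<^sup>2 * ((\<Sum>k<2^m. 1 / (x + real k)\<^sup>2) + (\<Sum>k<2^m. 1 / (x + real k - 2^m)\<^sup>2)))"
    by (simp add: algebra_simps)
  also have "\<dots> \<le> e + 1 / (2 * pi\<^sup>2) * (\<Sum>h\<in>?H. 1 / (real_of_int h)\<^sup>2)"
    using m le by (intro add_mono mult_left_mono) auto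
  finally show ?thesis by (intro exI[of _ M]) (simp add: add.commute)
next
  \<comment> \<open>For \<open>r = 0\<close> the class consists of the multiples of
    \<open>n\<close>, and the coefficient is a Basel sum.\<close>
  case True
  have "(\<lambda>N. \<Sum>k<N. 1 / real (Suc k)^2) \<longlonglongrightarrow> pi\<^sup>2 / 6"
    using inverse_squares_sums by (simp add: sums_def)
  then have "(\<lambda>N. 1 / (pi\<^sup>2 * (real n)\<^sup>2) * (\<Sum>k<N. 1 / real (Suc k)^2)) \<longlonglongrightarrow> 1 / (pi\<^sup>2 * (real n)\<^sup>2) * (pi\<^sup>2 / 6)"
    by (intro tendsto_intros)
  also have "1 / (pi\<^sup>2 * (real n)\<^sup>2) * (pi\<^sup>2 / 6) = B2_coeff n r" using True by (simp add: B2_coeff_def)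
  finally have "eventually (\<lambda>N. B2_coeff n r - e < 1 / (pi\<^sup>2 * (real n)\<^sup>2) * (\<Sum>k<N. 1 / real (Suc k)^2)) sequentially"
    using e by (intro order_tendstoD(1)) auto
  then obtain N where N: "B2_coeff n r - e < 1 / (pi\<^sup>2 * (real n)\<^sup>2) * (\<Sum>k<N. 1 / real (Suc k)^2)"
    by (meson eventually_sequentially order_refl)
  let ?H = "{h. h \<in> punctured (n * N) \<and> h mod int n = int r}"
  have inj: "inj_on (\<lambda>h. int n * h) (punctured N)" using n by (auto simp: inj_on_def)
  have sub: "(\<lambda>h. int n * h) ` punctured N \<subseteq> ?H"
  proof (rule image_subsetI)
    fix h assume h: "h \<in> punctured N"
    have "\<bar>int n * h\<bar> \<le> int n * int N" unfolding abs_mult using h by (intro mult_mono) (auto simp: punctured_def)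
    then show "int n * h \<in> ?H"
      using h n True by (auto simp: punctured_def)
  qed
  have "1 / (pi\<^sup>2 * (real n)\<^sup>2) * (\<Sum>k<N. 1 / real (Suc k)^2) = 1 / (2 * pi\<^sup>2 * (real n)\<^sup>2) * (\<Sum>h\<in>punctured N. 1 / (real_of_int h)\<^sup>2)"
    by (subst sum_punctured_even) auto
  also have "\<dots> = 1 / (2 * pi\<^sup>2) * (\<Sum>h\<in>punctured N. 1 / (real_of_int (int n * h))\<^sup>2)"
    unfolding sum_distrib_left by (intro sum.cong refl) (simp add: power_mult_distrib)
  also have "\<dots> = 1 / (2 * pi\<^sup>2) * (\<Sum>h\<in>(\<lambda>h. int n * h) ` punctured N. 1 / (real_of_int h)\<^sup>2)"
    by (subst sum.reindex[OF inj]) simp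
  also have "\<dots> \<le> 1 / (2 * pi\<^sup>2) * (\<Sum>h\<in>?H. 1 / (real_of_int h)\<^sup>2)"
    using sub by (intro mult_left_mono sum_mono2) auto
  finally show ?thesis using N by (intro exI[of _ "n * N"]) linarith
qed

text \<open>Finitely many residues admit a common truncation, because enlarging \<open>M\<close>
  only enlarges the sums.\<close>

lemma B2_coeff_le:
  assumes n: "1 \<le> n" and e: "0 < e"
  shows "\<exists>M. \<forall>r<n. B2_coeff n r \<le> 1 / (2 * pi\<^sup>2) * (\<Sum>h | h \<in> punctured M \<and> h mod int n = int r. 1 / (real_of_int h)\<^sup>2) + e"
proof -
  let ?P = "\<lambda>r M. B2_coeff n r \<le> 1 / (2 * pi\<^sup>2) * (\<Sum>h | h \<in> punctured M \<and> h mod int n = int r. 1 / (real_of_int h)\<^sup>2) + e"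
  have "\<forall>r. \<exists>M. r < n \<longrightarrow> ?P r M"
  proof
    fix r show "\<exists>M. r < n \<longrightarrow> ?P r M"
      by (cases "r < n") (use B2_coeff_le_aux[OF n _ e, of r] in simp_all)
  qed
  from choice[OF this] obtain N where N: "\<And>r. r < n \<Longrightarrow> ?P r (N r)" by auto
  define M where "M = Max (N ` {..<n})"
  show ?thesis
  proof (intro exI[of _ M] allI impI)
    fix r assume r: "r < n"
    then have "N r \<le> M" unfolding M_def by (intro Max_ge) auto
    then have "(\<Sum>h | h \<in> punctured (N r) \<and> h mod int n = int r. 1 / (real_of_int h)\<^sup>2) \<le> (\<Sum>h | h \<in> punctured M \<and> h mod int n = int r. 1 / (real_of_int h)\<^sup>2)"
      using punctured_mono by (intro sum_mono2) auto
    then have "1 / (2 * pi\<^sup>2) * (\<Sum>h | h \<in> punctured (N r) \<and> h mod int n = int r. 1 / (real_of_int h)\<^sup>2) \<le> 1 / (2 * pi\<^sup>2) * (\<Sum>h | h \<in> punctured M \<and> h mod int n = int r. 1 / (real_of_int h)\<^sup>2)"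
      by (intro mult_left_mono) auto
    with N[OF r] show "B2_coeff n r \<le> 1 / (2 * pi\<^sup>2) * (\<Sum>h | h \<in> punctured M \<and> h mod int n = int r. 1 / (real_of_int h)\<^sup>2) + e"
      by linarith
  qed
qed

lemma powr_add_le_add_powr:
  fixes a b :: real
  assumes "0 \<le> a" "0 \<le> b" "0 < p" "p \<le> 1"
  shows "(a + b) powr p \<le> a powr p + b powr p"
proof -
  have "(\<Sum>x\<in>{True, False}. if x then a else b) powr p \<le> (\<Sum>x\<in>{True, False}. (if x then a else b) powr p)"
    using assms by (intro powr_sum_le_sum_powr) auto
  then show ?thesis by simp
qed

lemma one_over_powr: "0 < x \<Longrightarrow> (1 / x) powr a = x powr (- a)" for x :: real
  by (simp add: powr_divide powr_minus_divide)

section \<open>Candidates that hit a given frequency\<close>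

definition coprime_residues :: "nat \<Rightarrow> nat set" where
  "coprime_residues n = {k. 1 \<le> k \<and> k < n \<and> gcd k n = 1}"

lemma finite_coprime_residues [simp]: "finite (coprime_residues n)"
  by (rule finite_subset[of _ "{..<n}"]) (auto simp: coprime_residues_def)

text \<open>Since \<open>k\<close> is a unit modulo \<open>n\<close>, a solution forces
  \<open>h\<close> and \<open>\<nu>\<close> to have the same gcd \<open>d\<close> with
  \<open>n\<close>. Dividing the congruence by \<open>d\<close> leaves an invertible coefficient, so
  \<open>k\<close> is determined modulo \<open>n div d\<close>, and only \<open>d\<close> such
  numbers lie below \<open>n\<close>.\<close>

lemma card_linear_cong_le:
  fixes h :: int
  assumes n: "1 \<le> n"
  shows "card {k \<in> coprime_residues n. int n dvd int \<nu> + h * int k} \<le> gcd \<nu> n"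
    and "{k \<in> coprime_residues n. int n dvd int \<nu> + h * int k} \<noteq> {} \<Longrightarrow> int (gcd \<nu> n) dvd h"
proof -
  let ?A = "{k \<in> coprime_residues n. int n dvd int \<nu> + h * int k}"
  have g: "gcd h (int n) = int (gcd \<nu> n)" if "k \<in> ?A" for k
  proof -
    have cop: "coprime (int k) (int n)" using that by (simp add: coprime_residues_def coprime_iff_gcd_eq_1)
    have "gcd (h * int k) (int n) = gcd (int \<nu>) (int n)"
    proof -
      have "int n dvd int \<nu> + h * int k" using that by simp
      then obtain q where q: "int \<nu> + h * int k = int n * q" by (elim dvdE)
      then have "h * int k = int n * q + (- int \<nu>)" by simp
      then have "gcd (h * int k) (int n) = gcd (- int \<nu>) (int n)"
        by (metis gcd.commute gcd_add_mult mult.commute add.commute)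
      then show ?thesis by simp
    qed
    moreover have "gcd (h * int k) (int n) = gcd h (int n)"
      using cop by (subst (1 2) gcd.commute) (simp add: gcd_mult_left_right_cancel coprime_commute)
    ultimately show ?thesis by (simp add: gcd_int_int_eq)
  qed
  show "int (gcd \<nu> n) dvd h" if ne: "?A \<noteq> {}"
  proof -
    obtain k where "k \<in> ?A" using ne by blast
    from g[OF this] show ?thesis using gcd_dvd1[of h "int n"] by simp
  qed
  show "card ?A \<le> gcd \<nu> n"
  proof (cases "?A = {}")
    case False
    then obtain k0 where k0: "k0 \<in> ?A" by blast
    define d where "d = gcd \<nu> n"
    have gd: "gcd h (int n) = int d" using g[OF k0] by (simp add: d_def)
    have d: "d > 0" "d dvd n" using n by (auto simp: d_def)
    define q where "q = n div d"
    have q: "n = d * q" "q > 0" using d n by (auto simp: q_def dvd_div_eq_0_iff)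
    have "int d dvd h" using gcd_dvd1[of h "int n"] gd by simp
    then obtain h' where h': "h = int d * h'" by (elim dvdE)
    have "gcd (int d * h') (int d * int q) = int d" using gd by (simp add: h' q(1))
    then have "int d * gcd h' (int q) = int d * 1" using gcd_mult_distrib_int[of "int d" h' "int q"] by simp
    then have cop: "coprime h' (int q)" using d by (simp add: coprime_iff_gcd_eq_1)
    have modq: "k mod q = k' mod q" if "k \<in> ?A" "k' \<in> ?A" for k k'
    proof -
      have "int n dvd (int \<nu> + h * int k) - (int \<nu> + h * int k')" using that by (intro dvd_diff) auto
      then have "int n dvd h * (int k - int k')" by (simp add: algebra_simps)
      then have "int d * int q dvd int d * (h' * (int k - int k'))" by (simp add: h' q(1) mult.assoc)
      then have "int q dvd h' * (int k - int k')" using d by simp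
      then have "int q dvd int k - int k'" using cop by (simp add: coprime_commute coprime_dvd_mult_right_iff)
      then have "int k mod int q = int k' mod int q" by (simp add: mod_eq_dvd_iff)
      then show ?thesis by (simp flip: of_nat_mod)
    qed
    \<comment> \<open>Solutions agree modulo \<open>q\<close>, so they are told apart by their
      quotients, which are smaller than \<open>d\<close>.\<close>
    have "inj_on (\<lambda>k. k div q) ?A"
    proof (rule inj_onI)
      fix k k' assume k: "k \<in> ?A" "k' \<in> ?A" and eq: "k div q = k' div q"
      have "k mod q = k' mod q" by (rule modq[OF k])
      with eq have "k div q * q + k mod q = k' div q * q + k' mod q" by (simp only:)
      then show "k = k'" by (simp only: div_mult_mod_eq)
    qed
    moreover have "(\<lambda>k. k div q) ` ?A \<subseteq> {..<d}"
    proof (rule image_subsetI)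
      fix k assume "k \<in> ?A"
      then have "k < d * q" using q by (simp add: coprime_residues_def)
      then show "k div q \<in> {..<d}" by (simp add: less_mult_imp_div_less)
    qed
    ultimately have "card ?A \<le> card {..<d}" by (intro card_inj_on_le) auto
    then show ?thesis by (simp add: d_def)
  next
    case True
    then show ?thesis by (simp only: card.empty)
  qed
qed

lemma B2_coeff_powr_le:
  fixes lam :: real
  assumes n: "1 \<le> n" and lam: "0 < lam" "lam \<le> 1" and e: "0 < e"
  shows "\<exists>M. \<forall>r<n. B2_coeff n r powr lam
      \<le> (2 * pi\<^sup>2) powr (- lam) * (\<Sum>h | h \<in> punctured M \<and> h mod int n = int r. \<bar>real_of_int h\<bar> powr (- 2 * lam)) + e"
proof -
  \<comment> \<open>Chosen so that subadditivity splits off exactly \<open>e\<close> after taking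
    the power.\<close>
  define \<epsilon> where "\<epsilon> = e powr (1 / lam)"
  have eps: "\<epsilon> > 0" "\<epsilon> powr lam = e" using e lam by (auto simp: \<epsilon>_def powr_powr)
  obtain M where M: "\<And>r. r < n \<Longrightarrow> B2_coeff n r \<le> 1 / (2 * pi\<^sup>2) * (\<Sum>h | h \<in> punctured M \<and> h mod int n = int r. 1 / (real_of_int h)\<^sup>2) + \<epsilon>"
    using B2_coeff_le[OF n eps(1)] by auto
  define w where "w h = \<bar>real_of_int h\<bar> powr (- 2 * lam)" for h
  have c: "B2_coeff n r powr lam \<le> (2 * pi\<^sup>2) powr (- lam) * (\<Sum>h | h \<in> punctured M \<and> h mod int n = int r. w h) + \<epsilon> powr lam" if "r < n" for r
  proof -
    let ?H = "{h. h \<in> punctured M \<and> h mod int n = int r}"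
    let ?S = "\<Sum>h\<in>?H. 1 / (real_of_int h)\<^sup>2"
    have S: "?S \<ge> 0" by (intro sum_nonneg) auto
    have "B2_coeff n r powr lam \<le> (1 / (2 * pi\<^sup>2) * ?S + \<epsilon>) powr lam"
      using M[OF that] lam B2_coeff_nonneg by (intro powr_mono2) auto
    also have "\<dots> \<le> (1 / (2 * pi\<^sup>2) * ?S) powr lam + \<epsilon> powr lam"
      by (rule powr_add_le_add_powr) (use S eps lam in simp_all)
    also have "(1 / (2 * pi\<^sup>2) * ?S) powr lam = (2 * pi\<^sup>2) powr (- lam) * ?S powr lam"
    proof -
      have "(1 / (2 * pi\<^sup>2) * ?S) powr lam = (1 / (2 * pi\<^sup>2)) powr lam * ?S powr lam"
        by (rule powr_mult)
      also have "(1 / (2 * pi\<^sup>2)) powr lam = (2 * pi\<^sup>2) powr (- lam)" by (rule one_over_powr) simp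
      finally show ?thesis .
    qed
    also have "?S powr lam \<le> (\<Sum>h\<in>?H. (1 / (real_of_int h)\<^sup>2) powr lam)"
      using lam by (intro powr_sum_le_sum_powr) auto
    also have "\<dots> = (\<Sum>h\<in>?H. w h)"
    proof (intro sum.cong refl)
      fix h assume "h \<in> ?H"
      then have h: "h \<noteq> 0" by (auto simp: punctured_def)
      have "(1 / (real_of_int h)\<^sup>2) powr lam = ((real_of_int h)\<^sup>2) powr (- lam)" by (rule one_over_powr) (use h in simp)
      also have "((real_of_int h)\<^sup>2) powr (- lam) = (\<bar>real_of_int h\<bar> powr 2) powr (- lam)" using h by simp
      also have "(\<bar>real_of_int h\<bar> powr 2) powr (- lam) = w h" unfolding powr_powr w_def by simp
      finally show "(1 / (real_of_int h)\<^sup>2) powr lam = w h" .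
    qed
    finally show ?thesis by simp
  qed

  show ?thesis using c unfolding eps w_def by blast
qed

text \<open>The residue classes modulo \<open>n\<close> partition \<open>punctured M\<close>, so the
  sum over \<open>r\<close> unfolds into one partial zeta sum.\<close>

lemma sum_B2_coeff_powr_le:
  fixes lam :: real
  assumes n: "1 \<le> n" and lam: "1 / 2 < lam" "lam \<le> 1"
  shows "(\<Sum>r<n. B2_coeff n r powr lam) \<le> rho lam"
proof (rule field_le_epsilon)
  fix e :: real assume e: "0 < e"
  obtain M where c: "\<And>r. r < n \<Longrightarrow> B2_coeff n r powr lam
      \<le> (2 * pi\<^sup>2) powr (- lam) * (\<Sum>h | h \<in> punctured M \<and> h mod int n = int r. \<bar>real_of_int h\<bar> powr (- 2 * lam)) + e / real n"
    using B2_coeff_powr_le[of n lam "e / real n"] n lam e by auto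
  let ?w = "\<lambda>h. \<bar>real_of_int h\<bar> powr (- 2 * lam)"
  have "(\<Sum>r<n. B2_coeff n r powr lam)
      \<le> (\<Sum>r<n. (2 * pi\<^sup>2) powr (- lam) * (\<Sum>h | h \<in> punctured M \<and> h mod int n = int r. ?w h) + e / real n)"
    by (intro sum_mono c) auto
  also have "\<dots> = (2 * pi\<^sup>2) powr (- lam) * (\<Sum>r<n. \<Sum>h | h \<in> punctured M \<and> h mod int n = int r. ?w h) + e"
    using n by (simp add: sum.distrib sum_distrib_left)
  also have "(\<Sum>r<n. \<Sum>h | h \<in> punctured M \<and> h mod int n = int r. ?w h) = (\<Sum>h\<in>punctured M. ?w h)"
  proof -
    have img: "(\<lambda>h. nat (h mod int n)) ` punctured M \<subseteq> {..<n}" using n by (auto simp: nat_less_iff)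
    have "(\<Sum>r\<in>{..<n}. \<Sum>h | h \<in> punctured M \<and> nat (h mod int n) = r. ?w h) = (\<Sum>h\<in>punctured M. ?w h)"
      by (rule sum.group) (use img in auto)
    moreover have "{h. h \<in> punctured M \<and> nat (h mod int n) = r} = {h. h \<in> punctured M \<and> h mod int n = int r}" for r
      using n by auto
    ultimately show ?thesis by simp
  qed
  also have "(2 * pi\<^sup>2) powr (- lam) * (\<Sum>h\<in>punctured M. ?w h) \<le> (2 * pi\<^sup>2) powr (- lam) * (2 * zeta (2 * lam))"
    using sum_punctured_powr_le[OF lam(1), of M] by (intro mult_left_mono) auto
  finally show "(\<Sum>r<n. B2_coeff n r powr lam) \<le> rho lam + e"
    by (simp add: rho_def powr_minus divide_inverse mult_ac)
qed

text \<open>For \<open>d = gcd \<nu> n\<close>, a frequency \<open>h\<close> is hit by at most \<open>d\<close> of the candidates \<open>k\<close>, and only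
  if \<open>d\<close> divides \<open>h\<close>; the resulting factor \<open>d powr (1 - 2 * lam)\<close> is at most \<open>1\<close>.\<close>

lemma sum_dual_lattice_le:
  fixes lam :: real
  assumes n: "1 \<le> n" and lam: "1 / 2 < lam" "lam \<le> 1"
  shows "(\<Sum>k\<in>coprime_residues n. \<Sum>r | r < n \<and> n dvd \<nu> + r * k. B2_coeff n r powr lam) \<le> rho lam"
proof (rule field_le_epsilon)
  fix e :: real assume e: "0 < e"
  \<comment> \<open>The error \<open>e\<close> is shared among at most
    \<open>card (coprime_residues n) * n\<close> summands; the \<open>1\<close> keeps the
    denominator positive.\<close>
  let ?N = "real (card (coprime_residues n)) * real n + 1"
  have N: "?N > 0" by (simp add: add_nonneg_pos)
  obtain M where c: "\<And>r. r < n \<Longrightarrow> B2_coeff n r powr lam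
      \<le> (2 * pi\<^sup>2) powr (- lam) * (\<Sum>h | h \<in> punctured M \<and> h mod int n = int r. \<bar>real_of_int h\<bar> powr (- 2 * lam)) + e / ?N"
    using B2_coeff_powr_le[of n lam "e / ?N"] n lam e N by auto
  define w where "w h = \<bar>real_of_int h\<bar> powr (- 2 * lam)" for h
  have w0: "w h \<ge> 0" for h by (simp add: w_def)
  define A where "A h = {k \<in> coprime_residues n. int n dvd int \<nu> + h * int k}" for h
  define d where "d = gcd \<nu> n"
  have d: "d \<ge> 1" using n by (simp add: d_def Suc_le_eq)
  have "(\<Sum>k\<in>coprime_residues n. \<Sum>r | r < n \<and> n dvd \<nu> + r * k. B2_coeff n r powr lam)
     \<le> (\<Sum>k\<in>coprime_residues n. \<Sum>r | r < n \<and> n dvd \<nu> + r * k. (2 * pi\<^sup>2) powr (- lam) * (\<Sum>h | h \<in> punctured M \<and> h mod int n = int r. w h) + e / ?N)"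
    unfolding w_def by (intro sum_mono c) auto
  also have "\<dots> = (2 * pi\<^sup>2) powr (- lam) * (\<Sum>k\<in>coprime_residues n. \<Sum>r | r < n \<and> n dvd \<nu> + r * k. \<Sum>h | h \<in> punctured M \<and> h mod int n = int r. w h)
      + (\<Sum>k\<in>coprime_residues n. \<Sum>r | r < n \<and> n dvd \<nu> + r * k. e / ?N)"
    by (simp only: sum.distrib sum_distrib_left)
  also have "(\<Sum>k\<in>coprime_residues n. \<Sum>r | r < n \<and> n dvd \<nu> + r * k. e / ?N) \<le> e"
  proof -
    have "(\<Sum>k\<in>coprime_residues n. \<Sum>r | r < n \<and> n dvd \<nu> + r * k. e / ?N) \<le> (\<Sum>k\<in>coprime_residues n. \<Sum>r<n. e / ?N)"
      using e N by (intro sum_mono sum_mono2) auto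
    also have "\<dots> = (?N - 1) * (e / ?N)" by simp
    also have "\<dots> \<le> e" using e N by (simp add: field_simps)
    finally show ?thesis .
  qed
  also have "(\<Sum>k\<in>coprime_residues n. \<Sum>r | r < n \<and> n dvd \<nu> + r * k. \<Sum>h | h \<in> punctured M \<and> h mod int n = int r. w h)
     = (\<Sum>k\<in>coprime_residues n. \<Sum>h | h \<in> punctured M \<and> int n dvd int \<nu> + h * int k. w h)"
  proof (intro sum.cong refl)
    fix k
    \<comment> \<open>The congruence sees only \<open>h mod int n\<close>. Hence the double sum over
      residues \<open>r\<close> and their members \<open>h\<close> merges into one sum over
      \<open>h\<close>.\<close>
    have red: "int n dvd int \<nu> + h * int k \<longleftrightarrow> n dvd \<nu> + nat (h mod int n) * k" for h
    proof -
      have "h * int k = (h mod int n + int n * (h div int n)) * int k" by simp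
      then have "int \<nu> + h * int k = (int \<nu> + (h mod int n) * int k) + int n * (h div int n * int k)"
        by (simp only: distrib_right mult.assoc add.assoc)
      then have "int n dvd int \<nu> + h * int k \<longleftrightarrow> int n dvd int \<nu> + (h mod int n) * int k"
        by (simp only: dvd_add_left_iff dvd_triv_left)
      also have "int \<nu> + (h mod int n) * int k = int (\<nu> + nat (h mod int n) * k)" using n by simp
      finally show ?thesis by (simp only: of_nat_dvd_iff)
    qed
    show "(\<Sum>r | r < n \<and> n dvd \<nu> + r * k. \<Sum>h | h \<in> punctured M \<and> h mod int n = int r. w h)
       = (\<Sum>h | h \<in> punctured M \<and> int n dvd int \<nu> + h * int k. w h)"
    proof -
      let ?R = "{r. r < n \<and> n dvd \<nu> + r * k}"
      let ?H = "{h. h \<in> punctured M \<and> int n dvd int \<nu> + h * int k}"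
      have img: "(\<lambda>h. nat (h mod int n)) ` ?H \<subseteq> ?R" using n by (auto simp: red nat_less_iff)
      have "(\<Sum>r\<in>?R. \<Sum>h | h \<in> ?H \<and> nat (h mod int n) = r. w h) = (\<Sum>h\<in>?H. w h)"
        by (rule sum.group) (use img in auto)
      moreover have "{h. h \<in> ?H \<and> nat (h mod int n) = r} = {h. h \<in> punctured M \<and> h mod int n = int r}" if "r \<in> ?R" for r
        using that n by (auto simp: red)
      ultimately show ?thesis by simp
    qed
  qed
  also have "\<dots> = (\<Sum>h\<in>punctured M. real (card (A h)) * w h)"
  proof -
    have "(\<Sum>k\<in>coprime_residues n. \<Sum>h | h \<in> punctured M \<and> int n dvd int \<nu> + h * int k. w h)
       = (\<Sum>k\<in>coprime_residues n. \<Sum>h\<in>punctured M. if int n dvd int \<nu> + h * int k then w h else 0)"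
      by (intro sum.cong refl sum.inter_filter) simp
    also have "\<dots> = (\<Sum>h\<in>punctured M. \<Sum>k\<in>coprime_residues n. if int n dvd int \<nu> + h * int k then w h else 0)"
      by (rule sum.swap)
    also have "\<dots> = (\<Sum>h\<in>punctured M. \<Sum>k\<in>A h. w h)"
      unfolding A_def by (intro sum.cong refl sum.inter_filter[symmetric]) simp
    finally show ?thesis by simp
  qed
  also have "\<dots> \<le> (\<Sum>h | h \<in> punctured M \<and> int d dvd h. real d * w h)"
  proof -
    have "(\<Sum>h\<in>punctured M. real (card (A h)) * w h) \<le> (\<Sum>h\<in>punctured M. if int d dvd h then real d * w h else 0)"
    proof (rule sum_mono)
      fix h
      show "real (card (A h)) * w h \<le> (if int d dvd h then real d * w h else 0)"
      proof (cases "A h = {}")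
        case False
        then have "int d dvd h" using card_linear_cong_le(2)[OF n, of \<nu> h] by (simp add: A_def d_def)
        moreover have "card (A h) \<le> d" using card_linear_cong_le(1)[OF n, of \<nu> h] by (simp add: A_def d_def)
        ultimately show ?thesis using w0 by (auto intro!: mult_right_mono)
      qed (use w0 in auto)
    qed
    also have "\<dots> = (\<Sum>h | h \<in> punctured M \<and> int d dvd h. real d * w h)"
      by (rule sum.inter_filter[symmetric]) simp
    finally show ?thesis .
  qed
  \<comment> \<open>Writing \<open>h = int d * h'\<close> lets \<open>h'\<close> run over all of
    \<open>punctured M\<close>, where it loses nothing since only an upper bound is sought.\<close>
  also have "\<dots> \<le> (\<Sum>h\<in>(\<lambda>h. int d * h) ` punctured M. real d * w h)"
  proof (rule sum_mono2)
    show "{h. h \<in> punctured M \<and> int d dvd h} \<subseteq> (\<lambda>h. int d * h) ` punctured M"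
    proof clarsimp
      fix h assume h: "h \<in> punctured M" "int d dvd h"
      then obtain h' where h': "h = int d * h'" by (auto elim: dvdE)
      have "1 * \<bar>h'\<bar> \<le> int d * \<bar>h'\<bar>" using d by (intro mult_right_mono) auto
      then have "\<bar>h'\<bar> \<le> \<bar>h\<bar>" by (simp add: h' abs_mult)
      then have "h' \<in> punctured M" using h h' by (auto simp: punctured_def)
      then show "h \<in> (\<lambda>h. int d * h) ` punctured M" using h' by blast
    qed
  qed (use w0 in auto)
  also have "\<dots> = (\<Sum>h\<in>punctured M. real d * w (int d * h))"
    using d by (subst sum.reindex) (auto simp: inj_on_def)
  also have "\<dots> = (\<Sum>h\<in>punctured M. real d powr (1 - 2 * lam) * w h)"
  proof (intro sum.cong refl)
    fix h
    have "real d * w (int d * h) = real d powr 1 * (real d powr (- 2 * lam) * w h)"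
      using d by (simp add: w_def abs_mult powr_mult)
    also have "\<dots> = real d powr (1 - 2 * lam) * w h"
      by (simp add: powr_diff powr_minus divide_inverse flip: mult.assoc)
    finally show "real d * w (int d * h) = real d powr (1 - 2 * lam) * w h" .
  qed
  also have "\<dots> \<le> (\<Sum>h\<in>punctured M. 1 * w h)"
  proof (intro sum_mono mult_right_mono w0)
    show "real d powr (1 - 2 * lam) \<le> 1"
      using powr_mono[of "1 - 2 * lam" 0 "real d"] d lam by simp
  qed
  also have "\<dots> \<le> 2 * zeta (2 * lam)"
    using sum_punctured_powr_le[OF lam(1), of M] by (simp add: w_def)
  finally show "(\<Sum>k\<in>coprime_residues n. \<Sum>r | r < n \<and> n dvd \<nu> + r * k. B2_coeff n r powr lam) \<le> rho lam + e"
    by (simp add: rho_def powr_minus divide_inverse mult_ac)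
qed

section \<open>The error bound for the component-by-component construction\<close>

lemma sum_PiE_insert:
  fixes F :: "('i \<Rightarrow> 'v) \<Rightarrow> 'b::comm_monoid_add"
  assumes "t \<notin> U"
  shows "(\<Sum>x\<in>PiE (insert t U) (\<lambda>_. A). F x) = (\<Sum>x\<in>PiE U (\<lambda>_. A). \<Sum>r\<in>A. F (x(t := r)))"
proof -
  have "(\<Sum>x\<in>PiE (insert t U) (\<lambda>_. A). F x) = (\<Sum>(r, x)\<in>A \<times> PiE U (\<lambda>_. A). F (x(t := r)))"
    unfolding PiE_insert_eq using assms
    by (subst sum.reindex[OF inj_combinator]) (auto simp: case_prod_unfold)
  also have "\<dots> = (\<Sum>r\<in>A. \<Sum>x\<in>PiE U (\<lambda>_. A). F (x(t := r)))" by (rule sum.cartesian_product[symmetric])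
  also have "\<dots> = (\<Sum>x\<in>PiE U (\<lambda>_. A). \<Sum>r\<in>A. F (x(t := r)))" by (rule sum.swap)
  finally show ?thesis .
qed

text \<open>The part of the squared worst-case error that depends on the component \<open>g t = k\<close>.\<close>

definition cbc_increment :: "(nat set \<Rightarrow> real) \<Rightarrow> nat \<Rightarrow> nat \<Rightarrow> (nat \<Rightarrow> nat) \<Rightarrow> nat \<Rightarrow> real" where
  "cbc_increment \<gamma> n t g k = (\<Sum>U\<in>Pow {..<t}. \<gamma> (insert t U) * (\<Sum>x\<in>PiE U (\<lambda>_. {..<n}).
     \<Sum>r | r < n \<and> n dvd (\<Sum>j\<in>U. x j * g j) + r * k. (\<Prod>j\<in>U. B2_coeff n (x j)) * B2_coeff n r))"

text \<open>A subset of \<open>{..<Suc t}\<close> either avoids \<open>t\<close>, and then its term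
  does not see the component \<open>k\<close>, or it is \<open>insert t U\<close> with
  \<open>U \<subseteq> {..<t}\<close>.\<close>

lemma sq_wce_Suc:
  assumes n: "1 \<le> n"
  shows "sq_wce \<gamma> n (Suc t) (g(t := k)) = sq_wce \<gamma> n t g + cbc_increment \<gamma> n t g k"
proof -
  let ?T = "\<lambda>g U. \<gamma> U * (1 / real n) * (\<Sum>i = 1..n. \<Prod>j\<in>U. B2 (frac (real i * real (g j) / real n)))"
  have P: "Pow {..<Suc t} - {{}} = (Pow {..<t} - {{}}) \<union> insert t ` Pow {..<t}"
    by (auto simp: lessThan_Suc Pow_insert)
  have inj: "inj_on (insert t) (Pow {..<t})" by (rule inj_onI) (metis PowD insert_ident lessThan_iff less_irrefl subsetD)
  have "sq_wce \<gamma> n (Suc t) (g(t := k)) = (\<Sum>U\<in>Pow {..<t} - {{}}. ?T (g(t := k)) U) + (\<Sum>U\<in>insert t ` Pow {..<t}. ?T (g(t := k)) U)"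
    unfolding sq_wce_def P by (rule sum.union_disjoint) auto
  also have "(\<Sum>U\<in>Pow {..<t} - {{}}. ?T (g(t := k)) U) = sq_wce \<gamma> n t g"
    unfolding sq_wce_def
  proof (intro sum.cong refl arg_cong2[where f = "(*)"] prod.cong arg_cong[where f = B2] arg_cong[where f = frac])
    fix U j assume "U \<in> Pow {..<t} - {{}}" "j \<in> U"
    then have "j \<noteq> t" by auto
    then show "real i * real ((g(t := k)) j) / real n = real i * real (g j) / real n" for i by simp
  qed
  also have "(\<Sum>U\<in>insert t ` Pow {..<t}. ?T (g(t := k)) U) = (\<Sum>U\<in>Pow {..<t}. ?T (g(t := k)) (insert t U))"
    by (subst sum.reindex[OF inj]) simp
  also have "\<dots> = cbc_increment \<gamma> n t g k"
    unfolding cbc_increment_def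
  proof (intro sum.cong refl)
    fix U assume "U \<in> Pow {..<t}"
    then have U: "finite U" "t \<notin> U" by (auto intro: finite_subset)
    have "?T (g(t := k)) (insert t U) = \<gamma> (insert t U) * (\<Sum>x\<in>PiE (insert t U) (\<lambda>_. {..<n}).
        if n dvd (\<Sum>j\<in>insert t U. x j * (g(t := k)) j) then \<Prod>j\<in>insert t U. B2_coeff n (x j) else 0)"
      using lattice_B2_sum[OF n, of "insert t U" "g(t := k)"] U(1) by (simp only: mult.assoc finite_insert)
    also have "\<dots> = \<gamma> (insert t U) * (\<Sum>x\<in>PiE U (\<lambda>_. {..<n}). \<Sum>r<n.
        if n dvd (\<Sum>j\<in>U. x j * g j) + r * k then (\<Prod>j\<in>U. B2_coeff n (x j)) * B2_coeff n r else 0)"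
    proof -
      have "(\<Sum>j\<in>insert t U. (x(t := r)) j * (g(t := k)) j) = (\<Sum>j\<in>U. x j * g j) + r * k" for x r
      proof -
        have "(\<Sum>j\<in>U. (x(t := r)) j * (g(t := k)) j) = (\<Sum>j\<in>U. x j * g j)"
          using U by (intro sum.cong refl) auto
        then show ?thesis using U by simp
      qed
      moreover have "(\<Prod>j\<in>insert t U. B2_coeff n ((x(t := r)) j)) = (\<Prod>j\<in>U. B2_coeff n (x j)) * B2_coeff n r" for x r
      proof -
        have "(\<Prod>j\<in>U. B2_coeff n ((x(t := r)) j)) = (\<Prod>j\<in>U. B2_coeff n (x j))"
          using U by (intro prod.cong refl) auto
        then show ?thesis using U by simp
      qed
      ultimately show ?thesis unfolding sum_PiE_insert[OF U(2)] by presburger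
    qed
    also have "\<dots> = \<gamma> (insert t U) * (\<Sum>x\<in>PiE U (\<lambda>_. {..<n}).
     \<Sum>r | r < n \<and> n dvd (\<Sum>j\<in>U. x j * g j) + r * k. (\<Prod>j\<in>U. B2_coeff n (x j)) * B2_coeff n r)"
    proof -
      have "{r. r < n \<and> n dvd \<nu> + r * k} = {r \<in> {..<n}. n dvd \<nu> + r * k}" for \<nu> by auto
      then show ?thesis by (simp only: sum.inter_filter[OF finite_lessThan])
    qed
    finally show "?T (g(t := k)) (insert t U) = \<dots>" .
  qed
  finally show ?thesis .
qed

lemma cbc_increment_nonneg: "(\<And>U. 0 \<le> \<gamma> U) \<Longrightarrow> 0 \<le> cbc_increment \<gamma> n t g k"
  unfolding cbc_increment_def
  by (intro sum_nonneg mult_nonneg_nonneg prod_nonneg B2_coeff_nonneg ballI) auto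

text \<open>Subadditivity moves the power inside all sums, after which \<open>k\<close> occurs only
  in the innermost congruence. Summing that over the candidates costs one \<open>rho lam\<close>,
  whatever the frequencies of the earlier components; each of these contributes another
  \<open>rho lam\<close>.\<close>

lemma cbc_increment_powr_mean:
  assumes n: "1 \<le> n" and \<gamma>: "\<And>U. 0 \<le> \<gamma> U" and lam: "1 / 2 < lam" "lam \<le> 1"
  shows "(\<Sum>k\<in>coprime_residues n. cbc_increment \<gamma> n t g k powr lam)
    \<le> (\<Sum>U\<in>Pow {..<t}. \<gamma> (insert t U) powr lam * rho lam ^ Suc (card U))"
proof -
  let ?X = "\<lambda>U. PiE U (\<lambda>_. {..<n})"
  let ?R = "\<lambda>U x k. {r. r < n \<and> n dvd (\<Sum>j\<in>U. x j * g j) + r * k}"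
  let ?c = "B2_coeff n"
  have finX: "finite (?X U)" if "U \<in> Pow {..<t}" for U
    using that by (intro finite_PiE) (auto intro: finite_subset)
  have bound: "cbc_increment \<gamma> n t g k powr lam
      \<le> (\<Sum>U\<in>Pow {..<t}. \<gamma> (insert t U) powr lam * (\<Sum>x\<in>?X U. (\<Prod>j\<in>U. ?c (x j) powr lam) * (\<Sum>r\<in>?R U x k. ?c r powr lam)))" for k
  proof -
    have pr: "0 \<le> (\<Prod>j\<in>U. ?c (x j))" for U and x :: "nat \<Rightarrow> nat" by (intro prod_nonneg) (simp add: B2_coeff_nonneg)
    have "cbc_increment \<gamma> n t g k powr lam \<le> (\<Sum>U\<in>Pow {..<t}. (\<gamma> (insert t U) * (\<Sum>x\<in>?X U. \<Sum>r\<in>?R U x k. (\<Prod>j\<in>U. ?c (x j)) * ?c r)) powr lam)"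
      unfolding cbc_increment_def using lam \<gamma> pr
      by (intro powr_sum_le_sum_powr) (auto intro!: mult_nonneg_nonneg sum_nonneg B2_coeff_nonneg)
    also have "\<dots> \<le> (\<Sum>U\<in>Pow {..<t}. \<gamma> (insert t U) powr lam * (\<Sum>x\<in>?X U. (\<Prod>j\<in>U. ?c (x j) powr lam) * (\<Sum>r\<in>?R U x k. ?c r powr lam)))"
    proof (rule sum_mono)
      fix U assume U: "U \<in> Pow {..<t}"
      have "(\<Sum>x\<in>?X U. \<Sum>r\<in>?R U x k. (\<Prod>j\<in>U. ?c (x j)) * ?c r) powr lam
         \<le> (\<Sum>x\<in>?X U. (\<Sum>r\<in>?R U x k. (\<Prod>j\<in>U. ?c (x j)) * ?c r) powr lam)"
        using lam pr finX[OF U] by (intro powr_sum_le_sum_powr) (auto intro!: sum_nonneg mult_nonneg_nonneg B2_coeff_nonneg)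
      also have "\<dots> \<le> (\<Sum>x\<in>?X U. \<Sum>r\<in>?R U x k. ((\<Prod>j\<in>U. ?c (x j)) * ?c r) powr lam)"
      proof (rule sum_mono)
        fix x
        show "(\<Sum>r\<in>?R U x k. (\<Prod>j\<in>U. ?c (x j)) * ?c r) powr lam \<le> (\<Sum>r\<in>?R U x k. ((\<Prod>j\<in>U. ?c (x j)) * ?c r) powr lam)"
          by (rule powr_sum_le_sum_powr) (use lam in \<open>simp_all add: pr B2_coeff_nonneg\<close>)
      qed
      also have "\<dots> = (\<Sum>x\<in>?X U. (\<Prod>j\<in>U. ?c (x j) powr lam) * (\<Sum>r\<in>?R U x k. ?c r powr lam))"
        unfolding sum_distrib_left
        using pr by (intro sum.cong refl) (simp add: powr_mult B2_coeff_nonneg prod_powr_distrib)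
      finally have le: "(\<Sum>x\<in>?X U. \<Sum>r\<in>?R U x k. (\<Prod>j\<in>U. ?c (x j)) * ?c r) powr lam
         \<le> (\<Sum>x\<in>?X U. (\<Prod>j\<in>U. ?c (x j) powr lam) * (\<Sum>r\<in>?R U x k. ?c r powr lam))" .
      show "(\<gamma> (insert t U) * (\<Sum>x\<in>?X U. \<Sum>r\<in>?R U x k. (\<Prod>j\<in>U. ?c (x j)) * ?c r)) powr lam
         \<le> \<gamma> (insert t U) powr lam * (\<Sum>x\<in>?X U. (\<Prod>j\<in>U. ?c (x j) powr lam) * (\<Sum>r\<in>?R U x k. ?c r powr lam))"
        unfolding powr_mult by (rule mult_left_mono[OF le]) simp
    qed
    finally show ?thesis .
  qed
  have "(\<Sum>k\<in>coprime_residues n. cbc_increment \<gamma> n t g k powr lam)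
      \<le> (\<Sum>k\<in>coprime_residues n. \<Sum>U\<in>Pow {..<t}. \<gamma> (insert t U) powr lam * (\<Sum>x\<in>?X U. (\<Prod>j\<in>U. ?c (x j) powr lam) * (\<Sum>r\<in>?R U x k. ?c r powr lam)))"
    by (intro sum_mono bound)
  \<comment> \<open>The sum over candidates is pulled in to the only place that depends on
    \<open>k\<close>.\<close>
  also have "\<dots> = (\<Sum>U\<in>Pow {..<t}. \<gamma> (insert t U) powr lam * (\<Sum>x\<in>?X U. (\<Prod>j\<in>U. ?c (x j) powr lam) * (\<Sum>k\<in>coprime_residues n. \<Sum>r\<in>?R U x k. ?c r powr lam)))"
    by (subst sum.swap, intro sum.cong refl, subst sum_distrib_left[symmetric], intro arg_cong2[where f = "(*)"] refl,
        subst sum.swap, intro sum.cong refl, rule sum_distrib_left[symmetric])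
  also have "\<dots> \<le> (\<Sum>U\<in>Pow {..<t}. \<gamma> (insert t U) powr lam * (\<Sum>x\<in>?X U. (\<Prod>j\<in>U. ?c (x j) powr lam) * rho lam))"
    by (intro sum_mono mult_left_mono sum_dual_lattice_le n lam prod_nonneg) auto
  also have "\<dots> = (\<Sum>U\<in>Pow {..<t}. \<gamma> (insert t U) powr lam * ((\<Sum>r<n. ?c r powr lam) ^ card U * rho lam))"
  proof (intro sum.cong refl arg_cong2[where f = "(*)"])
    fix U assume "U \<in> Pow {..<t}"
    then have "finite U" by (auto intro: finite_subset)
    then have "(\<Sum>x\<in>?X U. \<Prod>j\<in>U. ?c (x j) powr lam) = (\<Prod>j\<in>U. \<Sum>r<n. ?c r powr lam)"
      by (subst prod_sum_PiE) auto
    then show "(\<Sum>x\<in>?X U. (\<Prod>j\<in>U. ?c (x j) powr lam) * rho lam) = (\<Sum>r<n. ?c r powr lam) ^ card U * rho lam"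
      by (simp flip: sum_distrib_right)
  qed
  also have "\<dots> \<le> (\<Sum>U\<in>Pow {..<t}. \<gamma> (insert t U) powr lam * (rho lam ^ card U * rho lam))"
    using sum_B2_coeff_powr_le[OF n lam] rho_pos[OF lam(1)]
    by (intro sum_mono mult_left_mono mult_right_mono power_mono sum_nonneg) auto
  finally show ?thesis by (simp add: mult.commute)
qed

text \<open>Every prefix of a CBC vector is again one, so the bound is propagated in
  \<open>t\<close>. Old error and new increment are merged by subadditivity; their
  \<open>lam\<close>-th powers add up, matching the split of the subsets by membership of
  \<open>t\<close>.\<close>

theorem cbc_sq_wce_bound:
  assumes n: "2 \<le> n" and \<gamma>: "\<And>U. 0 \<le> \<gamma> U" and lam: "1 / 2 < lam" "lam \<le> 1"
    and cbc: "cbc_vector \<gamma> n s g"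
  shows "t \<le> s \<Longrightarrow> 0 \<le> sq_wce \<gamma> n t g \<and> sq_wce \<gamma> n t g powr lam
    \<le> (\<Sum>U\<in>Pow {..<t} - {{}}. \<gamma> U powr lam * rho lam ^ card U) / real (card (coprime_residues n))"
proof (induction t)
  case 0
  then show ?case by (simp add: sq_wce_def)
next
  case (Suc t)
  let ?\<phi> = "real (card (coprime_residues n))"
  let ?\<theta> = "cbc_increment \<gamma> n t g"
  have "1 \<in> coprime_residues n" using n by (simp add: coprime_residues_def)
  then have \<phi>: "?\<phi> > 0" by (metis card_gt_0_iff empty_iff finite_coprime_residues of_nat_0_less_iff)
  have n1: "1 \<le> n" using n by simp
  have min: "?\<theta> (g t) \<le> ?\<theta> k" if k: "k \<in> coprime_residues n" for k
  proof (cases "t = 0")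
    \<comment> \<open>The first component is fixed rather than chosen by minimisation. Every
      candidate gives the same increment here, because \<open>n dvd r * k'\<close> leaves only
      \<open>r = 0\<close>.\<close>
    case True
    have "{r. r < n \<and> n dvd r * k'} = {0}" if "k' \<in> coprime_residues n" for k'
    proof -
      have "coprime n k'" using that by (simp add: coprime_residues_def coprime_iff_gcd_eq_1 gcd.commute)
      then have "n dvd r * k' \<longleftrightarrow> n dvd r" for r by (simp add: coprime_dvd_mult_left_iff)
      then show ?thesis using n by (auto dest: dvd_imp_le)
    qed
    moreover have "g 0 \<in> coprime_residues n" using cbc n by (simp add: cbc_vector_def coprime_residues_def)
    ultimately show ?thesis using True k by (simp add: cbc_increment_def)
  next
    case False
    then have "is_arg_min (\<lambda>k. sq_wce \<gamma> n (Suc t) (g(t := k))) (\<lambda>k. 1 \<le> k \<and> k < n \<and> gcd k n = 1) (g t)"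
      using cbc Suc.prems by (simp add: cbc_vector_def)
    then have "\<not> sq_wce \<gamma> n (Suc t) (g(t := k)) < sq_wce \<gamma> n (Suc t) (g(t := g t))"
      using k by (simp add: is_arg_min_def coprime_residues_def del: fun_upd_triv)
    then show ?thesis unfolding sq_wce_Suc[OF n1] by simp
  qed
  have th0: "0 \<le> ?\<theta> k" for k by (rule cbc_increment_nonneg[OF \<gamma>])
  have E: "sq_wce \<gamma> n (Suc t) g = sq_wce \<gamma> n t g + ?\<theta> (g t)"
    using sq_wce_Suc[OF n1, of \<gamma> t g "g t"] by simp
  have IH: "0 \<le> sq_wce \<gamma> n t g" "sq_wce \<gamma> n t g powr lam
    \<le> (\<Sum>U\<in>Pow {..<t} - {{}}. \<gamma> U powr lam * rho lam ^ card U) / ?\<phi>"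
    using Suc by auto
  have "?\<phi> * ?\<theta> (g t) powr lam = (\<Sum>k\<in>coprime_residues n. ?\<theta> (g t) powr lam)" by simp
  also have "\<dots> \<le> (\<Sum>k\<in>coprime_residues n. ?\<theta> k powr lam)"
    using lam th0 min by (intro sum_mono powr_mono2) auto
  also have "\<dots> \<le> (\<Sum>U\<in>Pow {..<t}. \<gamma> (insert t U) powr lam * rho lam ^ Suc (card U))"
    by (rule cbc_increment_powr_mean[OF n1 \<gamma> lam])
  finally have th: "?\<theta> (g t) powr lam \<le> (\<Sum>U\<in>Pow {..<t}. \<gamma> (insert t U) powr lam * rho lam ^ Suc (card U)) / ?\<phi>"
    using \<phi> by (simp add: pos_le_divide_eq mult.commute)
  have P: "Pow {..<Suc t} - {{}} = (Pow {..<t} - {{}}) \<union> insert t ` Pow {..<t}"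
    by (auto simp: lessThan_Suc Pow_insert)
  have inj: "inj_on (insert t) (Pow {..<t})" by (rule inj_onI) (metis PowD insert_ident lessThan_iff less_irrefl subsetD)
  have "(\<Sum>U\<in>Pow {..<Suc t} - {{}}. \<gamma> U powr lam * rho lam ^ card U)
    = (\<Sum>U\<in>Pow {..<t} - {{}}. \<gamma> U powr lam * rho lam ^ card U) + (\<Sum>U\<in>insert t ` Pow {..<t}. \<gamma> U powr lam * rho lam ^ card U)"
    unfolding P by (rule sum.union_disjoint) auto
  also have "(\<Sum>U\<in>insert t ` Pow {..<t}. \<gamma> U powr lam * rho lam ^ card U) = (\<Sum>U\<in>Pow {..<t}. \<gamma> (insert t U) powr lam * rho lam ^ card (insert t U))"
    by (subst sum.reindex[OF inj]) simp
  also have "\<dots> = (\<Sum>U\<in>Pow {..<t}. \<gamma> (insert t U) powr lam * rho lam ^ Suc (card U))"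
  proof (intro sum.cong refl)
    fix U assume "U \<in> Pow {..<t}"
    then have "finite U" "t \<notin> U" by (auto intro: finite_subset)
    then show "\<gamma> (insert t U) powr lam * rho lam ^ card (insert t U) = \<gamma> (insert t U) powr lam * rho lam ^ Suc (card U)" by simp
  qed
  finally have sum: "(\<Sum>U\<in>Pow {..<Suc t} - {{}}. \<gamma> U powr lam * rho lam ^ card U)
    = (\<Sum>U\<in>Pow {..<t} - {{}}. \<gamma> U powr lam * rho lam ^ card U) + (\<Sum>U\<in>Pow {..<t}. \<gamma> (insert t U) powr lam * rho lam ^ Suc (card U))" .
  have "sq_wce \<gamma> n (Suc t) g powr lam \<le> sq_wce \<gamma> n t g powr lam + ?\<theta> (g t) powr lam"
    unfolding E by (rule powr_add_le_add_powr) (use IH(1) th0 lam in auto)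
  also have "\<dots> \<le> (\<Sum>U\<in>Pow {..<Suc t} - {{}}. \<gamma> U powr lam * rho lam ^ card U) / ?\<phi>"
    unfolding sum add_divide_distrib by (intro add_mono IH th)
  finally show ?case using E IH(1) th0 by auto
qed

text \<open>The odd numbers below \<open>2 ^ m\<close> are candidates. This is the origin of the
  factor \<open>2\<close> in \<open>2 / n\<close>.\<close>

lemma card_coprime_residues_power_2:
  assumes "1 \<le> m"
  shows "2 ^ m / 2 \<le> real (card (coprime_residues (2 ^ m)))"
proof -
  obtain k where k: "m = Suc k" using assms by (cases m) auto
  have "(\<lambda>j. 2 * j + 1) ` {..<2 ^ k} \<subseteq> coprime_residues (2 ^ m)"
  proof (rule image_subsetI)
    fix j :: nat assume "j \<in> {..<2 ^ k}"
    then have "2 * j + 1 < 2 ^ m" by (simp add: k)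
    moreover have "gcd (2 * j + 1) (2 ^ m) = 1"
      by (simp add: coprime_iff_gcd_eq_1[symmetric] coprime_power_right_iff)
    ultimately show "2 * j + 1 \<in> coprime_residues (2 ^ m)" by (simp add: coprime_residues_def)
  qed
  then have "card ((\<lambda>j::nat. 2 * j + 1) ` {..<2 ^ k}) \<le> card (coprime_residues (2 ^ m))"
    by (intro card_mono) auto
  also have "card ((\<lambda>j::nat. 2 * j + 1) ` {..<2 ^ k}) = 2 ^ k"
    by (subst card_image) (auto simp: inj_on_def)
  finally have "real (2 ^ k) \<le> real (card (coprime_residues (2 ^ m)))" by (simp only: of_nat_le_iff)
  then show ?thesis by (simp add: k)
qed

theorem cbc_sq_wce_power_2:
  assumes m: "1 \<le> m" and \<gamma>: "\<And>U. 0 \<le> \<gamma> U" and lam: "1 / 2 < lam" "lam \<le> 1"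
    and cbc: "cbc_vector \<gamma> (2 ^ m) s g"
  shows "sqrt (sq_wce \<gamma> (2 ^ m) s g)
    \<le> (2 / real (2 ^ m)) powr (1 / (2 * lam)) * (\<Sum>U\<in>Pow {..<s}. \<gamma> U powr lam * rho lam ^ card U) powr (1 / (2 * lam))"
proof -
  let ?\<phi> = "real (card (coprime_residues (2 ^ m)))" and ?E = "sq_wce \<gamma> (2 ^ m) s g"
  let ?S = "\<Sum>U\<in>Pow {..<s}. \<gamma> U powr lam * rho lam ^ card U"
  have n2: "2 \<le> (2::nat) ^ m" using m by (cases m) auto
  have rho: "0 < rho lam" by (rule rho_pos[OF lam(1)])
  have E: "0 \<le> ?E" "?E powr lam \<le> (\<Sum>U\<in>Pow {..<s} - {{}}. \<gamma> U powr lam * rho lam ^ card U) / ?\<phi>"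
    using cbc_sq_wce_bound[OF n2 \<gamma> lam cbc order_refl] by auto
  \<comment> \<open>Including the empty set only enlarges the sum and produces the first factor of
    \<open>C_gamma\<close>.\<close>
  have "?E powr lam \<le> ?S / ?\<phi>"
  proof -
    have "(\<Sum>U\<in>Pow {..<s} - {{}}. \<gamma> U powr lam * rho lam ^ card U) \<le> ?S"
      using rho by (intro sum_mono2) auto
    then show ?thesis using E(2) by (meson divide_right_mono of_nat_0_le_iff order_trans)
  qed
  also have "\<dots> \<le> ?S / (2 ^ m / 2)"
  proof (rule divide_left_mono[OF card_coprime_residues_power_2[OF m]])
    have "0 < (2::real) ^ m / 2" by simp
    then have "0 < ?\<phi>" using card_coprime_residues_power_2[OF m] by linarith
    then show "0 < ?\<phi> * (2 ^ m / 2)" by simp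
  qed (use rho in \<open>auto intro!: sum_nonneg\<close>)
  finally have le: "?E powr lam \<le> 2 / real (2 ^ m) * ?S" by (simp add: field_simps)
  have "sqrt ?E = ?E powr (1 / 2)" using E(1) by (simp add: powr_half_sqrt)
  also have "\<dots> = (?E powr lam) powr (1 / (2 * lam))" using lam by (simp add: powr_powr)
  also have "\<dots> \<le> (2 / real (2 ^ m) * ?S) powr (1 / (2 * lam))"
    using le lam by (intro powr_mono2) auto
  also have "\<dots> = (2 / real (2 ^ m)) powr (1 / (2 * lam)) * ?S powr (1 / (2 * lam))"
    by (rule powr_mult)
  finally show ?thesis .
qed

section \<open>The quadrature error for a fixed shift\<close>

lemma integral_uniform_measure_one:
  fixes f :: "'a \<Rightarrow> real"
  assumes "A \<in> sets M" "emeasure M A = 1" "f \<in> borel_measurable M"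
  shows "(LINT x|uniform_measure M A. f x) = (LINT x:A|M. f x)"
proof -
  have "uniform_measure M A = density M (\<lambda>x. ennreal (indicator A x))"
    unfolding uniform_measure_def by (rule density_cong) (use assms in \<open>auto split: split_indicator\<close>)
  then show ?thesis
    using assms by (simp add: integral_density set_lebesgue_integral_def)
qed

text \<open>The common core of the two Cauchy-Schwarz inequalities below, for integrals and for the
  form \<open>h\<close> of a coercive family.\<close>

lemma quadratic_nonneg_discriminant:
  fixes a b c :: real
  assumes "\<And>t. 0 \<le> a - 2 * t * b + t\<^sup>2 * c"
  shows "b\<^sup>2 \<le> a * c"
proof (cases "c = 0")
  case True
  have "b = 0"
  proof (rule ccontr)
    assume "b \<noteq> 0"
    \<comment> \<open>With \<open>c = 0\<close> the expression is affine in \<open>t\<close>, and at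
      this \<open>t\<close> its value is \<open>-1\<close>.\<close>
    then show False using assms[of "(a + 1) / (2 * b)"] True by simp
  qed
  then show ?thesis using True by simp
next
  case False
  have "c \<ge> 0"
  proof (rule ccontr)
    assume c: "\<not> c \<ge> 0"
    have a: "a \<ge> 0" using assms[of 0] by simp
    have *: "0 \<le> a + t\<^sup>2 * c" for t using assms[of t] assms[of "-t"] by simp
    have "(sqrt ((a + 1) / - c))\<^sup>2 = (a + 1) / - c" using a c by (intro real_sqrt_pow2 divide_nonneg_pos) auto
    then show False using *[of "sqrt ((a + 1) / - c)"] c by (simp add: field_simps)
  qed
  then have c: "c > 0" using False by simp
  have "0 \<le> a - 2 * (b / c) * b + (b / c)\<^sup>2 * c" by (rule assms)
  also have "\<dots> = a - b\<^sup>2 / c" using c by (simp add: field_simps power2_eq_square)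
  finally show ?thesis using c by (simp add: field_simps)
qed

lemma integral_Cauchy_Schwarz:
  fixes f g :: "'a \<Rightarrow> real"
  assumes "integrable M (\<lambda>x. (f x)\<^sup>2)" "integrable M (\<lambda>x. (g x)\<^sup>2)" "integrable M (\<lambda>x. f x * g x)"
  shows "(LINT x|M. f x * g x)\<^sup>2 \<le> (LINT x|M. (f x)\<^sup>2) * (LINT x|M. (g x)\<^sup>2)"
proof (rule quadratic_nonneg_discriminant)
  fix t
  have "0 \<le> (LINT x|M. (f x - t * g x)\<^sup>2)" by simp
  also have "(\<lambda>x. (f x - t * g x)\<^sup>2) = (\<lambda>x. (f x)\<^sup>2 - 2 * t * (f x * g x) + t\<^sup>2 * (g x)\<^sup>2)"
    by (auto simp: power2_eq_square algebra_simps)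
  also have "(LINT x|M. (f x)\<^sup>2 - 2 * t * (f x * g x) + t\<^sup>2 * (g x)\<^sup>2)
     = (LINT x|M. (f x)\<^sup>2) - 2 * t * (LINT x|M. f x * g x) + t\<^sup>2 * (LINT x|M. (g x)\<^sup>2)"
    using assms by simp
  finally show "0 \<le> (LINT x|M. (f x)\<^sup>2) - 2 * t * (LINT x|M. f x * g x) + t\<^sup>2 * (LINT x|M. (g x)\<^sup>2)" .
qed

section \<open>Kernel representation on the centred interval\<close>

definition centred :: "real measure" where
  "centred = uniform_measure lborel {-1/2..1/2}"

lemma space_centred [simp]: "space centred = UNIV" and sets_centred [simp, measurable_cong]: "sets centred = sets borel"
  by (simp_all add: centred_def)

abbreviation unit_uniform :: "real measure" where
  "unit_uniform \<equiv> uniform_measure lborel {0..1}"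

lemma prob_space_centred: "prob_space centred" and prob_space_unit: "prob_space unit_uniform"
  unfolding centred_def by (intro prob_space_uniform_measure; simp)+

lemma integral_centred: "f \<in> borel_measurable borel \<Longrightarrow> (LINT x|centred. f x) = (LINT x:{-1/2..1/2}|lborel. f x)" for f :: "real \<Rightarrow> real"
  unfolding centred_def by (rule integral_uniform_measure_one) auto

lemma integral_unit: "f \<in> borel_measurable borel \<Longrightarrow> (LINT x|unit_uniform. f x) = (LINT x:{0..1}|lborel. f x)" for f :: "real \<Rightarrow> real"
  by (rule integral_uniform_measure_one) auto

text \<open>\<open>kap\<close> is the kernel of the representation \<open>f y = \<integral> f + \<integral> f' x * kap y x dx\<close> on
  \<open>{-1/2..1/2}\<close>.\<close>

definition kap :: "real \<Rightarrow> real \<Rightarrow> real" where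
  "kap y x = x + 1/2 - (if y < x then 1 else 0)"

lemma kap_measurable [measurable (raw)]:
  assumes [measurable]: "f \<in> borel_measurable M" "g \<in> borel_measurable M"
  shows "(\<lambda>x. kap (f x) (g x)) \<in> borel_measurable M"
  unfolding kap_def by measurable

lemma set_integral_split:
  fixes f :: "real \<Rightarrow> real"
  assumes "a \<le> c" "c \<le> b" "set_integrable lborel {a..b} f"
  shows "(LINT x:{a..b}|lborel. f x) = (LINT x:{a..c}|lborel. f x) + (LINT x:{c..b}|lborel. f x)"
proof -
  have 1: "set_integrable lborel {a..c} f" "set_integrable lborel {c<..b} f" "set_integrable lborel {c..b} f"
    using assms by (auto intro: set_integrable_subset)
  have "{a..b} = {a..c} \<union> {c<..b}" using assms by auto
  then have "(LINT x:{a..b}|lborel. f x) = (LINT x:{a..c}|lborel. f x) + (LINT x:{c<..b}|lborel. f x)"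
    using 1 by (simp add: set_integral_Un ivl_disj_int)
  also have "(LINT x:{c<..b}|lborel. f x) = (LINT x:{c..b}|lborel. f x)"
  proof -
    have "AE x in lborel. x \<noteq> c" by (rule AE_lborel_singleton)
    then have "AE x in lborel. indicator {c<..b} x *\<^sub>R f x = indicator {c..b} x *\<^sub>R f x"
      by eventually_elim (auto split: split_indicator)
    moreover have "(\<lambda>x. indicator {c<..b} x *\<^sub>R f x) \<in> borel_measurable lborel" "(\<lambda>x. indicator {c..b} x *\<^sub>R f x) \<in> borel_measurable lborel"
      using 1 unfolding set_integrable_def by auto
    ultimately show ?thesis unfolding set_lebesgue_integral_def by (intro integral_cong_AE) auto
  qed
  finally show ?thesis .
qed

lemma set_integral_FTC:
  fixes F :: "real \<Rightarrow> real"
  assumes "a \<le> b" "\<And>x. x \<in> {a..b} \<Longrightarrow> (F has_real_derivative f x) (at x within {a..b})" "continuous_on {a..b} f"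
  shows "(LINT x:{a..b}|lborel. f x) = F b - F a"
  unfolding set_lebesgue_integral_def
  by (rule integral_FTC_Icc) (use assms in \<open>auto simp: has_real_derivative_iff_has_vector_derivative\<close>)

text \<open>By the product rule \<open>f x + f' x * (x + 1/2)\<close> integrates to
  \<open>f (1/2)\<close>. The jump of \<open>kap\<close> subtracts the integral of \<open>f'\<close>
  from \<open>y\<close> to \<open>1/2\<close>, which leaves \<open>f y\<close>.\<close>

lemma kernel_representation:
  fixes f f' :: "real \<Rightarrow> real"
  assumes y: "y \<in> {-1/2..1/2}"
    and der: "\<And>x. x \<in> {-1/2..1/2} \<Longrightarrow> (f has_real_derivative f' x) (at x within {-1/2..1/2})"
    and cont: "continuous_on {-1/2..1/2} f'"
    and meas: "f \<in> borel_measurable borel" "f' \<in> borel_measurable borel"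
  shows "f y = (LINT x|centred. f x + f' x * kap y x)"
proof -
  define l u :: real where lu: "l = -1/2" "u = 1/2"
  have l: "l \<le> u" "y \<in> {l..u}" using y by (auto simp: lu)
  have der: "\<And>x. x \<in> {l..u} \<Longrightarrow> (f has_real_derivative f' x) (at x within {l..u})"
    and cont: "continuous_on {l..u} f'" using der cont by (auto simp: lu)
  have cf: "continuous_on {l..u} f" using der by (meson DERIV_continuous continuous_on_eq_continuous_within)
  have int1: "set_integrable lborel {l..u} (\<lambda>x. f x + f' x * (x + 1/2))"
    by (intro borel_integrable_atLeastAtMost' continuous_intros cf cont)
  have i1: "(LINT x:{l..u}|lborel. f x + f' x * (x + 1/2)) = f u"
  proof (subst set_integral_FTC[where F = "\<lambda>x. f x * (x + 1/2)"])
    show "((\<lambda>x. f x * (x + 1/2)) has_real_derivative f x + f' x * (x + 1/2)) (at x within {l..u})" if "x \<in> {l..u}" for x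
      by (rule derivative_eq_intros der[OF that] refl | simp)+
    show "continuous_on {l..u} (\<lambda>x. f x + f' x * (x + 1/2))" by (intro continuous_intros cf cont)
  qed (use l lu in auto)
  have int2: "set_integrable lborel {y..u} f'"
    using l by (intro borel_integrable_atLeastAtMost' continuous_on_subset[OF cont]) auto
  have i2: "(LINT x:{y..u}|lborel. f' x) = f u - f y"
    using l by (intro set_integral_FTC continuous_on_subset[OF cont] DERIV_subset[OF der]) auto
  have "(LINT x|centred. f x + f' x * kap y x) = (LINT x:{l..u}|lborel. f x + f' x * kap y x)"
    unfolding lu using meas[measurable] by (intro integral_centred) measurable
  also have "\<dots> = (LINT x|lborel. indicator {l..u} x *\<^sub>R (f x + f' x * (x + 1/2)) - indicator {y..u} x *\<^sub>R f' x)"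
  proof -
    have "AE x in lborel. x \<noteq> y" by (rule AE_lborel_singleton)
    then have "AE x in lborel. indicator {l..u} x *\<^sub>R (f x + f' x * kap y x) = indicator {l..u} x *\<^sub>R (f x + f' x * (x + 1/2)) - indicator {y..u} x *\<^sub>R f' x"
      by eventually_elim (use l in \<open>auto split: split_indicator simp: kap_def algebra_simps\<close>)
    then show ?thesis unfolding set_lebesgue_integral_def
      using meas[measurable] by (intro integral_cong_AE) measurable
  qed
  also have "\<dots> = (LINT x:{l..u}|lborel. f x + f' x * (x + 1/2)) - (LINT x:{y..u}|lborel. f' x)"
    using int1 int2 unfolding set_lebesgue_integral_def set_integrable_def by (rule Bochner_Integration.integral_diff)
  also have "\<dots> = f y" unfolding i1 i2 by simp
  finally show ?thesis by simp
qed

lemma integral_kap_kap: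
  assumes a: "a \<in> {-1/2..1/2}" and b: "b \<in> {-1/2..1/2}"
  shows "(LINT x|centred. kap a x * kap b x) = ((a + 1/2)\<^sup>2 + (b + 1/2)\<^sup>2) / 2 - (max a b + 1/2) + 1/3"
proof -
  have *: "(LINT x|centred. kap a x * kap b x) = ((a + 1/2)\<^sup>2 + (b + 1/2)\<^sup>2) / 2 - (b + 1/2) + 1/3"
    if a: "a \<in> {-1/2..1/2}" and b: "b \<in> {-1/2..1/2}" and ab: "a \<le> b" for a b
  proof -
    let ?I = "{-1/2..1/2::real}"
    have i1: "(LINT x:?I|lborel. (x + 1/2)\<^sup>2) = 1/3"
      by (subst set_integral_FTC[where F = "\<lambda>x. (x + 1/2)^3 / 3"]) (auto intro!: derivative_eq_intros continuous_intros simp: power2_eq_square power3_eq_cube)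
    have i2: "(LINT x:{c..1/2}|lborel. (x + 1/2)) = (1 - (c + 1/2)\<^sup>2) / 2" if "c \<in> ?I" for c
      using that by (subst set_integral_FTC[where F = "\<lambda>x. (x + 1/2)^2 / 2"]) (auto intro!: derivative_eq_intros continuous_intros simp: field_simps power2_eq_square)
    have i3: "(LINT x:{b..1/2}|lborel. (1::real)) = 1/2 - b"
      using b by (subst set_integral_FTC[where F = "\<lambda>x. x"]) (auto intro!: derivative_eq_intros continuous_intros)
    have "(LINT x|centred. kap a x * kap b x) = (LINT x:?I|lborel. kap a x * kap b x)"
      by (intro integral_centred) measurable
    \<comment> \<open>The product of the two jump terms is the jump at the larger point
      \<open>b\<close>, whence the last indicator.\<close>
    also have "\<dots> = (LINT x|lborel. indicator ?I x *\<^sub>R (x + 1/2)\<^sup>2 - indicator {a..1/2} x *\<^sub>R (x + 1/2) - indicator {b..1/2} x *\<^sub>R (x + 1/2) + indicator {b..1/2} x *\<^sub>R 1)"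
    proof -
      have "AE x in lborel. x \<noteq> a" "AE x in lborel. x \<noteq> b" by (rule AE_lborel_singleton)+
      then have "AE x in lborel. indicator ?I x *\<^sub>R (kap a x * kap b x)
        = indicator ?I x *\<^sub>R (x + 1/2)\<^sup>2 - indicator {a..1/2} x *\<^sub>R (x + 1/2) - indicator {b..1/2} x *\<^sub>R (x + 1/2) + indicator {b..1/2} x *\<^sub>R 1"
        by eventually_elim (use a b ab in \<open>auto split: split_indicator simp: kap_def algebra_simps power2_eq_square\<close>)
      then show ?thesis unfolding set_lebesgue_integral_def by (intro integral_cong_AE) measurable
    qed
    also have "\<dots> = (LINT x:?I|lborel. (x + 1/2)\<^sup>2) - (LINT x:{a..1/2}|lborel. (x + 1/2)) - (LINT x:{b..1/2}|lborel. (x + 1/2)) + (LINT x:{b..1/2}|lborel. 1)"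
    proof -
      have "set_integrable lborel ?I (\<lambda>x. (x + 1/2)\<^sup>2)" "set_integrable lborel {a..1/2} (\<lambda>x. x + 1/2)"
        "set_integrable lborel {b..1/2} (\<lambda>x. x + 1/2)" "set_integrable lborel {b..1/2} (\<lambda>x. 1::real)"
        by (auto intro!: borel_integrable_atLeastAtMost' continuous_intros)
      then show ?thesis unfolding set_lebesgue_integral_def set_integrable_def by simp
    qed
    also have "\<dots> = ((a + 1/2)\<^sup>2 + (b + 1/2)\<^sup>2) / 2 - (b + 1/2) + 1/3"
      unfolding i1 i2[OF a] i2[OF b] i3 by (simp add: field_simps)
    finally show ?thesis .
  qed
  show ?thesis
  proof (cases "a \<le> b")
    case True
    then show ?thesis using *[OF a b] by (simp add: max_def)
  next
    case False
    then have "(LINT x|centred. kap b x * kap a x) = ((b + 1/2)\<^sup>2 + (a + 1/2)\<^sup>2) / 2 - (a + 1/2) + 1/3"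
      using *[OF b a] by simp
    then show ?thesis using False by (simp add: max_def mult.commute add.commute)
  qed
qed

section \<open>Averages over a random shift\<close>

lemma frac_cong: "x - y \<in> \<int> \<Longrightarrow> frac x = frac y" for x y :: real
  using frac_add_int_left[of "x - y" y] by simp

lemma frac_measurable [measurable]: "(frac :: real \<Rightarrow> real) \<in> borel_measurable borel"
  unfolding frac_def by measurable

lemma set_integral_translate:
  fixes h :: "real \<Rightarrow> real"
  shows "(LINT x:{a..b}|lborel. h x) = (LINT x:{a + t..b + t}|lborel. h (x - t))"
proof -
  have "(LINT x:{a..b}|lborel. h x) = \<bar>1\<bar> *\<^sub>R (LINT x|lborel. indicator {a..b} (- t + 1 * x) *\<^sub>R h (- t + 1 * x))"
    unfolding set_lebesgue_integral_def by (rule lborel_integral_real_affine) simp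
  also have "\<dots> = (LINT x|lborel. indicator {a + t..b + t} x *\<^sub>R h (x - t))"
    unfolding scaleR_one abs_one by (intro Bochner_Integration.integral_cong refl) (auto split: split_indicator)
  finally show ?thesis unfolding set_lebesgue_integral_def .
qed

lemma set_integrable_bounded:
  fixes h :: "real \<Rightarrow> real"
  assumes [measurable]: "h \<in> borel_measurable borel" and "\<And>x. \<bar>h x\<bar> \<le> C"
  shows "set_integrable lborel {a..b} h"
  unfolding set_integrable_def
proof (rule Bochner_Integration.integrable_bound)
  show "integrable lborel (\<lambda>x. indicator {a..b} x *\<^sub>R C)"
    using borel_integrable_atLeastAtMost'[of a b "\<lambda>_. C"] by (simp add: set_integrable_def)
  show "AE x in lborel. norm (indicator {a..b} x *\<^sub>R h x) \<le> norm (indicator {a..b} x *\<^sub>R C)"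
    by (intro AE_I2) (auto split: split_indicator intro!: order_trans[OF assms(2) abs_ge_self])
qed measurable

text \<open>A shift modulo 1 preserves the uniform distribution: the translated interval is cut at
  \<open>1\<close> and the overhang is moved back by one period.\<close>

lemma integral_unit_shift:
  fixes h :: "real \<Rightarrow> real"
  assumes [measurable]: "h \<in> borel_measurable borel" and C: "\<And>x. \<bar>h x\<bar> \<le> C"
  shows "(LINT \<delta>|unit_uniform. h (frac (\<tau> + \<delta>))) = (LINT \<delta>|unit_uniform. h \<delta>)"
proof -
  define \<theta> where "\<theta> = frac \<tau>"
  have \<theta>: "0 \<le> \<theta>" "\<theta> \<le> 1" using frac_lt_1[of \<tau>] by (auto simp: \<theta>_def)
  define k where "k x = h (frac x)" for x
  have [measurable]: "k \<in> borel_measurable borel" unfolding k_def by measurable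
  have si: "set_integrable lborel {a..b} k" for a b
    by (rule set_integrable_bounded[where C = C]) (auto simp: k_def C)
  have "(LINT \<delta>|unit_uniform. h (frac (\<tau> + \<delta>))) = (LINT \<delta>:{0..1}|lborel. h (frac (\<tau> + \<delta>)))"
    by (rule integral_unit) measurable
  also have "\<dots> = (LINT \<delta>:{0 + \<theta>..1 + \<theta>}|lborel. h (frac (\<tau> + (\<delta> - \<theta>))))"
    by (rule set_integral_translate)
  also have "(\<lambda>\<delta>. h (frac (\<tau> + (\<delta> - \<theta>)))) = k"
  proof
    fix \<delta>
    have "\<tau> + (\<delta> - \<theta>) - \<delta> \<in> \<int>" by (simp add: \<theta>_def frac_def)
    then show "h (frac (\<tau> + (\<delta> - \<theta>))) = k \<delta>" unfolding k_def by (subst frac_cong) auto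
  qed
  also have "(LINT \<delta>:{0 + \<theta>..1 + \<theta>}|lborel. k \<delta>) = (LINT \<delta>:{\<theta>..1}|lborel. k \<delta>) + (LINT \<delta>:{1..1 + \<theta>}|lborel. k \<delta>)"
    using \<theta> si by (subst set_integral_split[of _ 1]) auto
  also have "(LINT \<delta>:{1..1 + \<theta>}|lborel. k \<delta>) = (LINT \<delta>:{0..\<theta>}|lborel. k (\<delta> + 1))"
    by (subst set_integral_translate[where t = "-1"]) simp
  also have "(\<lambda>\<delta>. k (\<delta> + 1)) = k" unfolding k_def frac_1_eq ..
  also have "(LINT \<delta>:{\<theta>..1}|lborel. k \<delta>) + (LINT \<delta>:{0..\<theta>}|lborel. k \<delta>) = (LINT \<delta>:{0..1}|lborel. k \<delta>)"
    using set_integral_split[OF \<theta> si] by simp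
  also have "\<dots> = (LINT \<delta>|unit_uniform. k \<delta>)"
    by (rule integral_unit[symmetric]) measurable
  also have "\<dots> = (LINT \<delta>|unit_uniform. h \<delta>)"
  proof (rule integral_cong_AE)
    have "AE x in unit_uniform. x \<in> {0..1}" by (intro AE_uniform_measureI) auto
    \<comment> \<open>At \<open>1\<close> itself \<open>frac\<close> drops to \<open>0\<close>, so
      the two integrands agree only off this null set.\<close>
    moreover have "AE x in unit_uniform. x \<noteq> 1"
      using AE_lborel_singleton[of "1::real"] by (intro AE_uniform_measureI) auto
    ultimately show "AE x in unit_uniform. k x = h x"
      by eventually_elim (simp add: k_def frac_eq_id)
  qed measurable
  finally show ?thesis .
qed

text \<open>Equal to \<open>B2 \<bar>a - b\<bar> / 2 + (a - 1/2) * (b - 1/2)\<close>: the kernel of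
  the univariate unanchored Sobolev space without its constant \<open>1\<close>.\<close>

definition shift_kernel :: "real \<Rightarrow> real \<Rightarrow> real" where
  "shift_kernel a b = (a\<^sup>2 + b\<^sup>2) / 2 - max a b + 1/3"

lemma shift_kernel_measurable [measurable (raw)]:
  assumes [measurable]: "f \<in> borel_measurable M" "g \<in> borel_measurable M"
  shows "(\<lambda>x. shift_kernel (f x) (g x)) \<in> borel_measurable M"
  unfolding shift_kernel_def by measurable

lemma shift_kernel_bounded:
  assumes "a \<in> {0..1}" "b \<in> {0..1}"
  shows "\<bar>shift_kernel a b\<bar> \<le> 3"
proof -
  have sq: "a * a \<le> 1" "b * b \<le> 1" "0 \<le> a * a" "0 \<le> b * b" using assms by (auto intro: mult_le_one)
  have "0 \<le> max a b" "max a b \<le> 1" using assms by auto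
  moreover have "0 \<le> (a\<^sup>2 + b\<^sup>2) / 2" "(a\<^sup>2 + b\<^sup>2) / 2 \<le> 1" using sq by (auto simp: power2_eq_square)
  moreover have "\<bar>q - m + 1/3\<bar> \<le> 3" if "0 \<le> m" "m \<le> 1" "0 \<le> q" "q \<le> 1" for q m :: real
    using that by (simp add: abs_le_iff)
  ultimately show ?thesis unfolding shift_kernel_def by blast
qed

text \<open>A further shift reduces \<open>\<tau>'\<close> to \<open>0\<close>. The integral is then
  cut at \<open>1 - \<theta>\<close>, where \<open>frac (\<theta> + \<delta>)\<close> wraps around,
  and both pieces are integrals of polynomials. The two summands of the kernel each average to
  \<open>B2 / 2\<close>, hence the full \<open>B2\<close>.\<close>

lemma integral_shift_kernel:
  "(LINT \<delta>|unit_uniform. shift_kernel (frac (\<tau> + \<delta>)) (frac (\<tau>' + \<delta>))) = B2 (frac (\<tau> - \<tau>'))"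
proof -
  define \<theta> where "\<theta> = frac (\<tau> - \<tau>')"
  have \<theta>: "0 \<le> \<theta>" "\<theta> < 1" using frac_lt_1 by (auto simp: \<theta>_def)
  define h where "h \<delta> = shift_kernel (frac (\<theta> + \<delta>)) (frac \<delta>)" for \<delta>
  have [measurable]: "h \<in> borel_measurable borel" unfolding h_def by measurable
  have hC: "\<bar>h \<delta>\<bar> \<le> 3" for \<delta> unfolding h_def by (intro shift_kernel_bounded) (auto simp: less_imp_le[OF frac_lt_1])
  have "shift_kernel (frac (\<tau> + \<delta>)) (frac (\<tau>' + \<delta>)) = h (frac (\<tau>' + \<delta>))" for \<delta>
  proof -
    have "\<tau> + \<delta> - (\<theta> + frac (\<tau>' + \<delta>)) = of_int (\<lfloor>\<tau> - \<tau>'\<rfloor> + \<lfloor>\<tau>' + \<delta>\<rfloor>)" by (simp add: \<theta>_def frac_def)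
    then have "\<tau> + \<delta> - (\<theta> + frac (\<tau>' + \<delta>)) \<in> \<int>" by (metis Ints_of_int)
    then have "frac (\<tau> + \<delta>) = frac (\<theta> + frac (\<tau>' + \<delta>))" by (rule frac_cong)
    then show ?thesis by (simp add: h_def)
  qed
  then have "(LINT \<delta>|unit_uniform. shift_kernel (frac (\<tau> + \<delta>)) (frac (\<tau>' + \<delta>))) = (LINT \<delta>|unit_uniform. h (frac (\<tau>' + \<delta>)))"
    by simp
  also have "\<dots> = (LINT \<delta>|unit_uniform. h \<delta>)" by (rule integral_unit_shift[OF _ hC]) measurable
  also have "\<dots> = (LINT \<delta>:{0..1}|lborel. h \<delta>)" by (rule integral_unit) measurable
  also have "\<dots> = (LINT \<delta>:{0..1 - \<theta>}|lborel. h \<delta>) + (LINT \<delta>:{1 - \<theta>..1}|lborel. h \<delta>)"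
    using \<theta> by (intro set_integral_split set_integrable_bounded[OF _ hC]) auto
  also have "(LINT \<delta>:{0..1 - \<theta>}|lborel. h \<delta>) = (LINT \<delta>:{0..1 - \<theta>}|lborel. ((\<theta> + \<delta>)\<^sup>2 + \<delta>\<^sup>2) / 2 - (\<theta> + \<delta>) + 1/3)"
    unfolding set_lebesgue_integral_def
  proof (rule integral_cong_AE)
    have "AE x in lborel. x \<noteq> 1 - \<theta>" "AE x in lborel. x \<noteq> (1::real)" by (rule AE_lborel_singleton)+
    then show "AE x in lborel. indicator {0..1 - \<theta>} x *\<^sub>R h x = indicator {0..1 - \<theta>} x *\<^sub>R (((\<theta> + x)\<^sup>2 + x\<^sup>2) / 2 - (\<theta> + x) + 1/3)"
    proof eventually_elim
      case (elim x)
      show ?case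
      proof (cases "x \<in> {0..1 - \<theta>}")
        case True
        then have "frac (\<theta> + x) = \<theta> + x" "frac x = x" using \<theta> elim by (auto simp: frac_eq)
        then have "h x = ((\<theta> + x)\<^sup>2 + x\<^sup>2) / 2 - (\<theta> + x) + 1/3" using \<theta> by (simp add: h_def shift_kernel_def max_def)
        then show ?thesis by simp
      qed simp
    qed
  qed measurable
  also have "\<dots> = ((\<theta> + (1 - \<theta>))^3 + (1 - \<theta>)^3) / 6 - (\<theta> * (1 - \<theta>) + (1 - \<theta>)\<^sup>2 / 2) + (1 - \<theta>) / 3 - \<theta>^3 / 6"
    by (subst set_integral_FTC[where F = "\<lambda>x. ((\<theta> + x)^3 + x^3) / 6 - (\<theta> * x + x\<^sup>2 / 2) + x / 3"])
       (use \<theta> in \<open>auto intro!: derivative_eq_intros continuous_intros simp: power2_eq_square power3_eq_cube field_simps\<close>)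
  also have "(LINT \<delta>:{1 - \<theta>..1}|lborel. h \<delta>) = (LINT \<delta>:{1 - \<theta>..1}|lborel. ((\<theta> + \<delta> - 1)\<^sup>2 + \<delta>\<^sup>2) / 2 - \<delta> + 1/3)"
    unfolding set_lebesgue_integral_def
  proof (rule integral_cong_AE)
    have "AE x in lborel. x \<noteq> (1::real)" by (rule AE_lborel_singleton)
    then show "AE x in lborel. indicator {1 - \<theta>..1} x *\<^sub>R h x = indicator {1 - \<theta>..1} x *\<^sub>R (((\<theta> + x - 1)\<^sup>2 + x\<^sup>2) / 2 - x + 1/3)"
    proof eventually_elim
      case (elim x)
      show ?case
      proof (cases "x \<in> {1 - \<theta>..1}")
        case True
        then have "frac (\<theta> + x) = \<theta> + x - 1" "frac x = x" using \<theta> elim by (auto simp: frac_unique_iff frac_eq)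
        then have "h x = ((\<theta> + x - 1)\<^sup>2 + x\<^sup>2) / 2 - x + 1/3" using \<theta> by (simp add: h_def shift_kernel_def max_def)
        then show ?thesis by simp
      qed simp
    qed
  qed measurable
  also have "\<dots> = (\<theta>^3 + 1) / 6 - 1/2 + 1/3 - ((1 - \<theta>)^3 / 6 - (1 - \<theta>)\<^sup>2 / 2 + (1 - \<theta>) / 3)"
    by (subst set_integral_FTC[where F = "\<lambda>x. ((\<theta> + x - 1)^3 + x^3) / 6 - x\<^sup>2 / 2 + x / 3"])
       (use \<theta> in \<open>auto intro!: derivative_eq_intros continuous_intros simp: power2_eq_square power3_eq_cube field_simps\<close>)
  finally show ?thesis unfolding \<theta>_def[symmetric] by (simp add: B2_def power2_eq_square power3_eq_cube field_simps)
qed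

lemma integral_kap_kap':
  assumes "a \<in> {0..1}" "b \<in> {0..1}"
  shows "(LINT x|centred. kap (a - 1/2) x * kap (b - 1/2) x) = shift_kernel a b"
  using assms by (subst integral_kap_kap) (auto simp: shift_kernel_def max_def)

lemma AE_kap_bounded: "AE x in centred. \<bar>kap y x\<bar> \<le> 2"
  unfolding centred_def by (rule AE_uniform_measureI) (auto simp: kap_def)

lemma AE_kap_kap_bounded: "AE x in centred. \<bar>kap y x * kap y' x\<bar> \<le> 4"
  using AE_kap_bounded[of y] AE_kap_bounded[of y']
proof eventually_elim
  case (elim x)
  have "\<bar>kap y x\<bar> * \<bar>kap y' x\<bar> \<le> 2 * 2" using elim by (intro mult_mono) auto
  then show ?case by (simp add: abs_mult)
qed

lemma integrable_kap: "integrable centred (kap y)"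
proof -
  interpret prob_space centred by (rule prob_space_centred)
  show ?thesis by (rule integrable_const_bound[where B = 2]) (use AE_kap_bounded[of y] in auto)
qed

lemma integrable_kap_kap: "integrable centred (\<lambda>x. kap y x * kap y' x)"
proof -
  interpret prob_space centred by (rule prob_space_centred)
  show ?thesis by (rule integrable_const_bound[where B = 4]) (use AE_kap_kap_bounded[of y y'] in auto)
qed

section \<open>Mixed derivatives and the multivariate representation\<close>

lemma product_prob_space_centred: "product_prob_space (\<lambda>_::nat. centred)"
  by (rule product_prob_spaceI) (rule prob_space_centred)

lemma product_prob_space_unit: "product_prob_space (\<lambda>_::nat. unit_uniform)"
  by (rule product_prob_spaceI) (rule prob_space_unit)

lemma sets_PiM_centred: "sets (PiM K (\<lambda>_. centred)) = sets (PiM K (\<lambda>_. borel))"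
  by (rule sets_PiM_cong) auto

lemma measurable_PiM_centred: "measurable (PiM K (\<lambda>_. centred)) = measurable (PiM K (\<lambda>_. borel))"
  by (intro ext measurable_cong_sets sets_PiM_centred refl)

text \<open>\<open>F U\<close> plays the mixed first derivative of \<open>F {}\<close> in the
  variables of \<open>U\<close>. The other coordinates of \<open>y\<close> are unrestricted in these
  axioms, and \<open>restr\<close> allows arbitrary sequences as arguments although the product
  measures live on extensional functions.\<close>

locale mixed_family =
  fixes s :: nat and F :: "nat set \<Rightarrow> (nat \<Rightarrow> real) \<Rightarrow> real" and C :: real
  assumes der: "\<And>U k y t. U \<subseteq> {..<s} \<Longrightarrow> k < s \<Longrightarrow> k \<notin> U \<Longrightarrow> t \<in> {-1/2..1/2} \<Longrightarrow>
      ((\<lambda>t. F U (y(k := t))) has_real_derivative F (insert k U) (y(k := t))) (at t within {-1/2..1/2})"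
    and cont: "\<And>U k y. U \<subseteq> {..<s} \<Longrightarrow> k < s \<Longrightarrow> continuous_on {-1/2..1/2} (\<lambda>t. F U (y(k := t)))"
    and bdd: "\<And>U y. U \<subseteq> {..<s} \<Longrightarrow> \<bar>F U y\<bar> \<le> C"
    and meas: "\<And>U. U \<subseteq> {..<s} \<Longrightarrow> F U \<in> borel_measurable (PiM {..<s} (\<lambda>_. borel))"
    and restr: "\<And>U y. F U (restrict y {..<s}) = F U y"
begin

lemma meas_override:
  assumes "U \<subseteq> {..<s}" "K \<subseteq> {..<s}"
  shows "(\<lambda>x. F U (\<lambda>j. if j \<in> K then x j else y j)) \<in> borel_measurable (PiM K (\<lambda>_. borel))"
proof -
  have "(\<lambda>x. \<lambda>j\<in>{..<s}. if j \<in> K then x j else y j) \<in> measurable (PiM K (\<lambda>_. borel)) (PiM {..<s} (\<lambda>_. borel))"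
  proof (rule measurable_restrict)
    fix j
    show "(\<lambda>x. if j \<in> K then x j else y j) \<in> borel_measurable (PiM K (\<lambda>_. borel))"
      by (cases "j \<in> K") auto
  qed
  from measurable_compose[OF this meas[OF assms(1)]] show ?thesis unfolding restr .
qed

lemma meas_upd:
  assumes "U \<subseteq> {..<s}" "k < s"
  shows "(\<lambda>t. F U (y(k := t))) \<in> borel_measurable borel"
proof -
  have "(\<lambda>t. \<lambda>j\<in>{..<s}. (y(k := t)) j) \<in> measurable borel (PiM {..<s} (\<lambda>_. borel))"
    by (rule measurable_restrict) (auto simp: fun_upd_def)
  from measurable_compose[OF this meas[OF assms(1)]] show ?thesis unfolding restr .
qed

lemma integrable_override:
  assumes U: "V \<subseteq> {..<s}" and K: "K \<subseteq> {..<s}" and "U \<subseteq> K"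
  shows "integrable (PiM K (\<lambda>_. centred)) (\<lambda>x. F V (\<lambda>j. if j \<in> K then x j else y j) * (\<Prod>j\<in>U. kap (y j) (x j)))"
proof -
  interpret product_prob_space "\<lambda>_::nat. centred" by (rule product_prob_space_centred)
  have fin: "finite K" using K by (rule finite_subset) simp
  have U': "(\<Prod>j\<in>U. kap (y j) (x j)) = (\<Prod>j\<in>K. (if j \<in> U then kap (y j) (x j) else 1))" for x
    using fin assms(3) by (simp add: prod.inter_restrict[symmetric] Int_absorb1)
  have "integrable (PiM K (\<lambda>_. centred)) (\<lambda>x. \<Prod>j\<in>K. (\<lambda>t. if j \<in> U then kap (y j) t else 1) (x j))"
  proof (rule product_integrable_prod[OF fin])
    fix j show "integrable centred (\<lambda>t. if j \<in> U then kap (y j) t else 1)"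
      by (cases "j \<in> U") (auto simp: integrable_kap M.prob_space)
  qed
  then have int: "integrable (PiM K (\<lambda>_. centred)) (\<lambda>x. \<Prod>j\<in>U. kap (y j) (x j))" unfolding U' .
  show ?thesis
  proof (rule Bochner_Integration.integrable_bound)
    show "integrable (PiM K (\<lambda>_. centred)) (\<lambda>x. C * (\<Prod>j\<in>U. kap (y j) (x j)))" using int by simp
    have "(\<lambda>x. F V (\<lambda>j. if j \<in> K then x j else y j)) \<in> borel_measurable (PiM K (\<lambda>_. centred))"
      using meas_override[OF U K] by (simp add: measurable_PiM_centred)
    then show "(\<lambda>x. F V (\<lambda>j. if j \<in> K then x j else y j) * (\<Prod>j\<in>U. kap (y j) (x j))) \<in> borel_measurable (PiM K (\<lambda>_. centred))"
      using int by (intro borel_measurable_times) auto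
    show "AE x in PiM K (\<lambda>_. centred). norm (F V (\<lambda>j. if j \<in> K then x j else y j) * (\<Prod>j\<in>U. kap (y j) (x j))) \<le> norm (C * (\<Prod>j\<in>U. kap (y j) (x j)))"
      using bdd[OF U] by (intro AE_I2) (auto simp: abs_mult intro!: mult_right_mono order_trans[OF bdd[OF U] abs_ge_self])
  qed
qed

lemma kernel_representation_coord:
  assumes U: "U \<subseteq> {..<s}" "k < s" "k \<notin> U" and y: "y k \<in> {-1/2..1/2}"
  shows "F U y = (LINT t|centred. F U (y(k := t)) + F (insert k U) (y(k := t)) * kap (y k) t)"
proof -
  have "insert k U \<subseteq> {..<s}" using U by auto
  from kernel_representation[OF y der[OF U, where y = y] cont[OF this U(2)] meas_upd[OF U(1,2)] meas_upd[OF this U(2)]]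
  show ?thesis by simp
qed

text \<open>The univariate representation is applied to one coordinate after the other. Each
  application doubles the terms: the new coordinate is either integrated out or differentiated and
  paired with its kernel. Coordinates outside \<open>K\<close> keep their values from
  \<open>y\<close>, and \<open>W\<close> collects the derivatives already present.\<close>

lemma kernel_representation_multi:
  assumes "finite K" "K \<subseteq> {..<s}" "W \<subseteq> {..<s}" "W \<inter> K = {}" "\<And>j. j \<in> K \<Longrightarrow> y j \<in> {-1/2..1/2}"
  shows "F W y = (\<Sum>U\<in>Pow K. LINT x|PiM K (\<lambda>_. centred). F (W \<union> U) (\<lambda>j. if j \<in> K then x j else y j) * (\<Prod>j\<in>U. kap (y j) (x j)))"
  using assms
proof (induction K rule: finite_induct)
  case empty
  then show ?case by (simp add: PiM_empty lebesgue_integral_count_space_finite)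
next
  case (insert k K)
  interpret product_prob_space "\<lambda>_::nat. centred" by (rule product_prob_space_centred)
  let ?I = "insert k K"
  define ov where "ov K x = (\<lambda>j. if j \<in> K then x j else y j)" for K and x :: "nat \<Rightarrow> real"
  define P where "P U x = (\<Prod>j\<in>U. kap (y j) (x j))" for U and x :: "nat \<Rightarrow> real"
  have yk: "y k \<in> {-1/2..1/2}" and kW: "k \<notin> W" "k < s" using insert.prems by auto
  have IH: "F W y = (\<Sum>U\<in>Pow K. LINT x|PiM K (\<lambda>_. centred). F (W \<union> U) (ov K x) * P U x)"
    unfolding ov_def P_def by (rule insert.IH) (use insert.prems in auto)
  have int: "integrable (PiM ?I (\<lambda>_. centred)) (\<lambda>x. F V (ov ?I x) * P U x)" if "V \<subseteq> {..<s}" "U \<subseteq> ?I" for U V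
    unfolding ov_def P_def using insert.prems that by (intro integrable_override) auto
  have step: "(LINT x|PiM K (\<lambda>_. centred). F (W \<union> U) (ov K x) * P U x)
      = (LINT x|PiM ?I (\<lambda>_. centred). F (W \<union> U) (ov ?I x) * P U x) + (LINT x|PiM ?I (\<lambda>_. centred). F (W \<union> insert k U) (ov ?I x) * P (insert k U) x)"
    if U: "U \<in> Pow K" for U
  proof -
    have WU: "W \<union> U \<subseteq> {..<s}" "k \<notin> W \<union> U" "k \<notin> U" "finite U"
      using U insert.prems insert.hyps kW by (auto intro: finite_subset)
    have pt: "F (W \<union> U) (ov K x) * P U x
       = (LINT t|centred. F (W \<union> U) (ov ?I (x(k := t))) * P U (x(k := t)) + F (W \<union> insert k U) (ov ?I (x(k := t))) * P (insert k U) (x(k := t)))" for x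
    proof -
      have k: "ov K x k = y k" using insert.hyps by (simp add: ov_def)
      have o: "(ov K x)(k := t) = ov ?I (x(k := t))" for t using insert.hyps by (auto simp: ov_def)
      have P1: "P U (x(k := t)) = P U x" for t
        unfolding P_def using WU by (intro prod.cong refl) auto
      have P2: "P (insert k U) (x(k := t)) = kap (y k) t * P U x" for t
        using P1[of t] WU by (simp add: P_def)
      have "F (W \<union> U) (ov K x) = (LINT t|centred. F (W \<union> U) (ov ?I (x(k := t))) + F (insert k (W \<union> U)) (ov ?I (x(k := t))) * kap (y k) t)"
        using kernel_representation_coord[OF WU(1) kW(2) WU(2), of "ov K x"] yk unfolding k o by simp
      then have "F (W \<union> U) (ov K x) * P U x = (LINT t|centred. (F (W \<union> U) (ov ?I (x(k := t))) + F (insert k (W \<union> U)) (ov ?I (x(k := t))) * kap (y k) t) * P U x)"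
        by simp
      also have "\<dots> = (LINT t|centred. F (W \<union> U) (ov ?I (x(k := t))) * P U (x(k := t)) + F (W \<union> insert k U) (ov ?I (x(k := t))) * P (insert k U) (x(k := t)))"
        unfolding P1 P2 by (simp add: algebra_simps)
      finally show ?thesis .
    qed
    have i1: "integrable (PiM ?I (\<lambda>_. centred)) (\<lambda>x. F (W \<union> U) (ov ?I x) * P U x)"
      and i2: "integrable (PiM ?I (\<lambda>_. centred)) (\<lambda>x. F (W \<union> insert k U) (ov ?I x) * P (insert k U) x)"
      using U WU kW by (intro int; auto)+
    have "(LINT x|PiM K (\<lambda>_. centred). F (W \<union> U) (ov K x) * P U x)
       = (LINT x|PiM ?I (\<lambda>_. centred). F (W \<union> U) (ov ?I x) * P U x + F (W \<union> insert k U) (ov ?I x) * P (insert k U) x)"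
      unfolding pt using insert.hyps i1 i2
      by (subst product_integral_insert) (auto intro: Bochner_Integration.integrable_add)
    also have "\<dots> = (LINT x|PiM ?I (\<lambda>_. centred). F (W \<union> U) (ov ?I x) * P U x) + (LINT x|PiM ?I (\<lambda>_. centred). F (W \<union> insert k U) (ov ?I x) * P (insert k U) x)"
      by (rule Bochner_Integration.integral_add[OF i1 i2])
    finally show ?thesis .
  qed
  let ?J = "\<lambda>U. LINT x|PiM ?I (\<lambda>_. centred). F (W \<union> U) (ov ?I x) * P U x"
  have inj: "inj_on (insert k) (Pow K)" using insert.hyps by (intro inj_onI) (metis PowD insert_ident subsetD)
  have "F W y = (\<Sum>U\<in>Pow K. ?J U) + (\<Sum>U\<in>Pow K. ?J (insert k U))"
    unfolding IH sum.distrib[symmetric] by (intro sum.cong refl step)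
  also have "(\<Sum>U\<in>Pow K. ?J (insert k U)) = (\<Sum>U\<in>insert k ` Pow K. ?J U)"
    by (subst sum.reindex[OF inj]) simp
  also have "(\<Sum>U\<in>Pow K. ?J U) + (\<Sum>U\<in>insert k ` Pow K. ?J U) = (\<Sum>U\<in>Pow ?I. ?J U)"
    unfolding Pow_insert using insert.hyps by (intro sum.union_disjoint[symmetric]) auto
  finally show ?case unfolding ov_def P_def .
qed

end

section \<open>Worst-case error for one shift and on average\<close>

definition lattice_kernel :: "nat \<Rightarrow> nat \<Rightarrow> (nat \<Rightarrow> nat) \<Rightarrow> (nat \<Rightarrow> real) \<Rightarrow> nat set \<Rightarrow> (nat \<Rightarrow> real) \<Rightarrow> real" where
  "lattice_kernel s n g \<Delta> U x = 1 / real n * (\<Sum>i=1..n. \<Prod>j\<in>U. kap (lattice_point s n g \<Delta> i j) (x j))"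

text \<open>The squared worst-case error of the lattice rule for one fixed shift.\<close>

definition shift_wce :: "(nat set \<Rightarrow> real) \<Rightarrow> nat \<Rightarrow> nat \<Rightarrow> (nat \<Rightarrow> nat) \<Rightarrow> (nat \<Rightarrow> real) \<Rightarrow> real" where
  "shift_wce \<gamma> s n g \<Delta> = (\<Sum>U\<in>Pow {..<s} - {{}}. \<gamma> U * (LINT x|PiM {..<s} (\<lambda>_. centred). (lattice_kernel s n g \<Delta> U x)\<^sup>2))"

lemma shift_wce_nonneg: "(\<And>U. 0 \<le> \<gamma> U) \<Longrightarrow> 0 \<le> shift_wce \<gamma> s n g \<Delta>"
  unfolding shift_wce_def by (intro sum_nonneg mult_nonneg_nonneg) auto

lemma lattice_point_in: "j < s \<Longrightarrow> lattice_point s n g \<Delta> i j \<in> {-1/2..1/2}"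
  by (simp add: lattice_point_def less_imp_le[OF frac_lt_1])

lemma lattice_point_Xi_s: "lattice_point s n g \<Delta> i \<in> Xi_s s"
  using lattice_point_in[of _ s n g \<Delta> i] unfolding Xi_s_def
  by (intro PiE_I) (auto simp: lattice_point_def)

text \<open>Padding with factors \<open>1\<close> turns a product over \<open>U\<close> into one
  over all coordinates, the form in which integrals over product measures factorise.\<close>

lemma prod_restrict_if:
  assumes "U \<subseteq> {..<s::nat}"
  shows "(\<Prod>j\<in>U. f j) = (\<Prod>j<s. if j \<in> U then f j else (1::real))"
  using assms by (simp add: prod.inter_restrict[symmetric] Int_absorb1)

text \<open>The square is a double sum over pairs of lattice points of products with one factor per
  coordinate, so every integral factorises into values of \<open>shift_kernel\<close>.\<close>

lemma lattice_kernel_square: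
  assumes U: "U \<subseteq> {..<s}"
  shows "integrable (PiM {..<s} (\<lambda>_. centred)) (\<lambda>x. (lattice_kernel s n g \<Delta> U x)\<^sup>2)"
    and "(LINT x|PiM {..<s} (\<lambda>_. centred). (lattice_kernel s n g \<Delta> U x)\<^sup>2)
      = 1 / (real n)\<^sup>2 * (\<Sum>i=1..n. \<Sum>i'=1..n. \<Prod>j\<in>U. shift_kernel (frac (real i * real (g j) / real n + \<Delta> j)) (frac (real i' * real (g j) / real n + \<Delta> j)))"
proof -
  interpret product_prob_space "\<lambda>_::nat. centred" by (rule product_prob_space_centred)
  let ?p = "\<lambda>i j. lattice_point s n g \<Delta> i j"
  let ?h = "\<lambda>i i' j t. if j \<in> U then kap (?p i j) t * kap (?p i' j) t else 1"
  have int1: "integrable centred (?h i i' j)" for i i' j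
    by (cases "j \<in> U") (auto simp: integrable_kap_kap M.prob_space)
  have sq: "(lattice_kernel s n g \<Delta> U x)\<^sup>2 = 1 / (real n)\<^sup>2 * (\<Sum>i=1..n. \<Sum>i'=1..n. \<Prod>j<s. ?h i i' j (x j))" for x
  proof -
    have "(\<Sum>i=1..n. \<Prod>j\<in>U. kap (?p i j) (x j))\<^sup>2 = (\<Sum>i=1..n. \<Sum>i'=1..n. (\<Prod>j\<in>U. kap (?p i j) (x j)) * (\<Prod>j\<in>U. kap (?p i' j) (x j)))"
      unfolding power2_eq_square sum_product ..
    also have "\<dots> = (\<Sum>i=1..n. \<Sum>i'=1..n. \<Prod>j<s. ?h i i' j (x j))"
      unfolding prod.distrib[symmetric] by (intro sum.cong refl prod_restrict_if[OF U])
    finally show ?thesis unfolding lattice_kernel_def power_mult_distrib by (simp add: power_divide)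
  qed
  have int: "integrable (PiM {..<s} (\<lambda>_. centred)) (\<lambda>x. \<Prod>j<s. ?h i i' j (x j))" for i i'
    by (rule product_integrable_prod) (auto intro: int1)
  show "integrable (PiM {..<s} (\<lambda>_. centred)) (\<lambda>x. (lattice_kernel s n g \<Delta> U x)\<^sup>2)"
    unfolding sq by (intro integrable_mult_right Bochner_Integration.integrable_sum int)
  have "(LINT x|PiM {..<s} (\<lambda>_. centred). (lattice_kernel s n g \<Delta> U x)\<^sup>2)
      = 1 / (real n)\<^sup>2 * (\<Sum>i=1..n. \<Sum>i'=1..n. LINT x|PiM {..<s} (\<lambda>_. centred). (\<Prod>j<s. ?h i i' j (x j)))"
    unfolding sq by (simp only: integral_mult_right_zero Bochner_Integration.integral_sum int Bochner_Integration.integrable_sum)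
  also have "\<dots> = 1 / (real n)\<^sup>2 * (\<Sum>i=1..n. \<Sum>i'=1..n. \<Prod>j\<in>U. shift_kernel (frac (real i * real (g j) / real n + \<Delta> j)) (frac (real i' * real (g j) / real n + \<Delta> j)))"
  proof (intro arg_cong2[where f = "(*)"] refl sum.cong)
    fix i i'
    have "(LINT x|PiM {..<s} (\<lambda>_. centred). (\<Prod>j<s. ?h i i' j (x j))) = (\<Prod>j<s. LINT t|centred. ?h i i' j t)"
      by (rule product_integral_prod) (auto intro: int1)
    also have "\<dots> = (\<Prod>j<s. if j \<in> U then shift_kernel (frac (real i * real (g j) / real n + \<Delta> j)) (frac (real i' * real (g j) / real n + \<Delta> j)) else 1)"
    proof (intro prod.cong refl)
      fix j assume j: "j \<in> {..<s}"
      have "(LINT t|centred. kap (?p i j) t * kap (?p i' j) t) = shift_kernel (frac (real i * real (g j) / real n + \<Delta> j)) (frac (real i' * real (g j) / real n + \<Delta> j))"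
        using j integral_kap_kap'[of "frac (real i * real (g j) / real n + \<Delta> j)" "frac (real i' * real (g j) / real n + \<Delta> j)"]
        by (simp add: lattice_point_def less_imp_le[OF frac_lt_1])
      then show "(LINT t|centred. ?h i i' j t) = (if j \<in> U then shift_kernel (frac (real i * real (g j) / real n + \<Delta> j)) (frac (real i' * real (g j) / real n + \<Delta> j)) else 1)"
        using M.prob_space by simp
    qed
    also have "\<dots> = (\<Prod>j\<in>U. shift_kernel (frac (real i * real (g j) / real n + \<Delta> j)) (frac (real i' * real (g j) / real n + \<Delta> j)))"
      by (rule prod_restrict_if[OF U, symmetric])
    finally show "(LINT x|PiM {..<s} (\<lambda>_. centred). (\<Prod>j<s. ?h i i' j (x j))) = \<dots>" .
  qed
  finally show "(LINT x|PiM {..<s} (\<lambda>_. centred). (lattice_kernel s n g \<Delta> U x)\<^sup>2)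
      = 1 / (real n)\<^sup>2 * (\<Sum>i=1..n. \<Sum>i'=1..n. \<Prod>j\<in>U. shift_kernel (frac (real i * real (g j) / real n + \<Delta> j)) (frac (real i' * real (g j) / real n + \<Delta> j)))" .
qed

text \<open>Differences of points of a rank-1 lattice are lattice points again; this lets a double
  sum over pairs of points collapse to a single sum.\<close>

lemma sum_periodic_shift:
  fixes f :: "int \<Rightarrow> 'a::ab_group_add"
  assumes "\<And>m. f (m + int n) = f m"
  shows "(\<Sum>i=1..n. f (int i - int c)) = (\<Sum>i=1..n. f (int i))"
proof (induction c)
  case (Suc c)
  let ?h = "\<lambda>i::nat. f (int i - int c)"
  have "(\<Sum>i=1..n. f (int i - int (Suc c))) = (\<Sum>i<n. ?h i)"
    by (simp add: sum.atLeast1_atMost_eq)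
  also have "\<dots> = (\<Sum>i=1..n. ?h i)"
  proof -
    have "?h n = ?h 0" using assms[of "- int c"] by simp
    then show ?thesis using sum_shift_one[of ?h n] by simp
  qed
  finally show ?case using Suc.IH by simp
qed simp

text \<open>Each coordinate of the shift enters only its own factor, whose average is
  \<open>B2\<close> of the difference of two points modulo 1. The double sum then has
  \<open>n\<close> equal rows, which cancels one of the two factors \<open>1 / n\<close>.\<close>

lemma integral_shift_wce:
  assumes n: "1 \<le> n"
  shows "integrable (shift_measure s) (shift_wce \<gamma> s n g)"
    and "(LINT \<Delta>|shift_measure s. shift_wce \<gamma> s n g \<Delta>) = sq_wce \<gamma> n s g"
proof -
  interpret product_prob_space "\<lambda>_::nat. unit_uniform" by (rule product_prob_space_unit)
  let ?k = "\<lambda>i i' j t. shift_kernel (frac (real i * real (g j) / real n + t)) (frac (real i' * real (g j) / real n + t))"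
  let ?h = "\<lambda>U i i' j t. if j \<in> U then ?k i i' j t else 1"
  have int1: "integrable unit_uniform (?h U i i' j)" for U i i' j
  proof (rule M.integrable_const_bound[where B = 3])
    show "AE x in unit_uniform. norm (?h U i i' j x) \<le> 3"
      using shift_kernel_bounded by (intro AE_I2) (auto simp: less_imp_le[OF frac_lt_1])
  qed measurable
  have int2: "integrable (shift_measure s) (\<lambda>\<Delta>. \<Prod>j<s. ?h U i i' j (\<Delta> j))" for U i i'
    unfolding shift_measure_def by (rule product_integrable_prod) (auto intro: int1)
  have W: "shift_wce \<gamma> s n g = (\<lambda>\<Delta>. \<Sum>U\<in>Pow {..<s} - {{}}. \<gamma> U * (1 / (real n)\<^sup>2 * (\<Sum>i=1..n. \<Sum>i'=1..n. \<Prod>j<s. ?h U i i' j (\<Delta> j))))"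
  proof
    fix \<Delta>
    show "shift_wce \<gamma> s n g \<Delta> = (\<Sum>U\<in>Pow {..<s} - {{}}. \<gamma> U * (1 / (real n)\<^sup>2 * (\<Sum>i=1..n. \<Sum>i'=1..n. \<Prod>j<s. ?h U i i' j (\<Delta> j))))"
      unfolding shift_wce_def
    proof (intro sum.cong refl arg_cong2[where f = "(*)"])
      fix U assume "U \<in> Pow {..<s} - {{}}"
      then have U: "U \<subseteq> {..<s}" by auto
      show "(LINT x|PiM {..<s} (\<lambda>_. centred). (lattice_kernel s n g \<Delta> U x)\<^sup>2) = 1 / (real n)\<^sup>2 * (\<Sum>i=1..n. \<Sum>i'=1..n. \<Prod>j<s. ?h U i i' j (\<Delta> j))"
        unfolding lattice_kernel_square(2)[OF U] prod_restrict_if[OF U] ..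
    qed
  qed
  show "integrable (shift_measure s) (shift_wce \<gamma> s n g)"
    unfolding W by (intro integrable_mult_right Bochner_Integration.integrable_sum int2)
  have "(LINT \<Delta>|shift_measure s. shift_wce \<gamma> s n g \<Delta>)
      = (\<Sum>U\<in>Pow {..<s} - {{}}. \<gamma> U * (1 / (real n)\<^sup>2 * (\<Sum>i=1..n. \<Sum>i'=1..n. LINT \<Delta>|shift_measure s. (\<Prod>j<s. ?h U i i' j (\<Delta> j)))))"
    unfolding W by (simp only: integral_mult_right_zero Bochner_Integration.integral_sum int2 Bochner_Integration.integrable_sum integrable_mult_right)
  also have "\<dots> = sq_wce \<gamma> n s g"
    unfolding sq_wce_def mult.assoc
  proof (rule sum.cong[OF refl])
    fix U assume "U \<in> Pow {..<s} - {{}}"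
    then have U: "U \<subseteq> {..<s}" by auto
    define f where "f m = (\<Prod>j\<in>U. B2 (frac (real_of_int m * real (g j) / real n)))" for m
    have per: "f (m + int n) = f m" for m
      unfolding f_def
    proof (intro prod.cong refl arg_cong[where f = B2] frac_cong)
      fix j
      have "real_of_int (m + int n) * real (g j) / real n - real_of_int m * real (g j) / real n = real_of_int (int (g j))"
        using n by (simp add: field_simps)
      then show "real_of_int (m + int n) * real (g j) / real n - real_of_int m * real (g j) / real n \<in> \<int>"
        by (metis Ints_of_int)
    qed
    have "(\<Sum>i=1..n. \<Sum>i'=1..n. LINT \<Delta>|shift_measure s. (\<Prod>j<s. ?h U i i' j (\<Delta> j))) = (\<Sum>i=1..n. \<Sum>i'=1..n. f (int i - int i'))"
    proof (intro sum.cong refl)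
      fix i i'
      have "(LINT \<Delta>|shift_measure s. (\<Prod>j<s. ?h U i i' j (\<Delta> j))) = (\<Prod>j<s. LINT t|unit_uniform. ?h U i i' j t)"
        unfolding shift_measure_def by (rule product_integral_prod) (auto intro: int1)
      also have "\<dots> = (\<Prod>j<s. if j \<in> U then B2 (frac (real_of_int (int i - int i') * real (g j) / real n)) else 1)"
      proof (intro prod.cong refl)
        fix j
        have "real i * real (g j) / real n - real i' * real (g j) / real n = real_of_int (int i - int i') * real (g j) / real n"
          by (simp add: diff_divide_distrib left_diff_distrib)
        then have "(LINT t|unit_uniform. ?k i i' j t) = B2 (frac (real_of_int (int i - int i') * real (g j) / real n))"
          unfolding integral_shift_kernel by simp
        then show "(LINT t|unit_uniform. ?h U i i' j t) = (if j \<in> U then B2 (frac (real_of_int (int i - int i') * real (g j) / real n)) else 1)"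
          using M.prob_space by (cases "j \<in> U") simp_all
      qed
      also have "\<dots> = f (int i - int i')"
        unfolding f_def by (rule prod_restrict_if[OF U, symmetric])
      finally show "(LINT \<Delta>|shift_measure s. (\<Prod>j<s. ?h U i i' j (\<Delta> j))) = f (int i - int i')" .
    qed
    also have "\<dots> = (\<Sum>i'=1..n. \<Sum>i=1..n. f (int i - int i'))" by (rule sum.swap)
    also have "\<dots> = real n * (\<Sum>i=1..n. f (int i))"
      unfolding sum_periodic_shift[of f, OF per] by simp
    finally have eq: "1 / (real n)\<^sup>2 * (\<Sum>i=1..n. \<Sum>i'=1..n. LINT \<Delta>|shift_measure s. (\<Prod>j<s. ?h U i i' j (\<Delta> j)))
       = 1 / real n * (\<Sum>i=1..n. \<Prod>j\<in>U. B2 (frac (real i * real (g j) / real n)))"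
      using n by (simp add: f_def power2_eq_square)
    show "\<gamma> U * (1 / (real n)\<^sup>2 * (\<Sum>i=1..n. \<Sum>i'=1..n. LINT \<Delta>|shift_measure s. (\<Prod>j<s. ?h U i i' j (\<Delta> j))))
       = \<gamma> U * (1 / real n * (\<Sum>i=1..n. \<Prod>j\<in>U. B2 (frac (real i * real (g j) / real n))))"
      unfolding eq ..
  qed
  finally show "(LINT \<Delta>|shift_measure s. shift_wce \<gamma> s n g \<Delta>) = sq_wce \<gamma> n s g" .
qed

section \<open>The quadrature error of one integrand\<close>

context mixed_family
begin

lemma integrable_square:
  assumes U: "U \<subseteq> {..<s}"
  shows "integrable (PiM {..<s} (\<lambda>_. centred)) (F U)" "integrable (PiM {..<s} (\<lambda>_. centred)) (\<lambda>x. (F U x)\<^sup>2)"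
proof -
  interpret Q: prob_space "PiM {..<s} (\<lambda>_. centred)" by (rule prob_space_PiM) (rule prob_space_centred)
  have m [measurable]: "F U \<in> borel_measurable (PiM {..<s} (\<lambda>_. centred))"
    using meas[OF U] by (simp add: measurable_PiM_centred)
  show "integrable (PiM {..<s} (\<lambda>_. centred)) (F U)"
    by (rule Q.integrable_const_bound[where B = C]) (use bdd[OF U] in auto)
  show "integrable (PiM {..<s} (\<lambda>_. centred)) (\<lambda>x. (F U x)\<^sup>2)"
  proof (rule Q.integrable_const_bound[where B = "C\<^sup>2"])
    have "norm ((F U x)\<^sup>2) \<le> C\<^sup>2" for x
      using power_mono[OF bdd[OF U, of x], of 2] by simp
    then show "AE x in PiM {..<s} (\<lambda>_. centred). norm ((F U x)\<^sup>2) \<le> C\<^sup>2" by simp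
  qed measurable
qed

lemma representation:
  assumes "\<And>j. j < s \<Longrightarrow> y j \<in> {-1/2..1/2}"
  shows "F {} y = (\<Sum>U\<in>Pow {..<s}. LINT x|PiM {..<s} (\<lambda>_. centred). F U x * (\<Prod>j\<in>U. kap (y j) (x j)))"
proof -
  have o: "F U (\<lambda>j. if j \<in> {..<s} then x j else y j) = F U x" for U x
  proof -
    have "restrict (\<lambda>j. if j \<in> {..<s} then x j else y j) {..<s} = restrict x {..<s}" by auto
    then show ?thesis using restr by metis
  qed
  show ?thesis
    using kernel_representation_multi[of "{..<s}" "{}" y] assms unfolding o by simp
qed

lemma integrable_lattice_kernel:
  assumes U: "U \<subseteq> {..<s}"
  shows "integrable (PiM {..<s} (\<lambda>_. centred)) (\<lambda>x. F U x * (\<Prod>j\<in>U. kap (y j) (x j)))"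
proof -
  have o: "F U (\<lambda>j. if j \<in> {..<s} then x j else y j) = F U x" for x
  proof -
    have "restrict (\<lambda>j. if j \<in> {..<s} then x j else y j) {..<s} = restrict x {..<s}" by auto
    then show ?thesis using restr by metis
  qed
  show ?thesis using integrable_override[OF U order_refl U, of y] unfolding o .
qed

text \<open>In the representation the term \<open>U = {}\<close> is the exact integral, so the error
  consists of the other terms. Cauchy-Schwarz is used twice: for the integral belonging to each
  \<open>U\<close>, then for the sum over \<open>U\<close> with the weights split between the
  factors. The full integral of \<open>(F U x)\<^sup>2\<close> dominates the norm in which inactive
  variables are integrated before squaring.\<close>

theorem lattice_error_bound:
  assumes n: "1 \<le> n" and \<gamma>: "\<And>U. 0 \<le> \<gamma> U"
    and \<gamma>0: "\<And>U x. U \<subseteq> {..<s} \<Longrightarrow> \<gamma> U = 0 \<Longrightarrow> F U x = 0"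
  shows "((LINT x|PiM {..<s} (\<lambda>_. centred). F {} x) - 1 / real n * (\<Sum>i=1..n. F {} (lattice_point s n g \<Delta> i)))\<^sup>2
    \<le> shift_wce \<gamma> s n g \<Delta> * (\<Sum>U\<in>Pow {..<s} - {{}}. 1 / \<gamma> U * (LINT x|PiM {..<s} (\<lambda>_. centred). (F U x)\<^sup>2))"
proof -
  let ?M = "PiM {..<s} (\<lambda>_. centred)" and ?p = "lattice_point s n g \<Delta>"
  let ?K = "lattice_kernel s n g \<Delta>"
  let ?P = "Pow {..<s} - {{}}"
  \<comment> \<open>\<open>lattice_kernel\<close> represents the quadrature rule: paired with
    \<open>F U\<close> it gives the contribution of \<open>U\<close> to the average over the lattice
    points.\<close>
  have FK: "F U x * ?K U x = 1 / real n * (\<Sum>i=1..n. F U x * (\<Prod>j\<in>U. kap (?p i j) (x j)))" for U x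
    by (simp add: lattice_kernel_def sum_distrib_left)
  have intFK: "integrable ?M (\<lambda>x. F U x * ?K U x)" if "U \<subseteq> {..<s}" for U
    unfolding FK by (intro integrable_mult_right Bochner_Integration.integrable_sum integrable_lattice_kernel that)
  have "1 / real n * (\<Sum>i=1..n. F {} (?p i)) = 1 / real n * (\<Sum>i=1..n. \<Sum>U\<in>Pow {..<s}. LINT x|?M. F U x * (\<Prod>j\<in>U. kap (?p i j) (x j)))"
    by (intro arg_cong2[where f = "(*)"] refl sum.cong representation lattice_point_in)
  also have "\<dots> = (\<Sum>U\<in>Pow {..<s}. 1 / real n * (\<Sum>i=1..n. LINT x|?M. F U x * (\<Prod>j\<in>U. kap (?p i j) (x j))))"
    by (subst sum.swap) (rule sum_distrib_left)
  also have "\<dots> = (\<Sum>U\<in>Pow {..<s}. LINT x|?M. F U x * ?K U x)"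
  proof (rule sum.cong[OF refl])
    fix U assume "U \<in> Pow {..<s}"
    then have U: "U \<subseteq> {..<s}" by simp
    show "1 / real n * (\<Sum>i=1..n. LINT x|?M. F U x * (\<Prod>j\<in>U. kap (?p i j) (x j))) = (LINT x|?M. F U x * ?K U x)"
      unfolding FK integral_mult_right_zero
      by (subst Bochner_Integration.integral_sum) (rule integrable_lattice_kernel[OF U], rule refl)
  qed
  also have "\<dots> = (LINT x|?M. F {} x * ?K {} x) + (\<Sum>U\<in>?P. LINT x|?M. F U x * ?K U x)"
    by (rule sum.remove) auto
  also have "(LINT x|?M. F {} x * ?K {} x) = (LINT x|?M. F {} x)"
    using n by (simp add: lattice_kernel_def)
  finally have err: "(LINT x|?M. F {} x) - 1 / real n * (\<Sum>i=1..n. F {} (?p i)) = - (\<Sum>U\<in>?P. LINT x|?M. F U x * ?K U x)"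
    by simp
  define A where "A U = 1 / \<gamma> U * (LINT x|?M. (F U x)\<^sup>2)" for U
  define B where "B U = \<gamma> U * (LINT x|?M. (?K U x)\<^sup>2)" for U
  have A0: "0 \<le> A U" and B0: "0 \<le> B U" for U using \<gamma>[of U] by (auto simp: A_def B_def)
  have le: "\<bar>LINT x|?M. F U x * ?K U x\<bar> \<le> sqrt (A U) * sqrt (B U)" if "U \<in> ?P" for U
  proof -
    have U: "U \<subseteq> {..<s}" using that by auto
    have "(LINT x|?M. F U x * ?K U x)\<^sup>2 \<le> A U * B U"
    proof (cases "\<gamma> U = 0")
      \<comment> \<open>Here \<open>1 / \<gamma> U\<close> is \<open>0\<close> as well, and the
        inequality holds because \<open>F U\<close> vanishes.\<close>
      case True
      then show ?thesis using \<gamma>0[OF U] A0 B0 by simp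
    next
      case False
      then have "A U * B U = (LINT x|?M. (F U x)\<^sup>2) * (LINT x|?M. (?K U x)\<^sup>2)" by (simp add: A_def B_def)
      then show ?thesis
        using integral_Cauchy_Schwarz[OF integrable_square(2)[OF U] lattice_kernel_square(1)[OF U] intFK[OF U]] by simp
    qed
    then show ?thesis by (metis real_sqrt_abs real_sqrt_le_mono real_sqrt_mult)
  qed
  have "\<bar>\<Sum>U\<in>?P. LINT x|?M. F U x * ?K U x\<bar> \<le> (\<Sum>U\<in>?P. sqrt (A U) * sqrt (B U))"
    by (rule order_trans[OF sum_abs]) (rule sum_mono[OF le])
  then have "(\<Sum>U\<in>?P. LINT x|?M. F U x * ?K U x)\<^sup>2 \<le> (\<Sum>U\<in>?P. sqrt (A U) * sqrt (B U))\<^sup>2"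
    using power_mono[OF _ abs_ge_zero, of _ _ 2] by fastforce
  also have "\<dots> \<le> (\<Sum>U\<in>?P. (sqrt (A U))\<^sup>2) * (\<Sum>U\<in>?P. (sqrt (B U))\<^sup>2)"
    by (rule Cauchy_Schwarz_ineq_sum)
  also have "\<dots> = shift_wce \<gamma> s n g \<Delta> * (\<Sum>U\<in>?P. A U)"
    using A0 B0 by (simp add: shift_wce_def B_def[symmetric])
  finally show ?thesis unfolding err A_def by simp
qed

end

section \<open>Parametric families of coercive problems\<close>

text \<open>Linearity is demanded on \<open>V\<close> only: \<open>weak_gradient\<close> is defined
  by choice and arbitrary outside \<open>H1\<close>, so \<open>bform\<close> has no reason to be
  bilinear on all functions.\<close>

definition sym_bilinear_on :: "'v::real_vector set \<Rightarrow> ('v \<Rightarrow> 'v \<Rightarrow> real) \<Rightarrow> bool" where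
  "sym_bilinear_on V b \<longleftrightarrow> (\<forall>u\<in>V. \<forall>v\<in>V. b u v = b v u) \<and>
     (\<forall>u\<in>V. \<forall>v\<in>V. \<forall>w\<in>V. b (u + v) w = b u w + b v w) \<and>
     (\<forall>c. \<forall>u\<in>V. \<forall>w\<in>V. b (c *\<^sub>R u) w = c * b u w)"

definition functional_on :: "'v::real_vector set \<Rightarrow> ('v \<Rightarrow> real) \<Rightarrow> bool" where
  "functional_on V f \<longleftrightarrow> (\<forall>u\<in>V. \<forall>v\<in>V. f (u + v) = f u + f v) \<and> (\<forall>c. \<forall>u\<in>V. f (c *\<^sub>R u) = c * f u)"

lemma sym_bilinear_onD:
  assumes "sym_bilinear_on V b"
  shows "u \<in> V \<Longrightarrow> v \<in> V \<Longrightarrow> b u v = b v u"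
    and "u \<in> V \<Longrightarrow> v \<in> V \<Longrightarrow> w \<in> V \<Longrightarrow> b (u + v) w = b u w + b v w"
    and "u \<in> V \<Longrightarrow> w \<in> V \<Longrightarrow> b (c *\<^sub>R u) w = c * b u w"
  using assms unfolding sym_bilinear_on_def by blast+

lemma functional_onD:
  assumes "functional_on V f"
  shows "u \<in> V \<Longrightarrow> v \<in> V \<Longrightarrow> f (u + v) = f u + f v"
    and "u \<in> V \<Longrightarrow> f (c *\<^sub>R u) = c * f u"
  using assms unfolding functional_on_def by blast+

lemma functional_on_diff:
  assumes "functional_on V f" "subspace V" "u \<in> V" "v \<in> V"
  shows "f (u - v) = f u - f v"
proof -
  have "f (u - v) = f (u + (-1) *\<^sub>R v)" by simp
  also have "\<dots> = f u + f ((-1) *\<^sub>R v)" using assms by (intro functional_onD(1)[OF assms(1)] subspace_mul) auto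
  also have "f ((-1) *\<^sub>R v) = - f v" using functional_onD(2)[OF assms(1,4), of "-1"] by simp
  finally show ?thesis by simp
qed

lemma functional_on_zero: "functional_on V f \<Longrightarrow> 0 \<in> V \<Longrightarrow> f 0 = 0"
  using functional_onD(2)[of V f 0 0] by simp

lemma functional_on_left:
  assumes "sym_bilinear_on V b" "w \<in> V"
  shows "functional_on V (\<lambda>u. b u w)"
  using sym_bilinear_onD[OF assms(1)] assms(2) by (simp add: functional_on_def)

lemma functional_on_right:
  assumes "sym_bilinear_on V b" "w \<in> V" "subspace V"
  shows "functional_on V (b w)"
proof -
  have "b w u = b u w" if "u \<in> V" for u using sym_bilinear_onD(1)[OF assms(1)] assms(2) that by simp
  then show ?thesis using functional_on_left[OF assms(1,2)] assms(3)
    by (simp add: functional_on_def subspace_add subspace_mul)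
qed

lemma functional_on_minus:
  assumes "functional_on V f" "functional_on V g"
  shows "functional_on V (\<lambda>v. f v - g v)"
  using assms by (auto simp: functional_on_def algebra_simps)

lemma functional_on_sum:
  assumes "\<And>j. j \<in> J \<Longrightarrow> functional_on V (f j)"
  shows "functional_on V (\<lambda>v. \<Sum>j\<in>J. f j v)"
  using assms unfolding functional_on_def by (auto simp: sum.distrib sum_distrib_left intro!: sum.cong)

text \<open>Gram-Schmidt by induction on the spanning set. The induction hypothesis, applied to the
  functional \<open>b \<phi>\<close>, yields the projection \<open>p\<close> of the new vector;
  along \<open>e = \<phi> - p\<close>, which is orthogonal to the old span, the coefficient of the
  solution is \<open>F e / b e e\<close>. If \<open>e = 0\<close>, the span has not grown.\<close>

lemma riesz_finite_dimensional:
  fixes b :: "'v::real_vector \<Rightarrow> 'v \<Rightarrow> real"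
  assumes "finite E" "sym_bilinear_on (span E) b" "\<And>v. v \<in> span E \<Longrightarrow> v \<noteq> 0 \<Longrightarrow> b v v > 0"
    and "functional_on (span E) F"
  shows "\<exists>u\<in>span E. \<forall>v\<in>span E. b u v = F v"
  using assms
proof (induction E arbitrary: F rule: finite_induct)
  case empty
  then show ?case using functional_on_zero[of "span {}" F] sym_bilinear_onD(3)[OF empty.prems(1), of 0 0 0] by simp
next
  case (insert \<phi> E)
  let ?S = "span (insert \<phi> E)"
  note b = sym_bilinear_onD[OF insert.prems(1)]
  have sub: "span E \<subseteq> ?S" by (intro span_mono) auto
  have phi: "\<phi> \<in> ?S" by (intro span_base) simp
  have sb: "sym_bilinear_on (span E) b" using insert.prems(1) sub unfolding sym_bilinear_on_def by blast
  have pd: "\<And>v. v \<in> span E \<Longrightarrow> v \<noteq> 0 \<Longrightarrow> b v v > 0" using insert.prems(2) sub by blast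
  have fo: "functional_on (span E) G" if "functional_on ?S G" for G
    using that sub unfolding functional_on_def by blast
  obtain u0 where u0: "u0 \<in> span E" "\<And>v. v \<in> span E \<Longrightarrow> b u0 v = F v"
    using insert.IH[OF sb pd fo[OF insert.prems(3)]] by blast
  obtain p where p: "p \<in> span E" "\<And>v. v \<in> span E \<Longrightarrow> b p v = b \<phi> v"
    using insert.IH[OF sb pd fo[OF functional_on_right[OF insert.prems(1) phi subspace_span]]] by blast
  define e where "e = \<phi> - p"
  show ?case
  proof (cases "e = 0")
    case True
    then have "\<phi> \<in> span E" using p by (simp add: e_def)
    then have "?S = span E" by (simp add: span_redundant)
    then show ?thesis using u0 by auto
  next
    case False
    have pS: "p \<in> ?S" using p sub by auto
    have eS: "e \<in> ?S" unfolding e_def using phi pS by (rule span_diff)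
    have ee: "b e e > 0" by (rule insert.prems(2)[OF eS False])
    have be: "b e v = 0" if v: "v \<in> span E" for v
      using functional_on_diff[OF functional_on_left[OF insert.prems(1), of v] subspace_span phi pS] p(2)[OF v] v sub
      by (auto simp: e_def)
    define u where "u = u0 + (F e / b e e) *\<^sub>R e"
    have u0S: "u0 \<in> ?S" using u0 sub by auto
    have ceS: "c *\<^sub>R e \<in> ?S" for c using eS by (rule span_scale)
    have "b u v = F v" if v: "v \<in> ?S" for v
    proof -
      obtain k where k: "v - k *\<^sub>R \<phi> \<in> span E" using v by (auto simp: span_insert)
      define w where "w = (v - k *\<^sub>R \<phi>) + k *\<^sub>R p"
      have w: "w \<in> span E" unfolding w_def using k p by (intro span_add span_scale)
      have wS: "w \<in> ?S" using w sub by auto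
      have vw: "v = w + k *\<^sub>R e" by (simp add: w_def e_def scaleR_diff_right)
      have 1: "b u w = F w"
        unfolding u_def using b(2)[OF u0S ceS wS] b(3)[OF eS wS] be[OF w] u0(2)[OF w] by simp
      have "b u0 e = 0" using b(1)[OF u0S eS] be[OF u0(1)] by simp
      then have 2: "b u e = F e"
        unfolding u_def using b(2)[OF u0S ceS eS] b(3)[OF eS eS] ee by simp
      have uS: "u \<in> ?S" unfolding u_def using u0S ceS by (rule span_add)
      have "b u v = b u w + k * b u e"
        unfolding vw using functional_onD[OF functional_on_right[OF insert.prems(1) uS subspace_span]] wS ceS eS by simp
      also have "\<dots> = F w + k * F e" by (simp add: 1 2)
      also have "\<dots> = F v" unfolding vw using functional_onD[OF insert.prems(3)] wS ceS eS by simp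
      finally show ?thesis .
    qed
    moreover have "u \<in> ?S" unfolding u_def using u0S ceS by (rule span_add)
    ultimately show ?thesis by blast
  qed
qed

text \<open>Coordinates from \<open>s\<close> on are left free, unlike in \<open>Xi_s\<close>; zero
  extensions and clamped sequences therefore belong to it.\<close>

definition cube :: "nat \<Rightarrow> (nat \<Rightarrow> real) set" where
  "cube s = {y. \<forall>j<s. y j \<in> {-1/2..1/2}}"

text \<open>Abstracts from Sobolev spaces: \<open>h\<close> is the energy inner product,
  \<open>A0\<close> the form of the mean coefficient, \<open>B j\<close> that of the
  \<open>j\<close>-th fluctuation with norm at most \<open>\<beta> j\<close>, and \<open>a\<close>
  the coercivity constant, uniform over the cube.\<close>

locale coercive_family =
  fixes V :: "'v::real_vector set" and E :: "'v set" and h A0 :: "'v \<Rightarrow> 'v \<Rightarrow> real"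
    and B :: "nat \<Rightarrow> 'v \<Rightarrow> 'v \<Rightarrow> real" and s :: nat and \<beta> :: "nat \<Rightarrow> real" and a :: real
  assumes fin: "finite E" "V = span E"
    and h: "sym_bilinear_on V h" "\<And>v. v \<in> V \<Longrightarrow> v \<noteq> 0 \<Longrightarrow> h v v > 0"
    and A0: "sym_bilinear_on V A0"
    and B: "\<And>j. j < s \<Longrightarrow> sym_bilinear_on V (B j)"
    and B_le: "\<And>j u v. j < s \<Longrightarrow> u \<in> V \<Longrightarrow> v \<in> V \<Longrightarrow> \<bar>B j u v\<bar> \<le> \<beta> j * sqrt (h u u) * sqrt (h v v)"
    and \<beta>: "\<And>j. 0 \<le> \<beta> j"
    and a: "0 < a"
    and coercive: "\<And>y v. y \<in> cube s \<Longrightarrow> v \<in> V \<Longrightarrow> a * h v v \<le> A0 v v + (\<Sum>j<s. y j * B j v v)"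
begin

definition nrm :: "'v \<Rightarrow> real" where "nrm v = sqrt (h v v)"

definition A :: "(nat \<Rightarrow> real) \<Rightarrow> 'v \<Rightarrow> 'v \<Rightarrow> real" where
  "A y u v = A0 u v + (\<Sum>j<s. y j * B j u v)"

definition sol :: "(nat \<Rightarrow> real) \<Rightarrow> ('v \<Rightarrow> real) \<Rightarrow> 'v" where
  "sol y F = (THE u. u \<in> V \<and> (\<forall>v\<in>V. A y u v = F v))"

lemma subspace_V: "subspace V" unfolding fin by simp

lemma V_closed [simp]: "0 \<in> V" "u \<in> V \<Longrightarrow> v \<in> V \<Longrightarrow> u + v \<in> V" "u \<in> V \<Longrightarrow> v \<in> V \<Longrightarrow> u - v \<in> V" "u \<in> V \<Longrightarrow> c *\<^sub>R u \<in> V"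
  using subspace_V by (auto intro: subspace_0 subspace_add subspace_diff subspace_mul)

lemma h_nonneg: "v \<in> V \<Longrightarrow> 0 \<le> h v v"
  using h(2)[of v] functional_on_zero[OF functional_on_left[OF h(1), of 0]] by (cases "v = 0") (auto simp: less_imp_le)

lemma nrm_nonneg: "v \<in> V \<Longrightarrow> 0 \<le> nrm v"
  by (simp add: nrm_def h_nonneg)

lemma nrm_square: "v \<in> V \<Longrightarrow> (nrm v)\<^sup>2 = h v v"
  by (simp add: nrm_def h_nonneg)

lemma nrm_eq_0: "v \<in> V \<Longrightarrow> nrm v \<le> 0 \<Longrightarrow> v = 0"
  using h(2)[of v] by (auto simp: nrm_def)

lemma h_Cauchy_Schwarz:
  assumes u: "u \<in> V" and v: "v \<in> V"
  shows "\<bar>h u v\<bar> \<le> nrm u * nrm v"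
proof -
  have "(h u v)\<^sup>2 \<le> h u u * h v v"
  proof (rule quadratic_nonneg_discriminant)
    fix t
    let ?w = "u - t *\<^sub>R v"
    note L = functional_on_diff[OF functional_on_left[OF h(1)] subspace_V]
    have tv: "t *\<^sub>R v \<in> V" and w: "?w \<in> V" using u v by auto
    have "h ?w ?w = h u ?w - t * h v ?w"
      using L[OF w u tv] sym_bilinear_onD(3)[OF h(1) v w] by simp
    also have "h u ?w = h u u - t * h v u"
      using L[OF u u tv] sym_bilinear_onD(1)[OF h(1) u w] sym_bilinear_onD(3)[OF h(1) v u] by simp
    also have "h v ?w = h u v - t * h v v"
      using L[OF v u tv] sym_bilinear_onD(1)[OF h(1) v w] sym_bilinear_onD(3)[OF h(1) v v] by simp
    also have "h v u = h u v" using sym_bilinear_onD(1)[OF h(1) u v] by simp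
    finally have "h ?w ?w = h u u - 2 * t * h u v + t\<^sup>2 * h v v" by (simp add: algebra_simps power2_eq_square)
    then show "0 \<le> h u u - 2 * t * h u v + t\<^sup>2 * h v v" using h_nonneg[OF w] by simp
  qed
  then have "sqrt ((h u v)\<^sup>2) \<le> sqrt (h u u * h v v)" by (rule real_sqrt_le_mono)
  then show ?thesis by (simp add: nrm_def real_sqrt_mult)
qed

text \<open>In finite dimension the functional is represented by a vector, whose norm serves as the
  bound.\<close>

lemma functional_bounded:
  assumes "functional_on V f"
  shows "\<exists>M\<ge>0. \<forall>v\<in>V. \<bar>f v\<bar> \<le> M * nrm v"
proof -
  obtain r where "r \<in> V" "\<And>v. v \<in> V \<Longrightarrow> h r v = f v"
    using riesz_finite_dimensional[OF fin(1), of h f] h assms unfolding fin(2) by auto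
  then show ?thesis using h_Cauchy_Schwarz[of r] nrm_nonneg[of r] by (intro exI[of _ "nrm r"]) auto
qed

lemma A_bilinear: "sym_bilinear_on V (A y)"
  unfolding sym_bilinear_on_def A_def
proof (intro conjI ballI allI)
  fix u v assume u: "u \<in> V" and v: "v \<in> V"
  show "A0 u v + (\<Sum>j<s. y j * B j u v) = A0 v u + (\<Sum>j<s. y j * B j v u)"
    using sym_bilinear_onD(1)[OF A0 u v] sym_bilinear_onD(1)[OF B u v] by (auto intro!: sum.cong)
  fix c
  have "(\<Sum>j<s. y j * B j (c *\<^sub>R u) v) = c * (\<Sum>j<s. y j * B j u v)"
    unfolding sum_distrib_left using sym_bilinear_onD(3)[OF B u v] by (intro sum.cong) auto
  then show "A0 (c *\<^sub>R u) v + (\<Sum>j<s. y j * B j (c *\<^sub>R u) v) = c * (A0 u v + (\<Sum>j<s. y j * B j u v))"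
    using sym_bilinear_onD(3)[OF A0 u v] by (simp add: distrib_left)
  fix w assume w: "w \<in> V"
  have "(\<Sum>j<s. y j * B j (u + v) w) = (\<Sum>j<s. y j * B j u w) + (\<Sum>j<s. y j * B j v w)"
    unfolding sum.distrib[symmetric] using sym_bilinear_onD(2)[OF B u v w] by (intro sum.cong) (auto simp: distrib_left)
  then show "A0 (u + v) w + (\<Sum>j<s. y j * B j (u + v) w) = A0 u w + (\<Sum>j<s. y j * B j u w) + (A0 v w + (\<Sum>j<s. y j * B j v w))"
    using sym_bilinear_onD(2)[OF A0 u v w] by simp
qed

lemma A_coercive: "y \<in> cube s \<Longrightarrow> v \<in> V \<Longrightarrow> a * (nrm v)\<^sup>2 \<le> A y v v"
  using coercive[of y v] by (simp add: A_def nrm_square)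

lemma A_diff_left: "u \<in> V \<Longrightarrow> u' \<in> V \<Longrightarrow> v \<in> V \<Longrightarrow> A y (u - u') v = A y u v - A y u' v"
  by (rule functional_on_diff[OF functional_on_left[OF A_bilinear] subspace_V])

lemma B_diff_left: "j < s \<Longrightarrow> u \<in> V \<Longrightarrow> u' \<in> V \<Longrightarrow> v \<in> V \<Longrightarrow> B j (u - u') v = B j u v - B j u' v"
  by (rule functional_on_diff[OF functional_on_left[OF B] subspace_V])

lemma A_upd:
  assumes "k < s"
  shows "A (y(k := t)) u v = A y u v + (t - y k) * B k u v"
proof -
  have "(\<Sum>j<s. (y(k := t)) j * B j u v) = t * B k u v + (\<Sum>j\<in>{..<s} - {k}. (y(k := t)) j * B j u v)"
    using assms by (subst sum.remove[of _ k]) auto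
  also have "(\<Sum>j\<in>{..<s} - {k}. (y(k := t)) j * B j u v) = (\<Sum>j\<in>{..<s} - {k}. y j * B j u v)"
    by (intro sum.cong) auto
  also have "\<dots> = (\<Sum>j<s. y j * B j u v) - y k * B k u v"
    using assms by (subst sum.remove[of "{..<s}" k]) auto
  finally show ?thesis by (simp add: A_def algebra_simps)
qed

text \<open>Testing with \<open>v = u\<close> and dividing by the norm. Each estimate of a tower
  below exhibits the quantity in question as a solution at \<open>y\<close> and bounds its
  load.\<close>

lemma nrm_le_of_A:
  assumes y: "y \<in> cube s" and u: "u \<in> V" and M: "0 \<le> M" "\<And>v. v \<in> V \<Longrightarrow> \<bar>A y u v\<bar> \<le> M * nrm v"
  shows "nrm u \<le> M / a"
proof (cases "nrm u = 0")
  case True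
  then show ?thesis using M a by simp
next
  case False
  then have pos: "nrm u > 0" using nrm_nonneg[OF u] by simp
  have "a * nrm u * nrm u \<le> M * nrm u"
    using A_coercive[OF y u] M(2)[OF u] by (simp add: power2_eq_square mult.assoc)
  then have "a * nrm u \<le> M" using pos by simp
  then show ?thesis using a by (simp add: field_simps)
qed

lemma sol:
  assumes y: "y \<in> cube s" and F: "functional_on V F"
  shows "sol y F \<in> V \<and> (\<forall>v\<in>V. A y (sol y F) v = F v)"
  unfolding sol_def
proof (rule theI')
  have pd: "A y v v > 0" if "v \<in> V" "v \<noteq> 0" for v
  proof -
    have "0 < a * h v v" using h(2)[OF that] a by simp
    then show ?thesis using A_coercive[OF y that(1)] nrm_square[OF that(1)] by simp
  qed
  obtain u where u: "u \<in> V" "\<forall>v\<in>V. A y u v = F v"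
    using riesz_finite_dimensional[OF fin(1), of "A y" F] A_bilinear pd F unfolding fin(2) by auto
  show "\<exists>!u. u \<in> V \<and> (\<forall>v\<in>V. A y u v = F v)"
  proof (rule ex1I[of _ u])
    show "u \<in> V \<and> (\<forall>v\<in>V. A y u v = F v)" using u by blast
    fix u' assume u': "u' \<in> V \<and> (\<forall>v\<in>V. A y u' v = F v)"
    then have "A y (u' - u) (u' - u) = 0" using u A_diff_left[of u' u "u' - u" y] by simp
    then show "u' = u" using pd[of "u' - u"] u u' by fastforce
  qed
qed

section \<open>Mixed derivatives of parametric solutions\<close>

lemma sum_B_bound:
  assumes U: "U \<subseteq> {..<s}" and w: "\<And>j. j \<in> U \<Longrightarrow> w j \<in> V" "\<And>j. j \<in> U \<Longrightarrow> nrm (w j) \<le> f j" and v: "v \<in> V"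
  shows "\<bar>\<Sum>j\<in>U. B j (w j) v\<bar> \<le> (\<Sum>j\<in>U. \<beta> j * f j) * nrm v"
proof -
  have "\<bar>\<Sum>j\<in>U. B j (w j) v\<bar> \<le> (\<Sum>j\<in>U. \<bar>B j (w j) v\<bar>)" by (rule sum_abs)
  also have "\<dots> \<le> (\<Sum>j\<in>U. \<beta> j * f j * nrm v)"
  proof (rule sum_mono)
    fix j assume j: "j \<in> U"
    have "\<bar>B j (w j) v\<bar> \<le> \<beta> j * nrm (w j) * nrm v" using B_le[of j "w j" v] j U w v unfolding nrm_def by auto
    also have "\<dots> \<le> \<beta> j * f j * nrm v"
      using w(2)[OF j] \<beta>[of j] nrm_nonneg[OF v] by (intro mult_right_mono mult_left_mono) auto
    finally show "\<bar>B j (w j) v\<bar> \<le> \<beta> j * f j * nrm v" .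
  qed
  finally show ?thesis by (simp add: sum_distrib_right)
qed

text \<open>If \<open>G U\<close> are the mixed derivatives of a load \<open>G {}\<close>, then \<open>tower G U\<close> are those of the
  solution \<open>tower G {}\<close>: this is the equation \<open>A y u v = G {} y v\<close> differentiated by Leibniz' rule.\<close>

function tower :: "(nat set \<Rightarrow> (nat \<Rightarrow> real) \<Rightarrow> 'v \<Rightarrow> real) \<Rightarrow> nat set \<Rightarrow> (nat \<Rightarrow> real) \<Rightarrow> 'v" where
  "tower G U y = (if finite U then sol y (\<lambda>v. G U y v - (\<Sum>j\<in>U. B j (tower G (U - {j}) y) v)) else 0)"
  by auto
text \<open>The value \<open>0\<close> for infinite \<open>U\<close> makes \<open>card U\<close>
  decrease in every recursive call.\<close>

termination
  by (relation "Wellfounded.measure (\<lambda>(G, U, y). card U)") (auto simp: card_gt_0_iff intro!: diff_less)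

declare tower.simps [simp del]

lemma tower:
  assumes U: "U \<subseteq> {..<s}" and y: "y \<in> cube s" and G: "\<And>W. W \<subseteq> {..<s} \<Longrightarrow> functional_on V (G W y)"
  shows "tower G U y \<in> V \<and> (\<forall>v\<in>V. A y (tower G U y) v = G U y v - (\<Sum>j\<in>U. B j (tower G (U - {j}) y) v))"
proof -
  have "finite U" using U by (rule finite_subset) simp
  then show ?thesis using U
  proof (induction U rule: finite_psubset_induct)
    case (psubset U)
    have "functional_on V (\<lambda>v. G U y v - (\<Sum>j\<in>U. B j (tower G (U - {j}) y) v))"
    proof (rule functional_on_minus[OF G[OF psubset.prems] functional_on_sum])
      fix j assume j: "j \<in> U"
      then have "j < s" "tower G (U - {j}) y \<in> V" using psubset.prems psubset.IH[of "U - {j}"] by blast+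
      then show "functional_on V (B j (tower G (U - {j}) y))"
        by (intro functional_on_right[OF B _ subspace_V])
    qed
    from sol[OF y this] show ?case using psubset.hyps by (subst (1 2) tower.simps) simp
  qed
qed

text \<open>Besides linearity: boundedness, Lipschitz continuity and a second-order remainder in
  each single coordinate, with constants uniform over the cube. The remainder condition excludes
  \<open>k \<in> U\<close> because only mixed first derivatives occur.\<close>

definition regular_functionals :: "(nat set \<Rightarrow> (nat \<Rightarrow> real) \<Rightarrow> 'v \<Rightarrow> real) \<Rightarrow> bool" where
  "regular_functionals G \<longleftrightarrow>
     (\<forall>U\<subseteq>{..<s}. \<forall>y\<in>cube s. functional_on V (G U y)) \<and>
     (\<forall>U\<subseteq>{..<s}. \<exists>M\<ge>0. \<forall>y\<in>cube s. \<forall>v\<in>V. \<bar>G U y v\<bar> \<le> M * nrm v) \<and>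
     (\<forall>U\<subseteq>{..<s}. \<exists>M\<ge>0. \<forall>y k t. y \<in> cube s \<longrightarrow> k < s \<longrightarrow> y(k := t) \<in> cube s \<longrightarrow>
        (\<forall>v\<in>V. \<bar>G U (y(k := t)) v - G U y v\<bar> \<le> M * \<bar>t - y k\<bar> * nrm v)) \<and>
     (\<forall>U\<subseteq>{..<s}. \<exists>M\<ge>0. \<forall>y k t. y \<in> cube s \<longrightarrow> k < s \<longrightarrow> k \<notin> U \<longrightarrow> y(k := t) \<in> cube s \<longrightarrow>
        (\<forall>v\<in>V. \<bar>G U (y(k := t)) v - G U y v - (t - y k) * G (insert k U) y v\<bar> \<le> M * (t - y k)\<^sup>2 * nrm v))"

definition regular_vectors :: "(nat set \<Rightarrow> (nat \<Rightarrow> real) \<Rightarrow> 'v) \<Rightarrow> bool" where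
  "regular_vectors T \<longleftrightarrow>
     (\<forall>U\<subseteq>{..<s}. \<forall>y\<in>cube s. T U y \<in> V) \<and>
     (\<forall>U\<subseteq>{..<s}. \<exists>M\<ge>0. \<forall>y\<in>cube s. nrm (T U y) \<le> M) \<and>
     (\<forall>U\<subseteq>{..<s}. \<exists>M\<ge>0. \<forall>y k t. y \<in> cube s \<longrightarrow> k < s \<longrightarrow> y(k := t) \<in> cube s \<longrightarrow>
        nrm (T U (y(k := t)) - T U y) \<le> M * \<bar>t - y k\<bar>) \<and>
     (\<forall>U\<subseteq>{..<s}. \<exists>M\<ge>0. \<forall>y k t. y \<in> cube s \<longrightarrow> k < s \<longrightarrow> k \<notin> U \<longrightarrow> y(k := t) \<in> cube s \<longrightarrow>
        nrm (T U (y(k := t)) - T U y - (t - y k) *\<^sub>R T (insert k U) y) \<le> M * (t - y k)\<^sup>2)"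

lemma regular_functionalsD:
  assumes "regular_functionals G" and "U \<subseteq> {..<s}"
  shows "y \<in> cube s \<Longrightarrow> functional_on V (G U y)"
    and "\<exists>M\<ge>0. \<forall>y\<in>cube s. \<forall>v\<in>V. \<bar>G U y v\<bar> \<le> M * nrm v"
    and "\<exists>M\<ge>0. \<forall>y k t. y \<in> cube s \<longrightarrow> k < s \<longrightarrow> y(k := t) \<in> cube s \<longrightarrow>
        (\<forall>v\<in>V. \<bar>G U (y(k := t)) v - G U y v\<bar> \<le> M * \<bar>t - y k\<bar> * nrm v)"
    and "\<exists>M\<ge>0. \<forall>y k t. y \<in> cube s \<longrightarrow> k < s \<longrightarrow> k \<notin> U \<longrightarrow> y(k := t) \<in> cube s \<longrightarrow>
        (\<forall>v\<in>V. \<bar>G U (y(k := t)) v - G U y v - (t - y k) * G (insert k U) y v\<bar> \<le> M * (t - y k)\<^sup>2 * nrm v)"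
proof -
  note G = assms(1)[unfolded regular_functionals_def]
  show "y \<in> cube s \<Longrightarrow> functional_on V (G U y)" by (rule conjunct1[OF G, rule_format, OF assms(2)])
  show "\<exists>M\<ge>0. \<forall>y\<in>cube s. \<forall>v\<in>V. \<bar>G U y v\<bar> \<le> M * nrm v"
    by (rule conjunct1[OF conjunct2[OF G], rule_format, OF assms(2)])
  show "\<exists>M\<ge>0. \<forall>y k t. y \<in> cube s \<longrightarrow> k < s \<longrightarrow> y(k := t) \<in> cube s \<longrightarrow>
        (\<forall>v\<in>V. \<bar>G U (y(k := t)) v - G U y v\<bar> \<le> M * \<bar>t - y k\<bar> * nrm v)"
    by (rule conjunct1[OF conjunct2[OF conjunct2[OF G]], rule_format, OF assms(2)])
  show "\<exists>M\<ge>0. \<forall>y k t. y \<in> cube s \<longrightarrow> k < s \<longrightarrow> k \<notin> U \<longrightarrow> y(k := t) \<in> cube s \<longrightarrow>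
        (\<forall>v\<in>V. \<bar>G U (y(k := t)) v - G U y v - (t - y k) * G (insert k U) y v\<bar> \<le> M * (t - y k)\<^sup>2 * nrm v)"
    by (rule conjunct2[OF conjunct2[OF conjunct2[OF G]], rule_format, OF assms(2)])
qed

lemma tower_in:
  assumes "regular_functionals G" "U \<subseteq> {..<s}" "y \<in> cube s"
  shows "tower G U y \<in> V"
  using tower[OF assms(2,3), of G] regular_functionalsD(1)[OF assms(1) _ assms(3)] by simp

lemma tower_eq:
  assumes "regular_functionals G" "U \<subseteq> {..<s}" "y \<in> cube s" "v \<in> V"
  shows "A y (tower G U y) v = G U y v - (\<Sum>j\<in>U. B j (tower G (U - {j}) y) v)"
  using tower[OF assms(2,3), of G] regular_functionalsD(1)[OF assms(1) _ assms(3)] assms(4) by simp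

lemma tower_bounded:
  assumes G: "regular_functionals G" and U: "U \<subseteq> {..<s}"
  shows "\<exists>M\<ge>0. \<forall>y\<in>cube s. nrm (tower G U y) \<le> M"
proof -
  have "finite U" using U by (rule finite_subset) simp
  then show ?thesis using U
  proof (induction U rule: finite_psubset_induct)
    case (psubset U)
    have "\<forall>j\<in>U. \<exists>M. 0 \<le> M \<and> (\<forall>y\<in>cube s. nrm (tower G (U - {j}) y) \<le> M)"
    proof
      fix j assume "j \<in> U"
      then have "U - {j} \<subset> U" "U - {j} \<subseteq> {..<s}" using psubset.prems by auto
      from psubset.IH[OF this] show "\<exists>M. 0 \<le> M \<and> (\<forall>y\<in>cube s. nrm (tower G (U - {j}) y) \<le> M)" by blast
    qed
    from bchoice[OF this] obtain f where f: "\<forall>j\<in>U. 0 \<le> f j \<and> (\<forall>y\<in>cube s. nrm (tower G (U - {j}) y) \<le> f j)" by blast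
    obtain M where M: "0 \<le> M" "\<And>y v. y \<in> cube s \<Longrightarrow> v \<in> V \<Longrightarrow> \<bar>G U y v\<bar> \<le> M * nrm v"
      using regular_functionalsD(2)[OF G psubset.prems] by blast
    let ?N = "M + (\<Sum>j\<in>U. \<beta> j * f j)"
    have N: "0 \<le> ?N" using M f \<beta> by (intro add_nonneg_nonneg sum_nonneg mult_nonneg_nonneg) auto
    have "nrm (tower G U y) \<le> ?N / a" if y: "y \<in> cube s" for y
    proof (rule nrm_le_of_A[OF y tower_in[OF G psubset.prems y] N])
      fix v assume v: "v \<in> V"
      have "\<bar>\<Sum>j\<in>U. B j (tower G (U - {j}) y) v\<bar> \<le> (\<Sum>j\<in>U. \<beta> j * f j) * nrm v"
      proof (rule sum_B_bound[OF psubset.prems _ _ v])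
        fix j assume j: "j \<in> U"
        show "tower G (U - {j}) y \<in> V" using psubset.prems by (intro tower_in[OF G _ y]) auto
        show "nrm (tower G (U - {j}) y) \<le> f j" using f j y by blast
      qed
      then show "\<bar>A y (tower G U y) v\<bar> \<le> ?N * nrm v"
        unfolding tower_eq[OF G psubset.prems y v] distrib_right using M(2)[OF y v] by linarith
    qed
    then show ?case using N a by (intro exI[of _ "?N / a"]) auto
  qed
qed

text \<open>The increment solves the problem at \<open>y\<close> again. Its load consists of the
  increment of \<open>G U\<close>, of increments of lower members of the tower, and of
  \<open>(t - y k) * B k\<close> at the solution for the new parameter, which accounts for the
  change of \<open>A\<close>.\<close>

lemma tower_lipschitz:
  assumes G: "regular_functionals G" and U: "U \<subseteq> {..<s}"
  shows "\<exists>M\<ge>0. \<forall>y k t. y \<in> cube s \<longrightarrow> k < s \<longrightarrow> y(k := t) \<in> cube s \<longrightarrow>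
        nrm (tower G U (y(k := t)) - tower G U y) \<le> M * \<bar>t - y k\<bar>"
proof -
  have "finite U" using U by (rule finite_subset) simp
  then show ?thesis using U
  proof (induction U rule: finite_psubset_induct)
    case (psubset U)
    let ?P = "\<lambda>U M. \<forall>y k t. y \<in> cube s \<longrightarrow> k < s \<longrightarrow> y(k := t) \<in> cube s \<longrightarrow>
        nrm (tower G U (y(k := t)) - tower G U y) \<le> M * \<bar>t - y k\<bar>"
    have "\<forall>j\<in>U. \<exists>M. 0 \<le> M \<and> ?P (U - {j}) M"
    proof
      fix j assume "j \<in> U"
      then have "U - {j} \<subset> U" "U - {j} \<subseteq> {..<s}" using psubset.prems by auto
      from psubset.IH[OF this] show "\<exists>M. 0 \<le> M \<and> ?P (U - {j}) M" by blast
    qed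
    from bchoice[OF this] obtain f where f: "\<forall>j\<in>U. 0 \<le> f j \<and> ?P (U - {j}) (f j)" by blast
    obtain M where M: "0 \<le> M" "\<And>y k t v. y \<in> cube s \<Longrightarrow> k < s \<Longrightarrow> y(k := t) \<in> cube s \<Longrightarrow> v \<in> V \<Longrightarrow>
        \<bar>G U (y(k := t)) v - G U y v\<bar> \<le> M * \<bar>t - y k\<bar> * nrm v"
      using regular_functionalsD(3)[OF G psubset.prems] by blast
    obtain L where L: "0 \<le> L" "\<And>y. y \<in> cube s \<Longrightarrow> nrm (tower G U y) \<le> L"
      using tower_bounded[OF G psubset.prems] by blast
    \<comment> \<open>One summand for each part of the load: \<open>G U\<close>, the lower members,
      and the change of the bilinear form.\<close>
    let ?N = "M + (\<Sum>j\<in>U. \<beta> j * f j) + (\<Sum>j<s. \<beta> j) * L"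
    have N: "0 \<le> ?N" using M f \<beta> L by (intro add_nonneg_nonneg sum_nonneg mult_nonneg_nonneg) auto
    have step: "nrm (tower G U (y(k := t)) - tower G U y) \<le> ?N / a * \<bar>t - y k\<bar>"
      if y: "y \<in> cube s" and k: "k < s" and y': "y(k := t) \<in> cube s" for y k t
    proof -
      let ?S = "\<lambda>U. tower G U y" and ?S' = "\<lambda>U. tower G U (y(k := t))" and ?d = "\<bar>t - y k\<bar>"
      have inV: "?S W \<in> V" "?S' W \<in> V" if "W \<subseteq> {..<s}" for W
        using tower_in[OF G that y] tower_in[OF G that y'] by auto
      note V = inV[OF psubset.prems]
      have "nrm (?S' U - ?S U) \<le> (?N * ?d) / a"
      proof (rule nrm_le_of_A[OF y])
        show "?S' U - ?S U \<in> V" using V by simp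
        show "0 \<le> ?N * ?d" using N by simp
        fix v assume v: "v \<in> V"
        have Uj: "?S (U - {j}) \<in> V" "?S' (U - {j}) \<in> V" for j
          using psubset.prems by (intro inV; blast)+
        have "A y (?S' U - ?S U) v = (G U (y(k := t)) v - G U y v)
           - (\<Sum>j\<in>U. B j (?S' (U - {j})) v - B j (?S (U - {j})) v) - (t - y k) * B k (?S' U) v"
          unfolding A_diff_left[OF V(2,1) v] tower_eq[OF G psubset.prems y v]
          using tower_eq[OF G psubset.prems y' v] unfolding A_upd[OF k] by (simp add: sum_subtractf)
        also have "(\<Sum>j\<in>U. B j (?S' (U - {j})) v - B j (?S (U - {j})) v) = (\<Sum>j\<in>U. B j (?S' (U - {j}) - ?S (U - {j})) v)"
          using psubset.prems Uj v by (intro sum.cong refl B_diff_left[symmetric]) auto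
        finally have eq: "A y (?S' U - ?S U) v = (G U (y(k := t)) v - G U y v)
           - (\<Sum>j\<in>U. B j (?S' (U - {j}) - ?S (U - {j})) v) - (t - y k) * B k (?S' U) v" .
        have 1: "\<bar>\<Sum>j\<in>U. B j (?S' (U - {j}) - ?S (U - {j})) v\<bar> \<le> (\<Sum>j\<in>U. \<beta> j * (f j * ?d)) * nrm v"
        proof (rule sum_B_bound[OF psubset.prems _ _ v])
          fix j assume j: "j \<in> U"
          show "?S' (U - {j}) - ?S (U - {j}) \<in> V" using Uj by simp
          show "nrm (?S' (U - {j}) - ?S (U - {j})) \<le> f j * ?d" using f j y k y' by blast
        qed
        have "\<bar>B k (?S' U) v\<bar> \<le> \<beta> k * nrm (?S' U) * nrm v" using B_le[OF k V(2) v] by (simp add: nrm_def)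
        also have "\<dots> \<le> (\<Sum>j<s. \<beta> j) * L * nrm v"
        proof -
          have "\<beta> k \<le> (\<Sum>j<s. \<beta> j)" using k \<beta> by (intro member_le_sum) auto
          then show ?thesis using L(2)[OF y'] \<beta> nrm_nonneg[OF V(2)] nrm_nonneg[OF v]
            by (intro mult_right_mono mult_mono sum_nonneg) auto
        qed
        finally have 2: "\<bar>(t - y k) * B k (?S' U) v\<bar> \<le> ?d * ((\<Sum>j<s. \<beta> j) * L * nrm v)"
          unfolding abs_mult by (intro mult_left_mono) auto
        have 3: "(\<Sum>j\<in>U. \<beta> j * (f j * ?d)) = (\<Sum>j\<in>U. \<beta> j * f j) * ?d"
          by (simp add: sum_distrib_right mult.assoc)
        have "?N * ?d * nrm v = M * ?d * nrm v + (\<Sum>j\<in>U. \<beta> j * f j) * ?d * nrm v + ?d * ((\<Sum>j<s. \<beta> j) * L * nrm v)"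
          by (simp add: algebra_simps)
        then show "\<bar>A y (?S' U - ?S U) v\<bar> \<le> ?N * ?d * nrm v"
          unfolding eq using M(2)[OF y k y' v] 1[unfolded 3] 2 by linarith
      qed
      then show ?thesis by simp
    qed
    show ?case by (intro exI[of _ "?N / a"] conjI allI impI step) (assumption | use N a in simp)+
  qed
qed

text \<open>The remainder solves the problem at \<open>y\<close> as well. Its load contains the
  remainders of \<open>G U\<close> and of the lower members, and \<open>(t - y k) * B k\<close> at
  an increment of the solution; the Lipschitz bound makes this last part quadratic.\<close>

lemma tower_remainder:
  assumes G: "regular_functionals G" and U: "U \<subseteq> {..<s}"
  shows "\<exists>M\<ge>0. \<forall>y k t. y \<in> cube s \<longrightarrow> k < s \<longrightarrow> k \<notin> U \<longrightarrow> y(k := t) \<in> cube s \<longrightarrow>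
        nrm (tower G U (y(k := t)) - tower G U y - (t - y k) *\<^sub>R tower G (insert k U) y) \<le> M * (t - y k)\<^sup>2"
proof -
  have "finite U" using U by (rule finite_subset) simp
  then show ?thesis using U
  proof (induction U rule: finite_psubset_induct)
    case (psubset U)
    let ?P = "\<lambda>U M. \<forall>y k t. y \<in> cube s \<longrightarrow> k < s \<longrightarrow> k \<notin> U \<longrightarrow> y(k := t) \<in> cube s \<longrightarrow>
        nrm (tower G U (y(k := t)) - tower G U y - (t - y k) *\<^sub>R tower G (insert k U) y) \<le> M * (t - y k)\<^sup>2"
    have "\<forall>j\<in>U. \<exists>M. 0 \<le> M \<and> ?P (U - {j}) M"
    proof
      fix j assume "j \<in> U"
      then have "U - {j} \<subset> U" "U - {j} \<subseteq> {..<s}" using psubset.prems by auto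
      from psubset.IH[OF this] show "\<exists>M. 0 \<le> M \<and> ?P (U - {j}) M" by blast
    qed
    from bchoice[OF this] obtain f where f: "\<forall>j\<in>U. 0 \<le> f j \<and> ?P (U - {j}) (f j)" by blast
    obtain M where M: "0 \<le> M" "\<And>y k t v. y \<in> cube s \<Longrightarrow> k < s \<Longrightarrow> k \<notin> U \<Longrightarrow> y(k := t) \<in> cube s \<Longrightarrow> v \<in> V \<Longrightarrow>
        \<bar>G U (y(k := t)) v - G U y v - (t - y k) * G (insert k U) y v\<bar> \<le> M * (t - y k)\<^sup>2 * nrm v"
      using regular_functionalsD(4)[OF G psubset.prems] by blast
    obtain L where L: "0 \<le> L" "\<And>y k t. y \<in> cube s \<Longrightarrow> k < s \<Longrightarrow> y(k := t) \<in> cube s \<Longrightarrow>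
        nrm (tower G U (y(k := t)) - tower G U y) \<le> L * \<bar>t - y k\<bar>"
      using tower_lipschitz[OF G psubset.prems] by blast
    let ?N = "M + (\<Sum>j\<in>U. \<beta> j * f j) + (\<Sum>j<s. \<beta> j) * L"
    have N: "0 \<le> ?N" using M f \<beta> L by (intro add_nonneg_nonneg sum_nonneg mult_nonneg_nonneg) auto
    have step: "nrm (tower G U (y(k := t)) - tower G U y - (t - y k) *\<^sub>R tower G (insert k U) y) \<le> ?N / a * (t - y k)\<^sup>2"
      if y: "y \<in> cube s" and k: "k < s" and kU: "k \<notin> U" and y': "y(k := t) \<in> cube s" for y k t
    proof -
      let ?S = "\<lambda>U. tower G U y" and ?S' = "\<lambda>U. tower G U (y(k := t))" and ?d = "t - y k"
      let ?R = "\<lambda>U. ?S' U - ?S U - ?d *\<^sub>R ?S (insert k U)"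
      have inV: "?S W \<in> V" "?S' W \<in> V" if "W \<subseteq> {..<s}" for W
        using tower_in[OF G that y] tower_in[OF G that y'] by auto
      note V = inV[OF psubset.prems]
      have kU': "insert k U \<subseteq> {..<s}" using psubset.prems k by auto
      have Vk: "?S (insert k U) \<in> V" by (rule inV(1)[OF kU'])
      have "nrm (?R U) \<le> (?N * ?d\<^sup>2) / a"
      proof (rule nrm_le_of_A[OF y])
        show "?R U \<in> V" using V Vk by simp
        show "0 \<le> ?N * ?d\<^sup>2" using N by simp
        fix v assume v: "v \<in> V"
        have Uj: "?S (U - {j}) \<in> V" "?S' (U - {j}) \<in> V" "?S (insert k (U - {j})) \<in> V" for j
          using psubset.prems kU' by (intro inV; blast)+
        have fU: "finite U" by (rule psubset.hyps)
        \<comment> \<open>The summand \<open>j = k\<close> of the equation for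
          \<open>insert k U\<close> is \<open>B k\<close> at the undifferentiated solution; it
          cancels the first-order effect of changing \<open>A\<close>.\<close>
        have k1: "(\<Sum>j\<in>insert k U. B j (?S (insert k U - {j})) v) = B k (?S U) v + (\<Sum>j\<in>U. B j (?S (insert k (U - {j}))) v)"
        proof -
          have "insert k U - {k} = U" using kU by auto
          moreover have "insert k U - {j} = insert k (U - {j})" if "j \<in> U" for j using that kU by auto
          ultimately show ?thesis using kU fU by (simp cong: sum.cong)
        qed
        have expand: "(\<Sum>j\<in>U. B j (?S' (U - {j})) v - B j (?S (U - {j})) v - ?d * B j (?S (insert k (U - {j}))) v)
          = (\<Sum>j\<in>U. B j (?S' (U - {j})) v) - (\<Sum>j\<in>U. B j (?S (U - {j})) v) - ?d * (\<Sum>j\<in>U. B j (?S (insert k (U - {j}))) v)"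
          by (simp only: sum_subtractf sum_distrib_left)
        have "A y (?R U) v = A y (?S' U) v - A y (?S U) v - ?d * A y (?S (insert k U)) v"
          using V Vk v A_diff_left[of "?S' U - ?S U" "?d *\<^sub>R ?S (insert k U)" v y] A_diff_left[of "?S' U" "?S U" v y]
            sym_bilinear_onD(3)[OF A_bilinear Vk v] by simp
        also have "\<dots> = (G U (y(k := t)) v - G U y v - ?d * G (insert k U) y v)
           - (\<Sum>j\<in>U. B j (?S' (U - {j})) v - B j (?S (U - {j})) v - ?d * B j (?S (insert k (U - {j}))) v) - ?d * (B k (?S' U) v - B k (?S U) v)"
          unfolding tower_eq[OF G psubset.prems y v] tower_eq[OF G kU' y v] k1 expand
          using tower_eq[OF G psubset.prems y' v] unfolding A_upd[OF k]
          by (simp add: algebra_simps)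
        also have "(\<Sum>j\<in>U. B j (?S' (U - {j})) v - B j (?S (U - {j})) v - ?d * B j (?S (insert k (U - {j}))) v) = (\<Sum>j\<in>U. B j (?R (U - {j})) v)"
        proof (rule sum.cong[OF refl])
          fix j assume "j \<in> U"
          then have j: "j < s" using psubset.prems by auto
          show "B j (?S' (U - {j})) v - B j (?S (U - {j})) v - ?d * B j (?S (insert k (U - {j}))) v = B j (?R (U - {j})) v"
            using Uj[of j] v B_diff_left[OF j, of "?S' (U - {j}) - ?S (U - {j})" "?d *\<^sub>R ?S (insert k (U - {j}))" v]
              B_diff_left[OF j, of "?S' (U - {j})" "?S (U - {j})" v] sym_bilinear_onD(3)[OF B[OF j] Uj(3) v] by simp
        qed
        also have "B k (?S' U) v - B k (?S U) v = B k (?S' U - ?S U) v"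
          using B_diff_left[OF k V(2,1) v] by simp
        finally have eq: "A y (?R U) v = (G U (y(k := t)) v - G U y v - ?d * G (insert k U) y v)
           - (\<Sum>j\<in>U. B j (?R (U - {j})) v) - ?d * B k (?S' U - ?S U) v" .
        have 1: "\<bar>\<Sum>j\<in>U. B j (?R (U - {j})) v\<bar> \<le> (\<Sum>j\<in>U. \<beta> j * (f j * ?d\<^sup>2)) * nrm v"
        proof (rule sum_B_bound[OF psubset.prems _ _ v])
          fix j assume j: "j \<in> U"
          show "?R (U - {j}) \<in> V" using Uj by simp
          have "k \<notin> U - {j}" using kU by simp
          then show "nrm (?R (U - {j})) \<le> f j * ?d\<^sup>2" using f j y k y' by blast
        qed
        have "\<bar>B k (?S' U - ?S U) v\<bar> \<le> \<beta> k * nrm (?S' U - ?S U) * nrm v"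
          using B_le[OF k _ v, of "?S' U - ?S U"] V by (simp add: nrm_def)
        also have "\<dots> \<le> (\<Sum>j<s. \<beta> j) * (L * \<bar>?d\<bar>) * nrm v"
        proof -
          have "\<beta> k \<le> (\<Sum>j<s. \<beta> j)" using k \<beta> by (intro member_le_sum) auto
          then show ?thesis using L(2)[OF y k y'] \<beta> nrm_nonneg[of "?S' U - ?S U"] V nrm_nonneg[OF v]
            by (intro mult_right_mono mult_mono sum_nonneg) auto
        qed
        finally have "\<bar>?d * B k (?S' U - ?S U) v\<bar> \<le> \<bar>?d\<bar> * ((\<Sum>j<s. \<beta> j) * (L * \<bar>?d\<bar>) * nrm v)"
          unfolding abs_mult by (intro mult_left_mono) auto
        also have "\<dots> = (\<bar>?d\<bar> * \<bar>?d\<bar>) * ((\<Sum>j<s. \<beta> j) * L * nrm v)" by (simp only: mult_ac)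
        also have "\<bar>?d\<bar> * \<bar>?d\<bar> = ?d\<^sup>2" by (simp add: power2_eq_square)
        finally have 2: "\<bar>?d * B k (?S' U - ?S U) v\<bar> \<le> ?d\<^sup>2 * ((\<Sum>j<s. \<beta> j) * L * nrm v)" .
        have 3: "(\<Sum>j\<in>U. \<beta> j * (f j * ?d\<^sup>2)) = (\<Sum>j\<in>U. \<beta> j * f j) * ?d\<^sup>2"
          by (simp add: sum_distrib_right mult.assoc)
        have "?N * ?d\<^sup>2 * nrm v = M * ?d\<^sup>2 * nrm v + (\<Sum>j\<in>U. \<beta> j * f j) * ?d\<^sup>2 * nrm v + ?d\<^sup>2 * ((\<Sum>j<s. \<beta> j) * L * nrm v)"
          by (simp add: algebra_simps)
        then show "\<bar>A y (?R U) v\<bar> \<le> ?N * ?d\<^sup>2 * nrm v"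
          unfolding eq using M(2)[OF y k kU y' v] 1[unfolded 3] 2 by linarith
      qed
      then show ?thesis by simp
    qed
    show ?case by (intro exI[of _ "?N / a"] conjI allI impI step) (assumption | use N a in simp)+
  qed
qed

lemma tower_regular: "regular_functionals G \<Longrightarrow> regular_vectors (tower G)"
  unfolding regular_vectors_def
  by (intro conjI allI impI ballI tower_in tower_bounded tower_lipschitz tower_remainder)

text \<open>\<open>c\<close> and \<open>d\<close> are the growth sequences of the load and of the
  solution. Each of the \<open>Suc n\<close> elements of \<open>U\<close> contributes one lower
  member of the tower with the same product of factors \<open>\<beta> j / a\<close>, whence
  \<open>real (Suc n) * d n\<close> in the recurrence.\<close>

lemma tower_factorial_bound:
  assumes G: "regular_functionals G" and U: "U \<subseteq> {..<s}" and y: "y \<in> cube s"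
    and c: "\<And>U v. U \<subseteq> {..<s} \<Longrightarrow> v \<in> V \<Longrightarrow> \<bar>G U y v\<bar> \<le> a * (c (card U) * (\<Prod>j\<in>U. \<beta> j / a)) * nrm v"
    and d: "c 0 \<le> d 0" "\<And>n. c (Suc n) + real (Suc n) * d n \<le> d (Suc n)" "\<And>n. 0 \<le> d n"
  shows "nrm (tower G U y) \<le> d (card U) * (\<Prod>j\<in>U. \<beta> j / a)"
proof -
  have "finite U" using U by (rule finite_subset) simp
  then show ?thesis using U
  proof (induction U rule: finite_psubset_induct)
    case (psubset U)
    let ?b = "\<lambda>j. \<beta> j / a" and ?n = "card U"
    have b: "0 \<le> ?b j" for j using a \<beta>[of j] by simp
    let ?N = "a * (d ?n * (\<Prod>j\<in>U. ?b j))"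
    have "nrm (tower G U y) \<le> ?N / a"
    proof (rule nrm_le_of_A[OF y tower_in[OF G psubset.prems y]])
      show "0 \<le> ?N" using a d(3) b by (intro mult_nonneg_nonneg prod_nonneg) auto
      fix v assume v: "v \<in> V"
      have "\<bar>\<Sum>j\<in>U. B j (tower G (U - {j}) y) v\<bar> \<le> (\<Sum>j\<in>U. \<beta> j * (d (?n - 1) * (\<Prod>i\<in>U - {j}. ?b i))) * nrm v"
      proof (rule sum_B_bound[OF psubset.prems _ _ v])
        fix j assume j: "j \<in> U"
        show "tower G (U - {j}) y \<in> V" using psubset.prems by (intro tower_in[OF G _ y]) auto
        have "card (U - {j}) = ?n - 1" using j psubset.hyps by simp
        moreover have "U - {j} \<subset> U" "U - {j} \<subseteq> {..<s}" using j psubset.prems by auto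
        ultimately show "nrm (tower G (U - {j}) y) \<le> d (?n - 1) * (\<Prod>i\<in>U - {j}. ?b i)" using psubset.IH by metis
      qed
      also have "(\<Sum>j\<in>U. \<beta> j * (d (?n - 1) * (\<Prod>i\<in>U - {j}. ?b i))) = (\<Sum>j\<in>U. a * d (?n - 1) * (\<Prod>j\<in>U. ?b j))"
      proof (rule sum.cong[OF refl])
        fix j assume j: "j \<in> U"
        have "(\<Prod>j\<in>U. ?b j) = ?b j * (\<Prod>i\<in>U - {j}. ?b i)" using j psubset.hyps by (simp add: prod.remove)
        then show "\<beta> j * (d (?n - 1) * (\<Prod>i\<in>U - {j}. ?b i)) = a * d (?n - 1) * (\<Prod>j\<in>U. ?b j)" using a by simp
      qed
      also have "\<dots> = a * (real ?n * d (?n - 1) * (\<Prod>j\<in>U. ?b j))" by simp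
      finally have 1: "\<bar>\<Sum>j\<in>U. B j (tower G (U - {j}) y) v\<bar> \<le> a * (real ?n * d (?n - 1) * (\<Prod>j\<in>U. ?b j)) * nrm v" .
      have 2: "c ?n + real ?n * d (?n - 1) \<le> d ?n" using d(1) d(2)[of "?n - 1"] by (cases ?n) auto
      have "a * (c ?n * (\<Prod>j\<in>U. ?b j)) * nrm v + a * (real ?n * d (?n - 1) * (\<Prod>j\<in>U. ?b j)) * nrm v
         = a * ((c ?n + real ?n * d (?n - 1)) * (\<Prod>j\<in>U. ?b j)) * nrm v" by (simp only: distrib_left distrib_right)
      also have "\<dots> \<le> ?N * nrm v"
        using 2 a b nrm_nonneg[OF v] by (intro mult_right_mono mult_left_mono prod_nonneg) auto
      finally show "\<bar>A y (tower G U y) v\<bar> \<le> ?N * nrm v"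
        unfolding tower_eq[OF G psubset.prems y v] using c[OF psubset.prems v] 1 by linarith
    qed
    then show ?case using a by simp
  qed
qed

end

section \<open>From vector-valued derivatives to scalar mixed families\<close>

lemma has_real_derivative_of_quadratic_remainder:
  fixes f :: "real \<Rightarrow> real"
  assumes "\<And>x. x \<in> S \<Longrightarrow> \<bar>f x - f t - (x - t) * D\<bar> \<le> C * (x - t)\<^sup>2"
  shows "(f has_real_derivative D) (at t within S)"
  unfolding has_field_derivative_iff
proof (rule LIM_zero_cancel, rule Lim_null_comparison)
  show "((\<lambda>x. C * \<bar>x - t\<bar>) \<longlongrightarrow> 0) (at t within S)"
    by (rule tendsto_eq_intros refl | simp)+
  show "\<forall>\<^sub>F x in at t within S. norm ((f x - f t) / (x - t) - D) \<le> C * \<bar>x - t\<bar>"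
    unfolding eventually_at_filter
  proof (intro always_eventually allI impI)
    fix x assume x: "x \<noteq> t" "x \<in> S"
    have "norm ((f x - f t) / (x - t) - D) = \<bar>f x - f t - (x - t) * D\<bar> / \<bar>x - t\<bar>"
      using x by (simp add: field_simps flip: abs_divide)
    also have "\<dots> \<le> C * (x - t)\<^sup>2 / \<bar>x - t\<bar>" using assms[OF x(2)] by (intro divide_right_mono) auto
    also have "\<dots> = C * \<bar>x - t\<bar>"
    proof -
      have "C * (q * q) / q = C * q" if "q \<noteq> 0" for q :: real using that by simp
      from this[of "\<bar>x - t\<bar>"] show ?thesis using x by (simp add: power2_eq_square)
    qed
    finally show "norm ((f x - f t) / (x - t) - D) \<le> C * \<bar>x - t\<bar>" .
  qed
qed

text \<open>Changing the coordinates one after the other adds the bounds up to continuity in the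
  product topology, whose Borel sets form the product sigma-algebra; zero extension embeds the
  finite product.\<close>

lemma measurable_PiM_of_coordinate_lipschitz:
  fixes f :: "(nat \<Rightarrow> real) \<Rightarrow> real"
  assumes L: "\<And>y k t. k < s \<Longrightarrow> \<bar>f (y(k := t)) - f y\<bar> \<le> C * \<bar>t - y k\<bar>"
    and R: "\<And>y. f (restrict y {..<s}) = f y"
  shows "f \<in> borel_measurable (PiM {..<s} (\<lambda>_. borel))"
proof -
  have hyb: "m \<le> s \<Longrightarrow> \<bar>f (\<lambda>j. if j < m then y' j else y j) - f y\<bar> \<le> (\<Sum>j<m. C * \<bar>y' j - y j\<bar>)" for m y y'
  proof (induction m)
    case (Suc m)
    let ?z = "\<lambda>m j. if j < m then y' j else y j"
    have "?z (Suc m) = (?z m)(m := y' m)" by (auto simp: less_Suc_eq)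
    then have "\<bar>f (?z (Suc m)) - f (?z m)\<bar> \<le> C * \<bar>y' m - y m\<bar>"
      using L[of m "?z m" "y' m"] Suc.prems by simp
    then show ?case using Suc by simp
  qed simp
  have glob: "\<bar>f y' - f y\<bar> \<le> (\<Sum>j<s. C * \<bar>y' j - y j\<bar>)" for y y'
  proof -
    have "restrict (\<lambda>j. if j < s then y' j else y j) {..<s} = restrict y' {..<s}" by auto
    then have "f (\<lambda>j. if j < s then y' j else y j) = f y'" using R by metis
    then show ?thesis using hyb[of s y' y] by simp
  qed
  have "continuous_on UNIV f"
    unfolding continuous_on_def
  proof (intro ballI)
    fix y
    have "((\<lambda>x. f x - f y) \<longlongrightarrow> 0) (at y)"
    proof (rule Lim_null_comparison)
      show "\<forall>\<^sub>F x in at y. norm (f x - f y) \<le> (\<Sum>j<s. C * \<bar>x j - y j\<bar>)"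
        using glob[of _ y] by (intro always_eventually allI) simp
      have c: "((\<lambda>x. x j) \<longlongrightarrow> y j) (at y)" for j :: nat
        using continuous_on_product_coordinates[of j] unfolding continuous_on_def by blast
      have "((\<lambda>x. \<Sum>j<s. C * \<bar>x j - y j\<bar>) \<longlongrightarrow> (\<Sum>j<s. C * \<bar>y j - y j\<bar>)) (at y)"
        by (intro tendsto_intros c)
      then show "((\<lambda>x. \<Sum>j<s. C * \<bar>x j - y j\<bar>) \<longlongrightarrow> 0) (at y)" by simp
    qed
    then show "(f \<longlongrightarrow> f y) (at y within UNIV)" by (simp add: LIM_zero_iff)
  qed
  then have f: "f \<in> borel_measurable borel" by (rule borel_measurable_continuous_onI)
  have "(\<lambda>x j. if j \<in> {..<s} then x j else 0) \<in> measurable (PiM {..<s} (\<lambda>_. borel)) (PiM UNIV (\<lambda>_. borel :: real measure))"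
  proof (rule measurable_PiM_single')
    show "(\<lambda>x. if j \<in> {..<s} then x j else 0) \<in> measurable (PiM {..<s} (\<lambda>_. borel)) (borel :: real measure)" for j
      by (cases "j \<in> {..<s}") auto
  qed auto
  then have "(\<lambda>x j. if j \<in> {..<s} then x j else 0) \<in> measurable (PiM {..<s} (\<lambda>_. borel)) (borel :: (nat \<Rightarrow> real) measure)"
    by (subst measurable_cong_sets[OF refl sets_PiM_equal_borel[symmetric]])
  from measurable_compose[OF this f]
  have "(\<lambda>x. f (\<lambda>j. if j \<in> {..<s} then x j else 0)) \<in> borel_measurable (PiM {..<s} (\<lambda>_. borel))" .
  moreover have "f (\<lambda>j. if j \<in> {..<s} then x j else 0) = f x" for x
  proof -
    have "restrict (\<lambda>j. if j \<in> {..<s} then x j else 0) {..<s} = restrict x {..<s}" by auto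
    then show ?thesis using R by metis
  qed
  ultimately show ?thesis by simp
qed

text \<open>Projection to the cube, nonexpansive in every coordinate. It turns functions of cube
  points into the total functions that \<open>mixed_family\<close> asks for, keeping their Lipschitz
  constants.\<close>

definition clamp_cube :: "nat \<Rightarrow> (nat \<Rightarrow> real) \<Rightarrow> nat \<Rightarrow> real" where
  "clamp_cube s y j = (if j < s then max (-1/2) (min (1/2) (y j)) else 0)"

lemma clamp_cube_in: "clamp_cube s y \<in> cube s"
  by (auto simp: clamp_cube_def cube_def max_def min_def)

lemma clamp_cube_restrict: "clamp_cube s (restrict y {..<s}) = clamp_cube s y"
  by (auto simp: clamp_cube_def)

lemma clamp_cube_upd: "k < s \<Longrightarrow> clamp_cube s (y(k := t)) = (clamp_cube s y)(k := max (-1/2) (min (1/2) t))"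
  by (auto simp: clamp_cube_def)

lemma clamp_cube_Xi_s: "y \<in> Xi_s s \<Longrightarrow> clamp_cube s y = zero_ext s y"
  by (intro ext) (auto simp: clamp_cube_def zero_ext_def Xi_s_def PiE_def Pi_def max_def min_def)

context coercive_family
begin

lemma regular_vectorsD:
  assumes "regular_vectors T" and "U \<subseteq> {..<s}"
  shows "y \<in> cube s \<Longrightarrow> T U y \<in> V"
    and "\<exists>M\<ge>0. \<forall>y\<in>cube s. nrm (T U y) \<le> M"
    and "\<exists>M\<ge>0. \<forall>y k t. y \<in> cube s \<longrightarrow> k < s \<longrightarrow> y(k := t) \<in> cube s \<longrightarrow>
        nrm (T U (y(k := t)) - T U y) \<le> M * \<bar>t - y k\<bar>"
    and "\<exists>M\<ge>0. \<forall>y k t. y \<in> cube s \<longrightarrow> k < s \<longrightarrow> k \<notin> U \<longrightarrow> y(k := t) \<in> cube s \<longrightarrow>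
        nrm (T U (y(k := t)) - T U y - (t - y k) *\<^sub>R T (insert k U) y) \<le> M * (t - y k)\<^sup>2"
proof -
  note G = assms(1)[unfolded regular_vectors_def]
  show "y \<in> cube s \<Longrightarrow> T U y \<in> V" by (rule conjunct1[OF G, rule_format, OF assms(2)])
  show "\<exists>M\<ge>0. \<forall>y\<in>cube s. nrm (T U y) \<le> M"
    by (rule conjunct1[OF conjunct2[OF G], rule_format, OF assms(2)])
  show "\<exists>M\<ge>0. \<forall>y k t. y \<in> cube s \<longrightarrow> k < s \<longrightarrow> y(k := t) \<in> cube s \<longrightarrow>
        nrm (T U (y(k := t)) - T U y) \<le> M * \<bar>t - y k\<bar>"
    by (rule conjunct1[OF conjunct2[OF conjunct2[OF G]], rule_format, OF assms(2)])
  show "\<exists>M\<ge>0. \<forall>y k t. y \<in> cube s \<longrightarrow> k < s \<longrightarrow> k \<notin> U \<longrightarrow> y(k := t) \<in> cube s \<longrightarrow>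
        nrm (T U (y(k := t)) - T U y - (t - y k) *\<^sub>R T (insert k U) y) \<le> M * (t - y k)\<^sup>2"
    by (rule conjunct2[OF conjunct2[OF conjunct2[OF G]], rule_format, OF assms(2)])
qed

lemma regular_const:
  assumes f: "functional_on V f"
  shows "regular_functionals (\<lambda>U y v. if U = {} then f v else 0)"
proof -
  obtain M where M: "0 \<le> M" "\<And>v. v \<in> V \<Longrightarrow> \<bar>f v\<bar> \<le> M * nrm v" using functional_bounded[OF f] by blast
  have z: "functional_on V (\<lambda>v. 0)" by (simp add: functional_on_def)
  show ?thesis unfolding regular_functionals_def
  proof (intro conjI allI impI ballI)
    fix U y
    show "functional_on V (\<lambda>v. if U = {} then f v else 0)" using f z by (cases "U = {}") auto
  next
    fix U
    show "\<exists>M\<ge>0. \<forall>y\<in>cube s. \<forall>v\<in>V. \<bar>if U = {} then f v else 0\<bar> \<le> M * nrm v"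
      using M nrm_nonneg by (intro exI[of _ M]) auto
  qed (auto intro!: exI[of _ 0])
qed

text \<open>Lets the derivatives of the state act, through the \<open>L2\<close> inner product, as
  loads of the adjoint problem.\<close>

lemma regular_ip:
  assumes T: "regular_vectors T" and I: "sym_bilinear_on V I"
    and I_le: "\<And>w v. w \<in> V \<Longrightarrow> v \<in> V \<Longrightarrow> \<bar>I w v\<bar> \<le> c * nrm w * nrm v" and c: "0 \<le> c"
  shows "regular_functionals (\<lambda>U y v. I (T U y) v)"
  unfolding regular_functionals_def
proof (intro conjI allI impI ballI)
  fix U y assume "U \<subseteq> {..<s}" "y \<in> cube s"
  then show "functional_on V (\<lambda>v. I (T U y) v)"
    by (intro functional_on_right[OF I _ subspace_V] regular_vectorsD(1)[OF T])
next
  fix U assume U: "U \<subseteq> {..<s}"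
  obtain M where M: "0 \<le> M" "\<And>y. y \<in> cube s \<Longrightarrow> nrm (T U y) \<le> M" using regular_vectorsD(2)[OF T U] by blast
  show "\<exists>M\<ge>0. \<forall>y\<in>cube s. \<forall>v\<in>V. \<bar>I (T U y) v\<bar> \<le> M * nrm v"
  proof (intro exI[of _ "c * M"] conjI ballI)
    fix y v assume y: "y \<in> cube s" and v: "v \<in> V"
    have "\<bar>I (T U y) v\<bar> \<le> c * nrm (T U y) * nrm v" by (rule I_le[OF regular_vectorsD(1)[OF T U y] v])
    also have "\<dots> \<le> c * M * nrm v" using M(2)[OF y] c nrm_nonneg[OF v] by (intro mult_right_mono mult_left_mono) auto
    finally show "\<bar>I (T U y) v\<bar> \<le> c * M * nrm v" .
  qed (use c M in simp)
next
  fix U assume U: "U \<subseteq> {..<s}"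
  obtain M where M: "0 \<le> M" "\<And>y k t. y \<in> cube s \<Longrightarrow> k < s \<Longrightarrow> y(k := t) \<in> cube s \<Longrightarrow>
        nrm (T U (y(k := t)) - T U y) \<le> M * \<bar>t - y k\<bar>" using regular_vectorsD(3)[OF T U] by blast
  show "\<exists>M\<ge>0. \<forall>y k t. y \<in> cube s \<longrightarrow> k < s \<longrightarrow> y(k := t) \<in> cube s \<longrightarrow>
        (\<forall>v\<in>V. \<bar>I (T U (y(k := t))) v - I (T U y) v\<bar> \<le> M * \<bar>t - y k\<bar> * nrm v)"
  proof (intro exI[of _ "c * M"] conjI ballI allI impI)
    fix y k t v assume y: "y \<in> cube s" and k: "k < s" and y': "y(k := t) \<in> cube s" and v: "v \<in> V"
    note V = regular_vectorsD(1)[OF T U y] regular_vectorsD(1)[OF T U y']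
    have "\<bar>I (T U (y(k := t))) v - I (T U y) v\<bar> = \<bar>I (T U (y(k := t)) - T U y) v\<bar>"
      using functional_on_diff[OF functional_on_left[OF I v] subspace_V V(2,1)] by simp
    also have "\<dots> \<le> c * nrm (T U (y(k := t)) - T U y) * nrm v" using V v by (intro I_le) auto
    also have "\<dots> \<le> c * (M * \<bar>t - y k\<bar>) * nrm v"
      using M(2)[OF y k y'] c nrm_nonneg[OF v] by (intro mult_right_mono mult_left_mono) auto
    finally show "\<bar>I (T U (y(k := t))) v - I (T U y) v\<bar> \<le> c * M * \<bar>t - y k\<bar> * nrm v" by (simp only: mult.assoc)
  qed (use c M in simp)
next
  fix U assume U: "U \<subseteq> {..<s}"
  obtain M where M: "0 \<le> M" "\<And>y k t. y \<in> cube s \<Longrightarrow> k < s \<Longrightarrow> k \<notin> U \<Longrightarrow> y(k := t) \<in> cube s \<Longrightarrow>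
        nrm (T U (y(k := t)) - T U y - (t - y k) *\<^sub>R T (insert k U) y) \<le> M * (t - y k)\<^sup>2" using regular_vectorsD(4)[OF T U] by blast
  show "\<exists>M\<ge>0. \<forall>y k t. y \<in> cube s \<longrightarrow> k < s \<longrightarrow> k \<notin> U \<longrightarrow> y(k := t) \<in> cube s \<longrightarrow>
        (\<forall>v\<in>V. \<bar>I (T U (y(k := t))) v - I (T U y) v - (t - y k) * I (T (insert k U) y) v\<bar> \<le> M * (t - y k)\<^sup>2 * nrm v)"
  proof (intro exI[of _ "c * M"] conjI ballI allI impI)
    fix y k t v assume y: "y \<in> cube s" and k: "k < s" and kU: "k \<notin> U" and y': "y(k := t) \<in> cube s" and v: "v \<in> V"
    have kU': "insert k U \<subseteq> {..<s}" using U k by auto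
    note V = regular_vectorsD(1)[OF T U y] regular_vectorsD(1)[OF T U y'] regular_vectorsD(1)[OF T kU' y]
    let ?R = "T U (y(k := t)) - T U y - (t - y k) *\<^sub>R T (insert k U) y"
    have "\<bar>I (T U (y(k := t))) v - I (T U y) v - (t - y k) * I (T (insert k U) y) v\<bar> = \<bar>I ?R v\<bar>"
      using functional_on_diff[OF functional_on_left[OF I v] subspace_V V(2,1)] sym_bilinear_onD(3)[OF I V(3) v]
        functional_on_diff[OF functional_on_left[OF I v] subspace_V, of "T U (y(k := t)) - T U y" "(t - y k) *\<^sub>R T (insert k U) y"] V by simp
    also have "\<dots> \<le> c * nrm ?R * nrm v" using V v by (intro I_le) auto
    also have "\<dots> \<le> c * (M * (t - y k)\<^sup>2) * nrm v"
      using M(2)[OF y k kU y'] c nrm_nonneg[OF v] by (intro mult_right_mono mult_left_mono) auto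
    finally show "\<bar>I (T U (y(k := t))) v - I (T U y) v - (t - y k) * I (T (insert k U) y) v\<bar> \<le> c * M * (t - y k)\<^sup>2 * nrm v"
      by (simp only: mult.assoc)
  qed (use c M in simp)
qed

lemma regular_functionals_diff:
  assumes G: "regular_functionals G" and H: "regular_functionals H"
  shows "regular_functionals (\<lambda>U y v. G U y v - H U y v)"
  unfolding regular_functionals_def
proof (intro conjI allI impI ballI)
  fix U y assume "U \<subseteq> {..<s}" "y \<in> cube s"
  then show "functional_on V (\<lambda>v. G U y v - H U y v)"
    by (intro functional_on_minus regular_functionalsD(1)[OF G] regular_functionalsD(1)[OF H])
next
  fix U assume U: "U \<subseteq> {..<s}"
  obtain M where M: "0 \<le> M" "\<And>y v. y \<in> cube s \<Longrightarrow> v \<in> V \<Longrightarrow> \<bar>G U y v\<bar> \<le> M * nrm v" using regular_functionalsD(2)[OF G U] by blast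
  obtain N where N: "0 \<le> N" "\<And>y v. y \<in> cube s \<Longrightarrow> v \<in> V \<Longrightarrow> \<bar>H U y v\<bar> \<le> N * nrm v" using regular_functionalsD(2)[OF H U] by blast
  show "\<exists>M\<ge>0. \<forall>y\<in>cube s. \<forall>v\<in>V. \<bar>G U y v - H U y v\<bar> \<le> M * nrm v"
  proof (intro exI[of _ "M + N"] conjI ballI)
    fix y v assume yv: "y \<in> cube s" "v \<in> V"
    show "\<bar>G U y v - H U y v\<bar> \<le> (M + N) * nrm v"
      unfolding distrib_right using M(2)[OF yv] N(2)[OF yv] by linarith
  qed (use M N in simp)
next
  fix U assume U: "U \<subseteq> {..<s}"
  obtain M where M: "0 \<le> M" "\<And>y k t v. y \<in> cube s \<Longrightarrow> k < s \<Longrightarrow> y(k := t) \<in> cube s \<Longrightarrow> v \<in> V \<Longrightarrow>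
        \<bar>G U (y(k := t)) v - G U y v\<bar> \<le> M * \<bar>t - y k\<bar> * nrm v" using regular_functionalsD(3)[OF G U] by blast
  obtain N where N: "0 \<le> N" "\<And>y k t v. y \<in> cube s \<Longrightarrow> k < s \<Longrightarrow> y(k := t) \<in> cube s \<Longrightarrow> v \<in> V \<Longrightarrow>
        \<bar>H U (y(k := t)) v - H U y v\<bar> \<le> N * \<bar>t - y k\<bar> * nrm v" using regular_functionalsD(3)[OF H U] by blast
  show "\<exists>M\<ge>0. \<forall>y k t. y \<in> cube s \<longrightarrow> k < s \<longrightarrow> y(k := t) \<in> cube s \<longrightarrow>
        (\<forall>v\<in>V. \<bar>G U (y(k := t)) v - H U (y(k := t)) v - (G U y v - H U y v)\<bar> \<le> M * \<bar>t - y k\<bar> * nrm v)"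
  proof (intro exI[of _ "M + N"] conjI ballI allI impI)
    fix y k t v assume y: "y \<in> cube s" "k < s" "y(k := t) \<in> cube s" "v \<in> V"
    show "\<bar>G U (y(k := t)) v - H U (y(k := t)) v - (G U y v - H U y v)\<bar> \<le> (M + N) * \<bar>t - y k\<bar> * nrm v"
      unfolding distrib_right using M(2)[OF y] N(2)[OF y] by linarith
  qed (use M N in simp)
next
  fix U assume U: "U \<subseteq> {..<s}"
  obtain M where M: "0 \<le> M" "\<And>y k t v. y \<in> cube s \<Longrightarrow> k < s \<Longrightarrow> k \<notin> U \<Longrightarrow> y(k := t) \<in> cube s \<Longrightarrow> v \<in> V \<Longrightarrow>
        \<bar>G U (y(k := t)) v - G U y v - (t - y k) * G (insert k U) y v\<bar> \<le> M * (t - y k)\<^sup>2 * nrm v" using regular_functionalsD(4)[OF G U] by blast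
  obtain N where N: "0 \<le> N" "\<And>y k t v. y \<in> cube s \<Longrightarrow> k < s \<Longrightarrow> k \<notin> U \<Longrightarrow> y(k := t) \<in> cube s \<Longrightarrow> v \<in> V \<Longrightarrow>
        \<bar>H U (y(k := t)) v - H U y v - (t - y k) * H (insert k U) y v\<bar> \<le> N * (t - y k)\<^sup>2 * nrm v" using regular_functionalsD(4)[OF H U] by blast
  show "\<exists>M\<ge>0. \<forall>y k t. y \<in> cube s \<longrightarrow> k < s \<longrightarrow> k \<notin> U \<longrightarrow> y(k := t) \<in> cube s \<longrightarrow>
        (\<forall>v\<in>V. \<bar>G U (y(k := t)) v - H U (y(k := t)) v - (G U y v - H U y v) - (t - y k) * (G (insert k U) y v - H (insert k U) y v)\<bar>
           \<le> M * (t - y k)\<^sup>2 * nrm v)"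
  proof (intro exI[of _ "M + N"] conjI ballI allI impI)
    fix y k t v assume y: "y \<in> cube s" "k < s" "k \<notin> U" "y(k := t) \<in> cube s" "v \<in> V"
    show "\<bar>G U (y(k := t)) v - H U (y(k := t)) v - (G U y v - H U y v) - (t - y k) * (G (insert k U) y v - H (insert k U) y v)\<bar>
           \<le> (M + N) * (t - y k)\<^sup>2 * nrm v"
      unfolding distrib_right right_diff_distrib using M(2)[OF y] N(2)[OF y] by linarith
  qed (use M N in simp)
qed

text \<open>Serves for point evaluations, which give the quadrature error at a fixed point of
  \<open>\<Omega>\<close>, and for coordinates in a basis of \<open>V\<close>, which give
  integrability.\<close>

lemma mixed_family_of_vectors:
  assumes T: "regular_vectors T" and l: "functional_on V l"
  shows "\<exists>C. mixed_family s (\<lambda>U y. l (T U (clamp_cube s y))) C"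
proof -
  obtain K where K: "0 \<le> K" "\<And>v. v \<in> V \<Longrightarrow> \<bar>l v\<bar> \<le> K * nrm v" using functional_bounded[OF l] by blast
  note ldiff = functional_on_diff[OF l subspace_V] and lscale = functional_onD(2)[OF l]
  let ?c = "clamp_cube s" and ?I = "{-1/2..1/2::real}" and ?cl = "\<lambda>t::real. max (-1/2) (min (1/2) t)"
  have inV: "T U (?c y) \<in> V" if "U \<subseteq> {..<s}" for U y by (rule regular_vectorsD(1)[OF T that clamp_cube_in])
  have cl: "?cl t = t" if "t \<in> ?I" for t using that by auto
  have "\<forall>U\<in>Pow {..<s}. \<exists>M. 0 \<le> M \<and> (\<forall>y. \<bar>l (T U (?c y))\<bar> \<le> M)"
  proof
    fix U assume "U \<in> Pow {..<s}"
    then have U: "U \<subseteq> {..<s}" by simp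
    obtain M where M: "0 \<le> M" "\<And>y. y \<in> cube s \<Longrightarrow> nrm (T U y) \<le> M" using regular_vectorsD(2)[OF T U] by blast
    have "\<bar>l (T U (?c y))\<bar> \<le> K * M" for y
      using K(2)[OF inV[OF U, of y]] mult_left_mono[OF M(2)[OF clamp_cube_in[of s y]] K(1)] by linarith
    then show "\<exists>M. 0 \<le> M \<and> (\<forall>y. \<bar>l (T U (?c y))\<bar> \<le> M)" using K M by (intro exI[of _ "K * M"]) auto
  qed
  from bchoice[OF this] obtain m where m: "\<forall>U\<in>Pow {..<s}. 0 \<le> m U \<and> (\<forall>y. \<bar>l (T U (?c y))\<bar> \<le> m U)" by blast
  have lip: "\<exists>L\<ge>0. \<forall>y k t. k < s \<longrightarrow> \<bar>l (T U (?c (y(k := t)))) - l (T U (?c y))\<bar> \<le> L * \<bar>t - y k\<bar>" if U: "U \<subseteq> {..<s}" for U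
  proof -
    obtain M where M: "0 \<le> M" "\<And>y k t. y \<in> cube s \<Longrightarrow> k < s \<Longrightarrow> y(k := t) \<in> cube s \<Longrightarrow>
        nrm (T U (y(k := t)) - T U y) \<le> M * \<bar>t - y k\<bar>" using regular_vectorsD(3)[OF T U] by blast
    have "\<bar>l (T U (?c (y(k := t)))) - l (T U (?c y))\<bar> \<le> K * M * \<bar>t - y k\<bar>" if k: "k < s" for y k t
    proof -
      have 1: "nrm (T U (?c (y(k := t))) - T U (?c y)) \<le> M * \<bar>?cl t - ?c y k\<bar>"
        using M(2)[OF clamp_cube_in[of s y] k, of "?cl t"] clamp_cube_in[of s "y(k := t)"] unfolding clamp_cube_upd[OF k] by blast
      have "\<bar>l (T U (?c (y(k := t)))) - l (T U (?c y))\<bar> = \<bar>l (T U (?c (y(k := t))) - T U (?c y))\<bar>"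
        using ldiff[OF inV[OF U] inV[OF U]] by simp
      also have "\<dots> \<le> K * nrm (T U (?c (y(k := t))) - T U (?c y))" by (rule K(2)) (use inV[OF U] in simp)
      also have "\<dots> \<le> K * (M * \<bar>?cl t - ?c y k\<bar>)" using 1 K(1) by (rule mult_left_mono)
      also have "\<dots> \<le> K * (M * \<bar>t - y k\<bar>)"
      proof -
        have "\<bar>?cl t - ?c y k\<bar> \<le> \<bar>t - y k\<bar>" using k by (auto simp: clamp_cube_def max_def min_def)
        then show ?thesis using K(1) M(1) by (intro mult_left_mono)
      qed
      finally show ?thesis by (simp only: mult.assoc)
    qed
    then show ?thesis using K M by (intro exI[of _ "K * M"]) auto
  qed
  \<comment> \<open>Summing the bounds over the finitely many subsets gives one constant for all
    \<open>U\<close>.\<close>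
  have "mixed_family s (\<lambda>U y. l (T U (?c y))) (\<Sum>U\<in>Pow {..<s}. m U)"
  proof
    fix U k y t assume U: "U \<subseteq> {..<s}" and k: "k < s" and kU: "k \<notin> U" and t: "t \<in> ?I"
    obtain M where M: "0 \<le> M" "\<And>y k t. y \<in> cube s \<Longrightarrow> k < s \<Longrightarrow> k \<notin> U \<Longrightarrow> y(k := t) \<in> cube s \<Longrightarrow>
        nrm (T U (y(k := t)) - T U y - (t - y k) *\<^sub>R T (insert k U) y) \<le> M * (t - y k)\<^sup>2" using regular_vectorsD(4)[OF T U] by blast
    have kU': "insert k U \<subseteq> {..<s}" using U k by auto
    show "((\<lambda>t. l (T U (?c (y(k := t))))) has_real_derivative l (T (insert k U) (?c (y(k := t))))) (at t within ?I)"
    proof (rule has_real_derivative_of_quadratic_remainder)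
      fix x assume x: "x \<in> ?I"
      define w where "w = ?c (y(k := t))"
      have w: "w \<in> cube s" unfolding w_def by (rule clamp_cube_in)
      have wk: "w k = t" unfolding w_def clamp_cube_upd[OF k] using cl[OF t] by simp
      have wx: "?c (y(k := x)) = w(k := x)" unfolding w_def clamp_cube_upd[OF k] using cl[OF x] by simp
      have wx': "w(k := x) \<in> cube s" using clamp_cube_in[of s "y(k := x)"] unfolding wx .
      let ?R = "T U (w(k := x)) - T U w - (x - t) *\<^sub>R T (insert k U) w"
      note V = regular_vectorsD(1)[OF T U w] regular_vectorsD(1)[OF T U wx'] regular_vectorsD(1)[OF T kU' w]
      have "l (T U (w(k := x))) - l (T U w) - (x - t) * l (T (insert k U) w) = l ?R"
        using ldiff[OF V(2,1)] ldiff[of "T U (w(k := x)) - T U w" "(x - t) *\<^sub>R T (insert k U) w"] lscale[OF V(3)] V by simp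
      moreover have "\<bar>l ?R\<bar> \<le> K * nrm ?R" by (rule K(2)) (use V in simp)
      moreover have "K * nrm ?R \<le> K * (M * (x - t)\<^sup>2)" using M(2)[OF w k kU wx'] K(1) unfolding wk by (rule mult_left_mono)
      ultimately show "\<bar>l (T U (?c (y(k := x)))) - l (T U (?c (y(k := t)))) - (x - t) * l (T (insert k U) (?c (y(k := t))))\<bar> \<le> K * M * (x - t)\<^sup>2"
        unfolding wx w_def[symmetric] by (simp add: mult.assoc)
    qed
  next
    fix U k y assume U: "U \<subseteq> {..<s}" and k: "k < s"
    obtain L where L: "0 \<le> L" "\<And>y t. \<bar>l (T U (?c (y(k := t)))) - l (T U (?c y))\<bar> \<le> L * \<bar>t - y k\<bar>"
      using lip[OF U] k by blast
    have "L-lipschitz_on ?I (\<lambda>t. l (T U (?c (y(k := t)))))"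
    proof (rule lipschitz_onI)
      fix t t'
      have "(y(k := t'))(k := t) = y(k := t)" by simp
      then show "dist (l (T U (?c (y(k := t))))) (l (T U (?c (y(k := t'))))) \<le> L * dist t t'"
        using L(2)[of "y(k := t')" t] by (simp add: dist_real_def)
    qed (rule L(1))
    then show "continuous_on ?I (\<lambda>t. l (T U (?c (y(k := t)))))" by (rule lipschitz_on_continuous_on)
  next
    fix U y assume U: "U \<subseteq> {..<s}"
    have "\<bar>l (T U (?c y))\<bar> \<le> m U" using m U by blast
    also have "m U \<le> (\<Sum>U\<in>Pow {..<s}. m U)" using m U by (intro member_le_sum) auto
    finally show "\<bar>l (T U (?c y))\<bar> \<le> (\<Sum>U\<in>Pow {..<s}. m U)" .
  next
    fix U assume U: "U \<subseteq> {..<s}"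
    obtain L where L: "\<And>y k t. k < s \<Longrightarrow> \<bar>l (T U (?c (y(k := t)))) - l (T U (?c y))\<bar> \<le> L * \<bar>t - y k\<bar>"
      using lip[OF U] by blast
    show "(\<lambda>y. l (T U (?c y))) \<in> borel_measurable (PiM {..<s} (\<lambda>_. borel))"
      by (rule measurable_PiM_of_coordinate_lipschitz[where C = L]) (auto simp: L clamp_cube_restrict simp del: fun_upd_apply)
  next
    fix U y show "l (T U (?c (restrict y {..<s}))) = l (T U (?c y))" by (simp add: clamp_cube_restrict)
  qed
  then show ?thesis by blast
qed

end

section \<open>Weak gradients and bilinear forms\<close>

text \<open>Makes \<open>span\<close> and \<open>subspace\<close> available for sets of functions
  such as \<open>V\<close>.\<close>

instantiation "fun" :: (type, real_vector) real_vector
begin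

definition scaleR_fun :: "real \<Rightarrow> ('a \<Rightarrow> 'b) \<Rightarrow> 'a \<Rightarrow> 'b" where
  "scaleR_fun c f = (\<lambda>x. c *\<^sub>R f x)"

instance
  by standard (auto simp: scaleR_fun_def plus_fun_def scaleR_add_right scaleR_add_left)

end

lemma scaleR_fun_apply [simp]: "(c *\<^sub>R f) x = c *\<^sub>R f x"
  by (simp add: scaleR_fun_def)

lemma sum_fun_apply: "(\<Sum>i\<in>I. f i) x = (\<Sum>i\<in>I. f i x)" for f :: "'i \<Rightarrow> 'a \<Rightarrow> 'b::comm_monoid_add"
  by (induction I rule: infinite_finite_induct) auto

section \<open>Square-integrable functions and test functions\<close>

lemma L2_measurable: "f \<in> L2 \<Omega> \<Longrightarrow> f \<in> borel_measurable (lebesgue_on \<Omega>)"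
  and L2_integrable_square: "f \<in> L2 \<Omega> \<Longrightarrow> integrable (lebesgue_on \<Omega>) (\<lambda>x. (norm (f x))\<^sup>2)"
  by (auto simp: L2_def)

lemma L2_norm_nonneg: "0 \<le> L2_norm \<Omega> f"
  by (simp add: L2_norm_def)

lemma L2_norm_square: "(L2_norm \<Omega> f)\<^sup>2 = (LINT x|lebesgue_on \<Omega>. (norm (f x))\<^sup>2)"
  by (simp add: L2_norm_def)

lemma integrable_of_product_bound:
  fixes q :: "'a::euclidean_space \<Rightarrow> real" and f g :: "'a \<Rightarrow> 'b::euclidean_space"
  assumes "f \<in> L2 \<Omega>" "g \<in> L2 \<Omega>" and q: "q \<in> borel_measurable (lebesgue_on \<Omega>)"
    and le: "AE x in lebesgue_on \<Omega>. \<bar>q x\<bar> \<le> C * (norm (f x) * norm (g x))"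
  shows "integrable (lebesgue_on \<Omega>) q"
proof (rule Bochner_Integration.integrable_bound[OF _ q])
  show "integrable (lebesgue_on \<Omega>) (\<lambda>x. \<bar>C\<bar> * ((norm (f x))\<^sup>2 + (norm (g x))\<^sup>2))"
    using L2_integrable_square[OF assms(1)] L2_integrable_square[OF assms(2)] by simp
  show "AE x in lebesgue_on \<Omega>. norm (q x) \<le> norm (\<bar>C\<bar> * ((norm (f x))\<^sup>2 + (norm (g x))\<^sup>2))"
    using le
  proof eventually_elim
    case (elim x)
    have "0 \<le> (norm (f x) - norm (g x))\<^sup>2" "0 \<le> (norm (f x))\<^sup>2" "0 \<le> (norm (g x))\<^sup>2" by auto
    then have "norm (f x) * norm (g x) \<le> (norm (f x))\<^sup>2 + (norm (g x))\<^sup>2"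
      unfolding power2_diff by linarith
    then have "C * (norm (f x) * norm (g x)) \<le> \<bar>C\<bar> * ((norm (f x))\<^sup>2 + (norm (g x))\<^sup>2)"
      by (meson abs_ge_self abs_ge_zero mult_left_mono mult_right_mono order_trans mult_nonneg_nonneg norm_ge_zero)
    then show ?case using elim by simp
  qed
qed

lemma integrable_norm_mult:
  fixes f g :: "'a::euclidean_space \<Rightarrow> 'b::euclidean_space"
  assumes f: "f \<in> L2 \<Omega>" and g: "g \<in> L2 \<Omega>"
  shows "integrable (lebesgue_on \<Omega>) (\<lambda>x. norm (f x) * norm (g x))"
  by (rule integrable_of_product_bound[OF f g, where C = 1])
     (use L2_measurable[OF f] L2_measurable[OF g] in \<open>auto intro!: borel_measurable_times borel_measurable_norm\<close>)

lemma integral_product_bound: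
  fixes q :: "'a::euclidean_space \<Rightarrow> real" and f g :: "'a \<Rightarrow> 'b::euclidean_space"
  assumes f: "f \<in> L2 \<Omega>" and g: "g \<in> L2 \<Omega>" and q: "q \<in> borel_measurable (lebesgue_on \<Omega>)"
    and le: "AE x in lebesgue_on \<Omega>. \<bar>q x\<bar> \<le> C * (norm (f x) * norm (g x))" and C: "0 \<le> C"
  shows "\<bar>LINT x|lebesgue_on \<Omega>. q x\<bar> \<le> C * L2_norm \<Omega> f * L2_norm \<Omega> g"
proof -
  let ?M = "lebesgue_on \<Omega>"
  have iq: "integrable ?M q" by (rule integrable_of_product_bound[OF f g q le])
  have "\<bar>LINT x|?M. q x\<bar> \<le> (LINT x|?M. \<bar>q x\<bar>)" using integral_norm_bound[of ?M q] by simp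
  also have "\<dots> \<le> (LINT x|?M. C * (norm (f x) * norm (g x)))"
    using iq integrable_norm_mult[OF f g] le by (intro integral_mono_AE) auto
  also have "\<dots> = C * (LINT x|?M. norm (f x) * norm (g x))" by simp
  also have "\<dots> \<le> C * (L2_norm \<Omega> f * L2_norm \<Omega> g)"
  proof (rule mult_left_mono[OF _ C])
    have "(LINT x|?M. norm (f x) * norm (g x))\<^sup>2 \<le> (LINT x|?M. (norm (f x))\<^sup>2) * (LINT x|?M. (norm (g x))\<^sup>2)"
      by (intro integral_Cauchy_Schwarz L2_integrable_square f g integrable_norm_mult)
    also have "\<dots> = (L2_norm \<Omega> f * L2_norm \<Omega> g)\<^sup>2" by (simp add: power_mult_distrib L2_norm_square)
    finally show "(LINT x|?M. norm (f x) * norm (g x)) \<le> L2_norm \<Omega> f * L2_norm \<Omega> g"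
      by (rule power2_le_imp_le) (simp add: L2_norm_nonneg)
  qed
  finally show ?thesis by (simp add: mult.assoc)
qed

lemma L2_comb:
  fixes f g :: "'a::euclidean_space \<Rightarrow> 'b::euclidean_space"
  assumes f: "f \<in> L2 \<Omega>" and g: "g \<in> L2 \<Omega>"
  shows "(\<lambda>x. f x + c *\<^sub>R g x) \<in> L2 \<Omega>"
proof -
  have m: "(\<lambda>x. f x + c *\<^sub>R g x) \<in> borel_measurable (lebesgue_on \<Omega>)"
    using L2_measurable[OF f] L2_measurable[OF g] by simp
  have "integrable (lebesgue_on \<Omega>) (\<lambda>x. (norm (f x + c *\<^sub>R g x))\<^sup>2)"
  proof (rule Bochner_Integration.integrable_bound)
    show "integrable (lebesgue_on \<Omega>) (\<lambda>x. 2 * (norm (f x))\<^sup>2 + 2 * c\<^sup>2 * (norm (g x))\<^sup>2)"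
      using L2_integrable_square[OF f] L2_integrable_square[OF g] by simp
    have "norm ((norm (f x + c *\<^sub>R g x))\<^sup>2) \<le> norm (2 * (norm (f x))\<^sup>2 + 2 * c\<^sup>2 * (norm (g x))\<^sup>2)" for x
    proof -
      let ?p = "norm (f x)" and ?q = "\<bar>c\<bar> * norm (g x)"
      have "norm (f x + c *\<^sub>R g x) \<le> ?p + ?q" by (metis norm_scaleR norm_triangle_ineq)
      then have "(norm (f x + c *\<^sub>R g x))\<^sup>2 \<le> (?p + ?q)\<^sup>2" by (intro power_mono) auto
      also have "\<dots> \<le> 2 * ?p\<^sup>2 + 2 * ?q\<^sup>2"
        using zero_le_power2[of "?p - ?q"] unfolding power2_diff power2_sum by linarith
      finally show ?thesis by (simp add: power_mult_distrib)
    qed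
    then show "AE x in lebesgue_on \<Omega>. norm ((norm (f x + c *\<^sub>R g x))\<^sup>2) \<le> norm (2 * (norm (f x))\<^sup>2 + 2 * c\<^sup>2 * (norm (g x))\<^sup>2)"
      by (rule AE_I2)
  qed (use m in measurable)
  then show ?thesis using m by (simp add: L2_def)
qed

lemma L2_component:
  fixes G :: "'a::euclidean_space \<Rightarrow> 'b::euclidean_space"
  assumes G: "G \<in> L2 \<Omega>" and i: "i \<in> Basis"
  shows "(\<lambda>x. G x \<bullet> i) \<in> L2 \<Omega>"
proof -
  have m: "(\<lambda>x. G x \<bullet> i) \<in> borel_measurable (lebesgue_on \<Omega>)" using L2_measurable[OF G] by simp
  have "integrable (lebesgue_on \<Omega>) (\<lambda>x. (G x \<bullet> i)\<^sup>2)"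
  proof (rule Bochner_Integration.integrable_bound[OF L2_integrable_square[OF G]])
    have "norm ((G x \<bullet> i)\<^sup>2) \<le> norm ((norm (G x))\<^sup>2)" for x
      using Basis_le_norm[OF i, of "G x"] power_mono[of "\<bar>G x \<bullet> i\<bar>" "norm (G x)" 2] by simp
    then show "AE x in lebesgue_on \<Omega>. norm ((G x \<bullet> i)\<^sup>2) \<le> norm ((norm (G x))\<^sup>2)" by (rule AE_I2)
  qed (use m in measurable)
  then show ?thesis using m by (simp add: L2_def)
qed

lemma integrable_L2_mult:
  fixes f g :: "'a::euclidean_space \<Rightarrow> real"
  assumes f: "f \<in> L2 \<Omega>" and g: "g \<in> L2 \<Omega>"
  shows "integrable (lebesgue_on \<Omega>) (\<lambda>x. f x * g x)"
  by (rule integrable_of_product_bound[OF f g, where C = 1])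
     (use L2_measurable[OF f] L2_measurable[OF g] in \<open>auto simp: abs_mult\<close>)

text \<open>Off the closed support \<open>\<phi>\<close> vanishes in a neighbourhood, hence so does
  its derivative; the support of a partial derivative therefore stays compact inside
  \<open>\<Omega>\<close>.\<close>

lemma test_function_partial:
  assumes \<phi>: "test_function \<Omega> \<phi>" and i: "i \<in> Basis"
  shows "test_function \<Omega> (\<lambda>x. gradient \<phi> x \<bullet> i)"
proof -
  have g: "gradient \<phi> x \<bullet> i = frechet_derivative \<phi> (at x) i" for x
    using i by (simp add: gradient_def inner_sum_left_Basis)
  have C: "C_k k (\<lambda>x. gradient \<phi> x \<bullet> i)" for k
  proof -
    have "C_k (Suc k) \<phi>" using \<phi> unfolding test_function_def by blast
    then show ?thesis using i by (simp add: g)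
  qed
  let ?S = "{x. \<phi> x \<noteq> 0}"
  have sub: "{x. gradient \<phi> x \<bullet> i \<noteq> 0} \<subseteq> closure ?S"
  proof
    fix x assume x: "x \<in> {x. gradient \<phi> x \<bullet> i \<noteq> 0}"
    show "x \<in> closure ?S"
    proof (rule ccontr)
      assume nx: "x \<notin> closure ?S"
      have z: "0 = \<phi> y" if "y \<in> - closure ?S" for y using that closure_subset[of ?S] by auto
      have "((\<lambda>_. 0) has_derivative (\<lambda>_. 0)) (at x)" by simp
      then have "(\<phi> has_derivative (\<lambda>_. 0)) (at x)"
        by (rule has_derivative_transform_within_open[OF _ open_Compl[OF closed_closure] _ z]) (use nx in blast)
      then have "frechet_derivative \<phi> (at x) = (\<lambda>_. 0)" by (rule frechet_derivative_at[symmetric])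
      then show False using x by (simp add: g)
    qed
  qed
  let ?T = "{x. gradient \<phi> x \<bullet> i \<noteq> 0}"
  have T: "closure ?T \<subseteq> closure ?S" using sub by (rule closure_minimal) simp
  have S: "compact (closure ?S)" "closure ?S \<subseteq> \<Omega>" using \<phi> unfolding test_function_def by auto
  have "compact (closure ?S \<inter> closure ?T)" by (rule compact_Int_closed[OF S(1) closed_closure])
  then have "compact (closure ?T)" unfolding Int_absorb1[OF T] .
  then show ?thesis unfolding test_function_def using C order_trans[OF T S(2)] by blast
qed

lemma test_function_L2:
  assumes \<phi>: "test_function \<Omega> \<phi>" and \<Omega>: "\<Omega> \<in> lmeasurable"
  shows "\<phi> \<in> L2 \<Omega>"
proof -
  have c: "continuous_on UNIV \<phi>" using \<phi> unfolding test_function_def by (metis C_k.simps(1))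
  have "compact (\<phi> ` closure {x. \<phi> x \<noteq> 0})"
    using \<phi> c unfolding test_function_def by (intro compact_continuous_image) (auto intro: continuous_on_subset)
  then obtain K where K: "\<And>x. x \<in> closure {x. \<phi> x \<noteq> 0} \<Longrightarrow> \<bar>\<phi> x\<bar> \<le> K" "0 < K"
    using compact_imp_bounded[of "\<phi> ` closure {x. \<phi> x \<noteq> 0}"] by (auto simp: bounded_pos)
  have K': "\<bar>\<phi> x\<bar> \<le> K" for x
    using K closure_subset[of "{x. \<phi> x \<noteq> 0}"] by (cases "\<phi> x = 0") auto
  have m: "\<phi> \<in> borel_measurable (lebesgue_on \<Omega>)"
    using \<Omega> by (intro continuous_imp_measurable_on_sets_lebesgue continuous_on_subset[OF c]) auto
  have fin: "finite_measure (lebesgue_on \<Omega>)"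
    using \<Omega> by (intro finite_measureI) (auto simp: emeasure_restrict_space fmeasurable_def)
  have "integrable (lebesgue_on \<Omega>) (\<lambda>x. (norm (\<phi> x))\<^sup>2)"
  proof (rule finite_measure.integrable_const_bound[OF fin, where B = "K\<^sup>2"])
    have "norm ((norm (\<phi> x))\<^sup>2) \<le> K\<^sup>2" for x using power_mono[OF K'[of x], of 2] by simp
    then show "AE x in lebesgue_on \<Omega>. norm ((norm (\<phi> x))\<^sup>2) \<le> K\<^sup>2" by (rule AE_I2)
  qed (use m in measurable)
  then show ?thesis using m by (simp add: L2_def)
qed

lemma weak_gradient:
  assumes "u \<in> H01 \<Omega>"
  shows "weak_gradient \<Omega> u \<in> L2 \<Omega>" "has_weak_gradient \<Omega> u (weak_gradient \<Omega> u)" "u \<in> L2 \<Omega>"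
proof -
  have u: "u \<in> H1 \<Omega>" using assms by (simp add: H01_def)
  then have "\<exists>G. G \<in> L2 \<Omega> \<and> has_weak_gradient \<Omega> u G" by (auto simp: H1_def)
  from someI_ex[OF this] show "weak_gradient \<Omega> u \<in> L2 \<Omega>" "has_weak_gradient \<Omega> u (weak_gradient \<Omega> u)"
    unfolding weak_gradient_def by auto
  show "u \<in> L2 \<Omega>" using u by (simp add: H1_def)
qed

text \<open>Weak gradients are unique without an appeal to the density of test functions: a difference
  \<open>D\<close> of weak gradients of functions in \<open>H01 \<Omega>\<close> is an \<open>L\<^sup>2\<close>-limit of gradients of test functions,
  whose components are again test functions, and it is orthogonal to all of those.\<close>

lemma weak_gradient_linear:
  assumes \<Omega>: "\<Omega> \<in> lmeasurable" and u: "u \<in> H01 \<Omega>" and v: "v \<in> H01 \<Omega>" and w: "w \<in> H01 \<Omega>"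
    and eq: "\<And>x. w x = u x + c * v x"
  shows "AE x in lebesgue_on \<Omega>. weak_gradient \<Omega> w x = weak_gradient \<Omega> u x + c *\<^sub>R weak_gradient \<Omega> v x"
proof -
  let ?M = "lebesgue_on \<Omega>" and ?g = "weak_gradient \<Omega>"
  note gu = weak_gradient[OF u] and gv = weak_gradient[OF v] and gw = weak_gradient[OF w]
  define D where "D x = ?g w x - ?g u x - c *\<^sub>R ?g v x" for x
  have comp: "AE x in ?M. D x \<bullet> i = 0" if i: "i \<in> Basis" for i
  proof -
    note cu = L2_component[OF gu(1) i] and cv = L2_component[OF gv(1) i] and cw = L2_component[OF gw(1) i]
    have Di: "(\<lambda>x. D x \<bullet> i) \<in> L2 \<Omega>"
      using L2_comb[OF L2_comb[OF cw cu, of "-1"] cv, of "-c"] by (simp add: D_def inner_diff_left)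
    \<comment> \<open>\<open>D\<close> is a weak gradient of \<open>w - u - c * v\<close>, which
      vanishes identically.\<close>
    have orth: "(LINT x|?M. (D x \<bullet> i) * \<phi> x) = 0" if \<phi>: "test_function \<Omega> \<phi>" for \<phi>
    proof -
      let ?d = "\<lambda>x. gradient \<phi> x \<bullet> i"
      have p: "\<phi> \<in> L2 \<Omega>" by (rule test_function_L2[OF \<phi> \<Omega>])
      have d: "?d \<in> L2 \<Omega>" by (rule test_function_L2[OF test_function_partial[OF \<phi> i] \<Omega>])
      have "(LINT x|?M. (D x \<bullet> i) * \<phi> x) = (LINT x|?M. (?g w x \<bullet> i) * \<phi> x - (?g u x \<bullet> i) * \<phi> x - c * ((?g v x \<bullet> i) * \<phi> x))"
        by (simp add: D_def inner_diff_left left_diff_distrib mult.assoc)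
      also have "\<dots> = (LINT x|?M. (?g w x \<bullet> i) * \<phi> x) - (LINT x|?M. (?g u x \<bullet> i) * \<phi> x) - c * (LINT x|?M. (?g v x \<bullet> i) * \<phi> x)"
        using integrable_L2_mult[OF cu p] integrable_L2_mult[OF cv p] integrable_L2_mult[OF cw p] by simp
      also have "\<dots> = - (LINT x|?M. w x * ?d x) + (LINT x|?M. u x * ?d x) + c * (LINT x|?M. v x * ?d x)"
        using gu(2) gv(2) gw(2) \<phi> i unfolding has_weak_gradient_def by simp
      also have "(LINT x|?M. w x * ?d x) = (LINT x|?M. u x * ?d x + c * (v x * ?d x))"
        by (simp add: eq distrib_right mult.assoc)
      also have "\<dots> = (LINT x|?M. u x * ?d x) + c * (LINT x|?M. v x * ?d x)"
        using integrable_L2_mult[OF gu(3) d] integrable_L2_mult[OF gv(3) d] by simp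
      finally show ?thesis by simp
    qed
    obtain \<alpha> where \<alpha>: "\<And>k. test_function \<Omega> (\<alpha> k)" "(\<lambda>k. L2_norm \<Omega> (\<lambda>x. gradient (\<alpha> k) x - ?g w x)) \<longlonglongrightarrow> 0"
      using w unfolding H01_def by blast
    obtain \<beta> where \<beta>: "\<And>k. test_function \<Omega> (\<beta> k)" "(\<lambda>k. L2_norm \<Omega> (\<lambda>x. gradient (\<beta> k) x - ?g u x)) \<longlonglongrightarrow> 0"
      using u unfolding H01_def by blast
    obtain \<eta> where \<eta>: "\<And>k. test_function \<Omega> (\<eta> k)" "(\<lambda>k. L2_norm \<Omega> (\<lambda>x. gradient (\<eta> k) x - ?g v x)) \<longlonglongrightarrow> 0"
      using v unfolding H01_def by blast
    let ?I = "LINT x|?M. (D x \<bullet> i)\<^sup>2"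
    have grad_L2: "(\<lambda>x. gradient \<phi> x \<bullet> i) \<in> L2 \<Omega>" if "test_function \<Omega> \<phi>" for \<phi>
      by (rule test_function_L2[OF test_function_partial[OF that i] \<Omega>])
    have bound: "\<bar>?I\<bar> \<le> L2_norm \<Omega> (\<lambda>x. D x \<bullet> i) * (L2_norm \<Omega> (\<lambda>x. gradient (\<alpha> k) x - ?g w x)
        + L2_norm \<Omega> (\<lambda>x. gradient (\<beta> k) x - ?g u x) + \<bar>c\<bar> * L2_norm \<Omega> (\<lambda>x. gradient (\<eta> k) x - ?g v x))" for k
    proof -
      have cross: "\<bar>LINT x|?M. (D x \<bullet> i) * ((gradient \<phi> x - G x) \<bullet> i)\<bar> \<le> L2_norm \<Omega> (\<lambda>x. D x \<bullet> i) * L2_norm \<Omega> (\<lambda>x. gradient \<phi> x - G x)"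
        and cross_eq: "(LINT x|?M. (D x \<bullet> i) * ((gradient \<phi> x - G x) \<bullet> i)) = - (LINT x|?M. (D x \<bullet> i) * (G x \<bullet> i))"
        if \<phi>: "test_function \<Omega> \<phi>" and G: "G \<in> L2 \<Omega>" for \<phi> G
      proof -
        have gr: "gradient \<phi> \<in> L2 \<Omega>"
        proof -
          have m: "gradient \<phi> \<in> borel_measurable (lebesgue_on \<Omega>)"
          proof (subst borel_measurable_euclidean_space, intro ballI)
            fix j :: 'a assume "j \<in> Basis"
            then show "(\<lambda>x. gradient \<phi> x \<bullet> j) \<in> borel_measurable (lebesgue_on \<Omega>)"
              by (intro L2_measurable test_function_L2[OF test_function_partial[OF \<phi>] \<Omega>])
          qed
          have "integrable ?M (\<lambda>x. \<Sum>j\<in>Basis. (gradient \<phi> x \<bullet> j)\<^sup>2)"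
            using L2_integrable_square[OF test_function_L2[OF test_function_partial[OF \<phi>] \<Omega>]]
            by (intro Bochner_Integration.integrable_sum) simp
          moreover have "(norm v)\<^sup>2 = (\<Sum>j\<in>Basis. (v \<bullet> j)\<^sup>2)" for v :: 'a
            unfolding power2_norm_eq_inner euclidean_inner[of v v] by (simp add: power2_eq_square)
          ultimately show ?thesis using m by (simp add: L2_def)
        qed
        have diff: "(\<lambda>x. gradient \<phi> x - G x) \<in> L2 \<Omega>" using L2_comb[OF gr G, of "-1"] by simp
        have "\<bar>LINT x|?M. (D x \<bullet> i) * ((gradient \<phi> x - G x) \<bullet> i)\<bar> \<le> 1 * L2_norm \<Omega> (\<lambda>x. D x \<bullet> i) * L2_norm \<Omega> (\<lambda>x. (gradient \<phi> x - G x) \<bullet> i)"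
          by (rule integral_product_bound[OF Di L2_component[OF diff i]])
             (use L2_measurable[OF Di] L2_measurable[OF L2_component[OF diff i]] in \<open>auto simp: abs_mult\<close>)
        also have "\<dots> \<le> 1 * L2_norm \<Omega> (\<lambda>x. D x \<bullet> i) * L2_norm \<Omega> (\<lambda>x. gradient \<phi> x - G x)"
        proof (rule mult_left_mono)
          have "((gradient \<phi> x - G x) \<bullet> i)\<^sup>2 \<le> (norm (gradient \<phi> x - G x))\<^sup>2" for x
            using Basis_le_norm[OF i, of "gradient \<phi> x - G x"] power_mono[of "\<bar>(gradient \<phi> x - G x) \<bullet> i\<bar>" "norm (gradient \<phi> x - G x)" 2] by simp
          then show "L2_norm \<Omega> (\<lambda>x. (gradient \<phi> x - G x) \<bullet> i) \<le> L2_norm \<Omega> (\<lambda>x. gradient \<phi> x - G x)"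
            unfolding L2_norm_def using L2_integrable_square[OF diff] L2_integrable_square[OF L2_component[OF diff i]]
            by (intro real_sqrt_le_mono integral_mono) auto
        qed (simp add: L2_norm_nonneg)
        finally show "\<bar>LINT x|?M. (D x \<bullet> i) * ((gradient \<phi> x - G x) \<bullet> i)\<bar> \<le> L2_norm \<Omega> (\<lambda>x. D x \<bullet> i) * L2_norm \<Omega> (\<lambda>x. gradient \<phi> x - G x)" by simp
        have "(LINT x|?M. (D x \<bullet> i) * ((gradient \<phi> x - G x) \<bullet> i)) = (LINT x|?M. (D x \<bullet> i) * (gradient \<phi> x \<bullet> i) - (D x \<bullet> i) * (G x \<bullet> i))"
          by (simp add: inner_diff_left right_diff_distrib)
        also have "\<dots> = (LINT x|?M. (D x \<bullet> i) * (gradient \<phi> x \<bullet> i)) - (LINT x|?M. (D x \<bullet> i) * (G x \<bullet> i))"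
          by (intro Bochner_Integration.integral_diff integrable_L2_mult[OF Di] grad_L2 \<phi> L2_component[OF G i])
        finally show "(LINT x|?M. (D x \<bullet> i) * ((gradient \<phi> x - G x) \<bullet> i)) = - (LINT x|?M. (D x \<bullet> i) * (G x \<bullet> i))"
          using orth[OF test_function_partial[OF \<phi> i]] by simp
      qed
      have "?I = (LINT x|?M. (D x \<bullet> i) * (?g w x \<bullet> i) - (D x \<bullet> i) * (?g u x \<bullet> i) - c * ((D x \<bullet> i) * (?g v x \<bullet> i)))"
        by (rule Bochner_Integration.integral_cong) (simp_all add: D_def inner_diff_left power2_eq_square algebra_simps)
      also have "\<dots> = (LINT x|?M. (D x \<bullet> i) * (?g w x \<bullet> i)) - (LINT x|?M. (D x \<bullet> i) * (?g u x \<bullet> i)) - c * (LINT x|?M. (D x \<bullet> i) * (?g v x \<bullet> i))"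
        using integrable_L2_mult[OF Di cu] integrable_L2_mult[OF Di cv] integrable_L2_mult[OF Di cw] by simp
      \<comment> \<open>By orthogonality, pairing \<open>D\<close> with a weak gradient equals, up
        to sign, pairing it with the error of an approximation by gradients of test functions, and
        these errors tend to zero.\<close>
      also have "\<dots> = - (LINT x|?M. (D x \<bullet> i) * ((gradient (\<alpha> k) x - ?g w x) \<bullet> i)) + (LINT x|?M. (D x \<bullet> i) * ((gradient (\<beta> k) x - ?g u x) \<bullet> i))
          + c * (LINT x|?M. (D x \<bullet> i) * ((gradient (\<eta> k) x - ?g v x) \<bullet> i))"
        unfolding cross_eq[OF \<alpha>(1) gw(1)] cross_eq[OF \<beta>(1) gu(1)] cross_eq[OF \<eta>(1) gv(1)] by simp
      finally have I: "?I = \<dots>" .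
      have tri: "\<bar>- p + q + c * r\<bar> \<le> N * (a' + b' + \<bar>c\<bar> * e')" if "\<bar>p\<bar> \<le> N * a'" "\<bar>q\<bar> \<le> N * b'" "\<bar>r\<bar> \<le> N * e'" for p q r N a' b' e' :: real
      proof -
        have "\<bar>c * r\<bar> \<le> \<bar>c\<bar> * (N * e')" unfolding abs_mult using that(3) by (rule mult_left_mono) simp
        then have "\<bar>- p + q + c * r\<bar> \<le> N * a' + N * b' + \<bar>c\<bar> * (N * e')" using that(1,2) by linarith
        then show ?thesis by (simp add: algebra_simps)
      qed
      show ?thesis unfolding I
        by (rule tri[OF cross(1)[OF \<alpha>(1) gw(1)] cross(1)[OF \<beta>(1) gu(1)] cross(1)[OF \<eta>(1) gv(1)]])
    qed
    have "(\<lambda>k. L2_norm \<Omega> (\<lambda>x. D x \<bullet> i) * (L2_norm \<Omega> (\<lambda>x. gradient (\<alpha> k) x - ?g w x)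
        + L2_norm \<Omega> (\<lambda>x. gradient (\<beta> k) x - ?g u x) + \<bar>c\<bar> * L2_norm \<Omega> (\<lambda>x. gradient (\<eta> k) x - ?g v x)))
        \<longlonglongrightarrow> L2_norm \<Omega> (\<lambda>x. D x \<bullet> i) * (0 + 0 + \<bar>c\<bar> * 0)"
      by (intro tendsto_intros \<alpha> \<beta> \<eta>)
    then have "\<bar>?I\<bar> \<le> L2_norm \<Omega> (\<lambda>x. D x \<bullet> i) * (0 + 0 + \<bar>c\<bar> * 0)"
      by (rule LIMSEQ_le_const) (use bound in blast)
    then have "?I \<le> 0" by simp
    moreover have "0 \<le> ?I" by simp
    ultimately have "?I = 0" by (rule antisym)
    moreover have "integrable ?M (\<lambda>x. (D x \<bullet> i)\<^sup>2)" using L2_integrable_square[OF Di] by simp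
    ultimately have "AE x in ?M. (D x \<bullet> i)\<^sup>2 = 0" by (subst (asm) integral_nonneg_eq_0_iff_AE) auto
    then show ?thesis by simp
  qed
  have "AE x in ?M. \<forall>i\<in>Basis. D x \<bullet> i = 0" using comp by (intro AE_finite_allI) auto
  then show ?thesis
  proof eventually_elim
    case (elim x)
    have "?g w x = ?g u x + c *\<^sub>R ?g v x + D x" by (simp add: D_def)
    also have "D x = 0" using elim by (rule euclidean_all_zero_iff[THEN iffD1])
    finally show ?case by simp
  qed
qed

section \<open>Essential bounds and bilinear forms on the Galerkin space\<close>

lemma Linf_AE: "f \<in> Linf \<Omega> \<Longrightarrow> AE x in lebesgue_on \<Omega>. \<bar>f x\<bar> \<le> Linf_norm \<Omega> f"
proof -
  assume f: "f \<in> Linf \<Omega>"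
  let ?e = "esssup (lebesgue_on \<Omega>) (\<lambda>x. ereal \<bar>f x\<bar>)"
  have fin: "?e \<noteq> \<infinity>" using f by (simp add: Linf_def)
  have "AE x in lebesgue_on \<Omega>. ereal \<bar>f x\<bar> \<le> ?e" by (rule esssup_AE)
  then show ?thesis
  proof eventually_elim
    case (elim x)
    then have "?e \<noteq> - \<infinity>" by auto
    then have "?e = ereal (Linf_norm \<Omega> f)" using fin unfolding Linf_norm_def by (cases ?e) auto
    then show ?case using elim by simp
  qed
qed

text \<open>A negative value would force the measure to be zero; but then the essential supremum is
  \<open>- \<infinity>\<close>, which \<open>real_of_ereal\<close> sends to
  \<open>0\<close>.\<close>

lemma Linf_norm_nonneg: "f \<in> Linf \<Omega> \<Longrightarrow> 0 \<le> Linf_norm \<Omega> f"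
proof (rule ccontr)
  assume f: "f \<in> Linf \<Omega>" and "\<not> 0 \<le> Linf_norm \<Omega> f"
  then have neg: "Linf_norm \<Omega> f < 0" by simp
  have "AE x in lebesgue_on \<Omega>. False"
    using Linf_AE[OF f] by eventually_elim (use neg in linarith)
  then have "emeasure (lebesgue_on \<Omega>) (space (lebesgue_on \<Omega>)) = 0" by (simp add: AE_iff_measurable[OF sets.top])
  then have "esssup (lebesgue_on \<Omega>) (\<lambda>x. ereal \<bar>f x\<bar>) = - \<infinity>"
    using f by (intro esssup_zero_space) (auto simp: Linf_def)
  then show False using neg by (simp add: Linf_norm_def)
qed

locale galerkin_space =
  fixes \<Omega> :: "'a::euclidean_space set" and V E :: "('a \<Rightarrow> real) set" and c1 c2 :: real
  assumes \<Omega>: "\<Omega> \<in> lmeasurable"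
    and fin: "finite E" "V = span E" and V: "V \<subseteq> H01 \<Omega>"
    and V0: "\<And>v. v \<in> V \<Longrightarrow> (AE x in lebesgue_on \<Omega>. v x = 0) \<Longrightarrow> v = 0"
    and c1: "c1 > 0" "\<And>v. v \<in> L2 \<Omega> \<Longrightarrow> Hm1_norm \<Omega> v \<le> c1 * L2_norm \<Omega> v"
    and c2: "c2 > 0" "\<And>v. v \<in> H01 \<Omega> \<Longrightarrow> L2_norm \<Omega> v \<le> c2 * H01_norm \<Omega> v"
begin

abbreviation "M \<equiv> lebesgue_on \<Omega>"

lemma sub: "subspace V" unfolding fin by simp

lemma in_L2: "v \<in> V \<Longrightarrow> v \<in> L2 \<Omega>" using weak_gradient(3) V by blast

lemma grad_L2: "v \<in> V \<Longrightarrow> weak_gradient \<Omega> v \<in> L2 \<Omega>" using weak_gradient(1) V by blast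

lemma grad_comb:
  assumes "u \<in> V" "v \<in> V"
  shows "AE x in M. weak_gradient \<Omega> (u + c *\<^sub>R v) x = weak_gradient \<Omega> u x + c *\<^sub>R weak_gradient \<Omega> v x"
proof (rule weak_gradient_linear[OF \<Omega>])
  have "u + c *\<^sub>R v \<in> V" using assms sub by (intro subspace_add subspace_mul)
  then show "u + c *\<^sub>R v \<in> H01 \<Omega>" using V by blast
qed (use assms V in auto)

text \<open>An explicit constant in place of \<open>esssup\<close> also covers the diffusion
  coefficient, which is controlled through its bounds almost everywhere.\<close>

definition admissible :: "('a \<Rightarrow> real) \<Rightarrow> bool" where
  "admissible q \<longleftrightarrow> q \<in> borel_measurable M \<and> (\<exists>C\<ge>0. AE x in M. \<bar>q x\<bar> \<le> C)"

lemma admissible_Linf: "q \<in> Linf \<Omega> \<Longrightarrow> admissible q"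
  using Linf_AE[of q \<Omega>] Linf_norm_nonneg[of q \<Omega>] by (auto simp: admissible_def Linf_def)

lemma admissible_const: "admissible (\<lambda>_. c)"
  unfolding admissible_def by (auto intro!: exI[of _ "\<bar>c\<bar>"])

lemma bform_integrand:
  assumes u: "u \<in> V" and v: "v \<in> V" and q: "q \<in> borel_measurable M" and C: "AE x in M. \<bar>q x\<bar> \<le> C"
  shows "(\<lambda>x. q x * (weak_gradient \<Omega> u x \<bullet> weak_gradient \<Omega> v x)) \<in> borel_measurable M"
    and "AE x in M. \<bar>q x * (weak_gradient \<Omega> u x \<bullet> weak_gradient \<Omega> v x)\<bar> \<le> C * (norm (weak_gradient \<Omega> u x) * norm (weak_gradient \<Omega> v x))"
proof -
  show "(\<lambda>x. q x * (weak_gradient \<Omega> u x \<bullet> weak_gradient \<Omega> v x)) \<in> borel_measurable M"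
    using q L2_measurable[OF grad_L2[OF u]] L2_measurable[OF grad_L2[OF v]]
    by (intro borel_measurable_times borel_measurable_inner)
  show "AE x in M. \<bar>q x * (weak_gradient \<Omega> u x \<bullet> weak_gradient \<Omega> v x)\<bar> \<le> C * (norm (weak_gradient \<Omega> u x) * norm (weak_gradient \<Omega> v x))"
    using C
  proof eventually_elim
    case (elim x)
    then show ?case unfolding abs_mult using Cauchy_Schwarz_ineq2[of "weak_gradient \<Omega> u x" "weak_gradient \<Omega> v x"]
      by (intro mult_mono) auto
  qed
qed

lemma bform_integrable:
  assumes u: "u \<in> V" and v: "v \<in> V" and q: "admissible q"
  shows "integrable M (\<lambda>x. q x * (weak_gradient \<Omega> u x \<bullet> weak_gradient \<Omega> v x))"
proof -
  obtain C where C: "q \<in> borel_measurable M" "AE x in M. \<bar>q x\<bar> \<le> C" using q unfolding admissible_def by blast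
  show ?thesis
    by (rule integrable_of_product_bound[OF grad_L2[OF u] grad_L2[OF v] bform_integrand[OF u v C]])
qed

lemma bform_le:
  assumes u: "u \<in> V" and v: "v \<in> V" and q: "q \<in> borel_measurable M" "AE x in M. \<bar>q x\<bar> \<le> C" "0 \<le> C"
  shows "\<bar>bform \<Omega> q u v\<bar> \<le> C * H01_norm \<Omega> u * H01_norm \<Omega> v"
  unfolding bform_def H01_norm_def
  by (rule integral_product_bound[OF grad_L2[OF u] grad_L2[OF v] bform_integrand[OF u v q(1,2)] q(3)])

lemma bform_comb:
  assumes u: "u \<in> V" and v: "v \<in> V" and w: "w \<in> V" and q: "admissible q"
  shows "bform \<Omega> q (u + c *\<^sub>R v) w = bform \<Omega> q u w + c * bform \<Omega> q v w"
proof -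
  let ?g = "weak_gradient \<Omega>"
  have uv: "u + c *\<^sub>R v \<in> V" using u v sub by (intro subspace_add subspace_mul)
  have "bform \<Omega> q (u + c *\<^sub>R v) w = (LINT x|M. q x * (?g u x \<bullet> ?g w x) + c * (q x * (?g v x \<bullet> ?g w x)))"
    unfolding bform_def
  proof (rule integral_cong_AE)
    show "AE x in M. q x * (?g (u + c *\<^sub>R v) x \<bullet> ?g w x) = q x * (?g u x \<bullet> ?g w x) + c * (q x * (?g v x \<bullet> ?g w x))"
      using grad_comb[OF u v, of c] by eventually_elim (simp add: inner_add_left algebra_simps)
  qed (use bform_integrable[OF uv w q] bform_integrable[OF u w q] bform_integrable[OF v w q] in auto)
  also have "\<dots> = bform \<Omega> q u w + c * bform \<Omega> q v w"
    unfolding bform_def using bform_integrable[OF u w q] bform_integrable[OF v w q] by simp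
  finally show ?thesis .
qed

lemma bform_bilinear: "admissible q \<Longrightarrow> sym_bilinear_on V (bform \<Omega> q)"
  unfolding sym_bilinear_on_def
proof (intro conjI ballI allI)
  assume q: "admissible q"
  fix u v assume u: "u \<in> V" and v: "v \<in> V"
  show "bform \<Omega> q u v = bform \<Omega> q v u" by (simp add: bform_def inner_commute)
  fix c
  have 0: "0 \<in> V" using sub by (rule subspace_0)
  have z: "bform \<Omega> q 0 v = 0" using bform_comb[OF 0 0 v q, of 1] by simp
  show "bform \<Omega> q (c *\<^sub>R u) v = c * bform \<Omega> q u v" using bform_comb[OF 0 u v q, of c] z by simp
  fix w assume "w \<in> V"
  then show "bform \<Omega> q (u + v) w = bform \<Omega> q u w + bform \<Omega> q v w" using bform_comb[OF u v _ q, of w 1] by simp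
qed

lemma L2_inner_bilinear: "sym_bilinear_on V (L2_inner \<Omega>)"
  unfolding sym_bilinear_on_def
proof (intro conjI ballI allI)
  fix u v assume u: "u \<in> V" and v: "v \<in> V"
  show "L2_inner \<Omega> u v = L2_inner \<Omega> v u" by (simp add: L2_inner_def mult.commute)
  fix c show "L2_inner \<Omega> (c *\<^sub>R u) v = c * L2_inner \<Omega> u v" by (simp add: L2_inner_def mult.assoc)
  fix w assume w: "w \<in> V"
  show "L2_inner \<Omega> (u + v) w = L2_inner \<Omega> u w + L2_inner \<Omega> v w"
    using integrable_L2_mult[OF in_L2[OF u] in_L2[OF w]] integrable_L2_mult[OF in_L2[OF v] in_L2[OF w]]
    by (simp add: L2_inner_def distrib_right)
qed

lemma L2_inner_le: "\<bar>L2_inner \<Omega> f g\<bar> \<le> L2_norm \<Omega> f * L2_norm \<Omega> g" if "f \<in> L2 \<Omega>" "g \<in> L2 \<Omega>" for f g :: "'a \<Rightarrow> real"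
proof -
  have "\<bar>LINT x|M. f x \<bullet> g x\<bar> \<le> 1 * L2_norm \<Omega> f * L2_norm \<Omega> g"
    by (rule integral_product_bound[OF that]) (use L2_measurable[OF that(1)] L2_measurable[OF that(2)] in \<open>auto simp: abs_mult\<close>)
  then show ?thesis by (simp add: L2_inner_def)
qed

lemma L2_inner_functional: "f \<in> L2 \<Omega> \<Longrightarrow> functional_on V (L2_inner \<Omega> f)"
  unfolding functional_on_def
proof (intro conjI ballI allI)
  assume f: "f \<in> L2 \<Omega>"
  fix u assume u: "u \<in> V"
  fix c show "L2_inner \<Omega> f (c *\<^sub>R u) = c * L2_inner \<Omega> f u" by (simp add: L2_inner_def mult_ac)
  fix v assume v: "v \<in> V"
  show "L2_inner \<Omega> f (u + v) = L2_inner \<Omega> f u + L2_inner \<Omega> f v"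
    using integrable_L2_mult[OF f in_L2[OF u]] integrable_L2_mult[OF f in_L2[OF v]]
    by (simp add: L2_inner_def distrib_left)
qed

lemma H01_norm_eq: "H01_norm \<Omega> v = sqrt (bform \<Omega> (\<lambda>_. 1) v v)"
  by (simp add: H01_norm_def L2_norm_def bform_def power2_norm_eq_inner)

lemma H01_norm_nonneg: "0 \<le> H01_norm \<Omega> v"
  by (simp add: H01_norm_def L2_norm_nonneg)

lemma bform_one_nonneg: "0 \<le> bform \<Omega> (\<lambda>_. 1) v v"
  by (simp add: bform_def)

text \<open>The embedding constant \<open>c2\<close> makes the \<open>L2\<close> norm vanish; since
  distinct elements of \<open>V\<close> represent distinct classes, the function is then
  \<open>0\<close> everywhere.\<close>

lemma eq_0_of_H01_norm:
  assumes v: "v \<in> V" and "H01_norm \<Omega> v = 0"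
  shows "v = 0"
proof -
  have "L2_norm \<Omega> v \<le> 0" using c2(2)[of v] assms V by auto
  then have "L2_norm \<Omega> v = 0" using L2_norm_nonneg[of \<Omega> v] by simp
  then have "(LINT x|M. (norm (v x))\<^sup>2) = 0" using L2_norm_square[of \<Omega> v] by simp
  then have "AE x in M. (norm (v x))\<^sup>2 = 0"
    using integral_nonneg_eq_0_iff_AE[OF L2_integrable_square[OF in_L2[OF v]]] by simp
  then show ?thesis by (intro V0[OF v]) simp
qed

lemma bform_one_pos: "v \<in> V \<Longrightarrow> v \<noteq> 0 \<Longrightarrow> 0 < bform \<Omega> (\<lambda>_. 1) v v"
  using eq_0_of_H01_norm[of v] bform_one_nonneg[of v] H01_norm_eq[of v] by (auto simp: less_le)

lemma H01_norm_scale: "v \<in> V \<Longrightarrow> H01_norm \<Omega> (c *\<^sub>R v) = \<bar>c\<bar> * H01_norm \<Omega> v"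
proof -
  assume v: "v \<in> V"
  note b = sym_bilinear_onD[OF bform_bilinear[OF admissible_const[of 1]]]
  have cv: "c *\<^sub>R v \<in> V" using v sub by (intro subspace_mul)
  have "bform \<Omega> (\<lambda>_. 1) (c *\<^sub>R v) (c *\<^sub>R v) = c * bform \<Omega> (\<lambda>_. 1) v (c *\<^sub>R v)" by (rule b(3)[OF v cv])
  also have "bform \<Omega> (\<lambda>_. 1) v (c *\<^sub>R v) = c * bform \<Omega> (\<lambda>_. 1) v v"
    unfolding b(1)[OF v cv] by (rule b(3)[OF v v])
  finally have "bform \<Omega> (\<lambda>_. 1) (c *\<^sub>R v) (c *\<^sub>R v) = c\<^sup>2 * bform \<Omega> (\<lambda>_. 1) v v" by (simp only: power2_eq_square mult.assoc)
  then have "H01_norm \<Omega> (c *\<^sub>R v) = sqrt (c\<^sup>2 * bform \<Omega> (\<lambda>_. 1) v v)" by (simp only: H01_norm_eq)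
  also have "\<dots> = \<bar>c\<bar> * H01_norm \<Omega> v" by (simp add: H01_norm_eq real_sqrt_mult)
  finally show ?thesis .
qed

text \<open>Scaling \<open>w\<close> to unit norm makes it a competitor in the supremum that defines
  \<open>Hm1_norm\<close>.\<close>

lemma dual_pairing_le:
  assumes f: "f \<in> L2 \<Omega>" and w: "w \<in> V"
  shows "\<bar>L2_inner \<Omega> f w\<bar> \<le> c1 * L2_norm \<Omega> f * H01_norm \<Omega> w"
proof (cases "w = 0")
  case True
  then show ?thesis using L2_norm_nonneg[of \<Omega> f] H01_norm_nonneg[of w] c1(1) by (simp add: L2_inner_def)
next
  case False
  let ?N = "H01_norm \<Omega> w"
  have N: "?N > 0" using False eq_0_of_H01_norm[OF w] H01_norm_nonneg[of w] by (auto simp: less_le)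
  let ?w = "(1 / ?N) *\<^sub>R w"
  have wV: "?w \<in> V" using w sub by (intro subspace_mul)
  have w1: "H01_norm \<Omega> ?w = 1" using H01_norm_scale[OF w, of "1 / ?N"] N by simp
  \<comment> \<open>A real supremum is known to dominate its members once the set is bounded;
    Cauchy-Schwarz and \<open>c2\<close> provide the bound.\<close>
  have bdd: "bdd_above ((\<lambda>w. \<bar>L2_inner \<Omega> f w\<bar>) ` {w \<in> H01 \<Omega>. H01_norm \<Omega> w \<le> 1})"
  proof (rule bdd_aboveI2)
    fix x assume x: "x \<in> {w \<in> H01 \<Omega>. H01_norm \<Omega> w \<le> 1}"
    have "\<bar>L2_inner \<Omega> f x\<bar> \<le> L2_norm \<Omega> f * L2_norm \<Omega> x" using x by (intro L2_inner_le f weak_gradient(3)) auto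
    also have "\<dots> \<le> L2_norm \<Omega> f * c2"
    proof (rule mult_left_mono[OF _ L2_norm_nonneg])
      have "L2_norm \<Omega> x \<le> c2 * H01_norm \<Omega> x" using x by (intro c2(2)) auto
      also have "\<dots> \<le> c2 * 1" using x c2(1) by (intro mult_left_mono) auto
      finally show "L2_norm \<Omega> x \<le> c2" by simp
    qed
    finally show "\<bar>L2_inner \<Omega> f x\<bar> \<le> L2_norm \<Omega> f * c2" .
  qed
  have "\<bar>L2_inner \<Omega> f ?w\<bar> \<le> Hm1_norm \<Omega> f"
    unfolding Hm1_norm_def using wV V w1 by (intro cSUP_upper[OF _ bdd]) auto
  also have "\<dots> \<le> c1 * L2_norm \<Omega> f" by (rule c1(2)[OF f])
  finally have le: "\<bar>L2_inner \<Omega> f ?w\<bar> \<le> c1 * L2_norm \<Omega> f" .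
  have "L2_inner \<Omega> f ?w = 1 / ?N * L2_inner \<Omega> f w" by (rule functional_onD(2)[OF L2_inner_functional[OF f] w])
  then have "\<bar>L2_inner \<Omega> f w\<bar> = \<bar>L2_inner \<Omega> f ?w\<bar> * ?N" using N by (simp add: abs_mult)
  also have "\<dots> \<le> c1 * L2_norm \<Omega> f * ?N" using le N by (intro mult_right_mono) auto
  finally show ?thesis .
qed

lemma bform_coercive:
  assumes v: "v \<in> V" and q: "admissible q" and a: "AE x in M. a \<le> q x"
  shows "a * bform \<Omega> (\<lambda>_. 1) v v \<le> bform \<Omega> q v v"
proof -
  let ?g = "weak_gradient \<Omega> v"
  have i: "integrable M (\<lambda>x. ?g x \<bullet> ?g x)" using bform_integrable[OF v v admissible_const[of 1]] by simp
  have "a * bform \<Omega> (\<lambda>_. 1) v v = (LINT x|M. a * (?g x \<bullet> ?g x))" by (simp add: bform_def)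
  also have "\<dots> \<le> (LINT x|M. q x * (?g x \<bullet> ?g x))"
  proof (rule integral_mono_AE)
    show "AE x in M. a * (?g x \<bullet> ?g x) \<le> q x * (?g x \<bullet> ?g x)"
      using a by eventually_elim (simp add: mult_right_mono)
  qed (use i bform_integrable[OF v v q] in auto)
  finally show ?thesis by (simp add: bform_def)
qed

lemma bform_diffusion:
  assumes u: "u \<in> V" and v: "v \<in> V" and abar: "admissible abar" and \<psi>: "\<And>j. admissible (\<psi> j)"
  shows "bform \<Omega> (diffusion abar \<psi> (zero_ext s y)) u v = bform \<Omega> abar u v + (\<Sum>j<s. y j * bform \<Omega> (\<psi> j) u v)"
proof -
  let ?p = "\<lambda>x. weak_gradient \<Omega> u x \<bullet> weak_gradient \<Omega> v x"
  have d: "diffusion abar \<psi> (zero_ext s y) x = abar x + (\<Sum>j<s. y j * \<psi> j x)" for x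
  proof -
    have "(\<Sum>j. zero_ext s y j * \<psi> j x) = (\<Sum>j<s. zero_ext s y j * \<psi> j x)"
      by (rule suminf_finite) (auto simp: zero_ext_def)
    then show ?thesis by (simp add: diffusion_def zero_ext_def)
  qed
  have "bform \<Omega> (diffusion abar \<psi> (zero_ext s y)) u v = (LINT x|M. abar x * ?p x + (\<Sum>j<s. y j * (\<psi> j x * ?p x)))"
    unfolding bform_def d by (simp add: distrib_right sum_distrib_right mult.assoc)
  also have "\<dots> = (LINT x|M. abar x * ?p x) + (\<Sum>j<s. y j * (LINT x|M. \<psi> j x * ?p x))"
    using bform_integrable[OF u v abar] bform_integrable[OF u v \<psi>] by simp
  finally show ?thesis by (simp add: bform_def)
qed

lemma admissible_diffusion:
  assumes abar: "admissible abar" and \<psi>: "\<And>j. admissible (\<psi> j)"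
    and bd: "AE x in M. amin \<le> diffusion abar \<psi> (zero_ext s y) x \<and> diffusion abar \<psi> (zero_ext s y) x \<le> amax"
  shows "admissible (diffusion abar \<psi> (zero_ext s y))"
proof -
  have d: "diffusion abar \<psi> (zero_ext s y) = (\<lambda>x. abar x + (\<Sum>j<s. y j * \<psi> j x))"
  proof
    fix x
    have "(\<Sum>j. zero_ext s y j * \<psi> j x) = (\<Sum>j<s. zero_ext s y j * \<psi> j x)"
      by (rule suminf_finite) (auto simp: zero_ext_def)
    then show "diffusion abar \<psi> (zero_ext s y) x = abar x + (\<Sum>j<s. y j * \<psi> j x)" by (simp add: diffusion_def zero_ext_def)
  qed
  have m: "abar \<in> borel_measurable M" "\<And>j. \<psi> j \<in> borel_measurable M" using abar \<psi> unfolding admissible_def by auto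
  have "diffusion abar \<psi> (zero_ext s y) \<in> borel_measurable M" unfolding d using m by measurable
  moreover have "AE x in M. \<bar>diffusion abar \<psi> (zero_ext s y) x\<bar> \<le> \<bar>amin\<bar> + \<bar>amax\<bar>"
    using bd by eventually_elim linarith
  ultimately show ?thesis unfolding admissible_def by (meson abs_ge_zero add_nonneg_nonneg)
qed

end

section \<open>Weights and constants\<close>

text \<open>For the chosen weights both sums in \<open>C_gamma\<close> coincide; \<open>theta\<close> is the common exponent.\<close>

definition theta :: "real \<Rightarrow> real" where "theta lam = 2 * lam / (1 + lam)"

text \<open>What a single coordinate contributes when the weight is inserted into either sum of
  \<open>C_gamma\<close>. The exponent of \<open>rho lam\<close> arises as
  \<open>1 - theta lam / 2\<close> in the first sum and as \<open>(1/2) * (2 / (1 + lam))\<close> in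
  the second.\<close>

definition weight_factor :: "(nat \<Rightarrow> real) \<Rightarrow> real \<Rightarrow> nat \<Rightarrow> real" where
  "weight_factor b lam j = b j powr theta lam * rho lam powr (1 / (1 + lam))"

definition weight_sum :: "(nat \<Rightarrow> real) \<Rightarrow> real \<Rightarrow> nat \<Rightarrow> real" where
  "weight_sum b lam s = (\<Sum>U\<in>Pow {..<s}. fact (card U + 1) powr theta lam * (\<Prod>j\<in>U. weight_factor b lam j))"

lemma powr_prod: "finite I \<Longrightarrow> (\<Prod>i\<in>I. f i) powr p = (\<Prod>i\<in>I. f i powr p :: real)"
  by (induction I rule: finite_induct) (auto simp: powr_mult)

lemma weight_nonneg: "0 \<le> weight b lam U"
  by (simp add: weight_def)

lemma weight_powr_term:
  assumes lam: "1 / 2 < lam" and U: "finite U"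
  shows "weight b lam U powr lam * rho lam ^ card U = fact (card U + 1) powr theta lam * (\<Prod>j\<in>U. weight_factor b lam j)"
proof -
  have rho: "0 < rho lam" by (rule rho_pos[OF lam])
  have e: "2 / (1 + lam) * lam = theta lam" by (simp add: theta_def)
  have w: "(b j / rho lam powr (1/2)) powr theta lam * rho lam = weight_factor b lam j" for j
  proof -
    have "(b j / rho lam powr (1/2)) powr theta lam = b j powr theta lam / rho lam powr (1/2 * theta lam)"
      unfolding powr_divide powr_powr ..
    also have "\<dots> = b j powr theta lam * rho lam powr (- theta lam / 2)"
      using powr_minus_divide[of "rho lam" "theta lam / 2"] by simp
    finally have "(b j / rho lam powr (1/2)) powr theta lam * rho lam = b j powr theta lam * rho lam powr (- theta lam / 2) * rho lam"
      by simp
    also have "\<dots> = b j powr theta lam * (rho lam powr (- theta lam / 2) * rho lam powr 1)"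
      using rho by simp
    also have "rho lam powr (- theta lam / 2) * rho lam powr 1 = rho lam powr (- theta lam / 2 + 1)"
      by (rule powr_add[symmetric])
    also have "- theta lam / 2 + 1 = 1 / (1 + lam)" using lam by (simp add: theta_def field_simps)
    finally show ?thesis by (simp add: weight_factor_def)
  qed
  have "weight b lam U powr lam = (fact (card U + 1) * (\<Prod>j\<in>U. b j / rho lam powr (1/2))) powr theta lam"
    unfolding weight_def powr_powr e ..
  also have "\<dots> = fact (card U + 1) powr theta lam * (\<Prod>j\<in>U. (b j / rho lam powr (1/2)) powr theta lam)"
    unfolding powr_mult powr_prod[OF U] ..
  finally have "weight b lam U powr lam * rho lam ^ card U
     = fact (card U + 1) powr theta lam * (\<Prod>j\<in>U. (b j / rho lam powr (1/2)) powr theta lam * rho lam)"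
    by (simp add: prod.distrib)
  also have "\<dots> = fact (card U + 1) powr theta lam * (\<Prod>j\<in>U. weight_factor b lam j)" unfolding w ..
  finally show ?thesis .
qed

lemma weight_recip_term:
  assumes lam: "1 / 2 < lam" and U: "finite U" and b: "\<And>j. 0 \<le> b j"
  shows "(fact (card U + 1))\<^sup>2 / weight b lam U * (\<Prod>j\<in>U. (b j)\<^sup>2) = fact (card U + 1) powr theta lam * (\<Prod>j\<in>U. weight_factor b lam j)"
proof (cases "\<exists>j\<in>U. b j = 0")
  \<comment> \<open>With some \<open>b j = 0\<close> the weight itself is \<open>0\<close>; both
    sides vanish, the left one also under the convention for division.\<close>
  case True
  then have "(\<Prod>j\<in>U. (b j)\<^sup>2) = 0" "(\<Prod>j\<in>U. weight_factor b lam j) = 0"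
    using U by (auto simp: prod_zero_iff weight_factor_def)
  then show ?thesis by simp
next
  case False
  then have pos: "0 < b j" if "j \<in> U" for j using b[of j] that by (simp add: less_le)
  have rho: "0 < rho lam" by (rule rho_pos[OF lam])
  let ?e = "2 / (1 + lam)"
  have e: "2 - ?e = theta lam" using lam by (simp add: theta_def field_simps)
  have sq: "x\<^sup>2 / x powr ?e = x powr theta lam" if "0 < x" for x :: real
  proof -
    have "x\<^sup>2 = x powr 2" using that by simp
    then show ?thesis unfolding e[symmetric] powr_diff by simp
  qed
  have "(fact (card U + 1))\<^sup>2 / weight b lam U * (\<Prod>j\<in>U. (b j)\<^sup>2)
      = ((fact (card U + 1))\<^sup>2 / fact (card U + 1) powr ?e) * (\<Prod>j\<in>U. (b j)\<^sup>2 / (b j / rho lam powr (1/2)) powr ?e)"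
  proof -
    let ?P = "\<Prod>j\<in>U. (b j / rho lam powr (1/2)) powr ?e"
    have w: "weight b lam U = fact (card U + 1) powr ?e * ?P"
      unfolding weight_def powr_mult powr_prod[OF U] ..
    have "(\<Prod>j\<in>U. (b j)\<^sup>2 / (b j / rho lam powr (1/2)) powr ?e) = (\<Prod>j\<in>U. (b j)\<^sup>2) / ?P"
      by (rule prod_dividef)
    then show ?thesis unfolding w by (simp only: times_divide_eq_left times_divide_eq_right divide_divide_eq_left mult_ac)
  qed
  also have "(fact (card U + 1))\<^sup>2 / fact (card U + 1) powr ?e = (fact (card U + 1) :: real) powr theta lam"
    by (rule sq) simp
  also have "(\<Prod>j\<in>U. (b j)\<^sup>2 / (b j / rho lam powr (1/2)) powr ?e) = (\<Prod>j\<in>U. weight_factor b lam j)"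
  proof (rule prod.cong[OF refl])
    fix j assume j: "j \<in> U"
    have "(b j / rho lam powr (1/2)) powr ?e = b j powr ?e / rho lam powr (1 / (1 + lam))"
      unfolding powr_divide powr_powr by simp
    then have "(b j)\<^sup>2 / (b j / rho lam powr (1/2)) powr ?e = ((b j)\<^sup>2 / b j powr ?e) * rho lam powr (1 / (1 + lam))" by simp
    then show "(b j)\<^sup>2 / (b j / rho lam powr (1/2)) powr ?e = weight_factor b lam j"
      unfolding sq[OF pos[OF j]] weight_factor_def .
  qed
  finally show ?thesis .
qed

lemma C_gamma_eq:
  assumes lam: "1 / 2 < lam" and b: "\<And>j. 0 \<le> b j"
  shows "C_gamma (weight b lam) b s lam = weight_sum b lam s powr (1 / (2 * lam)) * weight_sum b lam s powr (1/2)"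
proof -
  have fin: "finite U" if "U \<in> Pow {..<s}" for U using that by (auto intro: finite_subset)
  have "(\<Sum>U\<in>Pow {..<s}. weight b lam U powr lam * rho lam ^ card U) = weight_sum b lam s"
    unfolding weight_sum_def by (intro sum.cong refl weight_powr_term lam fin)
  moreover have "(\<Sum>U\<in>Pow {..<s}. (fact (card U + 1))\<^sup>2 / weight b lam U * (\<Prod>j\<in>U. (b j)\<^sup>2)) = weight_sum b lam s"
    unfolding weight_sum_def by (intro sum.cong refl weight_recip_term lam fin b)
  ultimately show ?thesis unfolding C_gamma_def by simp
qed

section \<open>Bounds for the weight sum uniform in the dimension\<close>

lemma sum_Pow_insert:
  fixes f :: "'a set \<Rightarrow> real"
  assumes "x \<notin> I" "finite I"
  shows "(\<Sum>U\<in>Pow (insert x I). f U) = (\<Sum>U\<in>Pow I. f U) + (\<Sum>U\<in>Pow I. f (insert x U))"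
proof -
  have inj: "inj_on (insert x) (Pow I)" using assms by (intro inj_onI) (metis PowD insert_ident subsetD)
  have "(\<Sum>U\<in>Pow (insert x I). f U) = (\<Sum>U\<in>Pow I. f U) + (\<Sum>U\<in>insert x ` Pow I. f U)"
    unfolding Pow_insert using assms by (intro sum.union_disjoint) auto
  then show ?thesis by (simp add: sum.reindex[OF inj])
qed

text \<open>The left-hand side consists of the first two terms of the binomial expansion.\<close>

lemma power_add_ge:
  fixes A a :: real
  assumes "0 \<le> A" "0 \<le> a"
  shows "A ^ Suc k + real (Suc k) * a * A ^ k \<le> (A + a) ^ Suc k"
proof (induction k)
  case (Suc k)
  have "A ^ Suc (Suc k) + real (Suc (Suc k)) * a * A ^ Suc k \<le> (A + a) * (A ^ Suc k + real (Suc k) * a * A ^ k)"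
    using assms by (simp add: algebra_simps)
  also have "\<dots> \<le> (A + a) * (A + a) ^ Suc k" using Suc assms by (intro mult_left_mono) auto
  finally show ?case by simp
qed simp

text \<open>The symmetric functions satisfy \<open>e\<^sub>k(a) \<le> (\<Sum> a)\<^sup>k / k!\<close>; summing against \<open>f\<close> makes this
  amenable to induction.\<close>

lemma sum_Pow_le_exponential:
  fixes a :: "'i \<Rightarrow> real" and f :: "nat \<Rightarrow> real"
  assumes "finite I" "\<And>i. i \<in> I \<Longrightarrow> 0 \<le> a i" "\<And>k. 0 \<le> f k"
  shows "(\<Sum>U\<in>Pow I. f (card U) * (\<Prod>i\<in>U. a i)) \<le> (\<Sum>k\<le>card I. f k * ((\<Sum>i\<in>I. a i) ^ k / fact k))"
  using assms
proof (induction I arbitrary: f rule: finite_induct)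
  case empty
  then show ?case by simp
next
  case (insert x I)
  let ?A = "\<Sum>i\<in>I. a i" and ?n = "card I"
  have A: "0 \<le> ?A" and ax: "0 \<le> a x" using insert.prems by (auto intro: sum_nonneg)
  have "(\<Sum>U\<in>Pow (insert x I). f (card U) * (\<Prod>i\<in>U. a i))
      = (\<Sum>U\<in>Pow I. f (card U) * (\<Prod>i\<in>U. a i)) + (\<Sum>U\<in>Pow I. f (card (insert x U)) * (\<Prod>i\<in>insert x U. a i))"
    by (rule sum_Pow_insert[OF insert.hyps(2,1)])
  also have "(\<Sum>U\<in>Pow I. f (card (insert x U)) * (\<Prod>i\<in>insert x U. a i)) = (\<Sum>U\<in>Pow I. a x * f (Suc (card U)) * (\<Prod>i\<in>U. a i))"
  proof (rule sum.cong[OF refl])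
    fix U assume "U \<in> Pow I"
    then have "finite U" "x \<notin> U" using insert.hyps by (auto intro: finite_subset)
    then show "f (card (insert x U)) * (\<Prod>i\<in>insert x U. a i) = a x * f (Suc (card U)) * (\<Prod>i\<in>U. a i)" by simp
  qed
  \<comment> \<open>Adding the element \<open>x\<close> amounts to replacing \<open>f k\<close> by
    \<open>f k + a x * f (Suc k)\<close>; this is why \<open>f\<close> is kept arbitrary in the
    induction.\<close>
  also have "(\<Sum>U\<in>Pow I. f (card U) * (\<Prod>i\<in>U. a i)) + \<dots> = (\<Sum>U\<in>Pow I. (f (card U) + a x * f (Suc (card U))) * (\<Prod>i\<in>U. a i))"
    by (simp add: sum.distrib distrib_right)
  also have "\<dots> \<le> (\<Sum>k\<le>?n. (f k + a x * f (Suc k)) * (?A ^ k / fact k))"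
    by (rule insert.IH) (use insert.prems ax in auto)
  also have "\<dots> = (\<Sum>k\<le>?n. f k * (?A ^ k / fact k)) + (\<Sum>k\<le>?n. f (Suc k) * (a x * ?A ^ k / fact k))"
    unfolding sum.distrib[symmetric] by (intro sum.cong refl) (simp add: field_simps)
  also have "(\<Sum>k\<le>?n. f k * (?A ^ k / fact k)) \<le> (\<Sum>k\<le>Suc ?n. f k * (?A ^ k / fact k))"
    using insert.prems A by simp
  also have "\<dots> = f 0 + (\<Sum>k\<le>?n. f (Suc k) * (?A ^ Suc k / fact (Suc k)))"
    by (subst sum.atMost_Suc_shift) simp
  finally have "(\<Sum>U\<in>Pow (insert x I). f (card U) * (\<Prod>i\<in>U. a i))
     \<le> f 0 + (\<Sum>k\<le>?n. f (Suc k) * (?A ^ Suc k / fact (Suc k)) + f (Suc k) * (a x * ?A ^ k / fact k))"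
    by (simp only: sum.distrib add.assoc)
  also have "\<dots> \<le> f 0 + (\<Sum>k\<le>?n. f (Suc k) * ((?A + a x) ^ Suc k / fact (Suc k)))"
  proof (intro add_left_mono sum_mono)
    fix k
    have "f (Suc k) * (?A ^ Suc k / fact (Suc k)) + f (Suc k) * (a x * ?A ^ k / fact k)
        = f (Suc k) * ((?A ^ Suc k + real (Suc k) * a x * ?A ^ k) / fact (Suc k))"
    proof -
      have "a x * ?A ^ k / fact k = real (Suc k) * a x * ?A ^ k / fact (Suc k)"
        by (simp del: of_nat_Suc)
      then show ?thesis by (simp only: add_divide_distrib distrib_left)
    qed
    also have "\<dots> \<le> f (Suc k) * ((?A + a x) ^ Suc k / fact (Suc k))"
      using power_add_ge[OF A ax, of k] insert.prems by (intro mult_left_mono divide_right_mono) auto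
    finally show "f (Suc k) * (?A ^ Suc k / fact (Suc k)) + f (Suc k) * (a x * ?A ^ k / fact k) \<le> f (Suc k) * ((?A + a x) ^ Suc k / fact (Suc k))" .
  qed
  also have "\<dots> = (\<Sum>k\<le>Suc ?n. f k * ((?A + a x) ^ k / fact k))"
    by (subst sum.atMost_Suc_shift) simp
  finally show ?case using insert.hyps by (simp add: add.commute)
qed

text \<open>Consecutive terms have the ratio \<open>real (k + 2) powr th * A / real (k + 1)\<close>,
  which tends to zero because \<open>th < 1\<close>. The factor \<open>2\<close> in the proof pays
  for replacing \<open>k + 1\<close> by \<open>k + 2\<close>.\<close>

lemma summable_factorial_powr:
  fixes th A :: real
  assumes th: "th < 1" and A: "0 \<le> A"
  shows "summable (\<lambda>k. fact (k + 1) powr th * (A ^ k / fact k))"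
proof -
  let ?f = "\<lambda>k. fact (k + 1) powr th * (A ^ k / fact k)"
  have "filterlim (\<lambda>k. real (k + 2)) at_top sequentially"
    by (rule filterlim_compose[OF filterlim_real_sequentially filterlim_add_const_nat_at_top])
  then have "((\<lambda>k. real (k + 2) powr (th - 1)) \<longlongrightarrow> 0) sequentially"
    by (rule tendsto_neg_powr[rotated]) (use th in simp)
  then have "((\<lambda>k. 2 * A * real (k + 2) powr (th - 1)) \<longlongrightarrow> 2 * A * 0) sequentially" by (intro tendsto_intros)
  then have "eventually (\<lambda>k. 2 * A * real (k + 2) powr (th - 1) < 1/2) sequentially"
    by (rule order_tendstoD(2)) simp
  then obtain N where N: "\<And>k. k \<ge> N \<Longrightarrow> 2 * A * real (k + 2) powr (th - 1) < 1/2"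
    unfolding eventually_sequentially by blast
  show ?thesis
  proof (rule summable_ratio_test[where c = "1/2" and N = N])
    fix k assume k: "k \<ge> N"
    have f0: "0 \<le> ?f k" using A by simp
    have fs: "(fact (Suc k + 1) :: real) = real (k + 2) * fact (k + 1)" by simp
    have eq: "?f (Suc k) = (real (k + 2) powr th * A / real (k + 1)) * ?f k"
      unfolding fs powr_mult by (simp add: field_simps)
    have "real (k + 2) powr th * A / real (k + 1) \<le> 2 * A * real (k + 2) powr (th - 1)"
    proof -
      have "real (k + 2) powr (th - 1) = real (k + 2) powr th / real (k + 2)" by (simp add: powr_diff)
      moreover have "1 / real (k + 1) \<le> 2 / real (k + 2)" by (simp add: field_simps)
      then have "real (k + 2) powr th * A * (1 / real (k + 1)) \<le> real (k + 2) powr th * A * (2 / real (k + 2))"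
        using A by (intro mult_left_mono) auto
      ultimately show ?thesis by (simp add: mult_ac)
    qed
    also have "\<dots> \<le> 1/2" using N[OF k] by simp
    finally have c: "real (k + 2) powr th * A / real (k + 1) \<le> 1/2" .
    have "?f (Suc k) \<le> 1/2 * ?f k" unfolding eq by (rule mult_right_mono[OF c f0])
    moreover have "0 \<le> ?f (Suc k)" using A by simp
    ultimately show "norm (?f (Suc k)) \<le> 1/2 * norm (?f k)"
      unfolding real_norm_def using f0 by (simp only: abs_of_nonneg)
  qed simp
qed

text \<open>All but finitely many terms are at most \<open>1\<close>, where a larger exponent makes
  them smaller.\<close>

lemma summable_powr_mono_exponent:
  fixes b :: "nat \<Rightarrow> real"
  assumes b: "\<And>j. 0 \<le> b j" and p: "0 < p" "p \<le> q" and s: "summable (\<lambda>j. b j powr p)"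
  shows "summable (\<lambda>j. b j powr q)"
proof (rule summable_comparison_test_ev[OF _ s])
  have "eventually (\<lambda>j. b j powr p < 1) sequentially"
    by (rule order_tendstoD(2)[OF summable_LIMSEQ_zero[OF s]]) simp
  then show "eventually (\<lambda>j. norm (b j powr q) \<le> b j powr p) sequentially"
  proof eventually_elim
    case (elim j)
    have "b j \<le> 1"
    proof (rule ccontr)
      assume "\<not> b j \<le> 1"
      then have "1 \<le> b j powr p" using p by (intro ge_one_powr_ge_zero) auto
      then show False using elim by simp
    qed
    then show ?case using b[of j] p by (cases "b j = 0") (auto intro!: powr_mono')
  qed
qed

lemma weight_factor_nonneg: "0 \<le> weight_factor b lam j"
  by (simp add: weight_factor_def)

lemma weight_sum_ge_1: "1 \<le> weight_sum b lam s"
proof -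
  have "(\<Sum>U\<in>{{}}. fact (card U + 1) powr theta lam * (\<Prod>j\<in>U. weight_factor b lam j)) \<le> weight_sum b lam s"
    unfolding weight_sum_def by (rule sum_mono2) (auto intro!: mult_nonneg_nonneg prod_nonneg weight_factor_nonneg)
  then show ?thesis by simp
qed

lemma weight_sum_bounded:
  assumes lam: "1 / 2 < lam" "lam < 1" and s: "summable (\<lambda>j. b j powr theta lam)"
  shows "\<exists>T. \<forall>s. weight_sum b lam s \<le> T"
proof -
  let ?a = "weight_factor b lam"
  \<comment> \<open>At \<open>lam = 1\<close> the factorials would cancel up to
    \<open>(k + 1) * A ^ k\<close>, a series that converges only for small \<open>A\<close>.\<close>
  have th: "theta lam < 1" using lam by (simp add: theta_def field_simps)
  have sa: "summable ?a" unfolding weight_factor_def[abs_def] by (intro summable_mult2 s)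
  define A where "A = (\<Sum>j. ?a j)"
  have A: "0 \<le> A" unfolding A_def by (intro suminf_nonneg sa weight_factor_nonneg)
  let ?f = "\<lambda>k. fact (k + 1) powr theta lam"
  have sf: "summable (\<lambda>k. ?f k * (A ^ k / fact k))" by (rule summable_factorial_powr[OF th A])
  have "weight_sum b lam s \<le> (\<Sum>k. ?f k * (A ^ k / fact k))" for s
  proof -
    have le: "(\<Sum>j<s. ?a j) \<le> A" unfolding A_def by (intro sum_le_suminf sa) (auto simp: weight_factor_nonneg)
    have "weight_sum b lam s \<le> (\<Sum>k\<le>card {..<s}. ?f k * ((\<Sum>j<s. ?a j) ^ k / fact k))"
      unfolding weight_sum_def by (rule sum_Pow_le_exponential) (auto simp: weight_factor_nonneg)
    also have "\<dots> \<le> (\<Sum>k\<le>s. ?f k * (A ^ k / fact k))"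
      unfolding card_lessThan using le
      by (intro sum_mono mult_left_mono divide_right_mono power_mono sum_nonneg) (auto simp: weight_factor_nonneg)
    also have "\<dots> \<le> (\<Sum>k. ?f k * (A ^ k / fact k))"
      using A by (intro sum_le_suminf sf) auto
    finally show ?thesis .
  qed
  then show ?thesis by blast
qed

lemma C_gamma_bounded:
  assumes lam: "1 / 2 < lam" "lam < 1" and b: "\<And>j. 0 \<le> b j" and s: "summable (\<lambda>j. b j powr theta lam)"
  shows "\<exists>T. \<forall>s. C_gamma (weight b lam) b s lam \<le> T"
proof -
  obtain T where T: "\<And>s. weight_sum b lam s \<le> T" using weight_sum_bounded[OF lam s] by blast
  have "C_gamma (weight b lam) b s lam \<le> T powr (1 / (2 * lam)) * T powr (1/2)" for s
    unfolding C_gamma_eq[OF lam(1) b] using T[of s] weight_sum_ge_1[of b lam s] lam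
    by (intro mult_mono powr_mono2) auto
  then show ?thesis by blast
qed

text \<open>For \<open>p > 2/3\<close> one has \<open>theta lam = p\<close> exactly, and
  \<open>1/2 < lam\<close> says \<open>p > 2/3\<close>. Otherwise
  \<open>theta lam = 2 / (3 - 2 * \<delta>)\<close>, which is at least \<open>2/3\<close>; here
  \<open>\<delta> > 0\<close> is what keeps \<open>lam\<close> above \<open>1/2\<close>.\<close>

lemma lambda_rate:
  assumes p: "0 < p" "p < 1" and lr: "(lam, r) \<in> lambda_rate p"
  shows "1 / 2 < lam" "lam < 1" "p \<le> theta lam" "r = 1 / (2 * lam)"
proof -
  have "1 / 2 < lam \<and> lam < 1 \<and> p \<le> theta lam \<and> r = 1 / (2 * lam)"
  proof (cases "p \<le> 2/3")
    case True
    then obtain \<delta> where d: "0 < \<delta>" "\<delta> < 1/2" "lam = 1 / (2 - 2 * \<delta>)" "r = 1 - \<delta>"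
      using lr by (auto simp: lambda_rate_def)
    have "1 + lam = (3 - 2 * \<delta>) / (2 - 2 * \<delta>)" using d by (simp add: field_simps)
    then have "theta lam = 2 * (1 / (2 - 2 * \<delta>)) / ((3 - 2 * \<delta>) / (2 - 2 * \<delta>))" unfolding theta_def d(3) by simp
    also have "\<dots> = 2 / (3 - 2 * \<delta>)"
    proof -
      have "2 * (1 / x) / (y / x) = 2 / y" if "x \<noteq> 0" for x y :: real using that by simp
      from this[of "2 - 2 * \<delta>" "3 - 2 * \<delta>"] show ?thesis using d(2) by linarith
    qed
    finally have "theta lam = 2 / (3 - 2 * \<delta>)" .
    moreover have "2 / 3 \<le> 2 / (3 - 2 * \<delta>)" using d by (simp add: field_simps)
    ultimately have "p \<le> theta lam" using True by linarith
    moreover have "1 / 2 < lam" "lam < 1" "r = 1 / (2 * lam)"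
      unfolding d(3,4) using d(1,2) by (simp_all add: field_simps)
    ultimately show ?thesis by blast
  next
    case False
    then have l: "lam = p / (2 - p)" "r = 1 / p - 1/2" using lr by (auto simp: lambda_rate_def)
    have "1 + lam = 2 / (2 - p)" using l p by (simp add: field_simps)
    then have "theta lam = 2 * (p / (2 - p)) / (2 / (2 - p))" unfolding theta_def l(1) by simp
    moreover have "2 * (p / x) / (2 / x) = p" if "x \<noteq> 0" for x :: real using that by simp
    from this[of "2 - p"] have "2 * (p / (2 - p)) / (2 / (2 - p)) = p" using p by linarith
    moreover have "1 / 2 < lam" "lam < 1" "r = 1 / (2 * lam)"
      unfolding l using False p by (simp_all add: field_simps)
    ultimately show ?thesis by simp
  qed
  then show "1 / 2 < lam" "lam < 1" "p \<le> theta lam" "r = 1 / (2 * lam)" by auto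
qed

section \<open>Blow-up of the constant\<close>

lemma zeta_at_top: "filterlim zeta at_top (at_right 1)"
  unfolding filterlim_at_top
proof
  fix Z :: real
  have ns: "\<not> summable (\<lambda>k. real (Suc k) powr (-1))"
    using summable_real_powr_iff[of "-1"] summable_Suc_iff[of "\<lambda>k. real k powr (-1)"] by simp
  have "\<exists>N. \<not> (\<Sum>k<N. real (Suc k) powr (-1)) \<le> Z"
  proof (rule ccontr)
    assume "\<nexists>N. \<not> (\<Sum>k<N. real (Suc k) powr (-1)) \<le> Z"
    then have "summable (\<lambda>k. real (Suc k) powr (-1))" by (intro summableI_nonneg_bounded[where x = Z]) auto
    then show False using ns by contradiction
  qed
  then obtain N where "\<not> (\<Sum>k<N. real (Suc k) powr (-1)) \<le> Z" by blast
  then have N: "Z < (\<Sum>k<N. real (Suc k) powr (-1))" by (simp only: not_le)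
  \<comment> \<open>One partial sum of the harmonic series exceeds \<open>Z\<close>. Being finite it
    is continuous in the exponent, and \<open>zeta\<close> dominates it to the right of
    \<open>1\<close>.\<close>
  have "((\<lambda>x. \<Sum>k<N. real (Suc k) powr (- x)) \<longlongrightarrow> (\<Sum>k<N. real (Suc k) powr (- 1))) (at_right 1)"
    by (intro tendsto_intros) auto
  then have "eventually (\<lambda>x. Z < (\<Sum>k<N. real (Suc k) powr (- x))) (at_right 1)"
    by (rule order_tendstoD(1)[OF _ N])
  moreover have "eventually (\<lambda>x::real. 1 < x) (at_right 1)" by (rule eventually_at_right_less)
  ultimately show "eventually (\<lambda>x. Z \<le> zeta x) (at_right 1)"
  proof eventually_elim
    case (elim x)
    then show ?case using zeta_partial_sum_le[of x N] by simp
  qed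
qed

text \<open>The singleton \<open>{j}\<close> alone suffices. Its factor is bounded below with
  \<open>lam\<close> surviving only inside \<open>rho lam\<close>: \<open>b j powr theta lam\<close>
  is at least \<open>min 1 (b j)\<close> as \<open>0 < theta lam < 1\<close>, and
  \<open>1 / (1 + lam)\<close> is at least \<open>1/2\<close>.\<close>

lemma C_gamma_lower_bound:
  assumes lam: "1 / 2 < lam" "lam < 1" and b: "\<And>j. 0 \<le> b j" and j: "j < s" and rho1: "1 \<le> rho lam"
  shows "sqrt (min 1 (b j) * sqrt (rho lam)) \<le> C_gamma (weight b lam) b s lam"
proof -
  let ?S = "weight_sum b lam s"
  have th: "0 < theta lam" "theta lam < 1" using lam by (auto simp: theta_def field_simps)
  have "(\<Sum>U\<in>{{j}}. fact (card U + 1) powr theta lam * (\<Prod>j\<in>U. weight_factor b lam j)) \<le> ?S"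
    unfolding weight_sum_def using j by (intro sum_mono2) (auto intro!: mult_nonneg_nonneg prod_nonneg weight_factor_nonneg)
  then have 1: "2 powr theta lam * weight_factor b lam j \<le> ?S" by simp
  have "1 \<le> (2::real) powr theta lam" using th by (intro ge_one_powr_ge_zero) auto
  then have "1 * weight_factor b lam j \<le> 2 powr theta lam * weight_factor b lam j"
    by (intro mult_right_mono weight_factor_nonneg)
  with 1 have 2: "weight_factor b lam j \<le> ?S" by simp
  have 3: "min 1 (b j) \<le> b j powr theta lam"
  proof (cases "b j \<le> 1")
    case True
    have "b j powr 1 \<le> b j powr theta lam" by (rule powr_mono') (use True th b[of j] in simp_all)
    then show ?thesis using True b[of j] by (cases "b j = 0") auto
  next
    case False
    then have "1 \<le> b j powr theta lam" using th by (intro ge_one_powr_ge_zero) auto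
    then show ?thesis by simp
  qed
  have "sqrt (rho lam) = rho lam powr (1/2)" using rho1 by (simp add: powr_half_sqrt)
  also have "\<dots> \<le> rho lam powr (1 / (1 + lam))" using rho1 lam by (intro powr_mono) (auto simp: field_simps)
  finally have "min 1 (b j) * sqrt (rho lam) \<le> weight_factor b lam j"
    unfolding weight_factor_def using 3 b[of j] rho1 by (intro mult_mono) auto
  with 2 have "min 1 (b j) * sqrt (rho lam) \<le> ?S" by simp
  then have "sqrt (min 1 (b j) * sqrt (rho lam)) \<le> sqrt ?S" by simp
  also have "\<dots> = 1 * ?S powr (1/2)" using weight_sum_ge_1[of b lam s] by (simp add: powr_half_sqrt)
  also have "\<dots> \<le> ?S powr (1 / (2 * lam)) * ?S powr (1/2)"
    using weight_sum_ge_1[of b lam s] lam by (intro mult_right_mono ge_one_powr_ge_zero) auto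
  finally show ?thesis unfolding C_gamma_eq[OF lam(1) b] .
qed

lemma C_gamma_at_top:
  assumes b: "\<And>j. 0 \<le> b j" and j: "j < s" "b j \<noteq> 0"
  shows "filterlim (\<lambda>lam. C_gamma (weight b lam) b s lam) at_top (at_right (1/2))"
proof -
  have dbl: "filterlim (\<lambda>lam::real. 2 * lam) (at_right 1) (at_right (1/2))"
    unfolding filterlim_at
  proof
    show "eventually (\<lambda>lam::real. 2 * lam \<in> {1<..} \<and> 2 * lam \<noteq> 1) (at_right (1/2))"
      using eventually_at_right_less[of "1/2::real"] by eventually_elim auto
    show "((\<lambda>lam::real. 2 * lam) \<longlongrightarrow> 1) (at_right (1/2))" by (rule tendsto_eq_intros refl | simp)+
  qed
  have z: "filterlim (\<lambda>lam. zeta (2 * lam)) at_top (at_right (1/2))"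
    by (rule filterlim_compose[OF zeta_at_top dbl])
  have up: "eventually (\<lambda>lam::real. lam < 1) (at_right (1/2))"
    by (rule eventually_at_right_real[of "1/2" 1, THEN eventually_mono]) auto
  have low: "eventually (\<lambda>lam::real. 1/2 < lam) (at_right (1/2))" by (rule eventually_at_right_less)
  \<comment> \<open>For \<open>lam < 1\<close> the denominator of \<open>rho lam\<close> stays below
    \<open>2 * pi\<^sup>2\<close>, so \<open>rho lam\<close> inherits the pole of
    \<open>zeta\<close>.\<close>
  have rho_ge: "1 / pi\<^sup>2 * zeta (2 * lam) \<le> rho lam" if "1/2 < lam" "lam < 1" for lam
  proof -
    have "1 * 1 \<le> pi * pi" using pi_gt3 by (intro mult_mono) auto
    then have "1 \<le> 2 * pi\<^sup>2" by (simp add: power2_eq_square)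
    then have "(2 * pi\<^sup>2) powr lam \<le> (2 * pi\<^sup>2) powr 1" using that by (intro powr_mono) auto
    then have "2 * zeta (2 * lam) / (2 * pi\<^sup>2) \<le> 2 * zeta (2 * lam) / (2 * pi\<^sup>2) powr lam"
      using zeta_ge_1[of "2 * lam"] that by (intro divide_left_mono mult_pos_pos) auto
    then show ?thesis by (simp add: rho_def)
  qed
  have r: "filterlim rho at_top (at_right (1/2))"
  proof (rule filterlim_at_top_mono)
    show "filterlim (\<lambda>lam. 1 / pi\<^sup>2 * zeta (2 * lam)) at_top (at_right (1/2))"
      by (rule filterlim_tendsto_pos_mult_at_top[OF tendsto_const _ z]) simp
    show "eventually (\<lambda>lam. 1 / pi\<^sup>2 * zeta (2 * lam) \<le> rho lam) (at_right (1/2))"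
      using up low by eventually_elim (rule rho_ge)
  qed
  have m: "0 < min 1 (b j)" using b[of j] j by simp
  show ?thesis
  proof (rule filterlim_at_top_mono)
    show "filterlim (\<lambda>lam. sqrt (min 1 (b j) * sqrt (rho lam))) at_top (at_right (1/2))"
      by (intro filterlim_compose[OF sqrt_at_top] filterlim_tendsto_pos_mult_at_top[OF tendsto_const m] r)
    show "eventually (\<lambda>lam. sqrt (min 1 (b j) * sqrt (rho lam)) \<le> C_gamma (weight b lam) b s lam) (at_right (1/2))"
      using up low filterlim_at_top[THEN iffD1, OF r, rule_format, of 1]
      by eventually_elim (rule C_gamma_lower_bound[OF _ _ b j(1)])
  qed
qed

text \<open>Both substitutions tend to \<open>1/2\<close> strictly from above.\<close>

lemma C_gamma_blow_up:
  assumes b: "\<And>j. 0 \<le> b j" and j: "j < s" "b j \<noteq> 0"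
  shows "filterlim (\<lambda>\<delta>. C_gamma (weight b (1 / (2 - 2 * \<delta>))) b s (1 / (2 - 2 * \<delta>))) at_top (at_right 0)"
    and "filterlim (\<lambda>p'. C_gamma (weight b (p' / (2 - p'))) b s (p' / (2 - p'))) at_top (at_right (2/3))"
proof -
  have 1: "filterlim (\<lambda>\<delta>::real. 1 / (2 - 2 * \<delta>)) (at_right (1/2)) (at_right 0)"
    unfolding filterlim_at
  proof
    have "eventually (\<lambda>\<delta>::real. \<delta> < 1) (at_right 0)"
      by (rule eventually_at_right_real[of 0 1, THEN eventually_mono]) auto
    then show "eventually (\<lambda>\<delta>::real. 1 / (2 - 2 * \<delta>) \<in> {1/2<..} \<and> 1 / (2 - 2 * \<delta>) \<noteq> 1/2) (at_right 0)"
      using eventually_at_right_less[of "0::real"] by eventually_elim (auto simp: field_simps)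
    show "((\<lambda>\<delta>::real. 1 / (2 - 2 * \<delta>)) \<longlongrightarrow> 1/2) (at_right 0)" by (rule tendsto_eq_intros refl | simp)+
  qed
  have 2: "filterlim (\<lambda>p'::real. p' / (2 - p')) (at_right (1/2)) (at_right (2/3))"
    unfolding filterlim_at
  proof
    have "eventually (\<lambda>p'::real. p' < 1) (at_right (2/3))"
      by (rule eventually_at_right_real[of "2/3" 1, THEN eventually_mono]) auto
    then show "eventually (\<lambda>p'::real. p' / (2 - p') \<in> {1/2<..} \<and> p' / (2 - p') \<noteq> 1/2) (at_right (2/3))"
      using eventually_at_right_less[of "2/3::real"] by eventually_elim (auto simp: field_simps)
    show "((\<lambda>p'::real. p' / (2 - p')) \<longlongrightarrow> 1/2) (at_right (2/3))" by (rule tendsto_eq_intros refl | simp)+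
  qed
  show "filterlim (\<lambda>\<delta>. C_gamma (weight b (1 / (2 - 2 * \<delta>))) b s (1 / (2 - 2 * \<delta>))) at_top (at_right 0)"
    by (rule filterlim_compose[OF C_gamma_at_top[where b = b, OF b j] 1])
  show "filterlim (\<lambda>p'. C_gamma (weight b (p' / (2 - p'))) b s (p' / (2 - p'))) at_top (at_right (2/3))"
    by (rule filterlim_compose[OF C_gamma_at_top[where b = b, OF b j] 2])
qed

section \<open>The adjoint problem\<close>

lemma Xi_s_sets: "Xi_s s \<in> sets (PiM {..<s} (\<lambda>_. lborel))"
  unfolding Xi_s_def by (intro sets_PiM_I_finite) auto

lemma emeasure_Xi_s: "emeasure (PiM {..<s} (\<lambda>_. lborel)) (Xi_s s) = 1"
proof -
  interpret product_sigma_finite "\<lambda>_::nat. lborel :: real measure" by standard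
  show ?thesis unfolding Xi_s_def by (subst emeasure_PiM) auto
qed

text \<open>Identifies the probability space of the scalar analysis with the set integral over
  \<open>Xi_s\<close> in \<open>rmse\<close>. The cube has volume 1, so no normalising factor
  appears.\<close>

lemma PiM_centred_eq: "PiM {..<s} (\<lambda>_. centred) = uniform_measure (PiM {..<s} (\<lambda>_. lborel)) (Xi_s s)"
proof (rule sym)
  interpret L: product_sigma_finite "\<lambda>_::nat. lborel :: real measure" by standard
  interpret product_prob_space "\<lambda>_::nat. centred" by (rule product_prob_space_centred)
  show "uniform_measure (PiM {..<s} (\<lambda>_. lborel)) (Xi_s s) = PiM {..<s} (\<lambda>_. centred)"
  proof (rule PiM_eqI)
    show "sets (uniform_measure (PiM {..<s} (\<lambda>_. lborel)) (Xi_s s)) = sets (PiM {..<s} (\<lambda>_. centred))"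
      unfolding sets_uniform_measure by (rule sets_PiM_cong) auto
    fix A :: "nat \<Rightarrow> real set" assume A: "\<And>i. i \<in> {..<s} \<Longrightarrow> A i \<in> sets centred"
    have A': "A i \<in> sets lborel" if "i < s" for i using A[of i] that by simp
    have P: "PiE {..<s} A \<in> sets (PiM {..<s} (\<lambda>_. lborel))" using A' by (intro sets_PiM_I_finite) auto
    have "emeasure (uniform_measure (PiM {..<s} (\<lambda>_. lborel)) (Xi_s s)) (PiE {..<s} A)
        = emeasure (PiM {..<s} (\<lambda>_. lborel)) (Xi_s s \<inter> PiE {..<s} A) / emeasure (PiM {..<s} (\<lambda>_. lborel)) (Xi_s s)"
      by (rule emeasure_uniform_measure[OF Xi_s_sets P])
    also have "Xi_s s \<inter> PiE {..<s} A = PiE {..<s} (\<lambda>i. {-1/2..1/2} \<inter> A i)" unfolding Xi_s_def by (rule PiE_Int)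
    also have "emeasure (PiM {..<s} (\<lambda>_. lborel)) (PiE {..<s} (\<lambda>i. {-1/2..1/2} \<inter> A i)) = (\<Prod>i<s. emeasure lborel ({-1/2..1/2} \<inter> A i))"
      using A' by (intro L.emeasure_PiM) auto
    also have "(\<Prod>i<s. emeasure lborel ({-1/2..1/2} \<inter> A i)) = (\<Prod>i<s. emeasure centred (A i))"
    proof (rule prod.cong[OF refl])
      fix i assume "i \<in> {..<s}"
      then have "A i \<in> sets lborel" using A' by simp
      then show "emeasure lborel ({-1/2..1/2} \<inter> A i) = emeasure centred (A i)"
        unfolding centred_def by (subst emeasure_uniform_measure) (auto simp: divide_ennreal_def)
    qed
    finally show "emeasure (uniform_measure (PiM {..<s} (\<lambda>_. lborel)) (Xi_s s)) (PiE {..<s} A) = (\<Prod>i<s. emeasure centred (A i))"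
      unfolding emeasure_Xi_s by (simp add: divide_ennreal_def)
  qed simp
qed

lemma integral_PiM_centred:
  fixes f :: "(nat \<Rightarrow> real) \<Rightarrow> real"
  assumes "f \<in> borel_measurable (PiM {..<s} (\<lambda>_. borel))"
  shows "(LINT y|PiM {..<s} (\<lambda>_. centred). f y) = (LINT y:Xi_s s|PiM {..<s} (\<lambda>_. lborel). f y)"
proof -
  have "f \<in> borel_measurable (PiM {..<s} (\<lambda>_. lborel))"
    using assms by (simp cong: measurable_cong_sets sets_PiM_cong)
  then show ?thesis
    unfolding PiM_centred_eq by (intro integral_uniform_measure_one Xi_s_sets emeasure_Xi_s)
qed

section \<open>Parametric derivatives of state and adjoint state\<close>

locale adjoint_problem = galerkin_space \<Omega> V E c1 c2
  for \<Omega> :: "'a::euclidean_space set" and V E :: "('a \<Rightarrow> real) set" and c1 c2 :: real +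
  fixes abar u0 z :: "'a \<Rightarrow> real" and \<psi> :: "nat \<Rightarrow> 'a \<Rightarrow> real" and amin amax :: real and s :: nat
  assumes u0: "u0 \<in> L2 \<Omega>" and z: "z \<in> L2 \<Omega>"
    and abar: "abar \<in> Linf \<Omega>" and \<psi>: "\<And>j. \<psi> j \<in> Linf \<Omega>" and amin: "0 < amin"
    and bounds: "\<And>y. y \<in> Xi \<Longrightarrow> AE x in lebesgue_on \<Omega>. amin \<le> diffusion abar \<psi> y x \<and> diffusion abar \<psi> y x \<le> amax"
begin

definition b :: "nat \<Rightarrow> real" where "b j = Linf_norm \<Omega> (\<psi> j) / amin"

lemma b_nonneg: "0 \<le> b j"
  using Linf_norm_nonneg[OF \<psi>] amin by (simp add: b_def)

lemma zero_ext_Xi: "y \<in> cube s \<Longrightarrow> zero_ext s y \<in> Xi"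
  by (auto simp: cube_def Xi_def zero_ext_def)

sublocale C: coercive_family V E "bform \<Omega> (\<lambda>_. 1)" "bform \<Omega> abar" "\<lambda>j. bform \<Omega> (\<psi> j)" s "\<lambda>j. Linf_norm \<Omega> (\<psi> j)" amin
proof
  note adm = admissible_Linf[OF abar] admissible_Linf[OF \<psi>]
  show "finite E" "V = span E" by (rule fin)+
  show "sym_bilinear_on V (bform \<Omega> (\<lambda>_. 1))" by (intro bform_bilinear admissible_const)
  show "0 < bform \<Omega> (\<lambda>_. 1) v v" if "v \<in> V" "v \<noteq> 0" for v by (rule bform_one_pos[OF that])
  show "sym_bilinear_on V (bform \<Omega> abar)" by (intro bform_bilinear adm)
  show "sym_bilinear_on V (bform \<Omega> (\<psi> j))" for j by (intro bform_bilinear adm)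
  show "\<bar>bform \<Omega> (\<psi> j) u v\<bar> \<le> Linf_norm \<Omega> (\<psi> j) * sqrt (bform \<Omega> (\<lambda>_. 1) u u) * sqrt (bform \<Omega> (\<lambda>_. 1) v v)"
    if "u \<in> V" "v \<in> V" for j u v
    unfolding H01_norm_eq[symmetric]
    by (rule bform_le[OF that _ Linf_AE[OF \<psi>] Linf_norm_nonneg[OF \<psi>]]) (use \<psi> in \<open>simp add: Linf_def\<close>)
  show "0 \<le> Linf_norm \<Omega> (\<psi> j)" for j by (rule Linf_norm_nonneg[OF \<psi>])
  show "0 < amin" by (rule amin)
  fix y v assume y: "y \<in> cube s" and v: "v \<in> V"
  \<comment> \<open>The bounds on the coefficient concern sequences in \<open>Xi\<close>, of which
    the zero extension of a cube point is one.\<close>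
  note bd = bounds[OF zero_ext_Xi[OF y]]
  have "amin * bform \<Omega> (\<lambda>_. 1) v v \<le> bform \<Omega> (diffusion abar \<psi> (zero_ext s y)) v v"
    using bd by (intro bform_coercive[OF v admissible_diffusion[OF adm bd]]) auto
  then show "amin * bform \<Omega> (\<lambda>_. 1) v v \<le> bform \<Omega> abar v v + (\<Sum>j<s. y j * bform \<Omega> (\<psi> j) v v)"
    unfolding bform_diffusion[OF v v adm] .
qed

lemma nrm_eq: "C.nrm v = H01_norm \<Omega> v"
  by (simp add: C.nrm_def H01_norm_eq)

lemma galerkin_sol:
  assumes "\<And>v. v \<in> V \<Longrightarrow> F v = G v"
  shows "galerkin \<Omega> (diffusion abar \<psi> (zero_ext s y)) V F = C.sol y G"
proof -
  have "(u \<in> V \<and> (\<forall>v\<in>V. bform \<Omega> (diffusion abar \<psi> (zero_ext s y)) u v = F v)) \<longleftrightarrow> (u \<in> V \<and> (\<forall>v\<in>V. C.A y u v = G v))" for u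
    using assms bform_diffusion[where u = u and s = s and y = y, OF _ _ admissible_Linf[OF abar] admissible_Linf[OF \<psi>]] unfolding C.A_def by auto
  then show ?thesis unfolding galerkin_def C.sol_def by simp
qed

definition state_load :: "nat set \<Rightarrow> (nat \<Rightarrow> real) \<Rightarrow> ('a \<Rightarrow> real) \<Rightarrow> real" where
  "state_load U y v = (if U = {} then L2_inner \<Omega> z v else 0)"

text \<open>\<open>state_deriv U y\<close> and \<open>adjoint_deriv U y\<close> are the mixed first derivatives of the discrete state and of
  the discrete adjoint state with respect to the parameters in \<open>U\<close>.\<close>

definition "state_deriv = C.tower state_load"

definition adjoint_load :: "nat set \<Rightarrow> (nat \<Rightarrow> real) \<Rightarrow> ('a \<Rightarrow> real) \<Rightarrow> real" where
  "adjoint_load U y v = L2_inner \<Omega> (state_deriv U y) v - (if U = {} then L2_inner \<Omega> u0 v else 0)"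

definition "adjoint_deriv = C.tower adjoint_load"

lemma state_load_regular: "C.regular_functionals state_load"
  using C.regular_const[OF L2_inner_functional[OF z]] by (simp add: state_load_def[abs_def])

lemma state_regular: "C.regular_vectors state_deriv"
  unfolding state_deriv_def by (rule C.tower_regular[OF state_load_regular])

lemma L2_inner_V_le: "\<bar>L2_inner \<Omega> w v\<bar> \<le> c1 * c2 * C.nrm w * C.nrm v" if w: "w \<in> V" and v: "v \<in> V" for w v
proof -
  have "\<bar>L2_inner \<Omega> w v\<bar> \<le> c1 * L2_norm \<Omega> w * H01_norm \<Omega> v" by (rule dual_pairing_le[OF in_L2[OF w] v])
  also have "\<dots> \<le> c1 * (c2 * H01_norm \<Omega> w) * H01_norm \<Omega> v"
    using c1(1) c2(2)[of w] V w H01_norm_nonneg[of v] by (intro mult_right_mono mult_left_mono) auto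
  finally show ?thesis by (simp add: nrm_eq mult.assoc)
qed

lemma adjoint_load_regular: "C.regular_functionals adjoint_load"
  unfolding adjoint_load_def[abs_def]
  by (intro C.regular_functionals_diff C.regular_ip[OF state_regular L2_inner_bilinear L2_inner_V_le] C.regular_const L2_inner_functional u0)
     (use c1(1) c2(1) in auto)

lemma adjoint_regular: "C.regular_vectors adjoint_deriv"
  unfolding adjoint_deriv_def by (rule C.tower_regular[OF adjoint_load_regular])

text \<open>The member \<open>U = {}\<close> of a tower is the Galerkin solution itself, and on
  \<open>Xi_s\<close> clamping agrees with zero extension.\<close>

lemma q_sh_eq:
  assumes y: "y \<in> Xi_s s"
  shows "q_sh \<Omega> abar \<psi> V u0 z s y = adjoint_deriv {} (clamp_cube s y)"
proof -
  let ?y = "clamp_cube s y"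
  have yc: "?y \<in> cube s" by (rule clamp_cube_in)
  have ze: "zero_ext s y = zero_ext s ?y" using clamp_cube_Xi_s[OF y] by (auto simp: zero_ext_def)
  have u: "u_sh \<Omega> abar \<psi> V z s y = state_deriv {} ?y"
    unfolding u_sh_def ze state_deriv_def by (subst C.tower.simps) (auto intro!: galerkin_sol simp: state_load_def)
  have uV: "state_deriv {} ?y \<in> V" by (rule C.regular_vectorsD(1)[OF state_regular _ yc]) simp
  \<comment> \<open>The empty sum is kept so that the right-hand side is literally the load in the
    unfolded equation for \<open>tower\<close>.\<close>
  have i: "L2_inner \<Omega> (\<lambda>x. state_deriv {} ?y x - u0 x) w = adjoint_load {} ?y w - (\<Sum>j\<in>{}. bform \<Omega> (\<psi> j) (adjoint_deriv ({} - {j}) ?y) w)"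
    if w: "w \<in> V" for w
    using integrable_L2_mult[OF in_L2[OF uV] in_L2[OF w]] integrable_L2_mult[OF u0 in_L2[OF w]]
    by (simp add: adjoint_load_def L2_inner_def left_diff_distrib)
  have "adjoint_deriv {} ?y = C.sol ?y (\<lambda>w. adjoint_load {} ?y w - (\<Sum>j\<in>{}. bform \<Omega> (\<psi> j) (adjoint_deriv ({} - {j}) ?y) w))"
    unfolding adjoint_deriv_def by (subst C.tower.simps) simp
  also have "\<dots> = galerkin \<Omega> (diffusion abar \<psi> (zero_ext s ?y)) V (\<lambda>w. L2_inner \<Omega> (\<lambda>x. state_deriv {} ?y x - u0 x) w)"
    by (rule galerkin_sol[OF i, symmetric])
  finally show ?thesis unfolding q_sh_def u ze by simp
qed

text \<open>The load of the state is independent of the parameters, so all growth comes from the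
  recurrence \<open>d (Suc n) = real (Suc n) * d n\<close>, which gives a plain factorial.\<close>

lemma state_bound:
  assumes U: "U \<subseteq> {..<s}" and y: "y \<in> cube s"
  shows "C.nrm (state_deriv U y) \<le> fact (card U) * (c1 * L2_norm \<Omega> z / amin) * (\<Prod>j\<in>U. b j)"
proof -
  define K where "K = c1 * L2_norm \<Omega> z / amin"
  have K: "0 \<le> K" using c1(1) amin L2_norm_nonneg[of \<Omega> z] by (simp add: K_def)
  show ?thesis unfolding state_deriv_def b_def K_def[symmetric]
  proof (rule C.tower_factorial_bound[OF state_load_regular U y, where c = "\<lambda>n. if n = 0 then K else 0"])
    fix W v assume W: "W \<subseteq> {..<s}" and v: "v \<in> V"
    have fW: "finite W" using W by (rule finite_subset) simp
    show "\<bar>state_load W y v\<bar> \<le> amin * ((if card W = 0 then K else 0) * (\<Prod>j\<in>W. Linf_norm \<Omega> (\<psi> j) / amin)) * C.nrm v"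
      using dual_pairing_le[OF z v] fW amin by (auto simp: state_load_def nrm_eq K_def)
  qed (use K in \<open>simp_all add: algebra_simps\<close>)
qed

text \<open>\<open>z\<close> passes through two solves, which gives
  \<open>c1\<^sup>2 * c2 / amin\<^sup>2\<close>, and \<open>u0\<close> through one, which gives
  \<open>c1 / amin\<close>; \<open>C_q\<close> is the maximum of the two. The load now grows like
  \<open>fact n\<close>, and \<open>fact n + real n * fact n = fact (n + 1)\<close> explains the
  shift in the factorial.\<close>

lemma adjoint_bound:
  assumes U: "U \<subseteq> {..<s}" and y: "y \<in> cube s"
  shows "C.nrm (adjoint_deriv U y) \<le> fact (card U + 1) * (C_q c1 c2 amin * (L2_norm \<Omega> z + L2_norm \<Omega> u0)) * (\<Prod>j\<in>U. b j)"
proof -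
  let ?Z = "L2_norm \<Omega> z" and ?N = "L2_norm \<Omega> u0"
  define K where "K = C_q c1 c2 amin * (?Z + ?N)"
  define K1 where "K1 = c1\<^sup>2 * c2 / amin\<^sup>2 * ?Z"
  define K2 where "K2 = c1 / amin * ?N"
  have Z: "0 \<le> ?Z" "0 \<le> ?N" by (rule L2_norm_nonneg)+
  have K12: "0 \<le> K1" "0 \<le> K2" using Z c1(1) c2(1) amin by (auto simp: K1_def K2_def)
  have "K1 \<le> C_q c1 c2 amin * ?Z" "K2 \<le> C_q c1 c2 amin * ?N"
    unfolding K1_def K2_def C_q_def
    by (rule mult_right_mono[OF max.cobounded2 Z(1)], rule mult_right_mono[OF max.cobounded1 Z(2)])
  then have K: "K1 + K2 \<le> K" unfolding K_def by (simp add: distrib_left)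
  have "C.nrm (adjoint_deriv U y) \<le> fact (card U + 1) * K * (\<Prod>j\<in>U. b j)"
    unfolding adjoint_deriv_def b_def
  proof (rule C.tower_factorial_bound[OF adjoint_load_regular U y, where c = "\<lambda>n. fact n * K1 + (if n = 0 then K2 else 0)" and d = "\<lambda>n. fact (n + 1) * K"])
    fix W v assume W: "W \<subseteq> {..<s}" and v: "v \<in> V"
    have fW: "finite W" using W by (rule finite_subset) simp
    let ?P = "\<Prod>j\<in>W. Linf_norm \<Omega> (\<psi> j) / amin"
    have sV: "state_deriv W y \<in> V" by (rule C.regular_vectorsD(1)[OF state_regular W y])
    have v0: "0 \<le> C.nrm v" by (rule C.nrm_nonneg[OF v])
    have "\<bar>L2_inner \<Omega> (state_deriv W y) v\<bar> \<le> c1 * c2 * C.nrm (state_deriv W y) * C.nrm v" by (rule L2_inner_V_le[OF sV v])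
    also have "\<dots> \<le> c1 * c2 * (fact (card W) * (c1 * ?Z / amin) * ?P) * C.nrm v"
      using state_bound[OF W y] c1(1) c2(1) v0 unfolding b_def by (intro mult_right_mono mult_left_mono) auto
    also have "\<dots> = amin * (fact (card W) * K1 * ?P) * C.nrm v"
      using amin by (simp add: K1_def power2_eq_square)
    finally have 1: "\<bar>L2_inner \<Omega> (state_deriv W y) v\<bar> \<le> amin * (fact (card W) * K1 * ?P) * C.nrm v" .
    have 2: "\<bar>if W = {} then L2_inner \<Omega> u0 v else 0\<bar> \<le> amin * ((if card W = 0 then K2 else 0) * ?P) * C.nrm v"
      using dual_pairing_le[OF u0 v] fW amin by (auto simp: nrm_eq K2_def)
    show "\<bar>adjoint_load W y v\<bar> \<le> amin * ((fact (card W) * K1 + (if card W = 0 then K2 else 0)) * ?P) * C.nrm v"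
      unfolding adjoint_load_def distrib_right distrib_left using 1 2 by linarith
  next
    show "fact 0 * K1 + (if (0::nat) = 0 then K2 else 0) \<le> fact (0 + 1) * K" using K by simp
  next
    fix n
    have "fact (Suc n) * K1 \<le> fact (Suc n) * K" using K K12 by (intro mult_left_mono) auto
    moreover have "fact (Suc n) * K + real (Suc n) * (fact (n + 1) * K) = fact (Suc n + 1) * K"
      by (simp add: algebra_simps)
    ultimately show "fact (Suc n) * K1 + (if Suc n = 0 then K2 else 0) + real (Suc n) * (fact (n + 1) * K) \<le> fact (Suc n + 1) * K"
      by (simp only: nat.distinct if_False add_0_right)
  next
    fix n :: nat show "0 \<le> fact (n + 1) * K" using K K12 by simp
  qed
  then show ?thesis by (simp add: K_def)
qed

section \<open>The root-mean-square error of the adjoint state\<close>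

definition qconst :: real where "qconst = C_q c1 c2 amin * (L2_norm \<Omega> z + L2_norm \<Omega> u0)"

lemma qconst_nonneg: "0 \<le> qconst"
  unfolding qconst_def C_q_def using c1(1) amin L2_norm_nonneg[of \<Omega> z] L2_norm_nonneg[of \<Omega> u0]
  by (intro mult_nonneg_nonneg) (auto simp: le_max_iff_disj)

text \<open>The factor \<open>c2\<close> passes from the \<open>H01\<close> norm to the
  \<open>L2\<close> norm. It is squared along with the rest and leaves the square root as
  \<open>c2\<close>.\<close>

definition dbound :: "nat set \<Rightarrow> real" where
  "dbound U = c2 * (fact (card U + 1) * qconst * (\<Prod>j\<in>U. b j))"

lemma adjoint_in: "U \<subseteq> {..<s} \<Longrightarrow> y \<in> cube s \<Longrightarrow> adjoint_deriv U y \<in> V"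
  by (rule C.regular_vectorsD(1)[OF adjoint_regular])

lemma adjoint_L2_bound:
  assumes U: "U \<subseteq> {..<s}" and y: "y \<in> cube s"
  shows "L2_norm \<Omega> (adjoint_deriv U y) \<le> dbound U"
proof -
  have "L2_norm \<Omega> (adjoint_deriv U y) \<le> c2 * H01_norm \<Omega> (adjoint_deriv U y)"
    using adjoint_in[OF U y] V by (intro c2(2)) auto
  also have "\<dots> \<le> dbound U"
    using adjoint_bound[OF U y] c2(1) by (simp add: dbound_def qconst_def nrm_eq)
  finally show ?thesis .
qed

text \<open>Ensures the convention that a vanishing weight goes with a vanishing derivative.\<close>

lemma adjoint_zero:
  assumes U: "U \<subseteq> {..<s}" and y: "y \<in> cube s" and j: "j \<in> U" "b j = 0"
  shows "adjoint_deriv U y = 0"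
proof -
  have "finite U" using U by (rule finite_subset) simp
  then have "(\<Prod>j\<in>U. b j) = 0" using j by auto
  then show ?thesis using C.nrm_eq_0[OF adjoint_in[OF U y]] adjoint_bound[OF U y] by simp
qed

text \<open>Elements of \<open>V\<close> are genuine functions, so point evaluation is a linear
  functional, and a bounded one by finite dimension; it reduces the error analysis to scalar
  integrands.\<close>

lemma functional_eval: "functional_on V (\<lambda>v. v x)"
  by (simp add: functional_on_def)

text \<open>Interchange of the integrals over \<open>\<Omega>\<close> and over the cube by finite
  dimension: in coordinates the square is a finite sum of products of a function of \<open>y\<close>
  and a function of \<open>x\<close>, so linearity of the integral is enough.\<close>

lemma adjoint_square_integral:
  assumes U: "U \<subseteq> {..<s}"
  shows "integrable M (\<lambda>x. LINT y|PiM {..<s} (\<lambda>_. centred). (adjoint_deriv U (clamp_cube s y) x)\<^sup>2)"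
    and "(LINT x|M. LINT y|PiM {..<s} (\<lambda>_. centred). (adjoint_deriv U (clamp_cube s y) x)\<^sup>2) \<le> (dbound U)\<^sup>2"
proof -
  let ?P = "PiM {..<s} (\<lambda>_. centred)"
  interpret Q: prob_space ?P by (rule prob_space_PiM) (rule prob_space_centred)
  \<comment> \<open>A basis, since coordinates with respect to a merely spanning set would not be
    well defined as linear functionals.\<close>
  obtain D where D: "D \<subseteq> V" "independent D" "V \<subseteq> span D" by (rule basis_exists[of V])
  have "D \<subseteq> span E" using D(1) fin(2) by simp
  from independent_span_bound[OF fin(1) D(2) this] have fD: "finite D" ..
  have spanD: "span D = V" by (rule span_subspace[OF D(1,3) sub])
  define l where "l e v = representation D v e" for e and v :: "'a \<Rightarrow> real"
  have lf: "functional_on V (l e)" for e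
    unfolding functional_on_def l_def spanD[symmetric] using D(2) by (simp add: representation_add representation_scale)
  have expand: "v x = (\<Sum>e\<in>D. l e v * e x)" if "v \<in> V" for v x
  proof -
    have "(\<Sum>e\<in>D. l e v *\<^sub>R e) = v" unfolding l_def
      using that spanD by (intro sum_representation_eq D(2) fD) auto
    then have "v x = (\<Sum>e\<in>D. l e v *\<^sub>R e) x" by simp
    also have "\<dots> = (\<Sum>e\<in>D. l e v * e x)" unfolding sum_fun_apply by simp
    finally show ?thesis .
  qed
  define a where "a y = adjoint_deriv U (clamp_cube s y)" for y
  have aV: "a y \<in> V" for y unfolding a_def by (rule adjoint_in[OF U clamp_cube_in])
  have int_l: "integrable ?P (\<lambda>y. l e (a y) * l e' (a y))" for e e'
  proof -
    obtain C1 where "mixed_family s (\<lambda>U y. l e (adjoint_deriv U (clamp_cube s y))) C1"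
      using C.mixed_family_of_vectors[OF adjoint_regular lf] by blast
    then interpret F1: mixed_family s "\<lambda>U y. l e (adjoint_deriv U (clamp_cube s y))" C1 .
    obtain C2 where "mixed_family s (\<lambda>U y. l e' (adjoint_deriv U (clamp_cube s y))) C2"
      using C.mixed_family_of_vectors[OF adjoint_regular lf] by blast
    then interpret F2: mixed_family s "\<lambda>U y. l e' (adjoint_deriv U (clamp_cube s y))" C2 .
    have m: "(\<lambda>y. l e (a y)) \<in> borel_measurable ?P" "(\<lambda>y. l e' (a y)) \<in> borel_measurable ?P"
      using F1.meas[OF U] F2.meas[OF U] by (simp_all add: measurable_PiM_centred a_def)
    show ?thesis
    proof (rule Q.integrable_const_bound[where B = "C1 * C2"])
      have "norm (l e (a y) * l e' (a y)) \<le> C1 * C2" for y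
        unfolding real_norm_def abs_mult a_def
        using F1.bdd[OF U, of y] F2.bdd[OF U, of y] by (intro mult_mono) auto
      then show "AE y in ?P. norm (l e (a y) * l e' (a y)) \<le> C1 * C2" by (rule AE_I2)
    qed (use m in measurable)
  qed
  have sq: "(a y x)\<^sup>2 = (\<Sum>e\<in>D. \<Sum>e'\<in>D. (l e (a y) * l e' (a y)) * (e x * e' x))" for y x
    unfolding expand[OF aV, of y x] power2_eq_square sum_product by (simp add: mult_ac)
  have eL2: "e \<in> L2 \<Omega>" if "e \<in> D" for e using that D(1) in_L2 by blast
  have inner: "(LINT y|?P. (a y x)\<^sup>2) = (\<Sum>e\<in>D. \<Sum>e'\<in>D. (LINT y|?P. l e (a y) * l e' (a y)) * (e x * e' x))" for x
    unfolding sq using int_l by simp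
  have iM: "integrable M (\<lambda>x. e x * e' x)" if "e \<in> D" "e' \<in> D" for e e'
    by (rule integrable_L2_mult[OF eL2[OF that(1)] eL2[OF that(2)]])
  show "integrable M (\<lambda>x. LINT y|?P. (adjoint_deriv U (clamp_cube s y) x)\<^sup>2)"
    unfolding a_def[symmetric] inner
    by (intro Bochner_Integration.integrable_sum integrable_mult_right iM)
  have "(LINT x|M. LINT y|?P. (a y x)\<^sup>2) = (\<Sum>e\<in>D. \<Sum>e'\<in>D. (LINT y|?P. l e (a y) * l e' (a y)) * (LINT x|M. e x * e' x))"
    unfolding inner using iM by simp
  also have "\<dots> = (\<Sum>e\<in>D. \<Sum>e'\<in>D. LINT y|?P. (l e (a y) * l e' (a y)) * (LINT x|M. e x * e' x))" by simp
  also have "\<dots> = (LINT y|?P. (\<Sum>e\<in>D. \<Sum>e'\<in>D. (l e (a y) * l e' (a y)) * (LINT x|M. e x * e' x)))"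
    using int_l by (simp add: Bochner_Integration.integral_sum)
  also have "\<dots> = (LINT y|?P. LINT x|M. (a y x)\<^sup>2)"
    unfolding sq using iM by simp
  also have "\<dots> \<le> (LINT y|?P. (dbound U)\<^sup>2)"
  proof (rule integral_mono')
    fix y
    have "(LINT x|M. (a y x)\<^sup>2) = (L2_norm \<Omega> (a y))\<^sup>2" by (simp add: L2_norm_square)
    also have "\<dots> \<le> (dbound U)\<^sup>2"
      unfolding a_def by (intro power_mono adjoint_L2_bound[OF U clamp_cube_in] L2_norm_nonneg)
    finally show "(LINT x|M. (a y x)\<^sup>2) \<le> (dbound U)\<^sup>2" .
  qed auto
  finally show "(LINT x|M. LINT y|?P. (adjoint_deriv U (clamp_cube s y) x)\<^sup>2) \<le> (dbound U)\<^sup>2"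
    unfolding a_def by (simp add: Q.prob_space)
qed

text \<open>In the scalar estimate at a point \<open>x\<close> the factor \<open>shift_wce\<close>
  is independent of \<open>x\<close>, and the factor \<open>S x\<close> is independent of the shift.
  Integrating over \<open>\<Omega>\<close> and over the shift therefore acts on one factor
  each.\<close>

lemma rmse_le_wce:
  assumes n: "1 \<le> n" and \<gamma>: "\<And>U. 0 \<le> \<gamma> U"
    and \<gamma>0: "\<And>U. U \<subseteq> {..<s} \<Longrightarrow> \<gamma> U = 0 \<Longrightarrow> \<exists>j\<in>U. b j = 0"
  shows "rmse \<Omega> abar \<psi> V u0 z s n g
    \<le> sqrt (\<Sum>U\<in>Pow {..<s} - {{}}. 1 / \<gamma> U * (dbound U)\<^sup>2) * sqrt (sq_wce \<gamma> n s g)"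
proof -
  let ?P = "PiM {..<s} (\<lambda>_. centred)" and ?c = "clamp_cube s"
  let ?W = "shift_wce \<gamma> s n g"
  define R where "R = (\<Sum>U\<in>Pow {..<s} - {{}}. 1 / \<gamma> U * (dbound U)\<^sup>2)"
  define err where "err \<Delta> x = (LINT y:Xi_s s|PiM {..<s} (\<lambda>_. lborel). q_sh \<Omega> abar \<psi> V u0 z s y x)
        - 1 / real n * (\<Sum>i = 1..n. q_sh \<Omega> abar \<psi> V u0 z s (lattice_point s n g \<Delta> i) x)" for \<Delta> x
  define S where "S x = (\<Sum>U\<in>Pow {..<s} - {{}}. 1 / \<gamma> U * (LINT y|?P. (adjoint_deriv U (?c y) x)\<^sup>2))" for x
  have W0: "0 \<le> ?W \<Delta>" for \<Delta> by (rule shift_wce_nonneg[OF \<gamma>])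
  have S0: "0 \<le> S x" for x unfolding S_def using \<gamma> by (intro sum_nonneg mult_nonneg_nonneg) auto
  have R0: "0 \<le> R" unfolding R_def using \<gamma> by (intro sum_nonneg mult_nonneg_nonneg) auto
  have pt: "(err \<Delta> x)\<^sup>2 \<le> ?W \<Delta> * S x" for \<Delta> x
  proof -
    obtain C where "mixed_family s (\<lambda>U y. adjoint_deriv U (?c y) x) C"
      using C.mixed_family_of_vectors[OF adjoint_regular functional_eval] by blast
    then interpret F: mixed_family s "\<lambda>U y. adjoint_deriv U (?c y) x" C .
    have "(LINT y:Xi_s s|PiM {..<s} (\<lambda>_. lborel). q_sh \<Omega> abar \<psi> V u0 z s y x)
        = (LINT y:Xi_s s|PiM {..<s} (\<lambda>_. lborel). adjoint_deriv {} (?c y) x)"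
      by (rule set_lebesgue_integral_cong[OF Xi_s_sets]) (simp add: q_sh_eq)
    also have "\<dots> = (LINT y|?P. adjoint_deriv {} (?c y) x)"
      by (rule integral_PiM_centred[symmetric]) (rule F.meas, simp)
    finally have e: "err \<Delta> x = (LINT y|?P. adjoint_deriv {} (?c y) x) - 1 / real n * (\<Sum>i=1..n. adjoint_deriv {} (?c (lattice_point s n g \<Delta> i)) x)"
      unfolding err_def by (simp add: q_sh_eq[OF lattice_point_Xi_s])
    show ?thesis unfolding e S_def
    proof (rule F.lattice_error_bound[OF n \<gamma>])
      fix U y assume "U \<subseteq> {..<s}" "\<gamma> U = 0"
      then obtain j where "j \<in> U" "b j = 0" using \<gamma>0 by blast
      then show "adjoint_deriv U (?c y) x = 0" using adjoint_zero[OF \<open>U \<subseteq> {..<s}\<close> clamp_cube_in] by simp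
    qed
  qed
  have intS: "integrable M S" unfolding S_def
    by (intro Bochner_Integration.integrable_sum integrable_mult_right adjoint_square_integral(1)) auto
  have "(LINT x|M. S x) = (\<Sum>U\<in>Pow {..<s} - {{}}. 1 / \<gamma> U * (LINT x|M. LINT y|?P. (adjoint_deriv U (?c y) x)\<^sup>2))"
    unfolding S_def using adjoint_square_integral(1) by (subst Bochner_Integration.integral_sum) auto
  also have "\<dots> \<le> R"
    unfolding R_def using \<gamma> by (intro sum_mono mult_left_mono adjoint_square_integral(2)) auto
  finally have SR: "(LINT x|M. S x) \<le> R" .
  have L: "(L2_norm \<Omega> (err \<Delta>))\<^sup>2 \<le> ?W \<Delta> * R" for \<Delta>
  proof -
    have "(L2_norm \<Omega> (err \<Delta>))\<^sup>2 = (LINT x|M. (err \<Delta> x)\<^sup>2)" by (simp add: L2_norm_square)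
    also have "\<dots> \<le> (LINT x|M. ?W \<Delta> * S x)"
      using intS pt W0 S0 by (intro integral_mono') auto
    also have "\<dots> \<le> ?W \<Delta> * R" using SR W0 by (simp add: mult_left_mono)
    finally show ?thesis .
  qed
  \<comment> \<open>\<open>integral_mono'\<close> asks for integrability of the majorant alone; a
    non-integrable left-hand side would have the integral \<open>0\<close>.\<close>
  have "(LINT \<Delta>|shift_measure s. (L2_norm \<Omega> (err \<Delta>))\<^sup>2) \<le> (LINT \<Delta>|shift_measure s. ?W \<Delta> * R)"
    using integral_shift_wce(1)[OF n] L W0 R0 by (intro integral_mono') auto
  also have "\<dots> = R * sq_wce \<gamma> n s g" using integral_shift_wce(2)[OF n, of s \<gamma> g] by simp
  finally have "sqrt (LINT \<Delta>|shift_measure s. (L2_norm \<Omega> (err \<Delta>))\<^sup>2) \<le> sqrt (R * sq_wce \<gamma> n s g)" by simp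
  then show ?thesis unfolding rmse_def err_def[symmetric] R_def real_sqrt_mult by simp
qed

lemma rmse_cbc:
  assumes m: "1 \<le> m" and lam: "1 / 2 < lam" "lam < 1" and cbc: "cbc_vector (weight b lam) (2 ^ m) s g"
  shows "rmse \<Omega> abar \<psi> V u0 z s (2 ^ m) g
    \<le> c2 * C_gamma (weight b lam) b s lam * (2 / real (2 ^ m)) powr (1 / (2 * lam)) * qconst"
proof -
  let ?\<gamma> = "weight b lam"
  let ?Q = "\<Sum>U\<in>Pow {..<s}. (fact (card U + 1))\<^sup>2 / ?\<gamma> U * (\<Prod>j\<in>U. (b j)\<^sup>2)"
  let ?S = "\<Sum>U\<in>Pow {..<s}. ?\<gamma> U powr lam * rho lam ^ card U"
  let ?R = "\<Sum>U\<in>Pow {..<s} - {{}}. 1 / ?\<gamma> U * (dbound U)\<^sup>2"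
  let ?E = "sq_wce ?\<gamma> (2 ^ m) s g"
  have rho: "0 < rho lam" by (rule rho_pos[OF lam(1)])
  have g0: "\<exists>j\<in>U. b j = 0" if U: "U \<subseteq> {..<s}" and "?\<gamma> U = 0" for U
  proof -
    have fU: "finite U" using U by (rule finite_subset) simp
    have "fact (card U + 1) * (\<Prod>j\<in>U. b j / rho lam powr (1/2)) = 0" using that(2) by (simp add: weight_def)
    then have "(\<Prod>j\<in>U. b j / rho lam powr (1/2)) = 0" by simp
    then show ?thesis using rho fU by (auto simp: prod_zero_iff)
  qed
  have n: "1 \<le> (2::nat) ^ m" by simp
  have "rmse \<Omega> abar \<psi> V u0 z s (2 ^ m) g \<le> sqrt ?R * sqrt ?E"
    by (rule rmse_le_wce[OF n weight_nonneg g0])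
  also have "\<dots> \<le> (c2 * qconst * ?Q powr (1/2)) * ((2 / real (2 ^ m)) powr (1 / (2 * lam)) * ?S powr (1 / (2 * lam)))"
  proof (rule mult_mono)
    have Q0: "0 \<le> ?Q" using weight_nonneg by (intro sum_nonneg mult_nonneg_nonneg prod_nonneg divide_nonneg_nonneg) auto
    \<comment> \<open>The empty set is added to arrive at the second sum in
      \<open>C_gamma\<close>.\<close>
    have "?R \<le> (\<Sum>U\<in>Pow {..<s}. 1 / ?\<gamma> U * (dbound U)\<^sup>2)"
      using weight_nonneg by (intro sum_mono2) auto
    also have "\<dots> = (c2 * qconst)\<^sup>2 * ?Q"
      unfolding sum_distrib_left
      by (intro sum.cong refl) (simp add: dbound_def power_mult_distrib prod_power_distrib)
    finally have "sqrt ?R \<le> sqrt ((c2 * qconst)\<^sup>2 * ?Q)" by simp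
    also have "\<dots> = c2 * qconst * ?Q powr (1/2)"
      using c2(1) qconst_nonneg Q0 by (simp add: real_sqrt_mult powr_half_sqrt)
    finally show "sqrt ?R \<le> c2 * qconst * ?Q powr (1/2)" .
    show "sqrt ?E \<le> (2 / real (2 ^ m)) powr (1 / (2 * lam)) * ?S powr (1 / (2 * lam))"
      using lam by (intro cbc_sq_wce_power_2[OF m weight_nonneg _ _ cbc]) auto
    show "0 \<le> c2 * qconst * ?Q powr (1/2)" using c2(1) qconst_nonneg by simp
    show "0 \<le> sqrt ?E"
    proof -
      have "2 \<le> (2::nat) ^ m" using m by (cases m) auto
      then show ?thesis using cbc_sq_wce_bound[OF _ weight_nonneg lam(1) _ cbc order_refl] lam by simp
    qed
  qed
  finally show ?thesis unfolding C_gamma_def by (simp only: mult_ac)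
qed

end

theorem theorem5p9:
  fixes \<Omega> :: "(real ^ 'd) set"
    and abar u0 zmin zmax z :: "real ^ 'd \<Rightarrow> real"
    and \<psi> :: "nat \<Rightarrow> real ^ 'd \<Rightarrow> real"
    and V :: "(real ^ 'd \<Rightarrow> real) set"
    and amin amax c1 c2 p :: real
    and b :: "nat \<Rightarrow> real"
  assumes dim: "CARD('d) \<in> {1, 2, 3}"
    and domain: "bounded_lipschitz_domain \<Omega>"
    and u0: "u0 \<in> L2 \<Omega>"
    and c1: "c1 > 0" "\<And>v. v \<in> L2 \<Omega> \<Longrightarrow> Hm1_norm \<Omega> v \<le> c1 * L2_norm \<Omega> v"
    and c2: "c2 > 0" "\<And>v. v \<in> H01 \<Omega> \<Longrightarrow> L2_norm \<Omega> v \<le> c2 * H01_norm \<Omega> v"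
    and zminmax: "zmin \<in> L2 \<Omega>" "zmax \<in> L2 \<Omega>" "AE x in lebesgue_on \<Omega>. zmin x \<le> zmax x"
    and z: "z \<in> control_set \<Omega> zmin zmax"
    and abar: "abar \<in> Linf \<Omega>"
    and \<psi>: "\<And>j. \<psi> j \<in> Linf \<Omega>" "summable (\<lambda>j. Linf_norm \<Omega> (\<psi> j))"
    and amin: "0 < amin"
    and diffusion_bounds: "\<And>y. y \<in> Xi \<Longrightarrow>
          AE x in lebesgue_on \<Omega>. amin \<le> diffusion abar \<psi> y x \<and> diffusion abar \<psi> y x \<le> amax"
    and b: "\<And>j. b j = Linf_norm \<Omega> (\<psi> j) / amin"
    and V: "fin_dim_subspace_H01 \<Omega> V"
    and p: "0 < p" "p < 1" "summable (\<lambda>j. Linf_norm \<Omega> (\<psi> j) powr p)"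
  shows
    "(\<forall>(lam, r) \<in> lambda_rate p.
        \<comment> \<open>the bound is finite independently of \<open>s\<close>\<close>
        bdd_above (range (\<lambda>s. C_gamma (weight b lam) b s lam)) \<and>
        (\<forall>n\<ge>1. bdd_above (range (\<lambda>s. sqrt c2 * C_gamma (weight b lam) b s lam *
            (2 / real n) powr (1 / (2 * lam)) * C_q c1 c2 amin * (L2_norm \<Omega> z + L2_norm \<Omega> u0)))) \<and>
        \<comment> \<open>it bounds the root-mean-square error\<close>
        (\<forall>s\<ge>1. \<forall>m\<ge>1. \<forall>g. cbc_vector (weight b lam) (2 ^ m) s g \<longrightarrow>
            rmse \<Omega> abar \<psi> V u0 z s (2 ^ m) g
              \<le> c2 * C_gamma (weight b lam) b s lam * (2 / real (2 ^ m)) powr (1 / (2 * lam)) *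
                 C_q c1 c2 amin * (L2_norm \<Omega> z + L2_norm \<Omega> u0)) \<and>
        (c2 \<le> 1 \<longrightarrow> (\<forall>s\<ge>1. \<forall>m\<ge>1. \<forall>g. cbc_vector (weight b lam) (2 ^ m) s g \<longrightarrow>
            rmse \<Omega> abar \<psi> V u0 z s (2 ^ m) g
              \<le> sqrt c2 * C_gamma (weight b lam) b s lam * (2 / real (2 ^ m)) powr (1 / (2 * lam)) *
                 C_q c1 c2 amin * (L2_norm \<Omega> z + L2_norm \<Omega> u0))) \<and>
        \<comment> \<open>the error is of order \<open>\<kappa>(n)\<close>, with a constant independent of \<open>s\<close>\<close>
        (\<exists>K. \<forall>s\<ge>1. \<forall>m\<ge>1. \<forall>g. cbc_vector (weight b lam) (2 ^ m) s g \<longrightarrow>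
            rmse \<Omega> abar \<psi> V u0 z s (2 ^ m) g \<le> K * real (2 ^ m) powr (- r))) \<and>
     \<comment> \<open>blow-up of the constant, for every \<open>s\<close> for which it is not identically \<open>1\<close>\<close>
     (\<forall>s. (\<exists>j<s. b j \<noteq> 0) \<longrightarrow>
        filterlim (\<lambda>\<delta>. C_gamma (weight b (1 / (2 - 2 * \<delta>))) b s (1 / (2 - 2 * \<delta>)))
          at_top (at_right 0) \<and>
        filterlim (\<lambda>p'. C_gamma (weight b (p' / (2 - p'))) b s (p' / (2 - p')))
          at_top (at_right (2/3)))"
proof -
  note Vd = V[unfolded fin_dim_subspace_H01_def]
  have VH: "V \<subseteq> H01 \<Omega>" by (rule conjunct1[OF Vd])
  from conjunct1[OF conjunct2[OF Vd]]
  obtain B where B: "finite B" "V = range (\<lambda>(c :: (real ^ 'd \<Rightarrow> real) \<Rightarrow> real) x. \<Sum>\<phi>\<in>B. c \<phi> * \<phi> x)"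
    by (elim exE conjE)
  have V0: "v = (\<lambda>x. 0)" if "v \<in> V" "AE x in lebesgue_on \<Omega>. v x = 0" for v
    by (rule conjunct2[OF conjunct2[OF Vd], rule_format, OF that])
  have VB: "V = span B"
  proof -
    have "(\<lambda>x. \<Sum>\<phi>\<in>B. c \<phi> * \<phi> x) = (\<Sum>\<phi>\<in>B. c \<phi> *\<^sub>R \<phi>)" for c
      by (rule ext) (simp add: sum_fun_apply)
    then show ?thesis unfolding B(2) span_finite[OF B(1)] by simp
  qed
  have \<Omega>: "\<Omega> \<in> lmeasurable"
    using domain unfolding bounded_lipschitz_domain_def by (intro lmeasurable_open) auto
  have zL2: "z \<in> L2 \<Omega>" using z by (simp add: control_set_def)
  interpret G: galerkin_space \<Omega> V B c1 c2
    by unfold_locales (use \<Omega> B(1) VB VH V0 c1 c2 in \<open>auto simp: zero_fun_def\<close>)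
  have AP: "adjoint_problem \<Omega> V B c1 c2 abar u0 z \<psi> amin amax"
    by unfold_locales (use u0 zL2 abar \<psi>(1) amin diffusion_bounds in auto)
  have beq: "adjoint_problem.b \<Omega> \<psi> amin = b"
    using adjoint_problem.b_def[OF AP] b by auto
  have b0: "0 \<le> b j" for j using adjoint_problem.b_nonneg[OF AP] unfolding beq .
  have qc: "adjoint_problem.qconst \<Omega> c1 c2 u0 z amin = C_q c1 c2 amin * (L2_norm \<Omega> z + L2_norm \<Omega> u0)"
    by (rule adjoint_problem.qconst_def[OF AP])
  define K where "K = C_q c1 c2 amin * (L2_norm \<Omega> z + L2_norm \<Omega> u0)"
  have K0: "0 \<le> K" using adjoint_problem.qconst_nonneg[OF AP] unfolding qc K_def .
  have rmse: "rmse \<Omega> abar \<psi> V u0 z s (2 ^ m) g \<le> c2 * C_gamma (weight b lam) b s lam * (2 / real (2 ^ m)) powr (1 / (2 * lam)) * K"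
    if "1 / 2 < lam" "lam < 1" "1 \<le> m" "cbc_vector (weight b lam) (2 ^ m) s g" for lam s m g
    using adjoint_problem.rmse_cbc[OF AP that(3,1,2), of s g] that(4) unfolding beq qc K_def by simp
  have sp: "summable (\<lambda>j. b j powr p)"
    unfolding b powr_divide by (intro summable_divide p(3))
  have C0: "0 \<le> C_gamma \<gamma> b s lam" for \<gamma> s lam by (simp add: C_gamma_def)
  have main: "bdd_above (range (\<lambda>s. C_gamma (weight b lam) b s lam)) \<and>
        (\<forall>n\<ge>1. bdd_above (range (\<lambda>s. sqrt c2 * C_gamma (weight b lam) b s lam *
            (2 / real n) powr (1 / (2 * lam)) * C_q c1 c2 amin * (L2_norm \<Omega> z + L2_norm \<Omega> u0)))) \<and>
        (\<forall>s\<ge>1. \<forall>m\<ge>1. \<forall>g. cbc_vector (weight b lam) (2 ^ m) s g \<longrightarrow>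
            rmse \<Omega> abar \<psi> V u0 z s (2 ^ m) g
              \<le> c2 * C_gamma (weight b lam) b s lam * (2 / real (2 ^ m)) powr (1 / (2 * lam)) *
                 C_q c1 c2 amin * (L2_norm \<Omega> z + L2_norm \<Omega> u0)) \<and>
        (c2 \<le> 1 \<longrightarrow> (\<forall>s\<ge>1. \<forall>m\<ge>1. \<forall>g. cbc_vector (weight b lam) (2 ^ m) s g \<longrightarrow>
            rmse \<Omega> abar \<psi> V u0 z s (2 ^ m) g
              \<le> sqrt c2 * C_gamma (weight b lam) b s lam * (2 / real (2 ^ m)) powr (1 / (2 * lam)) *
                 C_q c1 c2 amin * (L2_norm \<Omega> z + L2_norm \<Omega> u0))) \<and>
        (\<exists>K. \<forall>s\<ge>1. \<forall>m\<ge>1. \<forall>g. cbc_vector (weight b lam) (2 ^ m) s g \<longrightarrow>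
            rmse \<Omega> abar \<psi> V u0 z s (2 ^ m) g \<le> K * real (2 ^ m) powr (- r))"
    if lr: "(lam, r) \<in> lambda_rate p" for lam r
  proof (intro conjI allI impI)
    note l = lambda_rate[OF p(1,2) lr]
    obtain T where T: "\<And>s. C_gamma (weight b lam) b s lam \<le> T"
      using C_gamma_bounded[OF l(1,2) b0 summable_powr_mono_exponent[OF b0 p(1) l(3) sp]] by blast
    show "bdd_above (range (\<lambda>s. C_gamma (weight b lam) b s lam))" by (rule bdd_aboveI2[OF T])
    show "bdd_above (range (\<lambda>s. sqrt c2 * C_gamma (weight b lam) b s lam *
            (2 / real n) powr (1 / (2 * lam)) * C_q c1 c2 amin * (L2_norm \<Omega> z + L2_norm \<Omega> u0)))" for n :: nat
    proof (rule bdd_aboveI2)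
      fix s
      have "sqrt c2 * C_gamma (weight b lam) b s lam * (2 / real n) powr (1 / (2 * lam)) * K
          \<le> sqrt c2 * T * (2 / real n) powr (1 / (2 * lam)) * K"
        using c2(1) K0 T[of s] by (intro mult_right_mono mult_left_mono) auto
      then show "sqrt c2 * C_gamma (weight b lam) b s lam * (2 / real n) powr (1 / (2 * lam)) * C_q c1 c2 amin * (L2_norm \<Omega> z + L2_norm \<Omega> u0)
          \<le> sqrt c2 * T * (2 / real n) powr (1 / (2 * lam)) * K"
        by (simp only: K_def mult.assoc)
    qed
    show "rmse \<Omega> abar \<psi> V u0 z s (2 ^ m) g
              \<le> c2 * C_gamma (weight b lam) b s lam * (2 / real (2 ^ m)) powr (1 / (2 * lam)) *
                 C_q c1 c2 amin * (L2_norm \<Omega> z + L2_norm \<Omega> u0)"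
      if "1 \<le> m" "cbc_vector (weight b lam) (2 ^ m) s g" for s m g
      using rmse[OF l(1,2) that] by (simp only: K_def mult.assoc)
    show "rmse \<Omega> abar \<psi> V u0 z s (2 ^ m) g
              \<le> sqrt c2 * C_gamma (weight b lam) b s lam * (2 / real (2 ^ m)) powr (1 / (2 * lam)) *
                 C_q c1 c2 amin * (L2_norm \<Omega> z + L2_norm \<Omega> u0)"
      if "c2 \<le> 1" "1 \<le> m" "cbc_vector (weight b lam) (2 ^ m) s g" for s m g
    proof -
      have "c2 = sqrt c2 * sqrt c2" using c2(1) by simp
      also have "\<dots> \<le> sqrt c2 * 1" using that(1) c2(1) by (intro mult_left_mono) auto
      finally have "c2 \<le> sqrt c2" by simp
      then have "c2 * C_gamma (weight b lam) b s lam * (2 / real (2 ^ m)) powr (1 / (2 * lam)) * K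
          \<le> sqrt c2 * C_gamma (weight b lam) b s lam * (2 / real (2 ^ m)) powr (1 / (2 * lam)) * K"
        using C0 K0 by (intro mult_right_mono) auto
      from order_trans[OF rmse[OF l(1,2) that(2,3)] this] show ?thesis by (simp only: K_def mult.assoc)
    qed
    show "\<exists>K. \<forall>s\<ge>1. \<forall>m\<ge>1. \<forall>g. cbc_vector (weight b lam) (2 ^ m) s g \<longrightarrow>
            rmse \<Omega> abar \<psi> V u0 z s (2 ^ m) g \<le> K * real (2 ^ m) powr (- r)"
    \<comment> \<open>\<open>T\<close> bounds \<open>C_gamma\<close> in all dimensions at once.
      Since \<open>r = 1 / (2 * lam)\<close>, the power of \<open>2 / n\<close> splits into
      \<open>2 powr r\<close> and the rate.\<close>
    proof (intro exI[of _ "c2 * T * 2 powr r * K"] allI impI)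
      fix s m :: nat and g assume m: "1 \<le> m" and g: "cbc_vector (weight b lam) (2 ^ m) s g"
      have pw: "(2 / real (2 ^ m)) powr (1 / (2 * lam)) = 2 powr r * real (2 ^ m) powr (- r)"
        unfolding l(4)[symmetric] powr_divide by (simp only: powr_minus divide_inverse)
      have "rmse \<Omega> abar \<psi> V u0 z s (2 ^ m) g \<le> c2 * C_gamma (weight b lam) b s lam * (2 powr r * real (2 ^ m) powr (- r)) * K"
        using rmse[OF l(1,2) m g] unfolding pw .
      also have "\<dots> \<le> c2 * T * (2 powr r * real (2 ^ m) powr (- r)) * K"
        using c2(1) K0 T[of s] by (intro mult_right_mono mult_left_mono) auto
      finally show "rmse \<Omega> abar \<psi> V u0 z s (2 ^ m) g \<le> c2 * T * 2 powr r * K * real (2 ^ m) powr (- r)"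
        by (simp only: mult_ac)
    qed
  qed
  have blow: "\<forall>s. (\<exists>j<s. b j \<noteq> 0) \<longrightarrow>
        filterlim (\<lambda>\<delta>. C_gamma (weight b (1 / (2 - 2 * \<delta>))) b s (1 / (2 - 2 * \<delta>)))
          at_top (at_right 0) \<and>
        filterlim (\<lambda>p'. C_gamma (weight b (p' / (2 - p'))) b s (p' / (2 - p')))
          at_top (at_right (2/3))"
  proof (intro allI impI)
    fix s assume "\<exists>j<s. b j \<noteq> 0"
    then obtain j where "j < s" "b j \<noteq> 0" by blast
    from C_gamma_blow_up[of b, OF b0 this]
    show "filterlim (\<lambda>\<delta>. C_gamma (weight b (1 / (2 - 2 * \<delta>))) b s (1 / (2 - 2 * \<delta>)))
        at_top (at_right 0) \<and>
      filterlim (\<lambda>p'. C_gamma (weight b (p' / (2 - p'))) b s (p' / (2 - p')))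
        at_top (at_right (2/3))" by (rule conjI)
  qed
  show ?thesis by (rule conjI[OF _ blow], intro ballI, clarify, rule main)
qed

end
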